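(* For every word $w\in\mathcal{B}^1$, the function $$\hat F_w(z)=\sum_{w=u_1u_2u_3}L_{\widetilde{u}_1}(\overline z)\,\hat{\mathcal{S}}_{u_2}\,L_{u_3}(z)$$ is single-valued and satisfies $\hat F_w(z)=\hat F_{\widetilde w}(\overline z)$. Moreover, for $i,j\in\{0,1\}$, if $\mathsf{x}_iw\mathsf{x}_j\in\mathcal{B}^1$, then $$\frac{\partial^2}{\partial z\,\partial\overline z}\hat F_{\mathsf{x}_iw\mathsf{x}_j}(z)=\frac{\hat F_w(z)}{(\overline z-i)(z-j)}.$$
   Context: Words: $\{\mathsf{x}_0,\mathsf{x}_1\}^\times$ is the set of all words (including the empty word $1$) in two non-commuting letters; $\widetilde w$ is the word $w$ written in reverse order, and for a formal power series $S\in\mathbb{R}\langle\langle\mathsf{x}_0,\mathsf{x}_1\rangle\rangle$, $\widetilde S$ is obtained by reversing every word in $S$. The sum defining $\hat F_w$ is over all factorizations of $w$ as a concatenation $u_1u_2u_3$ of (possibly empty) words. $\mathcal{B}^1$ is the set of words containing no consecutive $\mathsf{x}_0\mathsf{x}_0$, no consecutive $\mathsf{x}_1\mathsf{x}_1\mathsf{x}_1$, and at most one occurrence of consecutive $\mathsf{x}_1\mathsf{x}_1$. Multiple polylogarithms: $L_1=1$, $\frac{d}{dz}L_{w\mathsf{x}_i}(z)=\frac{L_w(z)}{z-i}$ for $i=0,1$, $L_{\mathsf{x}_0^n}(z)=\frac1{n!}\log^n z$, and $L_w(z)\to0$ as $z\to0$ for all $w$ not of the form $\mathsf{x}_0^n$.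 They are multivalued on $\mathbb{P}^1\setminus\{0,1,\infty\}(\mathbb{C})=\mathbb{C}\setminus\{0,1\}$ (take principal branches on $\mathbb{C}\setminus((-\infty,0]\cup[1,\infty))$). A combination of products $L_u(\overline z)L_v(z)$ is single-valued if its continuation along every closed path in $\mathbb{C}\setminus\{0,1\}$ ($\overline z$ following the conjugate path) returns to itself, i.e. it defines a real-analytic function on $\mathbb{C}\setminus\{0,1\}$. The series $\hat{\mathcal{S}}=1+\hat{\mathcal{S}}^0_{0,0}+\hat{\mathcal{S}}^1_{0,1}+\hat{\mathcal{S}}^1_{1,0}+\hat{\mathcal{S}}^1_{0,0}\in\mathbb{R}\langle\langle\mathsf{x}_0,\mathsf{x}_1\rangle\rangle$ is defined by $$\hat{\mathcal{S}}^0_{0,0}=-4\sum_{n\ge1}\zeta(2n+1)(\mathsf{x}_0\mathsf{x}_1)^n\mathsf{x}_0,$$ $$\hat{\mathcal{S}}^1_{1,0}=-4\sum_{m\ge0,\,n\ge1}(1-2^{-2n-2m})\binom{2m+2n}{2m+1}\zeta(2m+2n+1)(\mathsf{x}_1\mathsf{x}_0)^m\mathsf{x}_1(\mathsf{x}_1\mathsf{x}_0)^n,$$ $\hat{\mathcal{S}}^1_{0,1}=\widetilde{\hat{\mathcal{S}}^1_{1,0}}$, and $\hat{\mathcal{S}}^1_{0,0}=\frac12\big(\hat{\mathcal{S}}^0_{0,0}\hat{\mathcal{S}}^1_{1,0}+\hat{\mathcal{S}}^1_{0,1}\hat{\mathcal{S}}^0_{0,0}\big)$. $\hat{\mathcal{S}}_u$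 denotes the coefficient of the word $u$ in $\hat{\mathcal{S}}$. *)

theory Defs
  imports "HOL-Analysis.Analysis"
begin

datatype letter = X0 | X1

type_synonym word = "letter list"

definition pt :: "letter \<Rightarrow> complex" where
  "pt x = (case x of X0 \<Rightarrow> 0 | X1 \<Rightarrow> 1)"

definition wpow :: "word \<Rightarrow> nat \<Rightarrow> word" where
  "wpow w n = concat (replicate n w)"

definition occurrences :: "word \<Rightarrow> word \<Rightarrow> (word \<times> word) set" where
  "occurrences p w = {(u, v). w = u @ p @ v}"

definition B1 :: "word set" where
  "B1 = {w. occurrences [X0, X0] w = {} \<and> occurrences [X1, X1, X1] w = {}
            \<and> card (occurrences [X1, X1] w) \<le> 1}"

text \<open>A formal power series in two non-commuting letters is its coefficient function.\<close>

type_synonym series = "word \<Rightarrow> real"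

definition ser_mult :: "series \<Rightarrow> series \<Rightarrow> series" where
  "ser_mult S T = (\<lambda>w. \<Sum>(u, v)\<in>{(u, v). w = u @ v}. S u * T v)"

definition ser_rev :: "series \<Rightarrow> series" where
  "ser_rev S = (\<lambda>w. S (rev w))"

definition zeta :: "nat \<Rightarrow> real" where
  "zeta s = (\<Sum>n. 1 / real (Suc n) ^ s)"

text \<open>In the next two definitions the words indexed by distinct parameters are distinct, so
  each coefficient is a sum over at most one parameter value.\<close>

definition S0_00 :: series where
  "S0_00 = (\<lambda>w. -4 * (\<Sum>n\<in>{n. n \<ge> 1 \<and> wpow [X0, X1] n @ [X0] = w}. zeta (2 * n + 1)))"

definition S1_10 :: series where
  "S1_10 = (\<lambda>w. -4 *
     (\<Sum>(m, n)\<in>{(m, n). n \<ge> 1 \<and> wpow [X1, X0] m @ [X1] @ wpow [X1, X0] n = w}.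
        (1 - 1 / 2 ^ (2 * n + 2 * m)) * real ((2 * m + 2 * n) choose (2 * m + 1))
          * zeta (2 * m + 2 * n + 1)))"

definition S1_01 :: series where
  "S1_01 = ser_rev S1_10"

definition S1_00 :: series where
  "S1_00 = (\<lambda>w. 1 / 2 * (ser_mult S0_00 S1_10 w + ser_mult S1_01 S0_00 w))"

definition Shat :: series where
  "Shat = (\<lambda>w. (if w = [] then 1 else 0) + S0_00 w + S1_01 w + S1_10 w + S1_00 w)"

definition slit_plane :: "complex set" where
  "slit_plane = - (complex_of_real ` ({..0} \<union> {1..}))"

definition mpl_family :: "(word \<Rightarrow> complex \<Rightarrow> complex) \<Rightarrow> bool" where
  "mpl_family L \<longleftrightarrow>
     (\<forall>z\<in>slit_plane. L [] z = 1) \<and>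
     (\<forall>w x. \<forall>z\<in>slit_plane. (L (w @ [x]) has_field_derivative L w z / (z - pt x)) (at z)) \<and>
     (\<forall>n. \<forall>z\<in>slit_plane. L (replicate n X0) z = Ln z ^ n / fact n) \<and>
     (\<forall>w. (\<forall>n. w \<noteq> replicate n X0) \<longrightarrow> (L w \<longlongrightarrow> 0) (at 0 within slit_plane))"

text \<open>On the slit plane, \<open>mpl_family\<close> determines \<open>L\<close> uniquely: these are the principal branches.
  The values of \<open>mpl\<close> off the slit plane are unspecified and are never used.\<close>

definition mpl :: "word \<Rightarrow> complex \<Rightarrow> complex" where
  "mpl = (SOME L. mpl_family L)"

text \<open>The combination defining \<open>F\<^sub>w\<close>, built from a branch \<open>A\<close> of the polylogarithms for the
  factors in \<open>cnj z\<close> and a branch \<open>B\<close> for those in \<open>z\<close>.\<close>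

definition Fhat_branch ::
  "(word \<Rightarrow> complex \<Rightarrow> complex) \<Rightarrow> (word \<Rightarrow> complex \<Rightarrow> complex) \<Rightarrow> word \<Rightarrow> complex \<Rightarrow> complex" where
  "Fhat_branch A B w z =
     (\<Sum>(u1, u2, u3)\<in>{(u1, u2, u3). w = u1 @ u2 @ u3}.
        A (rev u1) (cnj z) * complex_of_real (Shat u2) * B u3 z)"

text \<open>The holomorphic germ of \<open>f\<close> at \<open>\<gamma> 0\<close> continues analytically along \<open>\<gamma>\<close> to the germ of
  \<open>g\<close> at \<open>\<gamma> 1\<close>; \<open>\<phi> t\<close> represents the continued germ at \<open>\<gamma> t\<close>.\<close>

definition continues_along ::
  "(real \<Rightarrow> complex) \<Rightarrow> (complex \<Rightarrow> complex) \<Rightarrow> (complex \<Rightarrow> complex) \<Rightarrow> bool" where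
  "continues_along \<gamma> f g \<longleftrightarrow>
     (\<exists>\<phi> :: real \<Rightarrow> complex \<Rightarrow> complex.
        (\<forall>t\<in>{0..1}. \<phi> t analytic_on {\<gamma> t}) \<and>
        (\<forall>t\<in>{0..1}. \<forall>\<^sub>F s in at t within {0..1}. \<forall>\<^sub>F z in nhds (\<gamma> s). \<phi> s z = \<phi> t z) \<and>
        (\<forall>\<^sub>F z in nhds (\<gamma> 0). \<phi> 0 z = f z) \<and>
        (\<forall>\<^sub>F z in nhds (\<gamma> 1). \<phi> 1 z = g z))"

text \<open>The continuations \<open>A\<close>, \<open>B\<close> are unique as germs by the identity theorem, so the
  existential quantifier says both that they exist and that the continued combination is the
  original one.\<close>

definition Fhat_single_valued :: "word \<Rightarrow> bool" where
  "Fhat_single_valued w \<longleftrightarrow>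
     (\<forall>\<gamma>. path \<gamma> \<and> path_image \<gamma> \<subseteq> - {0, 1} \<and> pathfinish \<gamma> = pathstart \<gamma>
            \<and> pathstart \<gamma> \<in> slit_plane \<longrightarrow>
        (\<exists>A B. (\<forall>u. continues_along (cnj \<circ> \<gamma>) (mpl u) (A u)) \<and>
               (\<forall>u. continues_along \<gamma> (mpl u) (B u)) \<and>
               (\<forall>\<^sub>F z in nhds (pathstart \<gamma>). Fhat_branch A B w z = Fhat_branch mpl mpl w z)))"

definition real_analytic_on :: "(complex \<Rightarrow> complex) \<Rightarrow> complex set \<Rightarrow> bool" where
  "real_analytic_on F S \<longleftrightarrow>
     (\<forall>z0\<in>S. \<exists>r>0. \<exists>a :: nat \<Rightarrow> nat \<Rightarrow> complex. \<forall>z\<in>ball z0 r.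
        ((\<lambda>(m, n). a m n * of_real (Re (z - z0)) ^ m * of_real (Im (z - z0)) ^ n)
           has_sum F z) UNIV)"

text \<open>The Wirtinger derivatives with respect to \<open>z\<close> and \<open>cnj z\<close>.\<close>

definition d_z :: "(complex \<Rightarrow> complex) \<Rightarrow> complex \<Rightarrow> complex" where
  "d_z F z = (frechet_derivative F (at z) 1 - \<i> * frechet_derivative F (at z) \<i>) / 2"

definition d_zbar :: "(complex \<Rightarrow> complex) \<Rightarrow> complex \<Rightarrow> complex" where
  "d_zbar F z = (frechet_derivative F (at z) 1 + \<i> * frechet_derivative F (at z) \<i>) / 2"

end

theory Submission
  imports Defs "HOL-Complex_Analysis.Complex_Analysis"
begin

text \<open>Let \<open>L(z)\<close> be the generating series of the polylogarithms. The functions in question are the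
  coefficients of \<open>cj (rv L) * Shat * L\<close>. Branches of \<open>L\<close> differ by constant left factors, generated
  by \<open>exp(2 pi i x0)\<close> and \<open>Z exp(2 pi i x1) Z^-1\<close>, where \<open>Z\<close> is the regularised value of \<open>L\<close> at 1.
  Hence it suffices that these factors leave the middle series invariant modulo words outside \<open>B1\<close>.
  For the first this is read off from \<open>Shat\<close>; for the second it amounts to \<open>Shat * N\<close> being
  palindromic for \<open>N = Z x1 Z^-1\<close>.

  That identity involves \<open>Z\<close> only at the alternating words and at those with a single \<open>x1 x1\<close>.
  These coefficients are sums over \<open>l\<close> of products of nested sums of inverse squares below and above
  \<open>l\<close>. Expanding powers of \<open>2 t\<close> against powers of \<open>cos t\<close> turns them into integrals of \<open>cot t\<close> against
  polynomials on \<open>[0, pi/2]\<close>, and their generating functions are given by the integrals of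
  \<open>cot t sin 2ut\<close> and \<open>cot t (1 - cos 2ut)\<close>, which are elementary up to a series in odd zeta values.
  The palindromic identity then becomes a trigonometric identity between bivariate power series.\<close>

section \<open>Noncommutative power series\<close>

text \<open>Modulo words outside \<open>B1\<close> one has x0^2 = 0, x1^3 = 0, and a product
  containing x1 x1 twice vanishes. So exp(c N) stops at N^2, and a commutation rule for N suffices.
  The coefficients of Z at words with one x1 x1 are complicated one by one. Palindromicity needs
  only the part of their generating function, multiplied by sin(pi y), that is antisymmetric in x
  and y. There the integral of cot t (cos 2xt cos 2yt - 1) drops out, since it enters with a
  symmetric factor; the other two integrals have sum and difference Lambda(x+y) sin pi(x+y) and
  Lambda(x-y) sin pi(x-y), where Lambda(u) is the sum of (-1)^(k+1) k / (k^2 - u^2). Hence the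
  constants of \<open>Shat\<close>: the binomials come from Lambda(x+y) - Lambda(x-y), the factors 1
  - 2^(-2n) from the alternating signs, which are the values cos(k pi) at the endpoint pi/2, and the
  plain zeta values in \<open>S0_00\<close> from y = 0, where the Lambda terms cancel. The factor
  1/2 in \<open>S1_00\<close> arises because both halves of the palindrome carry the same factor 1 +
  \<open>S0_00\<close> / 2.\<close>

datatype ser = Ser (cf: "word \<Rightarrow> complex")

lemma ser_eqI: "(\<And>w. cf X w = cf Y w) \<Longrightarrow> X = Y"
  by (simp add: ser.expand ext)

definition shift :: "letter \<Rightarrow> ser \<Rightarrow> ser" where
  "shift a X = Ser (\<lambda>w. cf X (a # w))"

lemma cf_shift [simp]: "cf (shift a X) w = cf X (a # w)"
  by (simp add: shift_def)

definition cst :: "complex \<Rightarrow> ser" where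
  "cst c = Ser (\<lambda>w. if w = [] then c else 0)"

lemma cf_cst: "cf (cst c) w = (if w = [] then c else 0)"
  by (simp add: cst_def)

instantiation ser :: ring_1
begin

definition "0 = Ser (\<lambda>_. 0)"
definition "1 = cst 1"
definition "X + Y = Ser (\<lambda>w. cf X w + cf Y w)"
definition "X - Y = Ser (\<lambda>w. cf X w - cf Y w)"
definition "- X = Ser (\<lambda>w. - cf X w)"
definition "X * Y = Ser (\<lambda>w. \<Sum>i\<le>length w. cf X (take i w) * cf Y (drop i w))"

lemma cf_ring [simp]:
  "cf 0 w = 0" "cf (X + Y) w = cf X w + cf Y w" "cf (X - Y) w = cf X w - cf Y w"
  "cf (- X) w = - cf X w"
  by (simp_all add: zero_ser_def plus_ser_def minus_ser_def uminus_ser_def)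

lemma cf_times: "cf (X * Y) w = (\<Sum>i\<le>length w. cf X (take i w) * cf Y (drop i w))"
  by (simp add: times_ser_def)

lemma cf_times_Nil [simp]: "cf (X * Y) [] = cf X [] * cf Y []"
  by (simp add: cf_times)

lemma cf_times_Cons: "cf (X * Y) (a # w) = cf X [] * cf Y (a # w) + cf (shift a X * Y) w"
  by (simp add: cf_times sum.atMost_Suc_shift del: sum.atMost_Suc)

lemma cf_cst_times [simp]: "cf (cst c * Y) w = c * cf Y w"
proof (cases w)
  case (Cons a v)
  have "cf (shift a (cst c) * Y) v = 0" by (simp add: cf_times cf_cst)
  with Cons show ?thesis by (simp add: cf_times_Cons) (simp add: cf_cst)
qed (simp add: cf_cst)

lemma distrib_right_ser: "(X + Y) * (W :: ser) = X * W + Y * W"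
  by (rule ser_eqI) (simp add: cf_times distrib_right sum.distrib)

text \<open>Peeling off the first letter works because \<open>shift a (X * Y)\<close> is again a sum
  of products; the left factor must vary in the induction, since \<open>shift a X\<close> replaces
  it.\<close>

lemma assoc_ser_aux: "cf ((X * Y) * W) w = cf (X * (Y * W)) w"
proof (induction w arbitrary: X)
  case (Cons a w)
  have sh: "shift a (X * Y) = cst (cf X []) * shift a Y + shift a X * Y"
    by (rule ser_eqI) (simp add: cf_times_Cons)
  have c: "cf ((cst c * U) * V) v = c * cf (U * V) v" for c U V v
    by (simp add: cf_times[of "cst c * U"] cf_times[of U] sum_distrib_left mult.assoc)
  show ?case
    by (simp add: cf_times_Cons sh distrib_right_ser c Cons.IH algebra_simps)
qed simp

instance
proof
  fix X Y W :: ser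
  show "X * Y * W = X * (Y * W)" by (rule ser_eqI) (rule assoc_ser_aux)
  show "1 * X = X" by (rule ser_eqI) (simp add: one_ser_def)
  show "X * 1 = X"
  proof (rule ser_eqI)
    fix w
    have "cf (X * 1) w = (\<Sum>i\<in>{length w}. cf X (take i w) * cf 1 (drop i w))"
      unfolding cf_times
      by (rule sum.mono_neutral_right) (auto simp: one_ser_def cf_cst)
    thus "cf (X * 1) w = cf X w" by (simp add: one_ser_def cf_cst)
  qed
  show "(X + Y) * W = X * W + Y * W" by (rule distrib_right_ser)
  show "X * (Y + W) = X * Y + X * W"
    by (rule ser_eqI) (simp add: cf_times distrib_left sum.distrib)
  show "(0 :: ser) \<noteq> 1"
    by (metis cf_ring(1) cf_cst one_ser_def zero_neq_one)
qed (rule ser_eqI; simp)+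

end

lemma cf_one: "cf 1 w = (if w = [] then 1 else 0)"
  by (simp add: one_ser_def cf_cst)

lemma cf_times_cst [simp]: "cf (Y * cst c) w = c * cf Y w"
proof -
  have "cf (Y * cst c) w = (\<Sum>i\<in>{length w}. cf Y (take i w) * cf (cst c) (drop i w))"
    unfolding cf_times by (rule sum.mono_neutral_right) (auto simp: cf_cst)
  thus ?thesis by (simp add: cf_cst)
qed

lemma cst_commute: "cst c * X = X * cst c"
  by (rule ser_eqI) simp

lemma cst_add: "cst (a + b) = cst a + cst b"
  by (rule ser_eqI) (simp add: cf_cst)

lemma cst_one [simp]: "cst 1 = 1"
  by (simp add: one_ser_def)

lemma cst_uminus: "cst (- a) = - cst a"
  by (rule ser_eqI) (simp add: cf_cst)

lemma bij_betw_splits: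
  "bij_betw (\<lambda>i. (take i w, drop i w)) {..length w} {(u, v). w = u @ v}"
  by (rule bij_betwI[where g = "\<lambda>(u, v). length u"]) auto

lemma sum_splits: "(\<Sum>(u, v)\<in>{(u, v). w = u @ v}. f u v) = (\<Sum>i\<le>length w. f (take i w) (drop i w))"
  using sum.reindex_bij_betw[OF bij_betw_splits, of "\<lambda>(u, v). f u v" w] by simp

lemma finite_splits: "finite {(u, v). w = u @ v}"
  using bij_betw_finite[OF bij_betw_splits, of w] by simp

lemma cf_times_splits: "cf (X * Y) w = (\<Sum>(u, v)\<in>{(u, v). w = u @ v}. cf X u * cf Y v)"
  by (simp add: sum_splits cf_times)

lemma cf_times3_splits:
  "cf (X * Y * W) w = (\<Sum>(u1, u2, u3)\<in>{(u1, u2, u3). w = u1 @ u2 @ u3}. cf X u1 * cf Y u2 * cf W u3)"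
proof -
  have "cf (X * Y * W) w = (\<Sum>(u, v)\<in>{(u, v). w = u @ v}. \<Sum>(v1, v2)\<in>{(v1, v2). v = v1 @ v2}. cf X u * (cf Y v1 * cf W v2))"
    by (simp add: mult.assoc cf_times_splits[of X] cf_times_splits[of Y] sum_distrib_left case_prod_unfold)
  also have "\<dots> = (\<Sum>(p, q)\<in>(SIGMA p:{(u, v). w = u @ v}. {(v1, v2). snd p = v1 @ v2}). cf X (fst p) * (cf Y (fst q) * cf W (snd q)))"
    using finite_splits by (subst sum.Sigma[symmetric]) (auto simp: case_prod_unfold)
  also have "\<dots> = (\<Sum>(u1, u2, u3)\<in>{(u1, u2, u3). w = u1 @ u2 @ u3}. cf X u1 * cf Y u2 * cf W u3)"
    by (rule sum.reindex_bij_witness[of _ "\<lambda>(u1,u2,u3). ((u1, u2 @ u3), (u2, u3))" "\<lambda>(p,q). (fst p, fst q, snd q)"])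
       (auto simp: mult.assoc)
  finally show ?thesis .
qed

definition lt :: "letter \<Rightarrow> ser" where
  "lt x = Ser (\<lambda>w. if w = [x] then 1 else 0)"

lemma cf_lt: "cf (lt x) w = (if w = [x] then 1 else 0)"
  by (simp add: lt_def)

lemma cf_lt_times_Cons: "cf (lt x * X) (a # w) = (if a = x then cf X w else 0)"
proof -
  have "shift a (lt x) = (if a = x then 1 else 0)"
    by (rule ser_eqI) (auto simp: cf_lt cf_one)
  thus ?thesis by (simp add: cf_times_Cons) (simp add: cf_lt)
qed

lemma cf_times_lt_snoc: "cf (X * lt x) (w @ [a]) = (if a = x then cf X w else 0)"
proof -
  have "cf (X * lt x) (w @ [a]) = (\<Sum>i\<in>{length w}. cf X (take i (w @ [a])) * cf (lt x) (drop i (w @ [a])))"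
    unfolding cf_times
  proof (rule sum.mono_neutral_right, simp, simp, intro ballI)
    fix i assume i: "i \<in> {..length (w @ [a])} - {length w}"
    hence "length (drop i (w @ [a])) \<noteq> 1" by auto
    hence "drop i (w @ [a]) \<noteq> [x]" by (metis One_nat_def length_Cons list.size(3))
    thus "cf X (take i (w @ [a])) * cf (lt x) (drop i (w @ [a])) = 0" by (simp add: cf_lt)
  qed
  thus ?thesis by (simp add: cf_lt)
qed

section \<open>Reversal, conjugation, exchange of the letters, and sign\<close>

definition rv :: "ser \<Rightarrow> ser" where "rv X = Ser (\<lambda>w. cf X (rev w))"
definition cj :: "ser \<Rightarrow> ser" where "cj X = Ser (\<lambda>w. cnj (cf X w))"
definition flip :: "letter \<Rightarrow> letter" where "flip x = (case x of X0 \<Rightarrow> X1 | X1 \<Rightarrow> X0)"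
definition sw :: "ser \<Rightarrow> ser" where "sw X = Ser (\<lambda>w. cf X (map flip w))"
text \<open>Composed with \<open>rv\<close> this is the antipode of the shuffle algebra, hence
  inversion on group-like series. For the series in question that inversion property is derived from
  the differential equation.\<close>

definition sg :: "ser \<Rightarrow> ser" where "sg X = Ser (\<lambda>w. (-1) ^ length w * cf X w)"

lemma cf_maps [simp]:
  "cf (rv X) w = cf X (rev w)" "cf (cj X) w = cnj (cf X w)" "cf (sw X) w = cf X (map flip w)"
  "cf (sg X) w = (-1) ^ length w * cf X w"
  by (simp_all add: rv_def cj_def sw_def sg_def)

lemma flip_simps [simp]: "flip X0 = X1" "flip X1 = X0" "flip (flip x) = x"
  by (simp_all add: flip_def split: letter.splits)

lemma flip_eq_iff: "flip x = y \<longleftrightarrow> x = flip y"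
  by (cases x; cases y) auto

lemma flip_comp [simp]: "flip \<circ> flip = id"
  by (simp add: fun_eq_iff)

lemma rv_times: "rv (X * Y) = rv Y * rv X"
proof (rule ser_eqI)
  fix w
  have "cf (rv (X * Y)) w = (\<Sum>(u, v)\<in>{(u, v). rev w = u @ v}. cf X u * cf Y v)"
    by (simp add: cf_times_splits)
  also have "\<dots> = (\<Sum>(u, v)\<in>{(u, v). w = u @ v}. cf (rv Y) u * cf (rv X) v)"
    by (rule sum.reindex_bij_witness[of _ "\<lambda>(u,v). (rev v, rev u)" "\<lambda>(u,v). (rev v, rev u)"])
       (auto simp: rev_swap)
  finally show "cf (rv (X * Y)) w = cf (rv Y * rv X) w" by (simp add: cf_times_splits)
qed

lemma cj_times: "cj (X * Y) = cj X * cj Y"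
  by (rule ser_eqI) (simp add: cf_times)

lemma sw_times: "sw (X * Y) = sw X * sw Y"
  by (rule ser_eqI) (simp add: cf_times take_map drop_map)

lemma sg_times: "sg (X * Y) = sg X * sg Y"
proof (rule ser_eqI)
  fix w :: word
  have "(-1) ^ length w * (cf X (take i w) * cf Y (drop i w)) =
      cf (sg X) (take i w) * cf (sg Y) (drop i w)" if "i \<le> length w" for i
  proof -
    have "(-1) ^ length w = (-1) ^ i * (-1 :: complex) ^ (length w - i)"
      using that by (simp flip: power_add)
    with that show ?thesis by (simp add: min_absorb2)
  qed
  hence "(\<Sum>i\<le>length w. (-1) ^ length w * (cf X (take i w) * cf Y (drop i w))) = cf (sg X * sg Y) w"
    unfolding cf_times by (intro sum.cong) auto
  thus "cf (sg (X * Y)) w = cf (sg X * sg Y) w"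
    by (simp add: sum_distrib_left cf_times[of X])
qed

lemma ser_maps_ring [simp]:
  "rv (X + Y) = rv X + rv Y" "rv (X - Y) = rv X - rv Y" "rv (- X) = - rv X" "rv 0 = 0" "rv 1 = 1"
  "cj (X + Y) = cj X + cj Y" "cj (X - Y) = cj X - cj Y" "cj (- X) = - cj X" "cj 0 = 0" "cj 1 = 1"
  "sw (X + Y) = sw X + sw Y" "sw (X - Y) = sw X - sw Y" "sw (- X) = - sw X" "sw 0 = 0" "sw 1 = 1"
  "sg 1 = 1" "rv (cst c) = cst c" "cj (cst c) = cst (cnj c)" "sw (cst c) = cst c"
  "rv (rv X) = X" "cj (cj X) = X" "sw (sw X) = X" "cj (rv X) = rv (cj X)" "sw (cj X) = cj (sw X)"
  by (rule ser_eqI; simp add: cf_one cf_cst)+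

lemma ser_maps_lt [simp]: "rv (lt x) = lt x" "cj (lt x) = lt x" "sw (lt x) = lt (flip x)"
proof -
  show "rv (lt x) = lt x" by (rule ser_eqI) (auto simp: cf_lt rev_swap)
  show "cj (lt x) = lt x" by (rule ser_eqI) (auto simp: cf_lt)
  show "sw (lt x) = lt (flip x)"
    by (rule ser_eqI) (auto simp: cf_lt flip_eq_iff map_eq_Cons_conv)
qed

section \<open>Exponentials of a single letter\<close>

definition ex :: "letter \<Rightarrow> complex \<Rightarrow> ser" where
  "ex x c = Ser (\<lambda>w. if w = replicate (length w) x then c ^ length w / fact (length w) else 0)"

lemma cf_ex: "cf (ex x c) w = (if w = replicate (length w) x then c ^ length w / fact (length w) else 0)"
  by (simp add: ex_def)

lemma cf_ex_Nil [simp]: "cf (ex x c) [] = 1"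
  by (simp add: cf_ex)

lemma cf_ex_replicate [simp]: "cf (ex x c) (replicate n x) = c ^ n / fact n"
  by (simp add: cf_ex)

lemma ex_zero [simp]: "ex x 0 = 1"
  by (rule ser_eqI) (auto simp: cf_ex cf_one)

text \<open>The convolution of coefficients is the binomial theorem; a word that is not a power of
  \<open>x\<close> never splits into two powers of \<open>x\<close>.\<close>

lemma ex_add: "ex x (a + b) = ex x a * ex x b"
proof (rule ser_eqI)
  fix w :: word
  define n where "n = length w"
  show "cf (ex x (a + b)) w = cf (ex x a * ex x b) w"
  proof (cases "w = replicate n x")
    case True
    have "cf (ex x a * ex x b) w = (\<Sum>i\<le>n. (a ^ i / fact i) * (b ^ (n - i) / fact (n - i)))"
      unfolding cf_times using True by (auto intro!: sum.cong simp: min_def)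
    also have "\<dots> = (a + b) ^ n / fact n"
      unfolding binomial_ring sum_divide_distrib
      by (rule sum.cong) (simp_all add: binomial_fact field_simps)
    finally show ?thesis using True by (metis cf_ex_replicate)
  next
    case False
    have "cf (ex x a) (take i w) * cf (ex x b) (drop i w) = 0" if "i \<le> n" for i
    proof (rule ccontr)
      assume "\<not> ?thesis"
      hence "take i w = replicate i x" "drop i w = replicate (n - i) x"
        using that by (auto simp: cf_ex n_def split: if_splits)
      hence "w = replicate n x"
        by (metis append_take_drop_id le_add_diff_inverse replicate_add that)
      with False show False by simp
    qed
    hence "cf (ex x a * ex x b) w = 0" unfolding cf_times n_def by (intro sum.neutral) auto
    with False show ?thesis by (simp add: cf_ex n_def)
  qed
qed

lemma ex_inverse: "ex x a * ex x (- a) = 1" "ex x (- a) * ex x a = 1"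
  by (simp_all flip: ex_add)

lemma ex_maps [simp]: "rv (ex x c) = ex x c" "cj (ex x c) = ex x (cnj c)" "sw (ex x c) = ex (flip x) c"
proof -
  have "rev w = replicate (length w) x \<longleftrightarrow> w = replicate (length w) x" for w :: word
    by (metis rev_replicate rev_rev_ident)
  thus "rv (ex x c) = ex x c" by (intro ser_eqI) (simp add: cf_ex)
  show "cj (ex x c) = ex x (cnj c)" by (intro ser_eqI) (simp add: cf_ex)
  have "map flip w = replicate (length w) x \<longleftrightarrow> w = replicate (length w) (flip x)" for w
    by (metis flip_comp list.map_comp list.map_id map_replicate)
  thus "sw (ex x c) = ex (flip x) c" by (intro ser_eqI) (simp add: cf_ex)
qed

section \<open>Words of the class B1\<close>

text \<open>Recursive counters are additive under concatenation up to a correction at the junction,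
  which the sets of occurrences do not show directly.\<close>

fun count11 :: "word \<Rightarrow> nat" where
  "count11 (X1 # X1 # w) = Suc (count11 (X1 # w))"
| "count11 (X1 # X0 # w) = count11 (X0 # w)"
| "count11 (X0 # w) = count11 w"
| "count11 [X1] = 0"
| "count11 [] = 0"

fun no00 :: "word \<Rightarrow> bool" where
  "no00 (X0 # X0 # w) = False"
| "no00 (X0 # X1 # w) = no00 (X1 # w)"
| "no00 (X1 # w) = no00 w"
| "no00 [X0] = True"
| "no00 [] = True"

lemma count11_Cons: "count11 (x # w) = count11 w + (if x = X1 \<and> w \<noteq> [] \<and> hd w = X1 then 1 else 0)"
  by (cases x; cases w; cases "hd w") auto

lemma no00_Cons: "no00 (x # w) \<longleftrightarrow> no00 w \<and> \<not> (x = X0 \<and> w \<noteq> [] \<and> hd w = X0)"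
  by (cases x; cases w; cases "hd w") auto

lemma count11_append:
  "count11 (u @ v) = count11 u + count11 v + (if u \<noteq> [] \<and> v \<noteq> [] \<and> last u = X1 \<and> hd v = X1 then 1 else 0)"
  by (induction u) (auto simp: count11_Cons hd_append)

lemma no00_append:
  "no00 (u @ v) \<longleftrightarrow> no00 u \<and> no00 v \<and> \<not> (u \<noteq> [] \<and> v \<noteq> [] \<and> last u = X0 \<and> hd v = X0)"
  by (induction u) (auto simp: no00_Cons hd_append)

lemma occurrences_Cons:
  "occurrences p (x # w) = (\<lambda>(u, v). (x # u, v)) ` occurrences p w
     \<union> (if take (length p) (x # w) = p then {([], drop (length p) (x # w))} else {})"
proof -
  have "(u, v) \<in> occurrences p (x # w) \<longleftrightarrow> (u, v) \<in> (\<lambda>(u, v). (x # u, v)) ` occurrences p w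
     \<union> (if take (length p) (x # w) = p then {([], drop (length p) (x # w))} else {})" for u v
  proof (cases u)
    case Nil
    have "x # w = p @ v \<longleftrightarrow> take (length p) (x # w) = p \<and> v = drop (length p) (x # w)"
      by (metis append_eq_conv_conj)
    thus ?thesis using Nil by (auto simp: occurrences_def)
  qed (auto simp: occurrences_def)
  thus ?thesis by auto
qed

lemma occurrences_Nil: "p \<noteq> [] \<Longrightarrow> occurrences p [] = {}"
  by (auto simp: occurrences_def)

lemma finite_occurrences: "finite (occurrences p w)"
  by (rule finite_subset[OF _ finite_imageI[OF finite_splits[of w], of "\<lambda>(u, v). (u, drop (length p) v)"]])
     (force simp: occurrences_def)

lemma card_occurrences_11: "card (occurrences [X1, X1] w) = count11 w"
proof (induction w)
  case (Cons x w)
  have "card (occurrences [X1, X1] (x # w)) = card ((\<lambda>(u, v). (x # u, v)) ` occurrences [X1, X1] w)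
     + card (if take 2 (x # w) = [X1, X1] then {([] :: word, drop 2 (x # w))} else {})"
    unfolding occurrences_Cons by (subst card_Un_disjoint) (auto simp: finite_occurrences)
  also have "card ((\<lambda>(u, v). (x # u, v)) ` occurrences [X1, X1] w) = count11 w"
    by (subst card_image) (auto simp: inj_on_def Cons.IH)
  also have "take 2 (x # w) = [X1, X1] \<longleftrightarrow> x = X1 \<and> w \<noteq> [] \<and> hd w = X1"
    by (cases w) auto
  finally show ?case by (simp add: count11_Cons)
qed (simp add: occurrences_Nil)

lemma occurrences_00_empty: "occurrences [X0, X0] w = {} \<longleftrightarrow> no00 w"
proof (induction w)
  case (Cons x w)
  have "take 2 (x # w) = [X0, X0] \<longleftrightarrow> x = X0 \<and> w \<noteq> [] \<and> hd w = X0"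
    by (cases w) auto
  thus ?case by (simp add: occurrences_Cons Cons.IH no00_Cons)
qed (simp add: occurrences_Nil)

text \<open>Three consecutive X1 contain two overlapping occurrences of \<open>[X1, X1]\<close>, so
  a count of at most one excludes them.\<close>

lemma B1_iff: "w \<in> B1 \<longleftrightarrow> no00 w \<and> count11 w \<le> 1"
proof -
  have "occurrences [X1, X1, X1] w = {}" if "count11 w \<le> 1"
  proof (rule ccontr)
    assume "occurrences [X1, X1, X1] w \<noteq> {}"
    then obtain u v where "w = u @ [X1, X1, X1] @ v" by (auto simp: occurrences_def)
    hence "count11 w \<ge> 2" by (simp add: count11_append count11_Cons)
    with that show False by simp
  qed
  thus ?thesis by (auto simp: B1_def occurrences_00_empty card_occurrences_11)
qed

text \<open>Closure under factors means that the words outside \<open>B1\<close> span an ideal, so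
  \<open>eqB\<close> is compatible with products.\<close>

lemma B1_append: "u @ v \<in> B1 \<Longrightarrow> u \<in> B1 \<and> v \<in> B1"
  by (auto simp: B1_iff no00_append count11_append split: if_splits)

lemma count11_rev [simp]: "count11 (rev w) = count11 w"
  by (induction w) (auto simp: count11_append count11_Cons last_rev)

lemma no00_rev [simp]: "no00 (rev w) = no00 w"
  by (induction w) (auto simp: no00_append no00_Cons last_rev)

lemma B1_rev [simp]: "rev w \<in> B1 \<longleftrightarrow> w \<in> B1"
  by (simp add: B1_iff)

section \<open>The quotient ring modulo words outside B1\<close>

definition eqB :: "ser \<Rightarrow> ser \<Rightarrow> bool" where
  "eqB X Y \<longleftrightarrow> (\<forall>w\<in>B1. cf X w = cf Y w)"

lemma eqB_times: "eqB X X' \<Longrightarrow> eqB Y Y' \<Longrightarrow> eqB (X * Y) (X' * Y')"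
  unfolding eqB_def cf_times
  by (intro ballI sum.cong refl) (metis B1_append append_take_drop_id)

quotient_type bser = ser / eqB
  by (rule equivpI) (auto simp: eqB_def reflp_def symp_def transp_def)

instantiation bser :: ring_1
begin

lift_definition zero_bser :: bser is 0 .
lift_definition one_bser :: bser is 1 .
lift_definition plus_bser :: "bser \<Rightarrow> bser \<Rightarrow> bser" is plus by (simp add: eqB_def)
lift_definition minus_bser :: "bser \<Rightarrow> bser \<Rightarrow> bser" is minus by (simp add: eqB_def)
lift_definition uminus_bser :: "bser \<Rightarrow> bser" is uminus by (simp add: eqB_def)
lift_definition times_bser :: "bser \<Rightarrow> bser \<Rightarrow> bser" is times by (rule eqB_times)

instance
proof
  fix a b c :: bser
  show "a * b * c = a * (b * c)" by transfer (simp add: eqB_def mult.assoc)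
  show "(a + b) * c = a * c + b * c" by transfer (simp add: eqB_def distrib_right)
  show "a * (b + c) = a * b + a * c" by transfer (simp add: eqB_def distrib_left)
  show "0 \<noteq> (1 :: bser)"
    by transfer (auto simp: eqB_def cf_one B1_iff intro!: bexI[of _ "[]"])
qed (transfer; simp add: eqB_def)+

end

lift_definition modB :: "ser \<Rightarrow> bser" is "\<lambda>X. X" .
lift_definition modB_rv :: "bser \<Rightarrow> bser" is rv by (simp add: eqB_def)

lemma modB_eq_iff: "modB X = modB Y \<longleftrightarrow> (\<forall>w\<in>B1. cf X w = cf Y w)"
  by transfer (simp add: eqB_def)

lemma modB_ring [simp]:
  "modB (X + Y) = modB X + modB Y" "modB (X - Y) = modB X - modB Y" "modB (- X) = - modB X" "modB 0 = 0" "modB 1 = 1"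
  by (transfer; simp add: eqB_def)+

lemma modB_times: "modB (X * Y) = modB X * modB Y"
  by transfer (simp add: eqB_def)

lemma modB_rv_modB [simp]: "modB_rv (modB X) = modB (rv X)"
  by transfer (simp add: eqB_def)

lemma modB_rv_ring [simp]:
  "modB_rv (x + y) = modB_rv x + modB_rv y" "modB_rv (x - y) = modB_rv x - modB_rv y" "modB_rv (- x) = - modB_rv x" "modB_rv 0 = 0" "modB_rv 1 = 1"
  "modB_rv (modB_rv x) = x"
  by (transfer; simp add: eqB_def)+

lemma modB_rv_times: "modB_rv (x * y) = modB_rv y * modB_rv x"
  by transfer (simp add: eqB_def rv_times)

text \<open>Cancellations in the quotient are read off from supports in this way, without computing
  coefficients.\<close>

lemma modB_times_eq_0:
  assumes "\<And>u v. cf X u \<noteq> 0 \<Longrightarrow> cf Y v \<noteq> 0 \<Longrightarrow> u @ v \<notin> B1"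
  shows "modB X * modB Y = 0"
proof -
  have "cf (X * Y) w = 0" if "w \<in> B1" for w
    unfolding cf_times
    by (rule sum.neutral) (metis append_take_drop_id assms mult_eq_0_iff that)
  thus ?thesis using modB_eq_iff[of "X * Y" 0] by (simp add: modB_times)
qed

lemma cf_times_nonzeroE:
  assumes "cf (X * Y) w \<noteq> 0"
  obtains u v where "w = u @ v" "cf X u \<noteq> 0" "cf Y v \<noteq> 0"
proof -
  have "\<exists>i\<le>length w. cf X (take i w) * cf Y (drop i w) \<noteq> 0"
    using assms unfolding cf_times by (metis (mono_tags, lifting) atMost_iff sum.neutral)
  thus ?thesis using that by (metis append_take_drop_id mult_eq_0_iff)
qed

lemma modB_times3_eq_0:
  assumes "\<And>u v w. cf X u \<noteq> 0 \<Longrightarrow> cf Y v \<noteq> 0 \<Longrightarrow> cf W w \<noteq> 0 \<Longrightarrow> u @ v @ w \<notin> B1"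
  shows "modB X * modB Y * modB W = 0"
proof -
  have "modB (X * Y) * modB W = 0"
    by (rule modB_times_eq_0) (metis append.assoc assms cf_times_nonzeroE)
  thus ?thesis by (simp add: modB_times)
qed

lemma wpow_0 [simp]: "wpow w 0 = []" and wpow_Suc: "wpow w (Suc n) = w @ wpow w n"
  by (simp_all add: wpow_def)

lemma length_wpow [simp]: "length (wpow w n) = n * length w"
  by (induction n) (simp_all add: wpow_Suc)

lemma wpow_Suc2: "wpow w (Suc n) = wpow w n @ w"
  by (induction n) (simp_all add: wpow_Suc)

lemma wpow_10_props: "no00 (wpow [X1, X0] n)" "count11 (wpow [X1, X0] n) = 0"
  "n > 0 \<Longrightarrow> hd (wpow [X1, X0] n) = X1" "n > 0 \<Longrightarrow> last (wpow [X1, X0] n) = X0"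
proof -
  have hd: "n > 0 \<Longrightarrow> hd (wpow [X1, X0] n) = X1" for n
    by (cases n) (simp_all add: wpow_Suc)
  show "no00 (wpow [X1, X0] n)"
  proof (induction n)
    case (Suc n)
    thus ?case using hd[of n] by (cases n) (auto simp: wpow_Suc[of _ "Suc _"] wpow_Suc[of _ 0] no00_Cons)
  qed simp
  show "count11 (wpow [X1, X0] n) = 0"
  proof (induction n)
    case (Suc n)
    thus ?case using hd[of n] by (cases n) (auto simp: wpow_Suc[of _ "Suc _"] wpow_Suc[of _ 0] count11_Cons)
  qed simp
  show "n > 0 \<Longrightarrow> hd (wpow [X1, X0] n) = X1" by (rule hd)
  show "n > 0 \<Longrightarrow> last (wpow [X1, X0] n) = X0"
    by (cases n) (simp_all add: wpow_Suc2)
qed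

lemma wpow_eq_Nil [simp]: "wpow w n = [] \<longleftrightarrow> n = 0 \<or> w = []"
  by (auto simp: wpow_def)

lemma wpow_shift: "wpow [x, y] n @ [x] = x # wpow [y, x] n"
  by (induction n) (simp_all add: wpow_Suc)

lemma rev_wpow: "rev (wpow [x, y] n) = wpow [y, x] n"
  by (induction n) (simp_all add: wpow_Suc wpow_Suc2[symmetric] flip: wpow_Suc2)

section \<open>The palindromic identity\<close>

definition cser :: "series \<Rightarrow> ser" where "cser F = Ser (\<lambda>w. complex_of_real (F w))"

lemma cf_cser [simp]: "cf (cser F) w = of_real (F w)"
  by (simp add: cser_def)

lemma cser_mult: "cser (ser_mult F G) = cser F * cser G"
  by (rule ser_eqI) (simp add: ser_mult_def cf_times_splits case_prod_unfold)

lemma S0_00_nonzero: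
  assumes "S0_00 w \<noteq> 0"
  shows "no00 w" "count11 w = 0" "w \<noteq> []" "hd w = X0" "last w = X0"
proof -
  have "{n. n \<ge> 1 \<and> wpow [X0, X1] n @ [X0] = w} \<noteq> {}"
    using assms unfolding S0_00_def by (metis mult_zero_right sum.empty)
  then obtain n where "w = wpow [X0, X1] n @ [X0]" "n \<ge> 1" by auto
  hence w: "w = X0 # wpow [X1, X0] n" "n \<ge> 1" by (simp_all add: wpow_shift)
  show "no00 w" "count11 w = 0" "w \<noteq> []" "hd w = X0" "last w = X0"
    using w by (auto simp: no00_Cons count11_Cons wpow_10_props)
qed

lemma S1_10_nonzero:
  assumes "S1_10 w \<noteq> 0"
  shows "no00 w" "count11 w = 1" "w \<noteq> []" "hd w = X1" "last w = X0"
proof -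
  have "{(m, n). n \<ge> 1 \<and> wpow [X1, X0] m @ [X1] @ wpow [X1, X0] n = w} \<noteq> {}"
    using assms unfolding S1_10_def by (metis (no_types, lifting) mult_zero_right sum.empty)
  then obtain m n where w: "w = wpow [X1, X0] m @ [X1] @ wpow [X1, X0] n" "n \<ge> 1" by auto
  show "no00 w" "count11 w = 1" "w \<noteq> []" "hd w = X1" "last w = X0"
    using w by (auto simp: no00_append no00_Cons count11_Cons count11_append wpow_10_props hd_append)
qed

lemma S1_01_nonzero:
  assumes "S1_01 w \<noteq> 0"
  shows "no00 w" "count11 w = 1" "w \<noteq> []" "hd w = X0" "last w = X1"
proof -
  have "S1_10 (rev w) \<noteq> 0" using assms by (simp add: S1_01_def ser_rev_def)
  from S1_10_nonzero[OF this] show "no00 w" "count11 w = 1" "w \<noteq> []" "hd w = X0" "last w = X1"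
    by (auto simp: hd_rev last_rev)
qed

lemma S1_00_nonzero:
  assumes "S1_00 w \<noteq> 0"
  shows "count11 w \<ge> 1" "w \<noteq> []" "hd w = X0" "last w = X0"
proof -
  have "cf (cser S0_00 * cser S1_10) w \<noteq> 0 \<or> cf (cser S1_01 * cser S0_00) w \<noteq> 0"
    using assms unfolding S1_00_def by (auto simp flip: cser_mult)
  then obtain u v where "w = u @ v" "S0_00 u \<noteq> 0 \<and> S1_10 v \<noteq> 0 \<or> S1_01 u \<noteq> 0 \<and> S0_00 v \<noteq> 0"
    by (elim disjE cf_times_nonzeroE) auto
  moreover have "S1_10 [] = 0" "S1_01 [] = 0" "S0_00 [] = 0"
    using S0_00_nonzero(3) S1_10_nonzero(3) S1_01_nonzero(3) by blast+
  ultimately show "count11 w \<ge> 1" "w \<noteq> []" "hd w = X0" "last w = X0"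
    using S0_00_nonzero S1_10_nonzero S1_01_nonzero by (auto simp: count11_append)
qed

lemma rv_cser_S0_00 [simp]: "rv (cser S0_00) = cser S0_00"
proof (rule ser_eqI)
  fix w
  have "wpow [X0, X1] n @ [X0] = rev w \<longleftrightarrow> wpow [X0, X1] n @ [X0] = w" for n
    by (metis rev_rev_ident rev_wpow rev.simps(2) wpow_shift)
  thus "cf (rv (cser S0_00)) w = cf (cser S0_00) w" by (simp add: S0_00_def)
qed

lemma rv_cser_S1 [simp]: "rv (cser S1_10) = cser S1_01" "rv (cser S1_01) = cser S1_10"
  by (rule ser_eqI; simp add: S1_01_def ser_rev_def)+

lemma cser_S1_00: "cser S1_00 = cst (1/2) * (cser S0_00 * cser S1_10 + cser S1_01 * cser S0_00)"
  by (rule ser_eqI) (simp add: S1_00_def flip: cser_mult)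

text \<open>Reversal interchanges the two products in the definition of
  \<open>S1_00\<close>.\<close>

lemma rv_cser_S1_00 [simp]: "rv (cser S1_00) = cser S1_00"
  by (simp add: cser_S1_00 rv_times cst_commute add.commute)

definition Sh :: ser where "Sh = cser Shat"

lemma Sh_eq: "Sh = 1 + cser S0_00 + cser S1_01 + cser S1_10 + cser S1_00"
  by (rule ser_eqI) (simp add: Sh_def Shat_def cf_one)

lemma rv_Sh [simp]: "rv Sh = Sh"
  by (simp add: Sh_eq algebra_simps)

definition pj :: "(word \<Rightarrow> bool) \<Rightarrow> ser \<Rightarrow> ser" where
  "pj P X = Ser (\<lambda>w. if P w then cf X w else 0)"

lemma cf_pj: "cf (pj P X) w = (if P w then cf X w else 0)"
  by (simp add: pj_def)

text \<open>Modulo words outside \<open>B1\<close>, the product \<open>Z * lt X1\<close> involves only the words \<open>u\<close> with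
  \<open>u @ [X1] \<in> B1\<close>. They fall into four families, according to the first letter and to whether
  \<open>u @ [X1]\<close> contains \<open>[X1, X1]\<close>.\<close>

definition pD where "pD w \<longleftrightarrow> no00 w \<and> count11 (w @ [X1]) = 0 \<and> (w = [] \<or> hd w = X1)"
definition pb where "pb w \<longleftrightarrow> no00 w \<and> count11 (w @ [X1]) = 0 \<and> w \<noteq> [] \<and> hd w = X0"
definition pH1 where "pH1 w \<longleftrightarrow> no00 w \<and> count11 (w @ [X1]) = 1 \<and> w \<noteq> [] \<and> hd w = X1"
definition pH0 where "pH0 w \<longleftrightarrow> no00 w \<and> count11 (w @ [X1]) = 1 \<and> w \<noteq> [] \<and> hd w = X0"

lemmas pdefs = pD_def pb_def pH1_def pH0_def

text \<open>Appending X1 forces an alternating word to be empty or to end in X0, so only its first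
  letter remains free.\<close>

lemma alternating_cases:
  assumes "no00 w" "count11 (w @ [X1]) = 0"
  obtains n where "w = wpow [X1, X0] n" | n where "w = X0 # wpow [X1, X0] n"
proof -
  have "\<exists>n. w = wpow [X1, X0] n \<or> w = X0 # wpow [X1, X0] n"
    using assms
  proof (induction w)
    case Nil
    show ?case by (rule exI[of _ 0]) simp
  next
    case (Cons x w)
    then obtain n where n: "w = wpow [X1, X0] n \<or> w = X0 # wpow [X1, X0] n"
      by (auto simp: no00_Cons count11_Cons split: if_splits)
    show ?case
    proof (cases x)
      case X0
      hence "w = wpow [X1, X0] n" using n Cons.prems by (auto simp: no00_Cons)
      thus ?thesis using X0 by auto
    next
      case X1
      have "w \<noteq> []" "hd w \<noteq> X1" using Cons.prems X1 by (auto simp: count11_Cons hd_append split: if_splits)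
      hence "w = X0 # wpow [X1, X0] n" using n wpow_10_props(3)[of n] by (cases n) auto
      thus ?thesis using X1 by (intro exI[of _ "Suc n"]) (simp add: wpow_Suc)
    qed
  qed
  thus ?thesis using that by blast
qed

text \<open>For \<open>k > 0\<close> the double X1 follows the first \<open>m\<close> blocks; for
  \<open>k = 0\<close> it appears only once X1 is appended, which is why the counter is applied to
  \<open>w @ [X1]\<close>.\<close>

definition A10 :: "nat \<Rightarrow> nat \<Rightarrow> word" where
  "A10 m k = wpow [X1, X0] m @ [X1] @ wpow [X1, X0] k"

lemma hd_A10: "hd (A10 m k) = X1"
  using wpow_10_props(3)[of m] by (cases m) (simp_all add: A10_def hd_append)

lemma one_double_cases:
  assumes "no00 w" "count11 (w @ [X1]) = 1" "w \<noteq> []"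
  obtains m k where "w = A10 m k" | m k where "w = X0 # A10 m k"
proof -
  have "\<exists>m k. w = A10 m k \<or> w = X0 # A10 m k"
    using assms
  proof (induction w)
    case (Cons x w)
    show ?case
    proof (cases "w = []")
      case True
      with Cons.prems show ?thesis
        by (cases x) (auto simp: count11_Cons A10_def intro!: exI[of _ 0])
    next
      case False
      show ?thesis
      proof (cases "count11 (w @ [X1]) = 0")
        case True
        have *: "x = X1" "hd w = X1" "no00 w"
          using True Cons.prems False by (auto simp: count11_Cons no00_Cons hd_append split: if_splits)
        from alternating_cases[OF *(3) True] obtain n where "w = wpow [X1, X0] n"
          using * False by (metis letter.distinct(1) list.sel(1))
        thus ?thesis using *(1) by (intro exI[of _ 0] exI[of _ n]) (simp add: A10_def)
      next
        case d: False
        have *: "count11 (w @ [X1]) = 1" "\<not> (x = X1 \<and> hd w = X1)" "\<not> (x = X0 \<and> hd w = X0)" "no00 w"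
          using d Cons.prems False by (auto simp: count11_Cons no00_Cons split: if_splits)
        then obtain m k where mk: "w = A10 m k \<or> w = X0 # A10 m k"
          using Cons.IH False by auto
        show ?thesis
        proof (cases x)
          case X0
          thus ?thesis using mk * by auto
        next
          case X1
          hence "w = X0 # A10 m k" using mk * hd_A10 by auto
          thus ?thesis using X1 by (intro exI[of _ "Suc m"] exI[of _ k]) (simp add: A10_def wpow_Suc)
        qed
      qed
    qed
  qed simp
  thus ?thesis using that by blast
qed

lemma no00_A10: "no00 (A10 m k)" and count11_A10: "count11 (A10 m k @ [X1]) = 1"
proof -
  show "no00 (A10 m k)"
    using wpow_10_props(1,3,4) by (auto simp: A10_def no00_append no00_Cons hd_append)
  show "count11 (A10 m k @ [X1]) = 1"
    using wpow_10_props by (cases "k = 0") (auto simp: A10_def count11_append count11_Cons hd_append)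
qed

lemma pD_iff: "pD w \<longleftrightarrow> (\<exists>n. w = wpow [X1, X0] n)"
proof
  assume "pD w"
  thus "\<exists>n. w = wpow [X1, X0] n"
    by (auto simp: pD_def elim!: alternating_cases intro: exI[of _ 0])
next
  assume "\<exists>n. w = wpow [X1, X0] n"
  thus "pD w" using wpow_10_props by (force simp: pD_def count11_append)
qed

lemma pb_iff: "pb w \<longleftrightarrow> (\<exists>n. w = X0 # wpow [X1, X0] n)"
proof
  assume "pb w"
  hence w: "no00 w" "count11 (w @ [X1]) = 0" "w \<noteq> []" "hd w = X0" by (auto simp: pb_def)
  from w(1,2) show "\<exists>n. w = X0 # wpow [X1, X0] n"
  proof (cases rule: alternating_cases)
    case (1 n)
    thus ?thesis using w wpow_10_props(3)[of n] by (cases n) auto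
  qed auto
next
  assume "\<exists>n. w = X0 # wpow [X1, X0] n"
  thus "pb w" using wpow_10_props by (force simp: pb_def count11_append no00_Cons count11_Cons)
qed

lemma pH1_iff: "pH1 w \<longleftrightarrow> (\<exists>m k. w = A10 m k)"
proof
  assume "pH1 w"
  thus "\<exists>m k. w = A10 m k"
    by (auto simp: pH1_def elim!: one_double_cases)
next
  assume "\<exists>m k. w = A10 m k"
  moreover have "A10 m k \<noteq> []" for m k by (simp add: A10_def)
  ultimately show "pH1 w" using hd_A10 no00_A10 count11_A10 by (auto simp: pH1_def)
qed

lemma pb_palindrome: "pb w \<Longrightarrow> rev w = w"
  by (auto simp: pb_iff rev_wpow wpow_shift)


definition Zx :: "ser \<Rightarrow> ser" where "Zx Z = pj pD Z + pj pb Z + pj pH1 Z + pj pH0 Z"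

lemma modB_times_x: "modB (Z * lt X1) = modB (Zx Z * lt X1)"
proof -
  have "cf (Z * lt X1) w = cf (Zx Z * lt X1) w" if "w \<in> B1" for w
  proof (cases w rule: rev_cases)
    case (snoc a y)
    show ?thesis
    proof (cases "y = X1")
      case True
      have a: "no00 a" "count11 (a @ [X1]) \<le> 1"
        using that snoc True by (auto simp: B1_iff no00_append)
      hence "cf (Zx Z) a = cf Z a"
        by (cases "count11 (a @ [X1]) = 0"; cases "hd a"; cases "a = []")
           (simp_all add: Zx_def cf_pj pdefs count11_Cons)
      thus ?thesis by (simp only: snoc cf_times_lt_snoc)
    qed (simp add: snoc cf_times_lt_snoc)
  qed (simp add: cf_lt)
  thus ?thesis by (simp add: modB_eq_iff)
qed

lemma pD_nonzero: "cf (pj pD Z) w \<noteq> 0 \<Longrightarrow> no00 w \<and> count11 (w @ [X1]) = 0 \<and> count11 w = 0 \<and> (w \<noteq> [] \<longrightarrow> hd w = X1)"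
  and pb_nonzero: "cf (pj pb Z) w \<noteq> 0 \<Longrightarrow> w \<noteq> [] \<and> hd w = X0"
  and pH1_nonzero: "cf (pj pH1 Z) w \<noteq> 0 \<Longrightarrow> w \<noteq> [] \<and> count11 (w @ [X1]) = 1 \<and> hd w = X1"
  and pH0_nonzero: "cf (pj pH0 Z) w \<noteq> 0 \<Longrightarrow> w \<noteq> [] \<and> count11 (w @ [X1]) = 1 \<and> hd w = X0"
  by (auto simp: cf_pj pdefs count11_append split: if_splits)

text \<open>The words of each family have lengths of constant parity, so the sign map acts on each
  family by a scalar.\<close>

lemma sg_pj:
  "sg (pj pD Z) = pj pD Z" "sg (pj pb Z) = - pj pb Z" "sg (pj pH1 Z) = - pj pH1 Z"
  "sg (pj pH0 Z) = pj pH0 Z"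
proof -
  have "even (length w)" if "pD w" for w
    using that by (auto simp: pD_iff)
  thus "sg (pj pD Z) = pj pD Z"
    by (intro ser_eqI) (simp add: cf_pj uminus_power_if)
  have "odd (length w)" if "pb w" for w
    using that by (auto simp: pb_iff)
  thus "sg (pj pb Z) = - pj pb Z"
    by (intro ser_eqI) (simp add: cf_pj uminus_power_if)
  have "odd (length w)" if "pH1 w" for w
    using that by (auto simp: pH1_iff A10_def)
  thus "sg (pj pH1 Z) = - pj pH1 Z"
    by (intro ser_eqI) (simp add: cf_pj uminus_power_if)
  have "even (length w)" if "pH0 w" for w
    using that by (auto simp: pH0_def A10_def elim!: one_double_cases)
        (use hd_A10 in \<open>auto simp: A10_def\<close>)
  thus "sg (pj pH0 Z) = pj pH0 Z"
    by (intro ser_eqI) (simp add: cf_pj uminus_power_if)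
qed

lemma rv_pb: "rv (pj pb Z) = pj pb Z"
proof (rule ser_eqI)
  fix w
  have "pb (rev w) \<longleftrightarrow> pb w" using pb_palindrome[of w] pb_palindrome[of "rev w"] by auto
  thus "cf (rv (pj pb Z)) w = cf (pj pb Z) w" using pb_palindrome[of w] by (simp add: cf_pj)
qed

lemma modB_sg: "modB X = modB Y \<Longrightarrow> modB (sg X) = modB (sg Y)"
  by (simp add: modB_eq_iff)

lemma sg_lt: "sg (lt x) = - lt x"
  by (rule ser_eqI) (auto simp: cf_lt)

lemma sg_ring: "sg (X + Y) = sg X + sg Y" "sg (- X) = - sg X" "sg (sg X) = X"
  by (rule ser_eqI; simp add: algebra_simps flip: power_add)+

lemma sg_rv: "sg (rv X) = rv (sg X)"
  by (rule ser_eqI) simp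

lemma modB_x_times:
  "modB (lt X1 * sg (rv Z)) = modB (lt X1 * (rv (pj pD Z) - pj pb Z - rv (pj pH1 Z) + rv (pj pH0 Z)))"
proof -
  have "rv (- sg (Z * lt X1)) = lt X1 * sg (rv Z)"
    by (simp add: rv_times sg_times sg_lt sg_rv)
  moreover have "- sg (Zx Z * lt X1) = (pj pD Z - pj pb Z - pj pH1 Z + pj pH0 Z) * lt X1"
    by (simp add: sg_times sg_lt Zx_def sg_ring sg_pj algebra_simps)
  hence "rv (- sg (Zx Z * lt X1)) = lt X1 * (rv (pj pD Z) - pj pb Z - rv (pj pH1 Z) + rv (pj pH0 Z))"
    by (simp add: rv_times rv_pb)
  moreover have "modB_rv (modB (- sg (Z * lt X1))) = modB_rv (modB (- sg (Zx Z * lt X1)))"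
    using modB_sg[OF modB_times_x[of Z]] by simp
  ultimately show ?thesis by (simp only: modB_rv_modB)
qed

lemma not_B1_zeros: "u \<noteq> [] \<Longrightarrow> v \<noteq> [] \<Longrightarrow> last u = X0 \<Longrightarrow> hd v = X0 \<Longrightarrow> u @ v \<notin> B1"
  by (simp add: B1_iff no00_append)

lemma not_B1_count11: "count11 u + count11 v \<ge> 2 \<Longrightarrow> u @ v \<notin> B1"
  by (auto simp: B1_iff count11_append)

lemma not_B1_mid: "count11 (u @ [X1]) \<ge> 1 \<Longrightarrow> count11 (v @ [X1]) \<ge> 1 \<Longrightarrow> u @ [X1] @ rev v \<notin> B1"
proof -
  assume *: "count11 (u @ [X1]) \<ge> 1" "count11 (v @ [X1]) \<ge> 1"
  have "count11 (v @ [X1]) = count11 ([X1] @ rev v)"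
    by (metis count11_rev rev.simps rev_append rev_singleton_conv append.left_neutral)
  hence "count11 (u @ [X1] @ rev v) \<ge> 2" using *
    by (auto simp: count11_append count11_Cons split: if_splits)
  thus ?thesis by (simp add: B1_iff)
qed

text \<open>The two facts about Z that the algebra consumes. I expresses \<open>pj pb Z\<close>
  through \<open>pj pD Z\<close>; II is what remains of the palindromic identity once the common
  factor 1 + \<open>S0_00\<close> / 2 is split off on both sides.\<close>

locale core =
  fixes Z :: ser
  assumes I: "modB (cser S0_00 * pj pD Z) = - modB (2 * pj pb Z)"
    and II: "modB_rv (modB ((2 * pj pH1 Z + cser S1_10 * pj pD Z) * lt X1 * rv (pj pD Z)))
           = modB ((2 * pj pH1 Z + cser S1_10 * pj pD Z) * lt X1 * rv (pj pD Z))"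
begin

definition "d = modB (pj pD Z)"
definition "d' = modB (rv (pj pD Z))"
definition "b = modB (pj pb Z)"
definition "h1 = modB (pj pH1 Z)"
definition "h1' = modB (rv (pj pH1 Z))"
definition "h0 = modB (pj pH0 Z)"
definition "h0' = modB (rv (pj pH0 Z))"
definition "s = modB (cser S0_00)"
definition "s10 = modB (cser S1_10)"
definition "s01 = modB (cser S1_01)"
definition "s00 = modB (cser S1_00)"
definition "x = modB (lt X1)"
definition "hf = modB (cst (1/2))"

lemmas names = d_def d'_def b_def h1_def h1'_def h0_def h0'_def s_def s10_def s01_def s00_def x_def

lemma modB_rv_names [simp]:
  "modB_rv d = d'" "modB_rv d' = d" "modB_rv b = b" "modB_rv h1 = h1'" "modB_rv h1' = h1" "modB_rv h0 = h0'" "modB_rv h0' = h0"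
  "modB_rv s = s" "modB_rv s10 = s01" "modB_rv s01 = s10" "modB_rv s00 = s00" "modB_rv x = x" "modB_rv hf = hf"
  by (simp_all add: names hf_def rv_pb)

text \<open>Either X0 X0 arises at a junction, or the product has two occurrences of X1 X1, where
  one may be completed by the final X1.\<close>

lemma vanish:
  "s * b = 0" "s * h0 = 0" "s10 * b = 0" "s00 * b = 0"
  "s10 * h1 * x = 0" "s10 * h0 * x = 0" "s01 * d * x = 0" "s01 * h1 * x = 0" "s01 * h0 * x = 0"
  "s00 * h1 * x = 0" "s00 * h0 * x = 0"
proof -
  note nz = S0_00_nonzero S1_10_nonzero S1_01_nonzero S1_00_nonzero
    pD_nonzero pb_nonzero pH1_nonzero pH0_nonzero
  show "s * b = 0" "s * h0 = 0" "s10 * b = 0" "s00 * b = 0"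
    unfolding names by (rule modB_times_eq_0, rule not_B1_zeros; auto dest: nz)+
  have *: "modB X * modB Y * modB (lt X1) = 0"
    if "\<And>u. cf X u \<noteq> 0 \<Longrightarrow> count11 u \<ge> 1" "\<And>v. cf Y v \<noteq> 0 \<Longrightarrow> count11 (v @ [X1]) \<ge> 1" for X Y
  proof (rule modB_times3_eq_0)
    fix u v w assume "cf X u \<noteq> 0" "cf Y v \<noteq> 0" "cf (lt X1) w \<noteq> 0"
    hence "count11 u \<ge> 1" "count11 (v @ w) \<ge> 1" using that by (auto simp: cf_lt split: if_splits)
    thus "u @ v @ w \<notin> B1" by (intro not_B1_count11) simp
  qed
  show "s10 * h1 * x = 0" "s10 * h0 * x = 0" "s01 * h1 * x = 0" "s01 * h0 * x = 0"
    "s00 * h1 * x = 0" "s00 * h0 * x = 0"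
    unfolding names by (rule *; auto dest: nz)+
  \<comment> \<open>Here the second X1 X1 arises at the junction: \<open>S1_01\<close> ends in X1,
    and the next letter is X1 even when the middle word is empty.\<close>
  show "s01 * d * x = 0"
    unfolding names
  proof (rule modB_times3_eq_0)
    fix u v w assume "cf (cser S1_01) u \<noteq> 0" "cf (pj pD Z) v \<noteq> 0" "cf (lt X1) w \<noteq> 0"
    hence "count11 u = 1 \<and> last u = X1 \<and> u \<noteq> []" "w = [X1]" "v \<noteq> [] \<longrightarrow> hd v = X1"
      by (auto simp: cf_lt split: if_splits dest: nz)
    hence "count11 (u @ v @ w) \<ge> 2" by (cases "v = []") (auto simp: count11_append)
    thus "u @ v @ w \<notin> B1" by (simp add: B1_iff)
  qed
qed

text \<open>The terms of \<open>Sh * Zx Z\<close> that survive \<open>vanish\<close> and use up the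
  single X1 X1 permitted in a word of \<open>B1\<close>.\<close>

definition "K = pj pH1 Z + cser S1_10 * pj pD Z + pj pH0 Z + cser S0_00 * pj pH1 Z
  + cser S1_01 * pj pb Z + cser S1_00 * pj pD Z"

lemma K_nonzero: "cf K u \<noteq> 0 \<Longrightarrow> count11 (u @ [X1]) \<ge> 1"
proof -
  assume "cf K u \<noteq> 0"
  then consider "cf (pj pH1 Z) u \<noteq> 0" | "cf (cser S1_10 * pj pD Z) u \<noteq> 0" | "cf (pj pH0 Z) u \<noteq> 0"
    | "cf (cser S0_00 * pj pH1 Z) u \<noteq> 0" | "cf (cser S1_01 * pj pb Z) u \<noteq> 0"
    | "cf (cser S1_00 * pj pD Z) u \<noteq> 0"
    unfolding K_def cf_ring by fastforce
  thus ?thesis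
  proof cases
    case 1 thus ?thesis using pH1_nonzero by force
  next
    case 3 thus ?thesis using pH0_nonzero by force
  next
    case 2 thus ?thesis using S1_10_nonzero(2)
      by (auto simp: count11_append elim!: cf_times_nonzeroE) fastforce?
  next
    case 4
    then obtain p q where "u = p @ q" "cf (pj pH1 Z) q \<noteq> 0" by (auto elim!: cf_times_nonzeroE)
    thus ?thesis using pH1_nonzero[of Z q] by (auto simp: count11_append split: if_splits)
  next
    case 5 thus ?thesis using S1_01_nonzero(2)
      by (auto simp: count11_append elim!: cf_times_nonzeroE) fastforce?
  next
    case 6
    then obtain p q where "u = p @ q" "S1_00 p \<noteq> 0" by (auto elim!: cf_times_nonzeroE)
    thus ?thesis using S1_00_nonzero(1)[of p] by (simp add: count11_append)
  qed
qed

lemma K_vanish: "modB K * x * h1' = 0" "modB K * x * h0' = 0" 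
  unfolding names
proof -
  have "modB K * modB (lt X1) * modB (rv Y) = 0" if "\<And>v. cf Y v \<noteq> 0 \<Longrightarrow> count11 (v @ [X1]) \<ge> 1" for Y
  proof (rule modB_times3_eq_0)
    fix u v w assume "cf K u \<noteq> 0" "cf (lt X1) v \<noteq> 0" "cf (rv Y) w \<noteq> 0"
    thus "u @ v @ w \<notin> B1"
      using not_B1_mid[of u "rev w"] K_nonzero that by (auto simp: cf_lt split: if_splits)
  qed
  thus "modB K * modB (lt X1) * modB (rv (pj pH1 Z)) = 0" "modB K * modB (lt X1) * modB (rv (pj pH0 Z)) = 0"
    using pH1_nonzero pH0_nonzero by force+
qed

lemma hf2: "hf + hf = 1" and hf_comm: "hf * y = y * hf"
proof -
  have "cst (1/2) + cst (1/2) = 1" by (simp flip: cst_add)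
  thus "hf + hf = 1" unfolding hf_def by (simp flip: modB_ring(1))
  show "hf * y = y * hf"
    unfolding hf_def by transfer (simp add: eqB_def)
qed

text \<open>With g = d - b and j = K - (h0 - h1), the claim reduces to j x rev(g) = g x rev(j). Both
  g and j have the left factor 1 + s/2; stripping it on both sides leaves hypothesis II.\<close>

lemma SN_palindrome:
  fixes N defines "N \<equiv> modB (Z * lt X1 * sg (rv Z))"
  shows "modB_rv (modB Sh * N) = modB Sh * N"
proof -
  have I': "s * d = - (b + b)" using I by (simp add: names modB_times mult_2)
  define q where "q = h1 + h1 + s10 * d"
  define q' where "q' = h1' + h1' + d' * s01"
  have q': "modB_rv q = q'" by (simp add: q_def q'_def modB_rv_times)
  have II': "q * x * d' = d * x * q'"
  proof -
    have "modB_rv (q * x * d') = q * x * d'"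
      using II by (simp add: q_def names modB_times mult_2 distrib_right)
    thus ?thesis by (simp add: modB_rv_times q' mult.assoc)
  qed
  have s00: "s00 = hf * (s * s10 + s01 * s)"
    by (simp add: names hf_def cser_S1_00 modB_times)
  define k where "k = modB K"
  have k: "k = h1 + s10 * d + h0 + s * h1 + s01 * b + s00 * d"
    by (simp add: k_def K_def names modB_times)
  have "N = modB (Z * lt X1) * modB (sg (rv Z))" by (simp add: N_def modB_times)
  also have "\<dots> = (d + b + h1 + h0) * (x * modB (sg (rv Z)))"
    unfolding modB_times_x[of Z] by (simp add: modB_times Zx_def names mult.assoc)
  also have "x * modB (sg (rv Z)) = x * (d' - b - h1' + h0')"
    using modB_x_times[of Z] by (simp add: modB_times names)
  finally have N: "N = (d + b + h1 + h0) * x * (d' - b - h1' + h0')" by (simp add: mult.assoc)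
  have "modB Sh * ((d + b + h1 + h0) * x) = (d - b + k) * x"
    using vanish unfolding k
    by (simp add: Sh_eq algebra_simps flip: s_def s10_def s01_def s00_def mult.assoc) (simp add: I' algebra_simps)
  hence SN: "modB Sh * N = (d - b + k) * x * (d' - b - h1' + h0')"
    by (simp add: N mult.assoc[symmetric])
  have kv: "k * x * h1' = 0" "k * x * h0' = 0" using K_vanish by (simp_all add: k_def)
  define g h where "g = d - b" and "h = h0 - h1"
  \<comment> \<open>The right factor is the reversal of g + h; the term pairing \<open>k\<close>
    with the reversal of \<open>h\<close> contains X1 X1 twice and drops out.\<close>
  have SN2: "modB Sh * N = g * x * modB_rv g + k * x * modB_rv g + g * x * modB_rv h"
    unfolding SN g_def h_def using kv by (simp add: algebra_simps)
  define j where "j = k - h"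
  have "j = h1 + h1 + s10 * d + s * h1 + s01 * b + s00 * d"
    by (simp add: j_def k h_def)
  \<comment> \<open>By I the second product in \<open>s00\<close> contributes exactly the negative
    of the summand \<open>s01 * b\<close> of \<open>j\<close>; this is what fixes the coefficient
    1/2.\<close>
  also have "s00 * d = hf * s * (s10 * d) - s01 * b"
  proof -
    have "s00 * d = hf * s * (s10 * d) + hf * (s01 * (s * d))"
      by (simp add: s00 algebra_simps)
    also have "hf * (s01 * (s * d)) = - ((hf + hf) * (s01 * b))"
      by (simp add: I' algebra_simps)
    finally show ?thesis by (simp add: hf2)
  qed
  also have "s * h1 = hf * s * (h1 + h1)"
    using arg_cong[OF hf2, of "\<lambda>y. y * (s * h1)"] by (simp add: algebra_simps)
  finally have j: "j = (1 + hf * s) * q" by (simp add: q_def algebra_simps)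
  have g: "g = (1 + hf * s) * d"
    using arg_cong[OF hf2, of "\<lambda>y. y * b"] by (simp add: g_def algebra_simps I')
  have jg: "j * x * modB_rv g = g * x * modB_rv j"
  proof -
    have "j * x * modB_rv g = (1 + hf * s) * (q * x * d') * (1 + s * hf)"
      unfolding j g by (simp add: modB_rv_times mult.assoc)
    also have "\<dots> = g * x * modB_rv j"
      unfolding II' unfolding j g by (simp add: modB_rv_times q' mult.assoc)
    finally show ?thesis .
  qed
  have "modB_rv (modB Sh * N) = g * x * modB_rv g + g * x * modB_rv k + h * x * modB_rv g"
    unfolding SN2 by (simp add: modB_rv_times mult.assoc)
  also have "\<dots> = modB Sh * N"
    unfolding SN2 using jg by (simp add: j_def algebra_simps)
  finally show ?thesis .
qed

end

text \<open>As \<open>Q\<close> has constant term 1, the coefficient of the quotient at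
  \<open>w\<close> can be solved for in terms of those at proper prefixes.\<close>

lemma ser_right_divide:
  assumes "cf Q [] = 1"
  obtains C where "C * Q = A"
proof -
  define rel where "rel = Wellfounded.measure (length :: word \<Rightarrow> nat)"
  define r where "r = wfrec rel (\<lambda>r w. cf A w - (\<Sum>i<length w. r (take i w) * cf Q (drop i w)))"
  have r: "r w = cf A w - (\<Sum>i<length w. r (take i w) * cf Q (drop i w))" for w
    unfolding r_def
    by (subst wfrec) (auto simp: rel_def cut_def intro!: sum.cong)
  have "cf (Ser r * Q) w = cf A w" for w
  proof -
    have "cf (Ser r * Q) w = (\<Sum>i<length w. r (take i w) * cf Q (drop i w)) + r w"
      using assms by (simp add: cf_times lessThan_Suc_atMost[symmetric])
    thus ?thesis using r[of w] by simp
  qed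
  hence "Ser r * Q = A" by (intro ser_eqI)
  thus ?thesis by (rule that)
qed

lemma ser_inverse:
  assumes "cf Q [] = 1"
  obtains R where "R * Q = 1" "Q * R = 1" "cf R [] = 1"
proof -
  obtain R where R: "R * Q = 1" by (rule ser_right_divide[OF assms])
  have "cf (R * Q) [] = 1" by (simp add: R cf_one)
  hence Rn: "cf R [] = 1" using assms by simp
  then obtain R' where R': "R' * R = 1" by (rule ser_right_divide)
  have "R' = R' * R * Q" by (simp add: R mult.assoc)
  hence "R' = Q" by (simp add: R')
  thus ?thesis using that R R' Rn by blast
qed

section \<open>Solutions of the differential equation\<close>

definition ser_deriv :: "(complex \<Rightarrow> ser) \<Rightarrow> ser \<Rightarrow> complex \<Rightarrow> bool" where
  "ser_deriv P P' z \<longleftrightarrow> (\<forall>w. ((\<lambda>z. cf (P z) w) has_field_derivative cf P' w) (at z))"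

lemma ser_deriv_times:
  assumes "ser_deriv P P' z" "ser_deriv Q Q' z"
  shows "ser_deriv (\<lambda>z. P z * Q z) (P' * Q z + P z * Q') z"
  unfolding ser_deriv_def
proof
  fix w
  have "((\<lambda>z. \<Sum>i\<le>length w. cf (P z) (take i w) * cf (Q z) (drop i w)) has_field_derivative
    (\<Sum>i\<le>length w. cf P' (take i w) * cf (Q z) (drop i w) + cf Q' (drop i w) * cf (P z) (take i w))) (at z)"
    using assms by (auto intro!: DERIV_sum DERIV_mult simp: ser_deriv_def)
  thus "((\<lambda>z. cf (P z * Q z) w) has_field_derivative cf (P' * Q z + P z * Q') w) (at z)"
    by (simp add: cf_times sum.distrib mult.commute)
qed

lemma ser_deriv_const: "ser_deriv (\<lambda>_. C) 0 z"
  by (simp add: ser_deriv_def)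

lemma ser_deriv_diff: "ser_deriv P P' z \<Longrightarrow> ser_deriv Q Q' z \<Longrightarrow> ser_deriv (\<lambda>z. P z - Q z) (P' - Q') z"
  unfolding ser_deriv_def cf_ring by (intro allI DERIV_diff) auto

lemma ser_deriv_cmult: "ser_deriv P P' z \<Longrightarrow> ser_deriv (\<lambda>z. C * P z) (C * P') z"
  using ser_deriv_times[OF ser_deriv_const, of P P' z C] by simp

lemma ser_deriv_maps:
  assumes "ser_deriv P P' z"
  shows "ser_deriv (\<lambda>z. sg (rv (P z))) (sg (rv P')) z" "ser_deriv (\<lambda>z. sw (P z)) (sw P') z"
proof -
  show "ser_deriv (\<lambda>z. sw (P z)) (sw P') z" using assms by (simp add: ser_deriv_def)
  show "ser_deriv (\<lambda>z. sg (rv (P z))) (sg (rv P')) z" using assms unfolding ser_deriv_def cf_maps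
    by (intro allI DERIV_cmult) auto
qed

text \<open>The connection form of the Knizhnik-Zamolodchikov equation in one variable. Multiplying
  by it on the right removes the last letter of a word, as differentiation of a polylogarithm
  does.\<close>

definition KZ_form :: "complex \<Rightarrow> ser" where
  "KZ_form z = cst (1 / z) * lt X0 + cst (1 / (z - 1)) * lt X1"

lemma cf_times_KZ_form:
  "cf (P * KZ_form z) [] = 0" "cf (P * KZ_form z) (w @ [x]) = cf P w / (z - pt x)"
proof -
  have *: "P * KZ_form z = cst (1 / z) * (P * lt X0) + cst (1 / (z - 1)) * (P * lt X1)"
    by (simp add: KZ_form_def distrib_left mult.assoc cst_commute[of _ "_ * _"]) (simp flip: cst_commute)
  show "cf (P * KZ_form z) [] = 0" by (simp add: * cf_lt)
  show "cf (P * KZ_form z) (w @ [x]) = cf P w / (z - pt x)"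
    by (cases x) (simp_all add: * cf_times_lt_snoc pt_def)
qed

text \<open>The sign in the first identity is that of the equation for an inverse; the sign in the
  second cancels the chain rule for 1 - z.\<close>

lemma KZ_form_maps [simp]: "sg (rv (KZ_form z)) = - KZ_form z" "sw (KZ_form (1 - z)) = - KZ_form z" "cj (KZ_form z) = KZ_form (cnj z)"
proof -
  have [simp]: "sg (cst c) = cst c" for c by (rule ser_eqI) (simp add: cf_cst)
  show "sg (rv (KZ_form z)) = - KZ_form z"
    by (simp add: KZ_form_def rv_times sg_times sg_lt sg_ring cst_commute)
  have "1 / (1 - z) = - (1 / (z - 1))" by (simp add: minus_divide_right)
  hence "cst (1 / (1 - z)) = - cst (1 / (z - 1))" by (simp only: cst_uminus)
  moreover have "1 / (1 - z - 1) = - (1 / z)" by simp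
  hence "cst (1 / (1 - z - 1)) = - cst (1 / z)" by (simp only: cst_uminus)
  ultimately show "sw (KZ_form (1 - z)) = - KZ_form z"
    by (simp only: KZ_form_def ser_maps_ring sw_times ser_maps_lt flip_simps) (simp add: algebra_simps)
  show "cj (KZ_form z) = KZ_form (cnj z)" by (simp add: KZ_form_def cj_times)
qed

definition KZ_sol :: "complex set \<Rightarrow> (complex \<Rightarrow> ser) \<Rightarrow> bool" where
  "KZ_sol U P \<longleftrightarrow> (\<forall>z\<in>U. ser_deriv P (P z * KZ_form z) z)"

lemma KZ_sol_cmult: "KZ_sol U P \<Longrightarrow> KZ_sol U (\<lambda>z. C * P z)"
  unfolding KZ_sol_def by (metis mult.assoc ser_deriv_cmult)

lemma KZ_sol_diff: "KZ_sol U P \<Longrightarrow> KZ_sol U Q \<Longrightarrow> KZ_sol U (\<lambda>z. P z - Q z)"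
  unfolding KZ_sol_def by (metis left_diff_distrib ser_deriv_diff)

text \<open>The equation is triangular: the derivative of each coefficient involves only a shorter
  word, so vanishing at one point propagates by induction.\<close>

lemma KZ_sol_zero:
  assumes "KZ_sol U P" "open U" "connected U" "z0 \<in> U" "P z0 = 0" "z \<in> U"
  shows "P z = 0"
proof -
  have const: "\<forall>z\<in>U. f z = 0" if "\<And>z. z \<in> U \<Longrightarrow> (f has_field_derivative 0) (at z)" "f z0 = 0" for f
    using has_field_derivative_0_imp_constant_on[OF that(1) assms(3,2)] that(2) assms(4)
    by (auto simp: constant_on_def)
  have "\<forall>z\<in>U. cf (P z) w = 0" for w
  proof (induction w rule: rev_induct)
    case Nil
    have "((\<lambda>z. cf (P z) []) has_field_derivative 0) (at z)" if "z \<in> U" for z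
      using assms(1) that unfolding KZ_sol_def ser_deriv_def by (metis cf_times_KZ_form(1))
    thus ?case using assms(5) by (intro const) auto
  next
    case (snoc x w)
    have "((\<lambda>z. cf (P z) (w @ [x])) has_field_derivative 0) (at z)" if "z \<in> U" for z
    proof -
      have "((\<lambda>z. cf (P z) (w @ [x])) has_field_derivative cf (P z * KZ_form z) (w @ [x])) (at z)"
        using assms(1) that by (auto simp: KZ_sol_def ser_deriv_def)
      thus ?thesis using snoc that by (simp add: cf_times_KZ_form)
    qed
    thus ?case using assms(5) by (intro const) auto
  qed
  thus ?thesis using assms(6) by (intro ser_eqI) simp
qed

lemma KZ_sol_eqI:
  assumes "KZ_sol U P" "KZ_sol U Q" "open U" "connected U" "z0 \<in> U" "P z0 = Q z0" "z \<in> U"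
  shows "P z = Q z"
  using KZ_sol_zero[OF KZ_sol_diff[OF assms(1,2)] assms(3-5)] assms(6,7) by simp

lemma ser_deriv_ex:
  assumes "(l has_field_derivative l') (at z)"
  shows "ser_deriv (\<lambda>z. ex x (l z)) (cst l' * (ex x (l z) * lt x)) z"
  unfolding ser_deriv_def
proof
  fix w
  show "((\<lambda>z. cf (ex x (l z)) w) has_field_derivative cf (cst l' * (ex x (l z) * lt x)) w) (at z)"
  proof (cases w rule: rev_cases)
    case (snoc v y)
    have *: "w = replicate (length w) x \<longleftrightarrow> v = replicate (length v) x \<and> y = x"
      by (simp add: snoc replicate_append_same[symmetric])
    show ?thesis
    proof (cases "v = replicate (length v) x \<and> y = x")
      case True
      define n where "n = length v"
      have "((\<lambda>z. l z ^ Suc n / fact (Suc n)) has_field_derivative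
          (of_nat (Suc n) * (l' * l z ^ n)) / fact (Suc n)) (at z)"
        using DERIV_cdivide[OF DERIV_power[OF assms, of "Suc n"], of "fact (Suc n)"] by simp
      also have "(of_nat (Suc n) * (l' * l z ^ n)) / fact (Suc n) = l' * (l z ^ n / fact n)"
        by (simp add: fact_reduce[of "Suc n"] del: of_nat_Suc)
      finally have D: "((\<lambda>z. l z ^ Suc n / fact (Suc n)) has_field_derivative
          l' * (l z ^ n / fact n)) (at z)" .
      have "w = replicate (Suc n) x" using True by (metis * n_def snoc length_append_singleton)
      hence "cf (ex x c) w = c ^ Suc n / fact (Suc n)" for c by (metis cf_ex_replicate)
      moreover have "cf (ex x (l z) * lt x) w = l z ^ n / fact n"
        using True by (simp add: snoc cf_times_lt_snoc n_def cf_ex)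
      ultimately show ?thesis using D by simp
    next
      case False
      hence "cf (ex x c) w = 0" for c using * by (auto simp: cf_ex)
      moreover have "cf (cst l' * (ex x (l z) * lt x)) w = 0"
        using False by (auto simp: snoc cf_times_lt_snoc cf_ex)
      ultimately show ?thesis by (simp del: cf_cst_times)
    qed
  qed (simp add: cf_lt)
qed

section \<open>The plane cut along [1, infinity) and the holomorphic factor at 0\<close>

definition U1 :: "complex set" where "U1 = - (complex_of_real ` {1..})"

lemma U1_iff: "z \<in> U1 \<longleftrightarrow> Im z \<noteq> 0 \<or> Re z < 1"
proof -
  have "z \<in> complex_of_real ` {1..} \<longleftrightarrow> Im z = 0 \<and> Re z \<ge> 1"
    by (auto simp: image_iff complex_eq_iff intro!: bexI[of _ "Re z"])
  thus ?thesis by (auto simp: U1_def)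
qed

lemma open_U1: "open U1"
proof -
  have "U1 = {z. Im z < 0} \<union> {z. Im z > 0} \<union> {z. Re z < 1}"
    by (auto simp: U1_iff)
  moreover have "open \<dots>"
    by (intro open_Un open_halfspace_Im_lt open_halfspace_Im_gt open_halfspace_Re_lt)
  ultimately show ?thesis by simp
qed

lemma zero_in_U1 [simp]: "0 \<in> U1"
  by (simp add: U1_iff)

lemma one_notin_U1: "z \<in> U1 \<Longrightarrow> z \<noteq> 1"
  by (auto simp: U1_iff)

text \<open>The centre is 0. Starlikeness supplies both connectedness and primitives of holomorphic
  functions.\<close>

lemma starlike_U1: "starlike U1"
  unfolding starlike_def
proof (intro bexI[of _ 0] ballI subsetI)
  fix z w assume z: "z \<in> U1" and "w \<in> closed_segment 0 z"
  then obtain u where u: "0 \<le> u" "u \<le> 1" "w = of_real u * z"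
    by (auto simp: in_segment scaleR_conv_of_real)
  have "u * Re z < 1" if "Re z < 1"
  proof (cases "Re z \<le> 0")
    case True
    hence "u * Re z \<le> 0" using u by (simp add: mult_nonneg_nonpos)
    thus ?thesis by simp
  next
    case False
    hence "u * Re z \<le> 1 * Re z" using u by (intro mult_right_mono) auto
    thus ?thesis using that by simp
  qed
  thus "w \<in> U1" using z u by (cases "u = 0") (auto simp: U1_iff)
qed simp

lemma connected_U1: "connected U1"
  by (rule starlike_imp_connected[OF starlike_U1])

text \<open>The series \<open>h(z) = exp(- x0 log z) L(z)\<close> is holomorphic at 0 and solves
  \<open>h' = h * KZ_form z - (x0 / z) * h\<close>; \<open>h_rhs\<close> is a coefficient of the right-hand side, with the pole at
  0 removed.\<close>

definition diff_quot :: "(complex \<Rightarrow> complex) \<Rightarrow> complex \<Rightarrow> complex" where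
  "diff_quot f z = (if z = 0 then deriv f 0 else (f z - f 0) / z)"

lemma diff_quot_holo: "f holomorphic_on U1 \<Longrightarrow> diff_quot f holomorphic_on U1"
  using pole_lemma_open[OF _ open_U1, of f 0] by (simp only: diff_quot_def[abs_def] diff_0_right)

definition h_rhs :: "word \<Rightarrow> (complex \<Rightarrow> complex) \<Rightarrow> (complex \<Rightarrow> complex) \<Rightarrow> complex \<Rightarrow> complex" where
  "h_rhs w f g z = (if last w = X0 then diff_quot f z else f z / (z - 1)) - (if hd w = X0 then diff_quot g z else 0)"

lemma h_rhs_holo:
  assumes "f holomorphic_on U1" "g holomorphic_on U1"
  shows "h_rhs w f g holomorphic_on U1"
  unfolding h_rhs_def[abs_def]
  by (cases "last w"; cases "hd w") (auto intro!: holomorphic_intros diff_quot_holo assms dest: one_notin_U1)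

text \<open>Recursion on the length through primitives that vanish at 0. \<open>SOME\<close> picks
  the primitive; its existence is shown only afterwards.\<close>

function h_coeff :: "word \<Rightarrow> complex \<Rightarrow> complex" where
  "h_coeff w = (if w = [] then (\<lambda>_. 1) else
     (SOME h. h 0 = 0 \<and> (\<forall>z\<in>U1. (h has_field_derivative h_rhs w (h_coeff (butlast w)) (h_coeff (tl w)) z) (at z))))"
  by auto
termination by (relation "Wellfounded.measure length") auto

declare h_coeff.simps [simp del]

lemma h_coeff_Nil [simp]: "h_coeff [] = (\<lambda>_. 1)"
  by (subst h_coeff.simps) simp

text \<open>Existence of the primitive needs holomorphy of the shorter coefficients, and holomorphy
  needs existence, so both go through one induction.\<close>

lemma h_coeff_props_aux:
  "h_coeff w holomorphic_on U1 \<and>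
     (w \<noteq> [] \<longrightarrow> h_coeff w 0 = 0 \<and> (\<forall>z\<in>U1. (h_coeff w has_field_derivative h_rhs w (h_coeff (butlast w)) (h_coeff (tl w)) z) (at z)))"
proof (induction w rule: length_induct)
  fix w :: word
  assume IH: "\<forall>ys. length ys < length w \<longrightarrow> h_coeff ys holomorphic_on U1 \<and>
     (ys \<noteq> [] \<longrightarrow> h_coeff ys 0 = 0 \<and> (\<forall>z\<in>U1. (h_coeff ys has_field_derivative h_rhs ys (h_coeff (butlast ys)) (h_coeff (tl ys)) z) (at z)))"
  have main: "h_coeff w 0 = 0 \<and> (\<forall>z\<in>U1. (h_coeff w has_field_derivative h_rhs w (h_coeff (butlast w)) (h_coeff (tl w)) z) (at z))"
    if "w \<noteq> []"
  proof -
    have "h_rhs w (h_coeff (butlast w)) (h_coeff (tl w)) holomorphic_on U1"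
      using IH that by (intro h_rhs_holo) auto
    then obtain g where g: "\<And>z. z \<in> U1 \<Longrightarrow> (g has_field_derivative h_rhs w (h_coeff (butlast w)) (h_coeff (tl w)) z) (at z)"
      using holomorphic_starlike_primitive[OF _ starlike_U1 open_U1, of _ "{}"]
      by (metis finite.emptyI holomorphic_on_imp_continuous_on holomorphic_on_imp_differentiable_at open_U1 Diff_empty)
    have "\<exists>h. h 0 = 0 \<and> (\<forall>z\<in>U1. (h has_field_derivative h_rhs w (h_coeff (butlast w)) (h_coeff (tl w)) z) (at z))"
      by (rule exI[of _ "\<lambda>z. g z - g 0"]) (auto intro!: derivative_eq_intros g)
    from someI_ex[OF this] show ?thesis
      using that by (subst h_coeff.simps, subst (2) h_coeff.simps) simp
  qed
  moreover have "h_coeff w holomorphic_on U1"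
  proof (cases "w = []")
    case False
    with main show ?thesis using holomorphic_on_open[OF open_U1] by blast
  qed simp
  ultimately show "h_coeff w holomorphic_on U1 \<and>
     (w \<noteq> [] \<longrightarrow> h_coeff w 0 = 0 \<and> (\<forall>z\<in>U1. (h_coeff w has_field_derivative h_rhs w (h_coeff (butlast w)) (h_coeff (tl w)) z) (at z)))"
    by blast
qed

lemma h_coeff_holo: "h_coeff w holomorphic_on U1"
  and h_coeff_0: "h_coeff w 0 = (if w = [] then 1 else 0)"
  and h_coeff_deriv: "w \<noteq> [] \<Longrightarrow> z \<in> U1 \<Longrightarrow>
    (h_coeff w has_field_derivative h_rhs w (h_coeff (butlast w)) (h_coeff (tl w)) z) (at z)"
  using h_coeff_props_aux[of w] by auto

definition h_ser :: "complex \<Rightarrow> ser" where "h_ser z = Ser (\<lambda>w. h_coeff w z)"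

lemma cf_h_ser [simp]: "cf (h_ser z) w = h_coeff w z"
  by (simp add: h_ser_def)

lemma ser_deriv_h_ser:
  assumes "z \<in> U1" "z \<noteq> 0"
  shows "ser_deriv h_ser (h_ser z * KZ_form z - cst (1 / z) * (lt X0 * h_ser z)) z"
  unfolding ser_deriv_def
proof
  fix w
  show "((\<lambda>z. cf (h_ser z) w) has_field_derivative cf (h_ser z * KZ_form z - cst (1 / z) * (lt X0 * h_ser z)) w) (at z)"
  proof (cases "w = []")
    case True
    moreover have "cf (KZ_form z) [] = 0" using cf_times_KZ_form(1)[of 1 z] by simp
    ultimately show ?thesis by (simp add: cf_lt)
  next
    case False
    \<comment> \<open>The residues at 0 of the two terms agree: both are 1 for
      \<open>w = [X0]\<close> and 0 otherwise. Hence the poles cancel and only difference quotients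
      remain.\<close>
    define p where "p = h_coeff (butlast w) 0 * (if last w = X0 then 1 else 0)"
    have p: "p = h_coeff (tl w) 0 * (if hd w = X0 then 1 else 0)"
      unfolding p_def h_coeff_0 using False by (cases w; cases "tl w") auto
    have "cf (h_ser z * KZ_form z) w = h_coeff (butlast w) z / (z - pt (last w))"
      using cf_times_KZ_form(2)[of "h_ser z" z "butlast w" "last w"] False by simp
    also have "\<dots> = (if last w = X0 then diff_quot (h_coeff (butlast w)) z else h_coeff (butlast w) z / (z - 1)) + p / z"
      using assms(2) by (cases "last w") (auto simp: p_def diff_quot_def pt_def diff_divide_distrib)
    finally have 1: "cf (h_ser z * KZ_form z) w = \<dots>" .
    have "cf (cst (1 / z) * (lt X0 * h_ser z)) w = (if hd w = X0 then h_coeff (tl w) z / z else 0)"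
      using False by (cases w) (auto simp: cf_lt_times_Cons)
    also have "\<dots> = (if hd w = X0 then diff_quot (h_coeff (tl w)) z else 0) + p / z"
      using assms(2) by (auto simp: p diff_quot_def diff_divide_distrib)
    finally have "cf (h_ser z * KZ_form z - cst (1 / z) * (lt X0 * h_ser z)) w = h_rhs w (h_coeff (butlast w)) (h_coeff (tl w)) z"
      using 1 by (simp add: h_rhs_def)
    thus ?thesis using h_coeff_deriv[OF False assms(1)] by simp
  qed
qed

text \<open>Removing the first or the last letter of a power of X0 gives the same word, so the two
  difference quotients cancel. All powers of the logarithm then sit in the exponential
  factor.\<close>

lemma h_coeff_replicate: "z \<in> U1 \<Longrightarrow> h_coeff (replicate (Suc n) X0) z = 0"
proof -
  define w where "w = replicate (Suc n) X0"
  have "butlast w = replicate n X0" "tl w = replicate n X0" "w \<noteq> []" "last w = X0" "hd w = X0"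
    by (auto simp: w_def butlast_conv_take take_replicate simp del: replicate.simps)
  hence "(h_coeff w has_field_derivative 0) (at z)" if "z \<in> U1" for z
    using h_coeff_deriv[OF _ that, of w] by (simp add: h_rhs_def)
  hence "h_coeff w constant_on U1"
    by (rule has_field_derivative_0_imp_constant_on[OF _ connected_U1 open_U1])
  moreover have "h_coeff w 0 = 0" by (simp add: h_coeff_0 w_def)
  ultimately show "z \<in> U1 \<Longrightarrow> h_coeff (replicate (Suc n) X0) z = 0"
    unfolding constant_on_def w_def by (metis zero_in_U1)
qed

text \<open>The product Q satisfies Q' = (Q x0 - x0 Q) / z. By induction its shorter coefficients
  are those of 1, so the commutator vanishes, each coefficient is constant, and its value is read
  off at 0.\<close>

lemma h_ser_antipode:
  assumes "z \<in> U1"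
  shows "h_ser z * sg (rv (h_ser z)) = 1"
proof -
  define Q where "Q z = h_ser z * sg (rv (h_ser z))" for z
  have cont: "continuous_on U1 (\<lambda>z. cf (Q z) w)" for w
    unfolding Q_def cf_times cf_maps cf_h_ser
    by (intro continuous_intros holomorphic_on_imp_continuous_on h_coeff_holo)
  have dQ: "ser_deriv Q (cst (1 / z) * (Q z * lt X0 - lt X0 * Q z)) z" if "z \<in> U1" "z \<noteq> 0" for z
  proof -
    note h = ser_deriv_h_ser[OF that]
    have c: "sg (cst c) = cst c" for c by (rule ser_eqI) (simp add: cf_cst)
    have "sg (rv (h_ser z * KZ_form z)) = - KZ_form z * sg (rv (h_ser z))"
      by (simp add: rv_times sg_times)
    moreover have "sg (rv (cst (1 / z) * (lt X0 * h_ser z))) = - (cst (1 / z) * (sg (rv (h_ser z)) * lt X0))"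
      by (simp add: rv_times sg_times sg_lt c cst_commute)
    moreover have "sg (A - C) = sg A - sg C" for A C by (rule ser_eqI) (simp add: algebra_simps)
    ultimately have "sg (rv (h_ser z * KZ_form z - cst (1 / z) * (lt X0 * h_ser z))) =
        - KZ_form z * sg (rv (h_ser z)) + cst (1 / z) * (sg (rv (h_ser z)) * lt X0)"
      by simp
    note h' = ser_deriv_maps(1)[OF h, unfolded this]
    have "(h_ser z * KZ_form z - cst (1 / z) * (lt X0 * h_ser z)) * sg (rv (h_ser z)) +
       h_ser z * (- KZ_form z * sg (rv (h_ser z)) + cst (1 / z) * (sg (rv (h_ser z)) * lt X0)) =
       cst (1 / z) * (Q z * lt X0 - lt X0 * Q z)"
      unfolding Q_def by (simp add: algebra_simps) (metis cst_commute mult.assoc)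
    thus ?thesis using ser_deriv_times[OF h h'] unfolding Q_def by simp
  qed
  have "\<forall>z\<in>U1. cf (Q z) w = cf 1 w" for w
  proof (induction w rule: length_induct)
    case (1 w)
    have d0: "((\<lambda>z. cf (Q z) w) has_field_derivative 0) (at z)" if z: "z \<in> U1" "z \<noteq> 0" for z
    proof -
      have "cf (Q z * lt X0) w = cf (lt X0 * Q z) w"
      proof (cases "w = []")
        case False
        have "cf (Q z * lt X0) w = (if last w = X0 then cf (Q z) (butlast w) else 0)"
          using cf_times_lt_snoc[of "Q z" X0 "butlast w" "last w"] False by simp
        also have "\<dots> = (if hd w = X0 then cf (Q z) (tl w) else 0)"
          using 1 z False by (cases w; cases "tl w") (auto simp: cf_one)
        also have "\<dots> = cf (lt X0 * Q z) w"
          using False by (cases w) (auto simp: cf_lt_times_Cons)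
        finally show ?thesis .
      qed (simp add: cf_lt)
      thus ?thesis using dQ[OF z] unfolding ser_deriv_def by (metis cf_cst_times cf_ring(3) diff_self mult_zero_right)
    qed
    \<comment> \<open>The derivative is known only away from 0; continuity bridges that
      point.\<close>
    have "(\<lambda>z. cf (Q z) w) constant_on U1"
      by (rule DERIV_zero_connected_constant_on[OF connected_U1 open_U1, of "{0}"]) (use cont d0 in auto)
    then obtain c where c: "\<And>z. z \<in> U1 \<Longrightarrow> cf (Q z) w = c"
      by (auto simp: constant_on_def)
    have "c = cf (Q 0) w" using c by simp
    also have "\<dots> = cf 1 w"
    proof (cases "w = []")
      case False
      hence "cf (h_ser 0) (take i w) * cf (sg (rv (h_ser 0))) (drop i w) = 0" for i
        by (cases "i = 0") (auto simp: h_coeff_0)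
      with False show ?thesis unfolding Q_def cf_times by (auto simp: cf_one intro!: sum.neutral)
    qed (simp add: Q_def cf_one)
    finally show ?case using c by simp
  qed
  thus ?thesis using assms by (intro ser_eqI) (simp add: Q_def)
qed

text \<open>The argument \<open>l\<close> stands for a value of the logarithm of \<open>z\<close>,
  so a change of branch is left multiplication by an exponential of X0.\<close>

definition L_branch :: "complex \<Rightarrow> complex \<Rightarrow> ser" where "L_branch l z = ex X0 l * h_ser z"

lemma L_branch_Nil [simp]: "cf (L_branch l z) [] = 1"
  by (simp add: L_branch_def)

lemma KZ_sol_L_branch:
  assumes "U \<subseteq> U1 - {0}" "\<And>z. z \<in> U \<Longrightarrow> (l has_field_derivative 1 / z) (at z)"
  shows "KZ_sol U (\<lambda>z. L_branch (l z) z)"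
  unfolding KZ_sol_def
proof
  fix z assume z: "z \<in> U"
  have "ser_deriv (\<lambda>z. ex X0 (l z) * h_ser z) (cst (1 / z) * (ex X0 (l z) * lt X0) * h_ser z +
     ex X0 (l z) * (h_ser z * KZ_form z - cst (1 / z) * (lt X0 * h_ser z))) z"
    using z assms by (intro ser_deriv_times ser_deriv_ex ser_deriv_h_ser) auto
  also have "cst (1 / z) * (ex X0 (l z) * lt X0) * h_ser z +
     ex X0 (l z) * (h_ser z * KZ_form z - cst (1 / z) * (lt X0 * h_ser z)) = L_branch (l z) z * KZ_form z"
    unfolding L_branch_def by (simp add: algebra_simps) (metis cst_commute mult.assoc)
  finally show "ser_deriv (\<lambda>z. L_branch (l z) z) (L_branch (l z) z * KZ_form z) z" unfolding L_branch_def .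
qed

lemma L_branch_antipode: "z \<in> U1 \<Longrightarrow> L_branch l z * sg (rv (L_branch l z)) = 1"
proof -
  assume z: "z \<in> U1"
  have "sg (ex X0 l) = ex X0 (- l)"
    by (rule ser_eqI) (simp add: cf_ex power_minus[of l])
  hence "L_branch l z * sg (rv (L_branch l z)) = ex X0 l * (h_ser z * sg (rv (h_ser z))) * ex X0 (- l)"
    by (simp add: L_branch_def rv_times sg_times mult.assoc)
  thus ?thesis by (simp add: h_ser_antipode[OF z] ex_inverse)
qed

section \<open>The slit plane and the principal branch\<close>

lemma slit_iff: "z \<in> slit_plane \<longleftrightarrow> Im z \<noteq> 0 \<or> 0 < Re z \<and> Re z < 1"
proof -
  have "z \<in> complex_of_real ` ({..0} \<union> {1..}) \<longleftrightarrow> Im z = 0 \<and> (Re z \<le> 0 \<or> Re z \<ge> 1)"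
    by (auto simp: image_iff complex_eq_iff intro!: bexI[of _ "Re z"])
  thus ?thesis by (auto simp: slit_plane_def)
qed

lemma slit_U1: "z \<in> slit_plane \<Longrightarrow> z \<in> U1 \<and> z \<noteq> 0 \<and> z \<noteq> 1 \<and> z \<notin> \<real>\<^sub>\<le>\<^sub>0"
  by (auto simp: slit_iff U1_iff complex_nonpos_Reals_iff)

lemma slit_maps [simp]: "1 - z \<in> slit_plane \<longleftrightarrow> z \<in> slit_plane" "cnj z \<in> slit_plane \<longleftrightarrow> z \<in> slit_plane"
  by (auto simp: slit_iff)

lemma open_slit: "open slit_plane"
proof -
  have "slit_plane = {z. Im z < 0} \<union> {z. Im z > 0} \<union> ({z. Re z < 1} \<inter> {z. Re z > 0})"
    by (auto simp: slit_iff)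
  moreover have "open \<dots>"
    by (intro open_Un open_Int open_halfspace_Im_lt open_halfspace_Im_gt open_halfspace_Re_lt open_halfspace_Re_gt)
  ultimately show ?thesis by simp
qed

lemma half_in_slit [simp]: "1/2 \<in> slit_plane"
  by (simp add: slit_iff)

lemma connected_slit: "connected slit_plane"
proof (rule starlike_imp_connected)
  show "starlike slit_plane"
    unfolding starlike_def
  proof (intro bexI[of _ "1/2"] ballI subsetI)
    fix z w assume z: "z \<in> slit_plane" and "w \<in> closed_segment (1/2) z"
    then obtain u where u: "0 \<le> u" "u \<le> 1" "w = (1 - u) *\<^sub>R (1/2) + u *\<^sub>R z"
      by (auto simp: in_segment)
    show "w \<in> slit_plane"
    proof (cases "Im z = 0")
      case True
      hence "z \<in> {z. Re z < 1} \<inter> {z. Re z > 0}" using z by (simp add: slit_iff)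
      moreover have "convex ({z. Re z < 1} \<inter> {z. Re z > 0})"
        by (intro convex_Int convex_halfspace_Re_lt convex_halfspace_Re_gt)
      ultimately have "w \<in> {z. Re z < 1} \<inter> {z. Re z > 0}"
        unfolding u(3) by (rule_tac convexD[of _ "1/2" z]) (use u in auto)
      thus ?thesis by (simp add: slit_iff)
    next
      case False
      show ?thesis
      proof (cases "u = 0")
        case True
        hence "w = 1/2" using u by (simp add: scaleR_conv_of_real)
        thus ?thesis using half_in_slit by (simp only:)
      qed (use u False in \<open>simp add: slit_iff\<close>)
    qed
  qed simp
qed

definition L_ser :: "complex \<Rightarrow> ser" where "L_ser z = L_branch (Ln z) z"

lemma KZ_sol_L_ser: "KZ_sol slit_plane L_ser"
proof -
  have "KZ_sol slit_plane (\<lambda>z. L_branch (Ln z) z)"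
    by (rule KZ_sol_L_branch) (auto dest: slit_U1 intro!: derivative_eq_intros simp: divide_inverse)
  thus ?thesis by (simp add: L_ser_def[abs_def])
qed

lemma L_ser_Nil [simp]: "cf (L_ser z) [] = 1"
  by (simp add: L_ser_def)

text \<open>With t = pi - ln |z| one has |Ln z| <= t and |z| = exp(pi) / exp(t), so the claim
  follows from the decay of t^n / exp(t).\<close>

lemma tendsto_z_Ln_power: "((\<lambda>z. z * Ln z ^ n) \<longlongrightarrow> 0) (at 0)"
proof -
  have lim: "((\<lambda>t. exp pi * (t ^ n / exp t)) \<longlongrightarrow> exp pi * 0) at_top"
    by (intro tendsto_intros tendsto_power_div_exp_0)
  have "filterlim (\<lambda>z :: complex. norm z) (at_right 0) (at 0)"
    unfolding filterlim_at by (auto intro!: tendsto_eq_intros simp: eventually_at_filter)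
  hence "filterlim (\<lambda>z :: complex. pi - ln (norm z)) at_top (at 0)"
    using filterlim_tendsto_add_at_top[OF tendsto_const[of pi],
        OF filterlim_compose[OF filterlim_uminus_at_top_at_bot filterlim_compose[OF ln_at_0]]]
    by (simp add: diff_conv_add_uminus del: add_uminus_conv_diff)
  from filterlim_compose[OF lim this]
  have lim2: "((\<lambda>z :: complex. exp pi * ((pi - ln (norm z)) ^ n / exp (pi - ln (norm z)))) \<longlongrightarrow> 0) (at 0)"
    by simp
  show ?thesis
  proof (rule Lim_null_comparison[OF _ lim2])
    have "\<forall>\<^sub>F z :: complex in at 0. z \<in> ball 0 1 - {0}"
      by (intro eventually_at_in_open) auto
    thus "\<forall>\<^sub>F z in at 0. norm (z * Ln z ^ n) \<le> exp pi * ((pi - ln (norm z)) ^ n / exp (pi - ln (norm z)))"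
    proof eventually_elim
      case (elim z)
      have "norm (Ln z) \<le> \<bar>Re (Ln z)\<bar> + \<bar>Im (Ln z)\<bar>" by (rule cmod_le)
      also have "\<dots> \<le> - ln (norm z) + pi"
        using elim Im_Ln_le_pi[of z] mpi_less_Im_Ln[of z] by (intro add_mono) (auto simp: ln_le_zero_iff)
      finally have "norm (Ln z) ^ n \<le> (pi - ln (norm z)) ^ n" by (intro power_mono) auto
      hence "norm (z * Ln z ^ n) \<le> norm z * (pi - ln (norm z)) ^ n"
        by (simp add: norm_mult norm_power mult_left_mono)
      also have "\<dots> = exp pi * ((pi - ln (norm z)) ^ n / exp (pi - ln (norm z)))"
        using elim by (simp add: exp_diff)
      finally show ?case .
    qed
  qed
qed

text \<open>A coefficient vanishing at 0 is z times a convergent quotient, and the factor z beats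
  every power of the logarithm.\<close>

lemma tendsto_Ln_h_coeff:
  assumes "v \<noteq> []"
  shows "((\<lambda>z. Ln z ^ n * h_coeff v z) \<longlongrightarrow> 0) (at 0)"
proof -
  have "(h_coeff v has_field_derivative h_rhs v (h_coeff (butlast v)) (h_coeff (tl v)) 0) (at 0)"
    using assms by (rule h_coeff_deriv) simp
  hence "((\<lambda>z. (h_coeff v z - h_coeff v 0) / (z - 0)) \<longlongrightarrow> h_rhs v (h_coeff (butlast v)) (h_coeff (tl v)) 0) (at 0)"
    by (simp add: has_field_derivative_iff)
  from tendsto_mult[OF tendsto_z_Ln_power[of n] this]
  have "((\<lambda>z. z * Ln z ^ n * (h_coeff v z / z)) \<longlongrightarrow> 0) (at 0)" using assms by (simp add: h_coeff_0)
  thus ?thesis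
    by (rule Lim_transform_eventually) (auto simp: eventually_at_filter)
qed

lemma cf_L_ser: "cf (L_ser z) w = (\<Sum>i\<le>length w. cf (ex X0 (Ln z)) (take i w) * h_coeff (drop i w) z)"
  by (simp add: L_ser_def L_branch_def cf_times)

lemma tendsto_Ln_L_ser:
  assumes "\<And>k. w \<noteq> replicate k X0"
  shows "((\<lambda>z. Ln z ^ n * cf (L_ser z) w) \<longlongrightarrow> 0) (at 0)"
proof -
  have "((\<lambda>z. Ln z ^ n * (cf (ex X0 (Ln z)) (take i w) * h_coeff (drop i w) z)) \<longlongrightarrow> 0) (at 0)"
    if "i \<le> length w" for i
  proof (cases "take i w = replicate i X0")
    case True
    hence "drop i w \<noteq> []" using assms[of i] by (metis append_Nil2 append_take_drop_id)
    from tendsto_mult[OF tendsto_const[of "1 / fact i"] tendsto_Ln_h_coeff[OF this, of "n + i"]]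
    show ?thesis by (simp add: True power_add mult_ac)
  next
    case False
    hence "cf (ex X0 c) (take i w) = 0" for c using that by (simp add: cf_ex min_absorb2)
    thus ?thesis by simp
  qed
  hence "((\<lambda>z. \<Sum>i\<le>length w. Ln z ^ n * (cf (ex X0 (Ln z)) (take i w) * h_coeff (drop i w) z)) \<longlongrightarrow> 0) (at 0)"
    by (intro tendsto_null_sum) auto
  thus ?thesis by (simp add: cf_L_ser sum_distrib_left)
qed

lemma cf_L_ser_replicate:
  assumes "z \<in> slit_plane"
  shows "cf (L_ser z) (replicate n X0) = Ln z ^ n / fact n"
proof -
  have "cf (L_ser z) (replicate n X0) = (\<Sum>i\<in>{n}. cf (ex X0 (Ln z)) (take i (replicate n X0)) * h_coeff (drop i (replicate n X0)) z)"
    unfolding cf_L_ser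
  proof (rule sum.mono_neutral_right, simp, simp, intro ballI)
    fix i assume "i \<in> {..length (replicate n X0)} - {n}"
    hence "n - i = Suc (n - i - 1)" by auto
    hence "drop i (replicate n X0) = replicate (Suc (n - i - 1)) X0" by (metis drop_replicate)
    thus "cf (ex X0 (Ln z)) (take i (replicate n X0)) * h_coeff (drop i (replicate n X0)) z = 0"
      using h_coeff_replicate[of z "n - i - 1"] assms slit_U1[of z] by simp
  qed
  thus ?thesis by simp
qed

lemma mpl_family_L_ser: "mpl_family (\<lambda>w z. cf (L_ser z) w)"
  unfolding mpl_family_def
proof (intro conjI allI ballI impI)
  fix w x z assume "z \<in> slit_plane"
  thus "((\<lambda>z. cf (L_ser z) (w @ [x])) has_field_derivative cf (L_ser z) w / (z - pt x)) (at z)"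
    using KZ_sol_L_ser unfolding KZ_sol_def ser_deriv_def by (metis cf_times_KZ_form(2))
next
  fix w assume "\<forall>n. w \<noteq> replicate n X0"
  hence "((\<lambda>z. Ln z ^ 0 * cf (L_ser z) w) \<longlongrightarrow> 0) (at 0)" by (intro tendsto_Ln_L_ser) auto
  thus "((\<lambda>z. cf (L_ser z) w) \<longlongrightarrow> 0) (at 0 within slit_plane)"
    by (auto intro: tendsto_within_subset)
qed (auto simp: cf_L_ser_replicate)

lemma zero_limpt_slit: "at (0 :: complex) within slit_plane \<noteq> bot"
proof -
  have "(0 :: complex) islimpt slit_plane"
    unfolding islimpt_approachable
  proof (intro allI impI)
    fix e :: real assume "e > 0"
    thus "\<exists>x\<in>slit_plane. x \<noteq> 0 \<and> dist x 0 < e"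
      by (intro bexI[of _ "Complex 0 (e / 2)"]) (auto simp: slit_iff complex_eq_iff cmod_def)
  qed
  thus ?thesis by (simp add: trivial_limit_within)
qed

text \<open>At each step two families differ by a constant, which the limit at 0 forces to be 0;
  powers of X0 are prescribed outright.\<close>

lemma mpl_family_unique:
  assumes "mpl_family L" "mpl_family M" "z \<in> slit_plane"
  shows "L w z = M w z"
proof -
  have "\<forall>z\<in>slit_plane. L w z - M w z = 0"
  proof (induction w rule: rev_induct)
    case Nil
    thus ?case using assms by (auto simp: mpl_family_def)
  next
    case (snoc x w)
    show ?case
    proof (cases "\<exists>n. w @ [x] = replicate n X0")
      case True
      thus ?thesis using assms by (auto simp: mpl_family_def simp del: replicate.simps)
    next
      case False
      have "((\<lambda>z. L (w @ [x]) z - M (w @ [x]) z) has_field_derivative 0) (at z)" if "z \<in> slit_plane" for z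
      proof -
        have "((\<lambda>z. L (w @ [x]) z - M (w @ [x]) z) has_field_derivative
            L w z / (z - pt x) - M w z / (z - pt x)) (at z)"
          using assms that by (intro DERIV_diff) (auto simp: mpl_family_def)
        thus ?thesis using snoc that by simp
      qed
      hence "(\<lambda>z. L (w @ [x]) z - M (w @ [x]) z) constant_on slit_plane"
        by (rule has_field_derivative_0_imp_constant_on[OF _ connected_slit open_slit])
      then obtain c where c: "\<forall>z\<in>slit_plane. L (w @ [x]) z - M (w @ [x]) z = c"
        by (auto simp: constant_on_def)
      have "((\<lambda>z. L (w @ [x]) z - M (w @ [x]) z) \<longlongrightarrow> 0 - 0) (at 0 within slit_plane)"
        using assms False by (intro tendsto_diff) (auto simp: mpl_family_def)
      hence "((\<lambda>z. L (w @ [x]) z - M (w @ [x]) z) \<longlongrightarrow> 0) (at 0 within slit_plane)" by simp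
      hence "((\<lambda>z. c) \<longlongrightarrow> 0) (at 0 within slit_plane)"
        by (rule Lim_transform_eventually) (use c in \<open>auto simp: eventually_at_filter\<close>)
      hence "c = 0" using zero_limpt_slit tendsto_unique[OF _ tendsto_const] by blast
      thus ?thesis using c by simp
    qed
  qed
  thus ?thesis using assms(3) by simp
qed

text \<open>Existence and uniqueness together evaluate the \<open>SOME\<close> in the definition of
  \<open>mpl\<close>.\<close>

lemma mpl_eq: "z \<in> slit_plane \<Longrightarrow> mpl w z = cf (L_ser z) w"
  using mpl_family_unique[OF _ mpl_family_L_ser, of mpl] someI[of mpl_family, OF mpl_family_L_ser]
  by (simp add: mpl_def)


text \<open>\<open>L_left\<close> continues \<open>L_ser\<close> from the upper half plane to \<open>Re z < 0\<close>; likewise \<open>L_right\<close> below continues it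
  from the lower half plane to \<open>Re z > 1\<close>.\<close>

definition L_left :: "complex \<Rightarrow> ser" where "L_left z = L_branch (Ln (- z) + \<i> * pi) z"

lemma KZ_sol_L_left: "KZ_sol {z. Re z < 0} L_left"
proof -
  have "KZ_sol {z. Re z < 0} (\<lambda>z. L_branch (Ln (- z) + \<i> * pi) z)"
    by (rule KZ_sol_L_branch) (auto simp: U1_iff complex_nonpos_Reals_iff field_simps intro!: derivative_eq_intros)
  thus ?thesis by (simp add: L_left_def[abs_def])
qed

lemma L_branch_add: "L_branch (a + l) z = ex X0 a * L_branch l z"
  by (simp add: L_branch_def ex_add mult.assoc)

lemma L_left_upper: "Re z < 0 \<Longrightarrow> Im z > 0 \<Longrightarrow> L_left z = L_ser z"
  using Ln_minus[of z] by (cases "z = 0") (auto simp: L_left_def L_ser_def)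

text \<open>Here the continued logarithm exceeds the principal one by 2 pi i: the source of the
  first monodromy generator.\<close>

lemma L_left_lower: "Re z < 0 \<Longrightarrow> Im z < 0 \<Longrightarrow> L_left z = ex X0 (2 * pi * \<i>) * L_ser z"
  using Ln_minus[of z] by (cases "z = 0") (auto simp: L_left_def L_ser_def algebra_simps simp flip: L_branch_add)

lemma KZ_sol_one_minus:
  assumes "KZ_sol U P" "\<And>z. z \<in> V \<Longrightarrow> 1 - z \<in> U"
  shows "KZ_sol V (\<lambda>z. sw (P (1 - z)))"
  unfolding KZ_sol_def
proof
  fix z assume "z \<in> V"
  hence "ser_deriv P (P (1 - z) * KZ_form (1 - z)) (1 - z)" using assms by (auto simp: KZ_sol_def)
  hence "((\<lambda>z. cf (P (1 - z)) w) has_field_derivative cf (P (1 - z) * KZ_form (1 - z)) w * (- 1)) (at z)" for w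
    unfolding ser_deriv_def
    by (intro DERIV_chain2[of "\<lambda>y. cf (P y) w" _ "\<lambda>z. 1 - z"]) (auto intro!: derivative_eq_intros)
  hence "ser_deriv (\<lambda>z. sw (P (1 - z))) (- sw (P (1 - z) * KZ_form (1 - z))) z"
    by (simp add: ser_deriv_def del: cf_times_Nil)
  thus "ser_deriv (\<lambda>z. sw (P (1 - z))) (sw (P (1 - z)) * KZ_form z) z" by (simp add: sw_times)
qed

lemma sw_sg_rv: "sw (sg (rv X)) = sg (rv (sw X))"
  by (rule ser_eqI) (simp add: rev_map)

lemma L_ser_antipode: "z \<in> slit_plane \<Longrightarrow> L_ser z * sg (rv (L_ser z)) = 1"
  by (auto simp: L_ser_def intro!: L_branch_antipode dest: slit_U1)

text \<open>\<open>L_ser z * sg (rv (sw (L_ser (1 - z))))\<close> is constant, since both \<open>L_ser z\<close> and \<open>sw (L_ser (1 - z))\<close> solve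
  the same equation and \<open>sg \<circ> rv\<close> inverts such a series; 1/2 is an arbitrary base point.\<close>

definition Z_one :: ser where "Z_one = L_ser (1/2) * sg (rv (sw (L_ser (1/2))))"
definition Z_one_inv :: ser where "Z_one_inv = sg (rv Z_one)"

lemma ser_one_commute: 
  assumes "X * Y = (1 :: ser)" "cf X [] = 1" shows "Y * X = 1"
proof -
  obtain R where R: "R * X = 1" using ser_inverse[OF assms(2)] by metis
  have "R = R * (X * Y)" by (simp add: assms)
  hence "R = Y" by (simp add: R flip: mult.assoc)
  thus ?thesis using R by simp
qed

lemma sg_rv_sg_rv [simp]: "sg (rv (sg (rv X))) = X"
  by (rule ser_eqI) (simp flip: power_add)

lemma sg_rv_times: "sg (rv (X * Y)) = sg (rv Y) * sg (rv X)"
  by (simp add: rv_times sg_times)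

lemma sw_L_ser_antipode: "z \<in> slit_plane \<Longrightarrow> sg (rv (sw (L_ser z))) * sw (L_ser z) = 1"
  using arg_cong[OF ser_one_commute[OF L_ser_antipode], of z sw] by (simp add: sw_times sw_sg_rv)

lemma L_ser_eq_Z: "z \<in> slit_plane \<Longrightarrow> L_ser z = Z_one * sw (L_ser (1 - z))"
  by (rule KZ_sol_eqI[OF KZ_sol_L_ser KZ_sol_cmult[OF KZ_sol_one_minus[OF KZ_sol_L_ser]] open_slit connected_slit half_in_slit])
     (auto simp: Z_one_def mult.assoc sw_L_ser_antipode)

lemma Z_one_Nil [simp]: "cf Z_one [] = 1"
  by (simp add: Z_one_def)

text \<open>The relation L(z) = Z sw(L(1 - z)) is applied twice at the fixed point 1/2 of z -> 1 -
  z.\<close>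

lemma Z_one_sw: "Z_one * sw Z_one = 1"
proof -
  have "L_ser (1/2) = Z_one * sw Z_one * L_ser (1/2)"
  proof -
    define A where "A = L_ser (1/2)"
    have 1: "A = Z_one * sw A" using L_ser_eq_Z[of "1/2"] by (simp add: A_def)
    have "sw A = sw Z_one * A" by (subst 1) (simp add: sw_times)
    with 1 have "A = Z_one * sw Z_one * A" by (simp add: mult.assoc)
    thus ?thesis by (simp add: A_def)
  qed
  hence "L_ser (1/2) * sg (rv (L_ser (1/2))) = Z_one * sw Z_one * (L_ser (1/2) * sg (rv (L_ser (1/2))))"
    by (metis mult.assoc)
  thus ?thesis by (simp add: L_ser_antipode)
qed

lemma Z_one_Z_one_inv: "Z_one * Z_one_inv = 1" "Z_one_inv * Z_one = 1"
proof -
  have "Z_one * Z_one_inv = L_ser (1/2) * (sg (rv (sw (L_ser (1/2)))) * sw (L_ser (1/2))) * sg (rv (L_ser (1/2)))"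
    by (simp add: Z_one_inv_def Z_one_def sg_rv_times mult.assoc)
  thus *: "Z_one * Z_one_inv = 1" by (simp add: sw_L_ser_antipode L_ser_antipode)
  show "Z_one_inv * Z_one = 1" by (rule ser_one_commute[OF *]) simp
qed

text \<open>The antipode and the symmetry z -> 1 - z describe the same inverse; comparing them later
  evaluates words that begin with X0.\<close>

lemma Z_one_inv_eq_sw: "Z_one_inv = sw Z_one"
  by (metis Z_one_Z_one_inv(2) Z_one_sw mult.assoc mult_1 mult.right_neutral)

text \<open>Conjugating argument and value gives a family with the same defining properties, so
  uniqueness applies.\<close>

lemma L_ser_cnj:
  assumes "z \<in> slit_plane"
  shows "L_ser (cnj z) = cj (L_ser z)"
proof -
  have "mpl_family (\<lambda>w z. cnj (cf (L_ser (cnj z)) w))"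
    unfolding mpl_family_def
  proof (intro conjI allI ballI impI)
    fix w x z assume z: "z \<in> slit_plane"
    hence "((\<lambda>z. cf (L_ser z) (w @ [x])) has_field_derivative cf (L_ser (cnj z)) w / (cnj z - pt x)) (at (cnj z))"
      using mpl_family_L_ser by (auto simp: mpl_family_def)
    from has_field_derivative_cnj_cnj[OF this]
    show "((\<lambda>z. cnj (cf (L_ser (cnj z)) (w @ [x]))) has_field_derivative cnj (cf (L_ser (cnj z)) w) / (z - pt x)) (at z)"
      by (cases x) (simp_all add: o_def pt_def)
  next
    fix n z assume z: "z \<in> slit_plane"
    thus "cnj (cf (L_ser (cnj z)) (replicate n X0)) = Ln z ^ n / fact n"
      using slit_U1[of "cnj z"] cnj_Ln[of "cnj z"] by (simp add: cf_L_ser_replicate)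
  next
    fix w assume "\<forall>n. w \<noteq> replicate n X0"
    hence "((\<lambda>z. Ln z ^ 0 * cf (L_ser z) w) \<longlongrightarrow> 0) (at 0)" by (intro tendsto_Ln_L_ser) auto
    moreover have "filterlim cnj (at 0) (at (0 :: complex))"
      unfolding filterlim_at by (auto intro!: tendsto_eq_intros simp: eventually_at_filter)
    ultimately have "((\<lambda>z. cf (L_ser (cnj z)) w) \<longlongrightarrow> 0) (at 0)"
      using filterlim_compose by fastforce
    hence "((\<lambda>z. cnj (cf (L_ser (cnj z)) w)) \<longlongrightarrow> cnj 0) (at 0)"
      by (intro tendsto_intros)
    thus "((\<lambda>z. cnj (cf (L_ser (cnj z)) w)) \<longlongrightarrow> 0) (at 0 within slit_plane)"
      by (auto intro: tendsto_within_subset)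
  qed simp
  from mpl_family_unique[OF this mpl_family_L_ser, of "cnj z"] assms
  show ?thesis by (intro ser_eqI) simp
qed

lemma cj_sg: "cj (sg X) = sg (cj X)"
  by (rule ser_eqI) simp

lemma cj_Z_one [simp]: "cj Z_one = Z_one"
proof -
  have "cj (L_ser (1/2)) = L_ser (1/2)" using L_ser_cnj[of "1/2"] by simp
  moreover from this have "cj (sw (L_ser (1/2))) = sw (L_ser (1/2))" by (metis ser_maps_ring(24))
  ultimately show ?thesis by (simp add: Z_one_def cj_times cj_sg)
qed

definition L_right :: "complex \<Rightarrow> ser" where "L_right z = Z_one * sw (L_left (1 - z))"

lemma KZ_sol_L_right: "KZ_sol {z. Re z > 1} L_right"
  unfolding L_right_def[abs_def] by (intro KZ_sol_cmult KZ_sol_one_minus[OF KZ_sol_L_left]) auto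

lemma L_right_lower: "Re z > 1 \<Longrightarrow> Im z < 0 \<Longrightarrow> L_right z = L_ser z"
  by (simp add: L_right_def L_left_upper L_ser_eq_Z[of z] slit_iff)

text \<open>The symmetry z -> 1 - z carries the monodromy at 0 to that at 1, at the price of
  conjugation by Z.\<close>

lemma L_right_upper: "Re z > 1 \<Longrightarrow> Im z > 0 \<Longrightarrow> L_right z = Z_one * ex X1 (2 * pi * \<i>) * Z_one_inv * L_ser z"
proof -
  assume z: "Re z > 1" "Im z > 0"
  have "L_right z = Z_one * ex X1 (2 * pi * \<i>) * sw (L_ser (1 - z))"
    using z by (simp add: L_right_def L_left_lower sw_times mult.assoc)
  also have "sw (L_ser (1 - z)) = Z_one_inv * Z_one * sw (L_ser (1 - z))"
    by (simp add: Z_one_Z_one_inv)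
  also have "\<dots> = Z_one_inv * L_ser z"
    using arg_cong[OF L_ser_eq_Z[of z], of "\<lambda>X. Z_one_inv * X"] z by (simp add: slit_iff mult.assoc)
  finally show ?thesis by (simp add: mult.assoc)
qed

text \<open>Only the powers of \<open>X1\<close> at the end of the word diverge at 1.\<close>

lemma tendsto_L_ser_at_1:
  "((\<lambda>z. cf (L_ser z) w - (\<Sum>i<length w. cf Z_one (take i w) *
     (if drop i w = replicate (length w - i) X1 then Ln (1 - z) ^ (length w - i) / fact (length w - i) else 0)))
     \<longlongrightarrow> cf Z_one w) (at 1 within slit_plane)"
proof -
  define t where "t = (\<lambda>i z. if drop i w = replicate (length w - i) X1 then Ln (1 - z) ^ (length w - i) / fact (length w - i) else 0)"
  have fl: "filterlim (\<lambda>z. 1 - z) (at 0) (at (1 :: complex) within slit_plane)"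
    unfolding filterlim_at by (auto intro!: tendsto_eq_intros simp: eventually_at_filter)
  have "((\<lambda>z. cf (L_ser (1 - z)) (map flip (drop i w)) - t i z) \<longlongrightarrow> 0) (at 1 within slit_plane)"
    if "i < length w" for i
  proof (cases "drop i w = replicate (length w - i) X1")
    case True
    hence "\<forall>\<^sub>F z in at 1 within slit_plane. cf (L_ser (1 - z)) (map flip (drop i w)) - t i z = 0"
      by (auto simp: eventually_at_filter t_def cf_L_ser_replicate)
    thus ?thesis by (simp add: tendsto_eventually)
  next
    case False
    have "map flip (drop i w) \<noteq> replicate k X0" for k
    proof
      assume *: "map flip (drop i w) = replicate k X0"
      hence "drop i w = replicate k X1" by (metis flip_comp flip_simps(1) list.map_comp list.map_id map_replicate)
      with False show False by (metis length_drop length_replicate)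
    qed
    from filterlim_compose[OF tendsto_Ln_L_ser[OF this, of 0] fl] False
    show ?thesis by (simp add: t_def)
  qed
  hence "((\<lambda>z. \<Sum>i<length w. cf Z_one (take i w) * (cf (L_ser (1 - z)) (map flip (drop i w)) - t i z)) \<longlongrightarrow> 0) (at 1 within slit_plane)"
    by (intro tendsto_null_sum tendsto_mult_right_zero) auto
  from tendsto_add[OF this tendsto_const[of "cf Z_one w"]]
  have "((\<lambda>z. (\<Sum>i<length w. cf Z_one (take i w) * (cf (L_ser (1 - z)) (map flip (drop i w)) - t i z)) + cf Z_one w) \<longlongrightarrow> cf Z_one w) (at 1 within slit_plane)"
    by simp
  moreover have "\<forall>\<^sub>F z in at 1 within slit_plane. (\<Sum>i<length w. cf Z_one (take i w) * (cf (L_ser (1 - z)) (map flip (drop i w)) - t i z)) + cf Z_one w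
       = cf (L_ser z) w - (\<Sum>i<length w. cf Z_one (take i w) * t i z)"
  proof -
    have "cf (L_ser z) w = (\<Sum>i<length w. cf Z_one (take i w) * cf (L_ser (1 - z)) (map flip (drop i w))) + cf Z_one w"
      if "z \<in> slit_plane" for z
      using arg_cong[OF L_ser_eq_Z[OF that], of "\<lambda>X. cf X w"]
      by (simp add: cf_times lessThan_Suc_atMost[symmetric])
    thus ?thesis by (simp add: eventually_at_filter sum_subtractf right_diff_distrib)
  qed
  ultimately have "((\<lambda>z. cf (L_ser z) w - (\<Sum>i<length w. cf Z_one (take i w) * t i z)) \<longlongrightarrow> cf Z_one w) (at 1 within slit_plane)"
    by (rule Lim_transform_eventually)
  thus ?thesis by (simp only: t_def)
qed

section \<open>Nested sums and integrals of powers of the cosine\<close>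

definition pI :: "nat \<Rightarrow> nat \<Rightarrow> real" where
  "pI k l = integral {0..pi/2} (\<lambda>t. cos t ^ (2 * l) * ((2 * t) ^ (2 * k) / fact (2 * k)))"

text \<open>This is the nested sum of 1 / (j1^2 ... jk^2) over l < j1 < ... < jk, as
  \<open>tau_rec\<close> and the limit 0 for growing \<open>l\<close> show; \<open>pI 0 l\<close> is
  the Wallis integral.\<close>

definition tau :: "nat \<Rightarrow> nat \<Rightarrow> real" where "tau k l = pI k l / pI 0 l"

lemma pI_has_integral:
  "((\<lambda>t. cos t ^ (2 * l) * ((2 * t) ^ (2 * k) / fact (2 * k))) has_integral pI k l) {0..pi/2}"
  unfolding pI_def by (intro integrable_integral integrable_continuous_real continuous_intros) auto

lemma DERIV_double_power:
  "((\<lambda>t. (2 * t) ^ Suc n / fact (Suc n)) has_real_derivative 2 * ((2 * x) ^ n / fact n)) (at x within S)"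
proof -
  have "((\<lambda>t. 2 * t) has_real_derivative 2) (at x within S)"
    by (auto intro!: derivative_eq_intros)
  from DERIV_cdivide[OF DERIV_power[OF this, of "Suc n"], of "fact (Suc n)"]
  show ?thesis by (simp add: fact_reduce[of "Suc n"] del: of_nat_Suc fact_Suc)
qed

lemma pI_0: "pI k 0 = pi ^ (2 * k + 1) / (2 * fact (2 * k + 1))"
proof -
  have "((\<lambda>t. cos t ^ (2 * 0) * ((2 * t) ^ (2 * k) / fact (2 * k))) has_integral
     (2 * (pi / 2)) ^ Suc (2 * k) / fact (Suc (2 * k)) / 2 - (2 * 0) ^ Suc (2 * k) / fact (Suc (2 * k)) / 2) {0..pi/2}"
  proof (rule fundamental_theorem_of_calculus)
    fix x assume "x \<in> {0..pi/2}"
    show "((\<lambda>t. (2 * t) ^ Suc (2 * k) / fact (Suc (2 * k)) / 2) has_vector_derivative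
       cos x ^ (2 * 0) * ((2 * x) ^ (2 * k) / fact (2 * k))) (at x within {0..pi/2})"
      using DERIV_cdivide[OF DERIV_double_power[of "2 * k" x "{0..pi/2}"], of 2]
      by (simp add: has_real_derivative_iff_has_vector_derivative del: fact_Suc power_Suc)
  qed auto
  from has_integral_unique[OF pI_has_integral this] show ?thesis by (simp add: mult.commute)
qed

text \<open>Two integrations by parts, packed into one antiderivative that vanishes at both
  endpoints.\<close>

lemma pI_rec:
  "4 * real (Suc l) ^ 2 * pI (Suc k) (Suc l) + 4 * pI k (Suc l) = 2 * real (Suc l) * (2 * real l + 1) * pI (Suc k) l"
proof -
  define L where "L = real (Suc l)"
  define p where "p k t = (2 * t) ^ (2 * k) / (fact (2 * k) :: real)" for k t
  define o1 where "o1 t = 2 * ((2 * t) ^ (2 * k + 1) / (fact (2 * k + 1) :: real))" for t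
  have p': "(p (Suc k) has_real_derivative o1 x) (at x within S)" for x S
    using DERIV_double_power[of "2 * k + 1" x S] by (simp add: p_def[abs_def] o1_def del: fact_Suc power_Suc)
  have o': "(o1 has_real_derivative 4 * p k x) (at x within S)" for x S
    using DERIV_cmult[OF DERIV_double_power[of "2 * k" x S], of 2] by (simp add: p_def o1_def[abs_def] del: fact_Suc power_Suc)
  define F where "F t = cos t ^ (2 * Suc l) * o1 t + 2 * L * (cos t ^ (2 * l + 1) * sin t * p (Suc k) t)" for t
  have A: "((\<lambda>t. 4 * (cos t ^ (2 * Suc l) * p k t) + (4 * L ^ 2 * (cos t ^ (2 * Suc l) * p (Suc k) t)
      - 2 * L * (2 * real l + 1) * (cos t ^ (2 * l) * p (Suc k) t))) has_integral F (pi/2) - F 0) {0..pi/2}"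
  proof (rule fundamental_theorem_of_calculus)
    fix x assume "x \<in> {0..pi/2}"
    have s2: "sin x * sin x = 1 - cos x * cos x" using sin_squared_eq[of x] by (simp add: power2_eq_square)
    have e: "cos x ^ (2 * l + 1) = cos x * cos x ^ (2 * l)" "cos x ^ (2 * Suc l) = cos x * cos x * cos x ^ (2 * l)"
      by simp_all
    have "(F has_real_derivative
       (real (2 * Suc l) * (cos x ^ (2 * l + 1) * (- sin x))) * o1 x + cos x ^ (2 * Suc l) * (4 * p k x)
       + 2 * L * (((real (2 * l + 1) * (cos x ^ (2 * l) * (- sin x))) * sin x + cos x ^ (2 * l + 1) * cos x) * p (Suc k) x
         + cos x ^ (2 * l + 1) * sin x * o1 x)) (at x within {0..pi/2})"
      unfolding F_def by (rule derivative_eq_intros p' o' refl | simp add: algebra_simps)+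
    also have "(real (2 * Suc l) * (cos x ^ (2 * l + 1) * (- sin x))) * o1 x + cos x ^ (2 * Suc l) * (4 * p k x)
       + 2 * L * (((real (2 * l + 1) * (cos x ^ (2 * l) * (- sin x))) * sin x + cos x ^ (2 * l + 1) * cos x) * p (Suc k) x
         + cos x ^ (2 * l + 1) * sin x * o1 x)
      = cos x ^ (2 * Suc l) * (4 * p k x) + 2 * L * (cos x ^ (2 * l) * p (Suc k) x) * (cos x * cos x - real (2 * l + 1) * (sin x * sin x))"
      unfolding e L_def by (simp add: algebra_simps)
    also have "\<dots> = 4 * (cos x ^ (2 * Suc l) * p k x) + (4 * L ^ 2 * (cos x ^ (2 * Suc l) * p (Suc k) x)
      - 2 * L * (2 * real l + 1) * (cos x ^ (2 * l) * p (Suc k) x))"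
      unfolding e s2 L_def by (simp add: algebra_simps power2_eq_square)
    finally show "(F has_vector_derivative 4 * (cos x ^ (2 * Suc l) * p k x) + (4 * L ^ 2 * (cos x ^ (2 * Suc l) * p (Suc k) x)
      - 2 * L * (2 * real l + 1) * (cos x ^ (2 * l) * p (Suc k) x))) (at x within {0..pi/2})"
      by (simp add: has_real_derivative_iff_has_vector_derivative)
  qed auto
  have modB: "F (pi/2) - F 0 = 0" by (simp add: F_def o1_def p_def)
  have C: "((\<lambda>t. 4 * (cos t ^ (2 * Suc l) * p k t) + (4 * L ^ 2 * (cos t ^ (2 * Suc l) * p (Suc k) t)
      - 2 * L * (2 * real l + 1) * (cos t ^ (2 * l) * p (Suc k) t))) has_integral
      4 * pI k (Suc l) + (4 * L ^ 2 * pI (Suc k) (Suc l) - 2 * L * (2 * real l + 1) * pI (Suc k) l)) {0..pi/2}"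
    unfolding p_def by (intro has_integral_add has_integral_diff has_integral_mult_right pI_has_integral)
  have "4 * pI k (Suc l) + (4 * L ^ 2 * pI (Suc k) (Suc l) - 2 * L * (2 * real l + 1) * pI (Suc k) l) = 0"
    using has_integral_unique[OF C A] modB by simp
  thus ?thesis by (simp add: L_def)
qed

lemma pI0_rec: "pI 0 (Suc l) = pI 0 l * (2 * real l + 1) / (2 * real l + 2)"
proof -
  define F where "F t = cos t ^ (2 * l + 1) * sin t" for t :: real
  have A: "((\<lambda>t. (2 * real l + 2) * (cos t ^ (2 * Suc l) * ((2 * t) ^ (2 * 0) / fact (2 * 0))) 
     - (2 * real l + 1) * (cos t ^ (2 * l) * ((2 * t) ^ (2 * 0) / fact (2 * 0)))) has_integral F (pi/2) - F 0) {0..pi/2}"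
  proof (rule fundamental_theorem_of_calculus)
    fix x assume "x \<in> {0..pi/2}"
    have s2: "sin x * sin x = 1 - cos x * cos x" using sin_squared_eq[of x] by (simp add: power2_eq_square)
    have "(F has_real_derivative
       (real (2 * l + 1) * (cos x ^ (2 * l) * (- sin x))) * sin x + cos x ^ (2 * l + 1) * cos x) (at x within {0..pi/2})"
      unfolding F_def by (rule derivative_eq_intros refl | simp add: algebra_simps)+
    also have "(real (2 * l + 1) * (cos x ^ (2 * l) * (- sin x))) * sin x + cos x ^ (2 * l + 1) * cos x
      = cos x ^ (2 * l) * (cos x * cos x - real (2 * l + 1) * (sin x * sin x))" by (simp add: algebra_simps)
    also have "\<dots> = (2 * real l + 2) * (cos x ^ (2 * Suc l) * ((2 * x) ^ (2 * 0) / fact (2 * 0))) 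
     - (2 * real l + 1) * (cos x ^ (2 * l) * ((2 * x) ^ (2 * 0) / fact (2 * 0)))"
      unfolding s2 by (simp add: algebra_simps)
    finally show "(F has_vector_derivative (2 * real l + 2) * (cos x ^ (2 * Suc l) * ((2 * x) ^ (2 * 0) / fact (2 * 0))) 
     - (2 * real l + 1) * (cos x ^ (2 * l) * ((2 * x) ^ (2 * 0) / fact (2 * 0)))) (at x within {0..pi/2})"
      by (simp add: has_real_derivative_iff_has_vector_derivative)
  qed auto
  have modB: "F (pi/2) - F 0 = 0" by (simp add: F_def)
  have C: "((\<lambda>t. (2 * real l + 2) * (cos t ^ (2 * Suc l) * ((2 * t) ^ (2 * 0) / fact (2 * 0))) 
     - (2 * real l + 1) * (cos t ^ (2 * l) * ((2 * t) ^ (2 * 0) / fact (2 * 0)))) has_integral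
     (2 * real l + 2) * pI 0 (Suc l) - (2 * real l + 1) * pI 0 l) {0..pi/2}"
    by (intro has_integral_diff has_integral_mult_right pI_has_integral)
  have "(2 * real l + 2) * pI 0 (Suc l) - (2 * real l + 1) * pI 0 l = 0"
    using has_integral_unique[OF C A] modB by simp
  thus ?thesis by (simp add: field_simps)
qed

lemma pI0_pos: "pI 0 l > 0"
  by (induction l) (simp_all add: pI_0 pI0_rec)

lemma pI_nonneg: "pI k l \<ge> 0"
  by (rule has_integral_nonneg[OF pI_has_integral]) (auto intro!: mult_nonneg_nonneg)

lemma tau_nonneg: "tau k l \<ge> 0"
  by (simp add: tau_def pI_nonneg)

lemma tau_0 [simp]: "tau 0 l = 1"
  using pI0_pos[of l] by (simp add: tau_def)

lemma tau_at_0: "tau k 0 = pi ^ (2 * k) / fact (2 * k + 1)"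
  by (simp add: tau_def pI_0)

lemma tau_rec: "tau (Suc k) l = tau (Suc k) (Suc l) + tau k (Suc l) / real (Suc l) ^ 2"
proof -
  define L where "L = real (Suc l)"
  have L: "L > 0" "2 * real l + 1 = 2 * L - 1" by (simp_all add: L_def)
  have "2 * real l + 2 \<noteq> 0" by linarith
  hence w: "pI 0 (Suc l) * (2 * L) = pI 0 l * (2 * L - 1)"
    unfolding pI0_rec L_def by (simp add: divide_simps) (simp add: algebra_simps)
  have L1: "2 * L - 1 > 0" by (simp add: L_def)
  have pos: "pI 0 l > 0" "pI 0 (Suc l) > 0" by (simp_all add: pI0_pos)
  have r: "4 * L ^ 2 * pI (Suc k) (Suc l) + 4 * pI k (Suc l) = 2 * L * (2 * L - 1) * pI (Suc k) l"
    using pI_rec[of l k] unfolding L(2) by (simp only: L_def)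
  have "tau (Suc k) l = pI (Suc k) l * (2 * L - 1) / (pI 0 (Suc l) * (2 * L))"
    unfolding w using L1 by (simp add: tau_def)
  also have "\<dots> = (2 * L * (2 * L - 1) * pI (Suc k) l) / (pI 0 (Suc l) * (4 * L ^ 2))"
    using L pos by (simp add: field_simps power2_eq_square)
  also have "\<dots> = tau (Suc k) (Suc l) + tau k (Suc l) / L ^ 2"
    unfolding r[symmetric] tau_def using L pos by (simp add: field_simps)
  finally show ?thesis by (simp add: L_def)
qed

lemma t_cos_le_sin:
  fixes t :: real
  assumes "0 \<le> t" "t \<le> pi"
  shows "t * cos t \<le> sin t"
proof -
  have "(\<lambda>x. sin x - x * cos x) 0 \<le> (\<lambda>x. sin x - x * cos x) t"
  proof (rule DERIV_nonneg_imp_nondecreasing[OF assms(1)])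
    fix x assume "0 \<le> x" "x \<le> t"
    hence "x * sin x \<ge> 0" using assms by (intro mult_nonneg_nonneg sin_ge_zero) auto
    moreover have "((\<lambda>x. sin x - x * cos x) has_real_derivative x * sin x) (at x)"
      by (auto intro!: derivative_eq_intros)
    ultimately show "\<exists>y. ((\<lambda>x. sin x - x * cos x) has_real_derivative y) (at x) \<and> 0 \<le> y" by blast
  qed
  thus ?thesis by simp
qed

text \<open>The inequality t cos t <= sin t trades t^2 cos^2 t for sin^2 t. What remains is a
  difference of consecutive Wallis integrals, smaller than the integral itself by the factor 2 l +
  1.\<close>

lemma tau_bound: "\<exists>C\<ge>0. \<forall>l. tau (Suc k) (Suc l) \<le> C / real (Suc l)"
proof -
  define C where "C = 4 * pi ^ (2 * k) / fact (2 * Suc k)"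
  have C: "C \<ge> 0" by (simp add: C_def)
  have "tau (Suc k) (Suc l) \<le> C / real (Suc l)" for l
  proof -
    have "pI (Suc k) (Suc l) \<le> C * (pI 0 l - pI 0 (Suc l))"
    proof (rule has_integral_le[OF pI_has_integral])
      show "((\<lambda>t. C * (cos t ^ (2 * l) * ((2 * t) ^ (2 * 0) / fact (2 * 0)) - cos t ^ (2 * Suc l) * ((2 * t) ^ (2 * 0) / fact (2 * 0))))
         has_integral C * (pI 0 l - pI 0 (Suc l))) {0..pi/2}"
        by (intro has_integral_diff has_integral_mult_right pI_has_integral)
      fix t assume t: "t \<in> {0..pi/2}"
      have "(t * cos t) ^ 2 \<le> sin t ^ 2"
        using t t_cos_le_sin[of t] by (intro power_mono) (auto intro!: mult_nonneg_nonneg cos_ge_zero)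
      have "(2 * t) ^ (2 * k) \<le> pi ^ (2 * k)" using t by (intro power_mono) auto
      hence "4 * t ^ 2 * (2 * t) ^ (2 * k) / fact (2 * Suc k) \<le> 4 * t ^ 2 * pi ^ (2 * k) / fact (2 * Suc k)"
        by (intro divide_right_mono mult_left_mono) auto
      hence *: "(2 * t) ^ (2 * Suc k) / fact (2 * Suc k) \<le> C * t ^ 2"
        by (simp add: C_def power2_eq_square mult_ac)
      have "cos t ^ (2 * Suc l) * ((2 * t) ^ (2 * Suc k) / fact (2 * Suc k)) \<le> cos t ^ (2 * Suc l) * (C * t ^ 2)"
        by (intro mult_left_mono * zero_le_even_power) auto
      also have "\<dots> = C * (cos t ^ (2 * l) * (t * cos t) ^ 2)"
        by (simp add: power2_eq_square mult_ac)
      also have "\<dots> \<le> C * (cos t ^ (2 * l) * sin t ^ 2)"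
        using C \<open>(t * cos t) ^ 2 \<le> sin t ^ 2\<close> by (intro mult_left_mono zero_le_even_power) auto
      also have "\<dots> = C * (cos t ^ (2 * l) * ((2 * t) ^ (2 * 0) / fact (2 * 0)) - cos t ^ (2 * Suc l) * ((2 * t) ^ (2 * 0) / fact (2 * 0)))"
        unfolding sin_squared_eq by (simp add: algebra_simps power2_eq_square)
      finally show "cos t ^ (2 * Suc l) * ((2 * t) ^ (2 * Suc k) / fact (2 * Suc k)) \<le> \<dots>" .
    qed
    also have "pI 0 l - pI 0 (Suc l) = pI 0 (Suc l) / (2 * real l + 1)"
    proof -
      have "2 * real l + 2 \<noteq> 0" "2 * real l + 1 \<noteq> 0" by linarith+
      thus ?thesis unfolding pI0_rec by (simp add: divide_simps) (simp add: algebra_simps)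
    qed
    also have "C * (pI 0 (Suc l) / (2 * real l + 1)) \<le> C * (pI 0 (Suc l) / real (Suc l))"
      using C pI0_pos[of "Suc l"] by (intro mult_left_mono divide_left_mono) auto
    finally show ?thesis using pI0_pos[of "Suc l"] by (simp add: tau_def field_simps)
  qed
  with C show ?thesis by (intro exI[of _ C]) blast
qed

lemma tau_tendsto_0: "tau (Suc k) \<longlonglongrightarrow> 0"
proof -
  obtain C where C: "\<And>l. tau (Suc k) (Suc l) \<le> C / real (Suc l)" using tau_bound[of k] by blast
  have "(\<lambda>l. tau (Suc k) (Suc l)) \<longlonglongrightarrow> 0"
  proof (rule tendsto_sandwich[OF _ _ tendsto_const])
    show "(\<lambda>l. C / real (Suc l)) \<longlonglongrightarrow> 0"
      using LIMSEQ_Suc[OF lim_const_over_n[of C]] by simp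
  qed (auto simp: tau_nonneg intro!: always_eventually C simp del: of_nat_Suc)
  thus ?thesis by (simp add: filterlim_sequentially_Suc)
qed

text \<open>Elementary symmetric functions of 1 / j^2 for 0 < j < l: the nested sums below
  \<open>l\<close>, complementary to \<open>tau\<close>.\<close>

primrec es :: "nat \<Rightarrow> nat \<Rightarrow> real" where
  "es 0 l = 1"
| "es (Suc m) l = (\<Sum>j\<in>{1..<l}. es m j / real j ^ 2)"

lemma es_nonneg: "es m l \<ge> 0"
  by (induction m arbitrary: l) (auto intro!: sum_nonneg divide_nonneg_nonneg)

lemma es_Suc: "es (Suc m) (Suc (Suc l)) = es (Suc m) (Suc l) + es m (Suc l) / real (Suc l) ^ 2"
  by simp

lemma es_1: "es m (Suc 0) = (if m = 0 then 1 else 0)"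
  by (cases m) auto

text \<open>A nested sum over all positive integers splits according to how many indices are at most
  \<open>l\<close>. The induction moves the single index \<open>Suc l\<close> from
  \<open>tau\<close> to \<open>es\<close>.\<close>

lemma es_tau_sum: "(\<Sum>j\<le>k. es j (Suc l) * tau (k - j) l) = tau k 0"
proof (induction l)
  case 0
  have "(\<Sum>j\<le>k. es j (Suc 0) * tau (k - j) 0) = (\<Sum>j\<in>{0}. es j (Suc 0) * tau (k - j) 0)"
    by (rule sum.mono_neutral_right) (auto simp: es_1)
  thus ?case by simp
next
  case (Suc l)
  define q where "q = real (Suc l) ^ 2"
  show ?case
  proof (cases k)
    case (Suc k')
    have "(\<Sum>j\<le>k. es j (Suc l) * tau (k - j) l) =
       (\<Sum>j\<le>k'. es j (Suc l) * tau (k - j) l) + es k (Suc l)"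
      by (simp add: Suc del: es.simps)
    also have "(\<Sum>j\<le>k'. es j (Suc l) * tau (k - j) l) =
        (\<Sum>j\<le>k'. es j (Suc l) * tau (k - j) (Suc l) + es j (Suc l) * tau (k' - j) (Suc l) / q)"
    proof (rule sum.cong[OF refl])
      fix j assume "j \<in> {..k'}"
      hence "k - j = Suc (k' - j)" using Suc by auto
      thus "es j (Suc l) * tau (k - j) l = es j (Suc l) * tau (k - j) (Suc l) + es j (Suc l) * tau (k' - j) (Suc l) / q"
        using tau_rec[of "k' - j" l] by (simp add: q_def distrib_left del: es.simps)
    qed
    also have "\<dots> + es k (Suc l) = (\<Sum>j\<le>k. es j (Suc l) * tau (k - j) (Suc l)) + (\<Sum>j\<le>k'. es j (Suc l) * tau (k' - j) (Suc l) / q)"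
      by (simp add: Suc sum.distrib del: es.simps)
    also have "\<dots> = (\<Sum>j\<le>k. es j (Suc (Suc l)) * tau (k - j) (Suc l))"
    proof -
      have "(\<Sum>j\<le>k. es j (Suc (Suc l)) * tau (k - j) (Suc l)) =
         tau k (Suc l) + (\<Sum>j\<le>k'. es (Suc j) (Suc (Suc l)) * tau (k' - j) (Suc l))"
        unfolding Suc by (subst sum.atMost_Suc_shift) simp
      also have "(\<Sum>j\<le>k'. es (Suc j) (Suc (Suc l)) * tau (k' - j) (Suc l)) =
         (\<Sum>j\<le>k'. es (Suc j) (Suc l) * tau (k' - j) (Suc l)) + (\<Sum>j\<le>k'. es j (Suc l) * tau (k' - j) (Suc l) / q)"
        unfolding es_Suc by (simp add: distrib_right sum.distrib q_def del: es.simps)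
      also have "tau k (Suc l) + \<dots> = (\<Sum>j\<le>k. es j (Suc l) * tau (k - j) (Suc l)) + (\<Sum>j\<le>k'. es j (Suc l) * tau (k' - j) (Suc l) / q)"
      proof -
        have "(\<Sum>j\<le>k. es j (Suc l) * tau (k - j) (Suc l)) =
           tau k (Suc l) + (\<Sum>j\<le>k'. es (Suc j) (Suc l) * tau (k' - j) (Suc l))"
          unfolding Suc by (subst sum.atMost_Suc_shift) simp
        thus ?thesis by simp
      qed
      finally show ?thesis by simp
    qed
    finally show ?thesis using Suc.IH by simp
  qed simp
qed

lemma es_le: "es k (Suc l) \<le> tau k 0"
proof -
  have "es k (Suc l) * tau (k - k) l \<le> (\<Sum>j\<le>k. es j (Suc l) * tau (k - j) l)"
    by (rule member_le_sum) (auto simp: es_nonneg tau_nonneg intro!: mult_nonneg_nonneg simp del: es.simps)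
  thus ?thesis by (simp add: es_tau_sum)
qed

text \<open>In the splitting identity every term with a nontrivial \<open>tau\<close> tends to 0.
  The limit is zeta(2,...,2) = pi^(2k) / (2k+1)!.\<close>

lemma es_tendsto: "es k \<longlonglongrightarrow> tau k 0"
proof -
  have "(\<lambda>l. \<Sum>j<k. es j (Suc l) * tau (k - j) l) \<longlonglongrightarrow> 0"
  proof (rule tendsto_null_sum)
    fix j assume "j \<in> {..<k}"
    then obtain i where i: "k - j = Suc i" by (metis Suc_diff_Suc lessThan_iff)
    show "(\<lambda>l. es j (Suc l) * tau (k - j) l) \<longlonglongrightarrow> 0"
    proof (rule tendsto_sandwich[OF _ _ tendsto_const])
      show "(\<lambda>l. tau j 0 * tau (k - j) l) \<longlonglongrightarrow> 0"
        unfolding i by (rule tendsto_mult_right_zero[OF tau_tendsto_0])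
    qed (auto simp: es_le es_nonneg tau_nonneg intro!: always_eventually mult_right_mono mult_nonneg_nonneg simp del: es.simps)
  qed
  from tendsto_diff[OF tendsto_const[of "tau k 0"] this]
  have "(\<lambda>l. tau k 0 - (\<Sum>j<k. es j (Suc l) * tau (k - j) l)) \<longlonglongrightarrow> tau k 0" by simp
  moreover have "tau k 0 - (\<Sum>j<k. es j (Suc l) * tau (k - j) l) = es k (Suc l)" for l
    using es_tau_sum[where k = k and l = l] by (simp add: lessThan_Suc_atMost[symmetric] del: es.simps)
  ultimately have "(\<lambda>l. es k (Suc l)) \<longlonglongrightarrow> tau k 0" by simp
  thus ?thesis by (simp only: filterlim_sequentially_Suc)
qed

section \<open>Powers of the arcsine as power series in the squared sine\<close>

definition bt :: "nat \<Rightarrow> real" where "bt l = (pi / 2) / (real (Suc l) * pI 0 (Suc l))"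

lemma bt_0: "bt 0 = 2"
  by (simp add: bt_def pI0_rec pI_0)

lemma bt_pos: "bt l > 0"
  using pI0_pos[of "Suc l"] by (simp add: bt_def)

lemma bt_Suc: "bt (Suc l) * (2 * real l + 3) = bt l * (2 * (real l + 1))"
proof -
  have "2 * real l + 3 \<noteq> 0" "2 * real l + 4 \<noteq> 0" "real l + 2 \<noteq> 0" by linarith+
  thus ?thesis using pI0_pos[of "Suc l"] unfolding bt_def pI0_rec[of "Suc l"]
    by (simp add: divide_simps) (simp add: algebra_simps)
qed

lemma bt_le: "bt l \<le> 2"
proof (induction l)
  case (Suc l)
  have "bt (Suc l) * (2 * real l + 3) \<le> bt l * (2 * real l + 3)"
    unfolding bt_Suc using bt_pos[of l] by (intro mult_left_mono) auto
  hence "bt (Suc l) \<le> bt l" by (rule mult_right_le_imp_le) auto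
  with Suc show ?case by simp
qed (simp add: bt_0)

text \<open>The numbers \<open>bt l\<close> are normalised so that
  \<open>bt l * pI k (Suc l)\<close> is pi/2 times \<open>tau k (Suc l) / real (Suc l)\<close>; for
  m = 0 the series expands 2p / (sin p cos p) in sin^2 p.\<close>

definition Fm :: "nat \<Rightarrow> real fps" where "Fm m = Abs_fps (\<lambda>l. es m (Suc l) * bt l)"
definition Km :: "nat \<Rightarrow> real fps" where
  "Km m = Abs_fps (\<lambda>l. if l = 0 then 0 else es m l * bt (l - 1) / real l)"

lemma fps_deriv_Km: "fps_deriv (Km m) = Fm m"
  by (rule fps_ext) (simp add: Km_def Fm_def del: es.simps)

text \<open>In X = sin^2 p the left-hand side is the derivative in p of sin p cos p F(sin^2 p), and
  the right-hand side is twice the preceding even power of 2p with its factorial.\<close>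

lemma Fm_eq: "(1 - 2 * fps_X) * Fm m + 2 * (fps_X * (1 - fps_X) * fps_deriv (Fm m)) =
   2 * (case m of 0 \<Rightarrow> 1 | Suc m' \<Rightarrow> Km m')"
proof (rule fps_ext)
  fix n
  have two: "(2 * F) $ n = 2 * F $ n" for F :: "real fps" and n
    by (simp add: fps_numeral_fps_const)
  have e: "(1 - 2 * fps_X) * Fm m + 2 * (fps_X * (1 - fps_X) * fps_deriv (Fm m)) =
     Fm m - 2 * (fps_X * Fm m) + 2 * (fps_X * fps_deriv (Fm m)) - 2 * (fps_X * (fps_X * fps_deriv (Fm m)))"
    by (simp add: algebra_simps)
  show "((1 - 2 * fps_X) * Fm m + 2 * (fps_X * (1 - fps_X) * fps_deriv (Fm m))) $ n =
   (2 * (case m of 0 \<Rightarrow> 1 | Suc m' \<Rightarrow> Km m')) $ n"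
  proof (cases n)
    case 0
    thus ?thesis unfolding e two by (cases m) (simp_all add: two Fm_def Km_def bt_0)
  next
    case (Suc l)
    have "((1 - 2 * fps_X) * Fm m + 2 * (fps_X * (1 - fps_X) * fps_deriv (Fm m))) $ n =
      es m (Suc (Suc l)) * (bt (Suc l) * (2 * real l + 3)) - es m (Suc l) * (bt l * (2 * (real l + 1)))"
      unfolding e by (cases l) (simp_all add: two Suc Fm_def algebra_simps del: es.simps)
    also have "\<dots> = (es m (Suc (Suc l)) - es m (Suc l)) * bt l * (2 * (real l + 1))"
      unfolding bt_Suc by (simp add: algebra_simps)
    also have "\<dots> = (2 * (case m of 0 \<Rightarrow> 1 | Suc m' \<Rightarrow> Km m')) $ n"
    proof (cases m)
      case 0
      thus ?thesis by (simp add: Suc numeral_fps_const)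
    next
      case m: (Suc m')
      have "real l + 1 \<noteq> 0" by linarith
      thus ?thesis unfolding m es_Suc
        by (simp add: two Suc Km_def divide_simps power2_eq_square del: es.simps)
    qed
    finally show ?thesis .
  qed
qed

lemma fps_conv_radius_bounded:
  fixes f :: "real fps"
  assumes "\<And>n. \<bar>f $ n\<bar> \<le> C"
  shows "fps_conv_radius f \<ge> 1"
  unfolding fps_conv_radius_def
proof (rule conv_radius_geI_ex')
  fix r :: real assume r: "0 < r" "ereal r < 1"
  hence "summable (\<lambda>n. C * r ^ n)" by (intro summable_mult summable_geometric) auto
  thus "summable (\<lambda>n. f $ n * of_real r ^ n)"
    by (rule summable_comparison_test') (use r assms in \<open>auto simp: abs_mult power_abs intro!: mult_right_mono\<close>)
qed

lemma conv_radius_Fm: "fps_conv_radius (Fm m) \<ge> 1"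
proof (rule fps_conv_radius_bounded[of _ "tau m 0 * 2"])
  fix n
  show "\<bar>Fm m $ n\<bar> \<le> tau m 0 * 2"
    using es_le[of m n] bt_le[of n] bt_pos[of n] es_nonneg[of m "Suc n"] tau_nonneg[of m 0]
    by (auto simp: Fm_def abs_mult intro!: mult_mono simp del: es.simps)
qed

lemma conv_radius_Km: "fps_conv_radius (Km m) \<ge> 1"
proof (rule fps_conv_radius_bounded[of _ "tau m 0 * 2"])
  fix n
  have "es m (Suc l) * bt l / (1 + real l) \<le> tau m 0 * 2" for l
  proof -
    have "es m (Suc l) * bt l / (1 + real l) \<le> es m (Suc l) * bt l"
      using es_nonneg[of m "Suc l"] bt_pos[of l] by (simp add: divide_le_eq mult_nonneg_nonneg distrib_left del: es.simps)
    also have "\<dots> \<le> tau m 0 * 2"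
      using es_le[of m l] bt_le[of l] bt_pos[of l] es_nonneg[of m "Suc l"] tau_nonneg[of m 0]
      by (intro mult_mono) (auto simp del: es.simps)
    finally show ?thesis .
  qed
  thus "\<bar>Km m $ n\<bar> \<le> tau m 0 * 2"
    using bt_pos es_nonneg tau_nonneg[of m 0]
    by (cases n) (auto simp: Km_def abs_mult less_imp_le simp del: es.simps)
qed

text \<open>Even and odd powers alternate: each identity follows from the preceding one by comparing
  derivatives in p and values at 0.\<close>

lemma arcsin_expansion_aux:
  assumes "0 \<le> p" "p < pi / 2"
  shows "(2 * p) ^ (2 * m) / fact (2 * m) = (case m of 0 \<Rightarrow> 1 | Suc m' \<Rightarrow> eval_fps (Km m') (sin p ^ 2)) \<and>
    (2 * p) ^ Suc (2 * m) / fact (Suc (2 * m)) = sin p * cos p * eval_fps (Fm m) (sin p ^ 2)"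
  using assms
proof (induction m arbitrary: p)
  note [simp del] = es.simps fact_Suc power_Suc
  have lt1: "ereal (norm (sin p ^ 2)) < fps_conv_radius F" if "0 \<le> p" "p < pi / 2" "fps_conv_radius F \<ge> 1" for p F
  proof -
    have "cos p > 0" using that by (intro cos_gt_zero_pi) auto
    hence "sin p ^ 2 < 1" by (simp add: sin_squared_eq)
    hence "ereal (norm (sin p ^ 2)) < 1" by simp
    thus ?thesis using that(3) by (rule less_le_trans)
  qed
  have eqI: "f p = (g p :: real)" if "0 \<le> p" "p < pi / 2" "f 0 = g 0"
    "\<And>x. 0 \<le> x \<Longrightarrow> x < pi / 2 \<Longrightarrow> (f has_real_derivative d x) (at x)"
    "\<And>x. 0 \<le> x \<Longrightarrow> x < pi / 2 \<Longrightarrow> (g has_real_derivative d x) (at x)" for f g d p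
  proof -
    have "\<exists>c. \<forall>x\<in>{0..<pi/2}. f x - g x = c"
    proof (rule has_field_derivative_zero_constant)
      fix x assume "x \<in> {0..<pi/2}"
      hence "((\<lambda>x. f x - g x) has_real_derivative d x - d x) (at x)"
        by (intro DERIV_diff that) auto
      thus "((\<lambda>x. f x - g x) has_real_derivative 0) (at x within {0..<pi/2})"
        by (auto intro: has_field_derivative_at_within)
    qed auto
    then obtain c where c: "\<And>x. 0 \<le> x \<Longrightarrow> x < pi / 2 \<Longrightarrow> f x - g x = c" by auto
    thus ?thesis using c[of 0] c[of p] that by simp
  qed
  have dsin: "((\<lambda>x. sin x ^ 2) has_real_derivative 2 * sin x * cos x) (at x)" for x :: real
    by (auto intro!: derivative_eq_intros simp: power2_eq_square)
  have odd: "(2 * p) ^ Suc (2 * m) / fact (Suc (2 * m)) = sin p * cos p * eval_fps (Fm m) (sin p ^ 2)"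
    if "0 \<le> p" "p < pi / 2"
      and ev: "\<And>p. 0 \<le> p \<Longrightarrow> p < pi / 2 \<Longrightarrow> (2 * p) ^ (2 * m) / fact (2 * m) = (case m of 0 \<Rightarrow> 1 | Suc m' \<Rightarrow> eval_fps (Km m') (sin p ^ 2))" for m p
  proof (rule eqI[OF that(1,2)])
    fix x :: real assume x: "0 \<le> x" "x < pi / 2"
    define s where "s = sin x ^ 2"
    have c2: "cos x * cos x = 1 - s" "sin x * sin x = s" 
      unfolding s_def using sin_squared_eq[of x] by (simp_all add: power2_eq_square)
    note r = lt1[OF x]
    define K where "K = (case m of 0 \<Rightarrow> 1 | Suc m' \<Rightarrow> Km m')"
    have rK: "fps_conv_radius K \<ge> 1"
      unfolding K_def by (cases m) (simp_all add: conv_radius_Km)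
    have rd: "fps_conv_radius (fps_deriv (Fm m)) \<ge> 1"
      using conv_radius_Fm fps_conv_radius_deriv order_trans by blast
    have mult: "fps_conv_radius (f * g) \<ge> 1 \<and> eval_fps (f * g) s = eval_fps f s * eval_fps g s"
      if "fps_conv_radius f \<ge> 1" "fps_conv_radius g \<ge> 1" for f g :: "real fps"
      unfolding s_def using that r by (intro conjI eval_fps_mult order_trans[OF _ fps_conv_radius_mult]) auto
    have add: "fps_conv_radius (f + g) \<ge> 1 \<and> eval_fps (f + g) s = eval_fps f s + eval_fps g s"
      if "fps_conv_radius f \<ge> 1" "fps_conv_radius g \<ge> 1" for f g :: "real fps"
      unfolding s_def using that r by (intro conjI eval_fps_add order_trans[OF _ fps_conv_radius_add]) auto
    have diff: "fps_conv_radius (f - g) \<ge> 1 \<and> eval_fps (f - g) s = eval_fps f s - eval_fps g s"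
      if "fps_conv_radius f \<ge> 1" "fps_conv_radius g \<ge> 1" for f g :: "real fps"
      unfolding s_def using that r by (intro conjI eval_fps_diff order_trans[OF _ fps_conv_radius_diff]) auto
    \<comment> \<open>Numerals are written as constant series, so that evaluation with its radius
      conditions can be distributed factor by factor.\<close>
    have "eval_fps (fps_const 2 * K) s =
       eval_fps ((fps_const 1 - fps_const 2 * fps_X) * Fm m + fps_const 2 * (fps_X * (fps_const 1 - fps_X) * fps_deriv (Fm m))) s"
      using Fm_eq[of m] by (simp add: K_def numeral_fps_const)
    hence "2 * eval_fps K s =
       (1 - 2 * s) * eval_fps (Fm m) s + 2 * (s * (1 - s) * eval_fps (fps_deriv (Fm m)) s)"
    proof -
      have cc: "fps_conv_radius (fps_const c) \<ge> 1" for c :: real by simp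
      have cX: "fps_conv_radius (fps_X :: real fps) \<ge> 1" by simp
      note [simp del] = fps_const_1_eq_1
      have A: "fps_conv_radius (fps_const 2 * fps_X :: real fps) \<ge> 1" "eval_fps (fps_const 2 * fps_X) s = 2 * s"
        using mult[OF cc cX, of 2] by simp_all
      have A': "fps_conv_radius (fps_const 1 - fps_const 2 * fps_X :: real fps) \<ge> 1" "eval_fps (fps_const 1 - fps_const 2 * fps_X) s = 1 - 2 * s"
        using diff[OF cc A(1), of 1] A(2) by simp_all
      have modB: "fps_conv_radius (fps_const 1 - fps_X :: real fps) \<ge> 1" "eval_fps (fps_const 1 - fps_X) s = 1 - s"
        using diff[OF cc cX, of 1] by simp_all
      note X = mult[OF cX modB(1)]
      note Y = mult[OF conjunct1[OF X] rd]
      note Z = mult[OF cc conjunct1[OF Y], of 2]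
      note W = mult[OF A'(1) conjunct1[OF conjI[OF conv_radius_Fm TrueI]], of m]
      note V = add[OF conjunct1[OF W] conjunct1[OF Z]]
      show "eval_fps (fps_const 2 * K) s =
       eval_fps ((fps_const 1 - fps_const 2 * fps_X) * Fm m + fps_const 2 * (fps_X * (fps_const 1 - fps_X) * fps_deriv (Fm m))) s \<Longrightarrow> ?thesis"
        unfolding conjunct2[OF V] conjunct2[OF W] conjunct2[OF Z] conjunct2[OF Y] conjunct2[OF X] A'(2) modB(2)
        using mult[OF cc rK, of 2] by simp
    qed
    moreover have "eval_fps K s = (2 * x) ^ (2 * m) / fact (2 * m)"
      unfolding ev[OF x] K_def s_def by (cases m) simp_all
    ultimately have "2 * ((2 * x) ^ (2 * m) / fact (2 * m)) = (1 - 2 * s) * eval_fps (Fm m) s + 2 * (s * (1 - s) * eval_fps (fps_deriv (Fm m)) s)"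
      by simp
    also have "\<dots> = (cos x * cos x - sin x * sin x) * eval_fps (Fm m) s + sin x * cos x * (eval_fps (fps_deriv (Fm m)) s * (2 * sin x * cos x))"
    proof -
      have "sin x * cos x * (eval_fps (fps_deriv (Fm m)) s * (2 * sin x * cos x)) =
        2 * ((sin x * sin x) * (cos x * cos x)) * eval_fps (fps_deriv (Fm m)) s" by (simp add: algebra_simps)
      thus ?thesis unfolding c2 by (simp add: algebra_simps)
    qed
    finally have e: "(cos x * cos x - sin x * sin x) * eval_fps (Fm m) s + sin x * cos x * (eval_fps (fps_deriv (Fm m)) s * (2 * sin x * cos x)) 
       = 2 * ((2 * x) ^ (2 * m) / fact (2 * m))" by simp
    have "((\<lambda>x. eval_fps (Fm m) (sin x ^ 2)) has_real_derivative eval_fps (fps_deriv (Fm m)) s * (2 * sin x * cos x)) (at x)"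
      unfolding s_def by (rule DERIV_chain2[OF has_field_derivative_eval_fps dsin]) (use r conv_radius_Fm in auto)
    hence "((\<lambda>x. sin x * cos x * eval_fps (Fm m) (sin x ^ 2)) has_real_derivative
       (cos x * cos x - sin x * sin x) * eval_fps (Fm m) s + sin x * cos x * (eval_fps (fps_deriv (Fm m)) s * (2 * sin x * cos x))) (at x)"
      by (intro DERIV_cong[OF DERIV_mult[OF DERIV_mult[OF DERIV_sin DERIV_cos]]]) (auto simp: s_def algebra_simps)
    thus "((\<lambda>x. sin x * cos x * eval_fps (Fm m) (sin x ^ 2)) has_real_derivative 2 * ((2 * x) ^ (2 * m) / fact (2 * m))) (at x)"
      unfolding e .
    show "((\<lambda>p. (2 * p) ^ Suc (2 * m) / fact (Suc (2 * m))) has_real_derivative 2 * ((2 * x) ^ (2 * m) / fact (2 * m))) (at x)"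
      by (rule DERIV_double_power)
  qed (simp add: power_Suc)
  have even: "(2 * p) ^ (2 * Suc m) / fact (2 * Suc m) = eval_fps (Km m) (sin p ^ 2)"
    if "0 \<le> p" "p < pi / 2"
      and od: "\<And>p. 0 \<le> p \<Longrightarrow> p < pi / 2 \<Longrightarrow> (2 * p) ^ Suc (2 * m) / fact (Suc (2 * m)) = sin p * cos p * eval_fps (Fm m) (sin p ^ 2)" for m p
  proof (rule eqI[OF that(1,2)])
    fix x :: real assume x: "0 \<le> x" "x < pi / 2"
    have "((\<lambda>x. eval_fps (Km m) (sin x ^ 2)) has_real_derivative eval_fps (fps_deriv (Km m)) (sin x ^ 2) * (2 * sin x * cos x)) (at x)"
      by (rule DERIV_chain2[OF has_field_derivative_eval_fps dsin]) (use lt1[OF x] conv_radius_Km in auto)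
    also have "eval_fps (fps_deriv (Km m)) (sin x ^ 2) * (2 * sin x * cos x) = 2 * ((2 * x) ^ Suc (2 * m) / fact (Suc (2 * m)))"
      unfolding fps_deriv_Km od[OF x] by simp
    finally show "((\<lambda>x. eval_fps (Km m) (sin x ^ 2)) has_real_derivative 2 * ((2 * x) ^ Suc (2 * m) / fact (Suc (2 * m)))) (at x)" .
    show "((\<lambda>p. (2 * p) ^ (2 * Suc m) / fact (2 * Suc m)) has_real_derivative 2 * ((2 * x) ^ Suc (2 * m) / fact (Suc (2 * m)))) (at x)"
      using DERIV_double_power[of "Suc (2 * m)" x UNIV] by (simp only: mult_Suc_right) simp
  qed (simp add: power_Suc eval_fps_at_0 Km_def)
  {
    case 0
    thus ?case using odd[of p 0] by simp
  next
    case (Suc m)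
    have "(2 * p) ^ (2 * Suc m) / fact (2 * Suc m) = eval_fps (Km m) (sin p ^ 2)" if "0 \<le> p" "p < pi / 2" for p
      using Suc.IH by (intro even that) auto
    thus ?case using odd[OF Suc.prems, of "Suc m"] Suc.prems by simp
  }
qed


definition oc :: "nat \<Rightarrow> real \<Rightarrow> real" where "oc m t = (pi - 2 * t) ^ Suc (2 * m) / fact (Suc (2 * m))"

text \<open>The odd expansion at p = pi/2 - t gives sin t cos t F(cos^2 t), and cot t turns sin t
  cos t into cos^2 t.\<close>

lemma cot_oc_sums:
  assumes "0 < t" "t \<le> pi / 2"
  shows "(\<lambda>l. es m (Suc l) * bt l * cos t ^ (2 * Suc l)) sums (cot t * oc m t)"
proof -
  define p where "p = pi / 2 - t"
  have p: "0 \<le> p" "p < pi / 2" using assms by (auto simp: p_def)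
  have sc: "sin p = cos t" "cos p = sin t" "2 * p = pi - 2 * t"
    by (simp_all add: p_def sin_diff cos_diff)
  have pos: "sin t > 0" using assms by (intro sin_gt_zero) auto
  hence "cos t ^ 2 < 1" by (simp add: cos_squared_eq)
  hence "ereal (norm (cos t ^ 2)) < 1" by simp
  hence "(\<lambda>l. Fm m $ l * (cos t ^ 2) ^ l) sums eval_fps (Fm m) (cos t ^ 2)"
    unfolding eval_fps_def by (intro summable_sums summable_fps less_le_trans[OF _ conv_radius_Fm])
  hence "(\<lambda>l. cos t ^ 2 * (Fm m $ l * (cos t ^ 2) ^ l)) sums (cos t ^ 2 * eval_fps (Fm m) (cos t ^ 2))"
    by (rule sums_mult)
  moreover have "cos t ^ 2 * eval_fps (Fm m) (cos t ^ 2) = cot t * oc m t"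
    using arcsin_expansion_aux[OF p, of m] pos unfolding sc
    by (simp add: oc_def cot_def power2_eq_square del: fact_Suc power_Suc)
  moreover have "cos t ^ 2 * (Fm m $ l * (cos t ^ 2) ^ l) = es m (Suc l) * bt l * cos t ^ (2 * Suc l)" for l
    by (simp add: Fm_def power_mult power2_eq_square del: es.simps)
  ultimately show ?thesis by simp
qed

lemma cot_t_le: "0 < t \<Longrightarrow> t \<le> pi / 2 \<Longrightarrow> 0 \<le> cot t \<and> cot t * t \<le> 1"
proof -
  assume t: "0 < t" "t \<le> pi / 2"
  hence "sin t > 0" "cos t \<ge> 0" by (auto intro!: sin_gt_zero cos_ge_zero)
  thus ?thesis using t_cos_le_sin[of t] t by (simp add: cot_def divide_simps mult.commute)
qed

text \<open>The terms are nonnegative, so the partial sums lie below the sum, whose bound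
  \<open>M\<close> permits dominated convergence.\<close>

lemma cot_sums_integral:
  fixes c :: "nat \<Rightarrow> real"
  assumes c: "\<And>l. c l \<ge> 0"
    and G: "\<And>t. 0 < t \<Longrightarrow> t \<le> pi / 2 \<Longrightarrow> (\<lambda>l. c l * cos t ^ (2 * Suc l)) sums (cot t * g t)"
    and M: "\<And>t. 0 < t \<Longrightarrow> t \<le> pi / 2 \<Longrightarrow> cot t * (g t * ((2 * t) ^ (2 * k) / fact (2 * k))) \<le> M"
  shows "(\<lambda>t. cot t * (g t * ((2 * t) ^ (2 * k) / fact (2 * k)))) integrable_on {0..pi/2} \<and>
    (\<lambda>l. c l * pI k (Suc l)) sums integral {0..pi/2} (\<lambda>t. cot t * (g t * ((2 * t) ^ (2 * k) / fact (2 * k))))"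
proof -
  define p where "p t = (2 * t) ^ (2 * k) / (fact (2 * k) :: real)" for t
  have p: "p t \<ge> 0" for t unfolding p_def by (intro divide_nonneg_nonneg zero_le_even_power) auto
  \<comment> \<open>The expansion is available only for t > 0; the value at the single point 0 does
    not affect the integrals.\<close>
  define h where "h t = (if t = 0 then 0 else cot t * (g t * p t))" for t
  define f where "f n t = (if t = 0 then 0 else (\<Sum>l<n. c l * (cos t ^ (2 * Suc l) * p t)))" for n and t :: real
  have S: "(\<lambda>l. c l * (cos t ^ (2 * Suc l) * p t)) sums h t" if "t \<in> {0..pi/2}" "t \<noteq> 0" for t
    using sums_mult2[OF G[of t], of "p t"] that by (simp add: h_def mult_ac del: mult_Suc_right)
  have nn: "c l * (cos t ^ (2 * Suc l) * p t) \<ge> 0" for l t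
    using c p by (intro mult_nonneg_nonneg zero_le_even_power) auto
  have fi: "(f n has_integral (\<Sum>l<n. c l * pI k (Suc l))) {0..pi/2}" for n
  proof (rule has_integral_spike_finite[of "{0}"])
    show "((\<lambda>t. \<Sum>l<n. c l * (cos t ^ (2 * Suc l) * p t)) has_integral (\<Sum>l<n. c l * pI k (Suc l))) {0..pi/2}"
      unfolding p_def by (intro has_integral_sum has_integral_mult_right pI_has_integral) auto
  qed (auto simp: f_def)
  have "h integrable_on {0..pi/2} \<and> (\<lambda>n. integral {0..pi/2} (f n)) \<longlonglongrightarrow> integral {0..pi/2} h"
  proof -
    have a: "f n integrable_on {0..pi/2}" for n using fi by blast
    have b: "norm (f n t) \<le> max M 0" if "t \<in> {0..pi/2}" for n t
    proof (cases "t = 0")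
      case False
      have "norm (f n t) = (\<Sum>l<n. c l * (cos t ^ (2 * Suc l) * p t))"
        using False nn by (simp add: f_def sum_nonneg del: mult_Suc_right)
      also have "\<dots> \<le> h t"
      proof -
        have sm: "summable (\<lambda>l. c l * (cos t ^ (2 * Suc l) * p t))" "(\<Sum>l. c l * (cos t ^ (2 * Suc l) * p t)) = h t"
          using S[OF that False] by (simp_all only: sums_iff)
        show ?thesis unfolding sm(2)[symmetric] by (rule sum_le_suminf[OF sm(1)]) (simp_all only: nn finite_lessThan)
      qed
      also have "\<dots> \<le> M" using M[of t] that False by (auto simp: h_def p_def)
      finally show ?thesis by simp
    qed (simp add: f_def)
    have c: "(\<lambda>n. f n t) \<longlonglongrightarrow> h t" if "t \<in> {0..pi/2}" for t
      using S[OF that] by (cases "t = 0") (auto simp: f_def h_def sums_def simp del: mult_Suc_right)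
    have d: "(\<lambda>_. max M 0) integrable_on {0..pi/2}" by auto
    from dominated_convergence[OF a d b c] show ?thesis by blast
  qed
  moreover have "integral {0..pi/2} (f n) = (\<Sum>l<n. c l * pI k (Suc l))" for n
    using fi by (rule integral_unique)
  moreover have "h integrable_on {0..pi/2} \<longleftrightarrow> (\<lambda>t. cot t * (g t * p t)) integrable_on {0..pi/2}"
    by (rule integrable_spike_finite_eq[of "{0}"]) (auto simp: h_def)
  moreover have "integral {0..pi/2} h = integral {0..pi/2} (\<lambda>t. cot t * (g t * p t))"
    by (rule integral_spike[of "{0}"]) (auto simp: h_def)
  ultimately have "(\<lambda>t. cot t * (g t * p t)) integrable_on {0..pi/2} \<and>
    (\<lambda>l. c l * pI k (Suc l)) sums integral {0..pi/2} (\<lambda>t. cot t * (g t * p t))"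
    by (simp add: sums_def)
  thus ?thesis by (simp only: p_def)
qed

text \<open>For \<open>k > 0\<close> the factor (2t)^(2k) compensates the pole of cot at 0.\<close>

lemma es_tau_sums:
  assumes "k > 0"
  shows "(\<lambda>t. cot t * (oc m t * ((2 * t) ^ (2 * k) / fact (2 * k)))) integrable_on {0..pi/2} \<and>
    (\<lambda>l. es m (Suc l) * tau k (Suc l) / real (Suc l)) sums
      (2 / pi * integral {0..pi/2} (\<lambda>t. cot t * (oc m t * ((2 * t) ^ (2 * k) / fact (2 * k)))))"
proof -
  define M where "M = pi ^ Suc (2 * m) / fact (Suc (2 * m)) * (2 * pi ^ (2 * k - 1) / fact (2 * k))"
  have "cot t * (oc m t * ((2 * t) ^ (2 * k) / fact (2 * k))) \<le> M" if t: "0 < t" "t \<le> pi / 2" for t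
  proof -
    obtain k' where k': "2 * k = Suc k'" using assms by (metis mult_pos_pos not0_implies_Suc less_numeral_extra(3) pos2)
    have "cot t * (oc m t * ((2 * t) ^ (2 * k) / fact (2 * k))) = oc m t * (2 * (cot t * t) * (2 * t) ^ k' / fact (2 * k))"
      unfolding k' by (simp add: mult_ac del: fact_Suc)
    also have "\<dots> \<le> (pi ^ Suc (2 * m) / fact (Suc (2 * m))) * (2 * 1 * pi ^ k' / fact (2 * k))"
      using cot_t_le[OF t] t unfolding oc_def
      by (intro mult_mono divide_right_mono power_mono mult_nonneg_nonneg divide_nonneg_nonneg) auto
    finally show ?thesis unfolding M_def k' by simp
  qed
  from cot_sums_integral[OF _ cot_oc_sums this]
  have *: "(\<lambda>t. cot t * (oc m t * ((2 * t) ^ (2 * k) / fact (2 * k)))) integrable_on {0..pi/2}"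
    "(\<lambda>l. es m (Suc l) * bt l * pI k (Suc l)) sums
       integral {0..pi/2} (\<lambda>t. cot t * (oc m t * ((2 * t) ^ (2 * k) / fact (2 * k))))"
    using es_nonneg bt_pos by (auto simp: less_imp_le simp del: es.simps)
  have "2 / pi * (es m (Suc l) * bt l * pI k (Suc l)) = es m (Suc l) * tau k (Suc l) / real (Suc l)" for l
    by (simp add: bt_def tau_def del: es.simps of_nat_Suc)
  with sums_mult[OF *(2), of "2 / pi"] *(1) show ?thesis by simp
qed

text \<open>For k = 0 the corresponding series diverges like the harmonic series. Subtracting the
  limit \<open>tau m 0\<close> from \<open>es\<close> amounts to subtracting a multiple of the case
  m = 0, which also removes the pole of cot.\<close>

lemma es_defect_sums:
  "(\<lambda>t. cot t * ((pi - 2 * t) * tau m 0 - oc m t)) integrable_on {0..pi/2} \<and>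
    (\<lambda>l. (tau m 0 - es m (Suc l)) / real (Suc l)) sums
      (2 / pi * integral {0..pi/2} (\<lambda>t. cot t * ((pi - 2 * t) * tau m 0 - oc m t)))"
proof -
  define M where "M = pi * (pi ^ (2 * m) * (real (2 * m) * (2 / pi))) / fact (Suc (2 * m))"
  have "cot t * (((pi - 2 * t) * tau m 0 - oc m t) * ((2 * t) ^ (2 * 0) / fact (2 * 0))) \<le> M" if t: "0 < t" "t \<le> pi / 2" for t
  proof -
    define s where "s = 2 * t / pi"
    have s: "s \<ge> 0" "s \<le> 1" "pi - 2 * t = pi * (1 - s)" using t by (auto simp: s_def field_simps)
    \<comment> \<open>Bernoulli's inequality in s = 2t / pi gives a bound linear in t, to be
      absorbed by cot t * t <= 1.\<close>
    have "1 + real (2 * m) * (- s) \<le> (1 + - s) ^ (2 * m)"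
      by (rule Bernoulli_inequality) (use s in auto)
    hence "pi ^ (2 * m) * (1 - (1 - s) ^ (2 * m)) \<le> pi ^ (2 * m) * (real (2 * m) * s)"
      by (intro mult_left_mono) auto
    hence 1: "pi ^ (2 * m) - (pi - 2 * t) ^ (2 * m) \<le> pi ^ (2 * m) * (real (2 * m) * s)"
      unfolding s(3) power_mult_distrib by (simp add: algebra_simps)
    have "(pi - 2 * t) * tau m 0 - oc m t = (pi - 2 * t) * (pi ^ (2 * m) - (pi - 2 * t) ^ (2 * m)) / fact (Suc (2 * m))"
      by (simp add: tau_at_0 oc_def diff_divide_distrib right_diff_distrib del: fact_Suc)
    also have "\<dots> \<le> pi * (pi ^ (2 * m) * (real (2 * m) * s)) / fact (Suc (2 * m))"
    proof (intro divide_right_mono)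
      have "(pi - 2 * t) * (pi ^ (2 * m) - (pi - 2 * t) ^ (2 * m)) \<le> (pi - 2 * t) * (pi ^ (2 * m) * (real (2 * m) * s))"
        using t by (intro mult_left_mono 1) auto
      also have "\<dots> \<le> pi * (pi ^ (2 * m) * (real (2 * m) * s))"
        using t s by (intro mult_right_mono mult_nonneg_nonneg) auto
      finally show "(pi - 2 * t) * (pi ^ (2 * m) - (pi - 2 * t) ^ (2 * m)) \<le> \<dots>" .
    qed auto
    also have "\<dots> = M * t" by (simp add: M_def s_def)
    finally have "cot t * ((pi - 2 * t) * tau m 0 - oc m t) \<le> cot t * (M * t)"
      using cot_t_le[OF t] by (intro mult_left_mono) auto
    also have "\<dots> = M * (cot t * t)" by simp
    also have "\<dots> \<le> M * 1"
      using cot_t_le[OF t] by (intro mult_left_mono) (auto simp: M_def)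
    finally show ?thesis by simp
  qed
  moreover have "(\<lambda>l. (tau m 0 - es m (Suc l)) * bt l * cos t ^ (2 * Suc l)) sums (cot t * ((pi - 2 * t) * tau m 0 - oc m t))"
    if t: "0 < t" "t \<le> pi / 2" for t
  proof -
    have "(\<lambda>l. tau m 0 * (es 0 (Suc l) * bt l * cos t ^ (2 * Suc l)) - es m (Suc l) * bt l * cos t ^ (2 * Suc l))
       sums (tau m 0 * (cot t * oc 0 t) - cot t * oc m t)"
      by (intro sums_diff sums_mult cot_oc_sums t)
    thus ?thesis by (simp add: oc_def[of 0] algebra_simps del: es.simps(2))
  qed
  ultimately have *: "(\<lambda>t. cot t * (((pi - 2 * t) * tau m 0 - oc m t) * ((2 * t) ^ (2 * 0) / fact (2 * 0)))) integrable_on {0..pi/2} \<and>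
     (\<lambda>l. (tau m 0 - es m (Suc l)) * bt l * pI 0 (Suc l)) sums
       integral {0..pi/2} (\<lambda>t. cot t * (((pi - 2 * t) * tau m 0 - oc m t) * ((2 * t) ^ (2 * 0) / fact (2 * 0))))"
    using es_le[of m] bt_pos
    by (intro cot_sums_integral[where c = "\<lambda>l. (tau m 0 - es m (Suc l)) * bt l"]) (auto simp: less_imp_le simp del: es.simps)
  have "2 / pi * ((tau m 0 - es m (Suc l)) * bt l * pI 0 (Suc l)) = (tau m 0 - es m (Suc l)) / real (Suc l)" for l
    using pI0_pos[of "Suc l"]
    by (simp add: bt_def del: es.simps of_nat_Suc) (simp add: diff_divide_distrib del: es.simps of_nat_Suc)
  with sums_mult[OF conjunct2[OF *], of "2 / pi"] conjunct1[OF *] show ?thesis by simp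
qed

text \<open>Up to sign, the coefficient of z^l in the polylogarithm of \<open>A10 m k\<close>: each
  further block X1 X0 contributes a partial sum and a division by l^2.\<close>

primrec V :: "nat \<Rightarrow> nat \<Rightarrow> nat \<Rightarrow> real" where
  "V m 0 l = es m l / real l"
| "V m (Suc k) l = (\<Sum>j<l. V m k j) / real l ^ 2"

lemma V_nonneg: "V m k l \<ge> 0"
  by (induction k arbitrary: l) (auto intro!: divide_nonneg_nonneg sum_nonneg es_nonneg)

lemma V_0 [simp]: "V m k 0 = 0"
  by (cases k) auto

lemma sum_inverse_sqrt_le:
  assumes "C \<ge> 0" "\<And>l. l > 0 \<Longrightarrow> g l \<le> C / sqrt (real l)" "g 0 = (0 :: real)"
  shows "(\<Sum>l<Suc N. g l) \<le> 2 * C * sqrt (real N)"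
proof (induction N)
  case (Suc N)
  have "g (Suc N) \<le> C / sqrt (real (Suc N))" by (rule assms) simp
  also have "1 / sqrt (real (Suc N)) \<le> 2 * (sqrt (real (Suc N)) - sqrt (real N))"
  proof -
    define a b where "a = sqrt (real (Suc N))" and "b = sqrt (real N)"
    have ab: "a > 0" "b \<ge> 0" "b \<le> a" "a * a = b * b + 1" by (simp_all add: a_def b_def)
    have "1 = (a - b) * (a + b)" using ab by (simp add: algebra_simps)
    also have "\<dots> \<le> (a - b) * (2 * a)" using ab by (intro mult_left_mono) auto
    finally show ?thesis unfolding a_def[symmetric] b_def[symmetric] using ab by (simp add: divide_le_eq mult_ac)
  qed
  hence "C / sqrt (real (Suc N)) \<le> C * (2 * (sqrt (real (Suc N)) - sqrt (real N)))"
    using mult_left_mono[OF _ assms(1)] by fastforce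
  finally show ?case using Suc by (simp add: algebra_simps)
qed (simp add: assms)

text \<open>A crude bound, enough for the boundary terms of the summation by parts because
  \<open>tau\<close> decays like 1/N; the square root leaves room for logarithms.\<close>

lemma V_sum_growth: "\<exists>C\<ge>0. \<forall>N. (\<Sum>l<N. V m k l) \<le> C * sqrt (real N)"
proof -
  have "\<exists>C\<ge>0. \<forall>l>0. V m k l \<le> C / sqrt (real l)"
  proof (induction k)
    case 0
    show ?case
    proof (intro exI[of _ "tau m 0"] conjI allI impI tau_nonneg)
      fix l :: nat assume "l > 0"
      then obtain l' where l: "l = Suc l'" by (cases l) auto
      have "V m 0 l \<le> tau m 0 / real l"
        using es_le[of m l'] by (simp add: l divide_right_mono del: es.simps)
      also have "\<dots> \<le> tau m 0 / sqrt (real l)"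
      proof -
        define s where "s = sqrt (real l)"
        have s: "s \<ge> 1" "real l = s * s" using \<open>l > 0\<close> by (simp_all add: s_def)
        hence "s * 1 \<le> s * s" by (intro mult_left_mono) auto
        thus ?thesis unfolding s_def[symmetric] s(2) using s tau_nonneg[of m 0]
          by (intro divide_left_mono) auto
      qed
      finally show "V m 0 l \<le> tau m 0 / sqrt (real l)" .
    qed
  next
    case (Suc k)
    then obtain C where C: "C \<ge> 0" "\<And>l. l > 0 \<Longrightarrow> V m k l \<le> C / sqrt (real l)" by blast
    show ?case
    proof (intro exI[of _ "2 * C"] conjI allI impI)
      fix l :: nat assume "l > 0"
      then obtain l' where l: "l = Suc l'" by (cases l) auto
      define s where "s = sqrt (real l)"
      have s: "s \<ge> 1" "real l = s * s" using \<open>l > 0\<close> by (simp_all add: s_def)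
      have "(\<Sum>j<l. V m k j) \<le> 2 * C * sqrt (real l')"
        unfolding l by (rule sum_inverse_sqrt_le) (use C in auto)
      also have "\<dots> \<le> 2 * C * s"
        using C unfolding s_def l by (intro mult_left_mono) auto
      finally have "V m (Suc k) l \<le> 2 * C * s / (s * s) ^ 2"
        unfolding V.simps s(2)[symmetric] by (intro divide_right_mono) auto
      also have "\<dots> \<le> 2 * C / s"
      proof -
        have "s * s \<le> s * s * (s * s)" using s mult_mono[of 1 "s * s" "s * s" "s * s"] mult_mono[of 1 s 1 s] by simp
        hence "1 \<le> s * s" using s by simp
        hence "C * 1 \<le> C * (s * s)" using C by (intro mult_left_mono) auto
        thus ?thesis using s C by (simp add: divide_simps power2_eq_square mult.assoc)
      qed
      finally show "V m (Suc k) l \<le> 2 * C / sqrt (real l)" by (simp add: s_def)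
    qed (use C in auto)
  qed
  then obtain C where C: "C \<ge> 0" "\<And>l. l > 0 \<Longrightarrow> V m k l \<le> C / sqrt (real l)" by blast
  have "(\<Sum>l<N. V m k l) \<le> 2 * C * sqrt (real N)" for N
  proof (cases N)
    case (Suc n)
    have "(\<Sum>l<N. V m k l) \<le> 2 * C * sqrt (real n)"
      unfolding Suc by (rule sum_inverse_sqrt_le) (use C in auto)
    also have "\<dots> \<le> 2 * C * sqrt (real N)" using C Suc by (intro mult_left_mono) auto
    finally show ?thesis .
  qed simp
  with C show ?thesis by (intro exI[of _ "2 * C"]) auto
qed

text \<open>Summation by parts: by \<open>tau_rec\<close>, dividing \<open>tau i\<close> by the
  squared index gives a difference of consecutive values of \<open>tau (Suc i)\<close>, so one outer
  index passes from \<open>tau\<close> into \<open>V\<close>.\<close>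

lemma V_tau_step:
  assumes "(\<lambda>l. V m k l * tau (Suc i) l) sums s"
  shows "(\<lambda>l. V m (Suc k) l * tau i l) sums s"
proof -
  define S where "S N = (\<Sum>j<N. V m k j)" for N
  have S0: "S N \<ge> 0" for N by (simp add: S_def V_nonneg sum_nonneg)
  have part: "(\<Sum>l<Suc N. V m (Suc k) l * tau i l) = (\<Sum>l<N. V m k l * tau (Suc i) l) - S N * tau (Suc i) N" for N
  proof (induction N)
    case (Suc N)
    have "V m (Suc k) (Suc N) * tau i (Suc N) = S (Suc N) * (tau (Suc i) N - tau (Suc i) (Suc N))"
      unfolding tau_rec[of i N] by (simp add: S_def)
    also have "\<dots> = S N * tau (Suc i) N + V m k N * tau (Suc i) N - S (Suc N) * tau (Suc i) (Suc N)"
      by (simp add: S_def algebra_simps)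
    finally show ?case using Suc by simp
  qed (simp add: S_def)
  obtain C where C: "C \<ge> 0" "\<And>N. S N \<le> C * sqrt (real N)" using V_sum_growth[of m k] unfolding S_def by blast
  obtain D where D: "D \<ge> 0" "\<And>N. tau (Suc i) (Suc N) \<le> D / real (Suc N)" using tau_bound[of i] by blast
  have "(\<lambda>N. S (Suc N) * tau (Suc i) (Suc N)) \<longlonglongrightarrow> 0"
  proof (rule tendsto_sandwich[OF _ _ tendsto_const])
    have "S (Suc N) * tau (Suc i) (Suc N) \<le> C * D / sqrt (real (Suc N))" for N
    proof -
      have "S (Suc N) * tau (Suc i) (Suc N) \<le> (C * sqrt (real (Suc N))) * (D / real (Suc N))"
        using C D tau_nonneg S0 by (intro mult_mono) (auto simp del: of_nat_Suc)
      also have "\<dots> = C * D / sqrt (real (Suc N))"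
        by (simp add: divide_simps)
      finally show ?thesis .
    qed
    thus "\<forall>\<^sub>F N in sequentially. S (Suc N) * tau (Suc i) (Suc N) \<le> C * D / sqrt (real (Suc N))" by simp
    have "filterlim (\<lambda>N. sqrt (real (Suc N))) at_top sequentially"
      by (intro filterlim_compose[OF sqrt_at_top] filterlim_compose[OF filterlim_real_sequentially] filterlim_Suc)
    thus "(\<lambda>N. C * D / sqrt (real (Suc N))) \<longlonglongrightarrow> 0"
      by (rule tendsto_divide_0[OF tendsto_const filterlim_at_top_imp_at_infinity])
  qed (simp add: S0 tau_nonneg)
  hence lim: "(\<lambda>N. S N * tau (Suc i) N) \<longlonglongrightarrow> 0"
    using filterlim_sequentially_Suc[of "\<lambda>N. S N * tau (Suc i) N"] by blast
  from tendsto_diff[OF assms[unfolded sums_def] lim]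
  have "(\<lambda>N. \<Sum>l<Suc N. V m (Suc k) l * tau i l) \<longlonglongrightarrow> s" unfolding part by simp
  thus ?thesis unfolding sums_def
    using filterlim_sequentially_Suc[of "\<lambda>N. \<Sum>l<N. V m (Suc k) l * tau i l"] by blast
qed

lemma V_tau_sums: "(\<lambda>l. V m 0 l * tau (i + k) l) sums s \<Longrightarrow> (\<lambda>l. V m k l * tau i l) sums s"
proof (induction k arbitrary: i)
  case (Suc k)
  thus ?case using V_tau_step Suc.IH[of "Suc i"] by simp
qed simp

text \<open>Meant for \<open>k > 0\<close>, where (2t)^(2k) compensates the pole of cot;
  \<open>cI\<close> is the regularised counterpart for k = 0.\<close>

definition etaI :: "nat \<Rightarrow> nat \<Rightarrow> real" where
  "etaI m k = 2 / pi * integral {0..pi/2} (\<lambda>t. cot t * (oc m t * ((2 * t) ^ (2 * k) / fact (2 * k))))"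
definition cI :: "nat \<Rightarrow> real" where
  "cI m = 2 / pi * integral {0..pi/2} (\<lambda>t. cot t * ((pi - 2 * t) * tau m 0 - oc m t))"

lemma V_sums: "k > 0 \<Longrightarrow> V m k sums etaI m k"
proof -
  assume "k > 0"
  hence "(\<lambda>l. es m (Suc l) * tau k (Suc l) / real (Suc l)) sums etaI m k"
    using es_tau_sums[of k m] by (simp add: etaI_def)
  hence "(\<lambda>l. V m 0 (Suc l) * tau k (Suc l)) sums etaI m k" by (simp del: es.simps of_nat_Suc)
  hence "(\<lambda>l. V m 0 l * tau (0 + k) l) sums etaI m k"
    using sums_Suc_iff[of "\<lambda>l. V m 0 l * tau (0 + k) l" "etaI m k"] by simp
  from V_tau_sums[OF this] show ?thesis by simp
qed

section \<open>Regularised values at 1\<close>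

definition h_fps :: "word \<Rightarrow> complex fps" where "h_fps w = fps_expansion (h_coeff w) 0"

lemma h_coeff_fps: "h_coeff w has_fps_expansion h_fps w"
  unfolding h_fps_def by (rule has_fps_expansion_fps_expansion[OF open_U1 zero_in_U1 h_coeff_holo])

lemma h_coeff_eval:
  assumes "norm z < 1" shows "(\<lambda>l. h_fps w $ l * z ^ l) sums h_coeff w z"
proof -
  have "ball 0 1 \<subseteq> U1"
  proof
    fix z :: complex assume "z \<in> ball 0 1"
    hence "Re z < 1" using complex_Re_le_cmod[of z] by simp
    thus "z \<in> U1" by (simp add: U1_iff)
  qed
  hence h: "h_coeff w holomorphic_on ball 0 1" using h_coeff_holo holomorphic_on_subset by blast
  have "eball (0 :: complex) 1 = ball 0 1" by (auto simp: eball_def one_ereal_def)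
  hence "h_coeff w holomorphic_on eball 0 1" using h by simp
  hence "fps_conv_radius (h_fps w) \<ge> 1" unfolding h_fps_def by (rule conv_radius_fps_expansion)
  hence "ereal (norm z) < fps_conv_radius (h_fps w)" using assms less_le_trans[of "ereal (norm z)" 1] by simp
  hence "(\<lambda>l. h_fps w $ l * z ^ l) sums eval_fps (h_fps w) z"
    unfolding eval_fps_def by (intro summable_sums summable_fps)
  thus ?thesis using has_fps_expansion_imp_eval_fps_eq[OF h_coeff_fps assms h] by simp
qed

text \<open>For a word beginning with X1 the correction by X0 on the left is absent, so the
  coefficient obeys the differential equation of the polylogarithm itself.\<close>

lemma deriv_h_coeff:
  assumes "z \<in> U1" "w \<noteq> []" "hd w = X1"
  shows "(z - pt (last w)) * deriv (h_coeff w) z = h_coeff (butlast w) z"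
proof -
  have d: "deriv (h_coeff w) z = h_rhs w (h_coeff (butlast w)) (h_coeff (tl w)) z"
    using h_coeff_deriv[OF assms(2,1)] by (rule DERIV_imp_deriv)
  show ?thesis
  proof (cases "last w")
    case X1
    thus ?thesis using assms one_notin_U1[of z] by (simp add: d h_rhs_def pt_def)
  next
    case X0
    hence "butlast w \<noteq> []" using assms by (cases w; cases "tl w") auto
    thus ?thesis using assms X0 by (cases "z = 0") (simp_all add: d h_rhs_def pt_def diff_quot_def h_coeff_0)
  qed
qed

lemma h_fps_Nil: "h_fps [] = 1"
  using h_coeff_fps[of "[]"] by (intro fps_expansion_unique_complex[OF _ has_fps_expansion_1]) simp

lemma h_fps_0: "w \<noteq> [] \<Longrightarrow> h_fps w $ 0 = 0"
  using fps_nth_fps_expansion[OF h_coeff_fps, of w 0] by (simp add: h_coeff_0)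

lemma h_fps_rec:
  assumes "w \<noteq> []" "hd w = X1"
  shows "(fps_X - fps_const (pt (last w))) * fps_deriv (h_fps w) = h_fps (butlast w)"
proof (rule fps_expansion_unique_complex[OF _ h_coeff_fps])
  have "(\<lambda>z. (z - pt (last w)) * deriv (h_coeff w) z) has_fps_expansion
      (fps_X - fps_const (pt (last w))) * fps_deriv (h_fps w)"
    by (intro fps_expansion_intros h_coeff_fps)
  note e = this
  have "eventually (\<lambda>z. z \<in> U1) (nhds 0)"
    by (intro eventually_nhds_in_open open_U1) auto
  hence ev: "\<forall>\<^sub>F z in nhds 0. (z - pt (last w)) * deriv (h_coeff w) z = h_coeff (butlast w) z"
    by eventually_elim (use deriv_h_coeff assms in blast)
  show "h_coeff (butlast w) has_fps_expansion (fps_X - fps_const (pt (last w))) * fps_deriv (h_fps w)"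
    using iffD1[OF has_fps_expansion_cong[OF ev refl] e] .
qed

lemma h_fps_snoc_X0:
  assumes "w \<noteq> []" "hd w = X1"
  shows "h_fps (w @ [X0]) $ l = h_fps w $ l / of_nat l"
proof (cases l)
  case (Suc n)
  have "fps_X * fps_deriv (h_fps (w @ [X0])) = h_fps w"
    using h_fps_rec[of "w @ [X0]"] assms by (simp add: pt_def)
  from arg_cong[OF this, of "\<lambda>F. F $ l"] Suc show ?thesis
    by (simp add: field_simps del: of_nat_Suc)
qed (simp add: h_fps_0)

lemma h_fps_snoc_X1:
  assumes "w = [] \<or> hd w = X1"
  shows "h_fps (w @ [X1]) $ l = - (\<Sum>j<l. h_fps w $ j) / of_nat l"
proof -
  define G where "G = h_fps (w @ [X1])"
  have r: "(fps_X - 1) * fps_deriv G = h_fps w"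
    using h_fps_rec[of "w @ [X1]"] assms by (cases "w = []") (auto simp: pt_def G_def)
  have "of_nat l * G $ l = - (\<Sum>j<l. h_fps w $ j)"
  proof (induction l)
    case (Suc l)
    have "of_nat l * G $ l - of_nat (Suc l) * G $ Suc l = h_fps w $ l"
      using arg_cong[OF r, of "\<lambda>F. F $ l"] by (cases l) (simp_all add: left_diff_distrib)
    thus ?case using Suc by (simp add: algebra_simps)
  qed simp
  thus ?thesis by (cases "l = 0") (auto simp: G_def h_fps_0 field_simps)
qed

lemma wpow_10_snoc: "wpow [X1, X0] (Suc m) = (wpow [X1, X0] m @ [X1]) @ [X0]"
  by (simp add: wpow_Suc2)

lemma hd_wpow_10: "wpow [X1, X0] m = [] \<or> hd (wpow [X1, X0] m) = X1"
  using wpow_10_props(3)[of m] by (cases m) auto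

lemma h_fps_A10_0: "h_fps (wpow [X1, X0] m @ [X1]) $ l = of_real ((-1) ^ Suc m * V m 0 l)"
proof (induction m arbitrary: l)
  case 0
  have "(\<Sum>j<l. (1 :: complex fps) $ j) = (if l = 0 then 0 else 1)"
  proof (cases l)
    case (Suc n)
    thus ?thesis by (simp add: sum.lessThan_Suc_shift del: sum.lessThan_Suc)
  qed simp
  thus ?case using h_fps_snoc_X1[of "[]" l] by (auto simp: h_fps_Nil)
next
  case (Suc m)
  have h: "hd (wpow [X1, X0] m @ [X1]) = X1" using hd_wpow_10[of m] by (auto simp: hd_append)
  have "h_fps (wpow [X1, X0] (Suc m)) $ j = of_real ((-1) ^ Suc m * (es m j / real j ^ 2))" for j
    unfolding wpow_10_snoc using h_fps_snoc_X0[OF _ h, of j] Suc[of j] by (simp add: power2_eq_square)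
  hence "h_fps (wpow [X1, X0] (Suc m) @ [X1]) $ l = - (\<Sum>j<l. of_real ((-1) ^ Suc m * (es m j / real j ^ 2))) / of_nat l"
    using h_fps_snoc_X1[of "wpow [X1, X0] (Suc m)"] hd_wpow_10[of "Suc m"] by auto
  also have "(\<Sum>j<l. of_real ((-1) ^ Suc m * (es m j / real j ^ 2))) = complex_of_real ((-1) ^ Suc m * es (Suc m) l)"
  proof -
    have "(\<Sum>j<l. es m j / real j ^ 2) = es (Suc m) l"
      by (simp, rule sum.mono_neutral_right) (auto simp: not_less)
    thus ?thesis by (simp only: of_real_sum[symmetric] sum_distrib_left[symmetric])
  qed
  finally show ?case by simp
qed

lemma h_fps_wpow: "h_fps (wpow [X1, X0] (Suc m)) $ l = of_real ((-1) ^ Suc m * (es m l / real l ^ 2))"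
proof -
  have h: "hd (wpow [X1, X0] m @ [X1]) = X1" using hd_wpow_10[of m] by (auto simp: hd_append)
  show ?thesis
    unfolding wpow_10_snoc using h_fps_snoc_X0[OF _ h, of l] h_fps_A10_0[of m l] by (simp add: power2_eq_square)
qed

lemma A10_Suc: "A10 m (Suc k) = (A10 m k @ [X1]) @ [X0]"
  by (simp add: A10_def wpow_Suc2)

lemma h_fps_A10: "h_fps (A10 m k) $ l = of_real ((-1) ^ (Suc m + k) * V m k l)"
proof (induction k arbitrary: l)
  case 0
  thus ?case using h_fps_A10_0[of m l] by (simp add: A10_def)
next
  case (Suc k)
  have n: "A10 m k \<noteq> []" by (simp add: A10_def)
  have "h_fps (A10 m k @ [X1]) $ l = - (\<Sum>j<l. of_real ((-1) ^ (Suc m + k) * V m k j)) / of_nat l" for l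
    using h_fps_snoc_X1[of "A10 m k" l] hd_A10 Suc by simp
  also have "\<dots> l = of_real ((-1) ^ (Suc m + Suc k) * (\<Sum>j<l. V m k j) / real l)" for l
  proof -
    have "(\<Sum>j<l. of_real ((-1) ^ (Suc m + k) * V m k j)) = complex_of_real ((-1) ^ (Suc m + k) * (\<Sum>j<l. V m k j))"
      by (simp only: of_real_sum sum_distrib_left)
    thus ?thesis by simp
  qed
  finally have "h_fps (A10 m k @ [X1]) $ l = of_real ((-1) ^ (Suc m + Suc k) * (\<Sum>j<l. V m k j) / real l)" for l .
  thus ?case
    unfolding A10_Suc using h_fps_snoc_X0[of "A10 m k @ [X1]" l] hd_A10[of m k] n by (simp add: power2_eq_square)
qed


text \<open>The exponential factor contributes only through a prefix of letters X0, and here that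
  prefix is empty.\<close>

lemma cf_L_ser_h_coeff: "w \<noteq> [] \<Longrightarrow> hd w = X1 \<Longrightarrow> cf (L_ser z) w = h_coeff w z"
proof -
  assume w: "w \<noteq> []" "hd w = X1"
  have "cf (L_ser z) w = (\<Sum>i\<in>{0}. cf (ex X0 (Ln z)) (take i w) * h_coeff (drop i w) z)"
    unfolding cf_L_ser
    by (rule sum.mono_neutral_right) (use w in \<open>auto simp: cf_ex neq_Nil_conv take_Cons' gr0_conv_Suc split: if_splits\<close>)
  thus ?thesis by simp
qed

lemma filterlim_of_real_slit: "filterlim complex_of_real (at 1 within slit_plane) (at_left 1)"
proof -
  have "eventually (\<lambda>x :: real. x \<in> {0<..<1}) (at_left 1)" by (rule eventually_at_left_real) simp
  hence "eventually (\<lambda>x. complex_of_real x \<in> slit_plane \<and> complex_of_real x \<noteq> 1) (at_left 1)"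
    by eventually_elim (auto simp: slit_iff)
  thus ?thesis unfolding filterlim_at by (auto intro!: tendsto_eq_intros)
qed

text \<open>Abel's limit theorem; with nonnegative coefficients the coefficients themselves serve as
  the dominating sequence.\<close>

lemma abel_nonneg:
  fixes a :: "nat \<Rightarrow> real"
  assumes "\<And>l. a l \<ge> 0" "a sums s"
  shows "((\<lambda>x. \<Sum>l. a l * x ^ l) \<longlongrightarrow> s) (at_left 1)"
proof -
  have ev: "eventually (\<lambda>x :: real. x \<in> {0<..<1}) (at_left 1)" by (rule eventually_at_left_real) simp
  have "((\<lambda>x. \<Sum>l. a l * x ^ l) \<longlongrightarrow> (\<Sum>l. a l * 1 ^ l)) (at_left 1)"
  proof (rule conjunct2[OF conjunct2[OF tannerys_theorem[where M = a]]])
    show "((\<lambda>x. a k * x ^ k) \<longlongrightarrow> a k * 1 ^ k) (at_left 1)" for k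
      by (intro tendsto_intros)
    show "\<forall>\<^sub>F (k, x) in at_top \<times>\<^sub>F at_left 1. norm (a k * x ^ k) \<le> a k"
      unfolding case_prod_beta
    proof (rule eventually_mono[OF eventually_prod_filter[THEN iffD2]])
      show "\<exists>P Q. eventually P (at_top :: nat filter) \<and> eventually Q (at_left (1 :: real)) \<and> (\<forall>x y. P x \<longrightarrow> Q y \<longrightarrow> snd (x, y) \<in> {0<..<1})"
        using ev by (intro exI[of _ "\<lambda>_. True"] exI[of _ "\<lambda>x. x \<in> {0<..<1}"]) auto
      fix p :: "nat \<times> real" assume "snd p \<in> {0<..<1}"
      hence "snd p ^ fst p \<le> 1" "snd p ^ fst p \<ge> 0" by (auto intro: power_le_one)
      thus "norm (a (fst p) * snd p ^ fst p) \<le> a (fst p)"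
        using assms(1)[of "fst p"] by (simp add: abs_mult mult_left_le)
    qed
  qed (use assms in \<open>auto simp: sums_iff trivial_limit_at_left_real\<close>)
  thus ?thesis using assms by (simp add: sums_iff)
qed

text \<open>A word ending in X0 has no logarithmic divergence at 1, so its coefficient in Z is a
  plain limit from the left, which Abel's theorem evaluates.\<close>

lemma Z_one_eqI:
  assumes w: "w \<noteq> []" "hd w = X1" "last w = X0"
    and F: "\<And>l. h_fps w $ l = of_real (s * a l)" and a: "\<And>l. a l \<ge> 0" "a sums v"
  shows "cf Z_one w = of_real (s * v)"
proof -
  have "drop i w \<noteq> replicate (length w - i) X1" if "i < length w" for i
  proof
    assume *: "drop i w = replicate (length w - i) X1"
    have "last (drop i w) = X0" using w that by (simp add: last_drop)
    thus False unfolding * using that by (simp add: last_replicate)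
  qed
  hence "((\<lambda>z. cf (L_ser z) w) \<longlongrightarrow> cf Z_one w) (at 1 within slit_plane)"
    using tendsto_L_ser_at_1[of w] by (simp cong: sum.cong_simp)
  from filterlim_compose[OF this filterlim_of_real_slit]
  have lim1: "((\<lambda>x. h_coeff w (complex_of_real x)) \<longlongrightarrow> cf Z_one w) (at_left 1)"
    using w by (simp add: cf_L_ser_h_coeff)
  have ev: "eventually (\<lambda>x :: real. x \<in> {0<..<1}) (at_left 1)" by (rule eventually_at_left_real) simp
  have "((\<lambda>x. complex_of_real (s * (\<Sum>l. a l * x ^ l))) \<longlongrightarrow> of_real (s * v)) (at_left 1)"
    by (intro tendsto_of_real tendsto_mult tendsto_const abel_nonneg a)
  moreover have "\<forall>\<^sub>F x in at_left 1. complex_of_real (s * (\<Sum>l. a l * x ^ l)) = h_coeff w (complex_of_real x)"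
    using ev
  proof eventually_elim
    case (elim x)
    have "summable (\<lambda>l. a l * x ^ l)"
    proof (rule summable_comparison_test'[of a 0])
      show "summable a" using a by (simp add: sums_iff)
      show "norm (a l * x ^ l) \<le> a l" for l
        using elim a(1)[of l] power_le_one[of x l] by (simp add: abs_mult mult_left_le)
    qed
    hence "(\<lambda>l. complex_of_real (s * (a l * x ^ l))) sums complex_of_real (s * (\<Sum>l. a l * x ^ l))"
      by (intro sums_of_real sums_mult summable_sums)
    moreover have "(\<lambda>l. h_fps w $ l * of_real x ^ l) sums h_coeff w (of_real x)"
      using elim by (intro h_coeff_eval) auto
    ultimately show ?case using sums_unique2 by (simp add: F mult.assoc)
  qed
  ultimately have "((\<lambda>x. h_coeff w (complex_of_real x)) \<longlongrightarrow> of_real (s * v)) (at_left 1)"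
    by (rule Lim_transform_eventually)
  from tendsto_unique[OF _ lim1 this] show ?thesis by simp
qed

lemma Z_one_wpow: "cf Z_one (wpow [X1, X0] n) = of_real ((-1) ^ n * tau n 0)"
proof (cases n)
  case (Suc m)
  have "(\<lambda>N. \<Sum>l<N. es m l / real l ^ 2) = es (Suc m)"
    by (rule ext, simp, rule sum.mono_neutral_right) (auto simp: not_less)
  hence "(\<lambda>l. es m l / real l ^ 2) sums tau (Suc m) 0"
    unfolding sums_def using es_tendsto[of "Suc m"] by simp
  thus ?thesis unfolding Suc
    using wpow_10_props(3,4)[of "Suc m"] h_fps_wpow[of m] es_nonneg
    by (intro Z_one_eqI[where a = "\<lambda>l. es m l / real l ^ 2"]) auto
qed simp

lemma Z_one_A10: "k > 0 \<Longrightarrow> cf Z_one (A10 m k) = of_real ((-1) ^ (Suc m + k) * etaI m k)"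
  using wpow_10_props(4)[of k]
  by (intro Z_one_eqI[where a = "V m k"] h_fps_A10 V_nonneg V_sums hd_A10) (auto simp: A10_def)

text \<open>The final X1 produces one divergent term, the coefficient of the prefix times Ln (1 -
  z). Subtracting the logarithm series termwise leaves the series summed by
  \<open>cI\<close>.\<close>

lemma Z_one_A10_0: "cf Z_one (A10 m 0) = of_real ((-1) ^ m * cI m)"
proof -
  define u where "u = wpow [X1, X0] m"
  define w where "w = A10 m 0"
  have w: "w = u @ [X1]" "w \<noteq> []" by (simp_all add: w_def A10_def u_def)
  have hd: "hd w = X1" unfolding w_def by (rule hd_A10)
  have u: "u = [] \<or> last u = X0" using wpow_10_props(4)[of m] by (cases m) (auto simp: u_def)
  have "cf Z_one (take i w) * (if drop i w = replicate (length w - i) X1 then Ln (1 - z) ^ (length w - i) / fact (length w - i) else 0)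
     = (if i = length u then cf Z_one u * Ln (1 - z) else 0)" if "i < length w" for i z
  proof (cases "i = length u")
    case False
    hence i: "i < length u" using that by (simp add: w)
    have "drop i w \<noteq> replicate (length w - i) X1"
    proof
      assume "drop i w = replicate (length w - i) X1"
      hence "drop i u @ [X1] = replicate (length u - i) X1 @ [X1]"
        using i by (simp add: w Suc_diff_le replicate_append_same)
      hence "drop i u = replicate (length u - i) X1" by simp
      moreover have "last (drop i u) = X0" using u i by (auto simp: last_drop)
      ultimately show False using i by (simp add: last_replicate)
    qed
    thus ?thesis using False by simp
  qed (simp add: w)
  hence "(\<Sum>i<length w. cf Z_one (take i w) * (if drop i w = replicate (length w - i) X1 then Ln (1 - z) ^ (length w - i) / fact (length w - i) else 0))
     = cf Z_one u * Ln (1 - z)" for z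
    by (simp cong: sum.cong_simp) (simp add: w)
  hence "((\<lambda>z. cf (L_ser z) w - cf Z_one u * Ln (1 - z)) \<longlongrightarrow> cf Z_one w) (at 1 within slit_plane)"
    using tendsto_L_ser_at_1[of w] by simp
  from filterlim_compose[OF this filterlim_of_real_slit]
  have lim1: "((\<lambda>x. h_coeff w (complex_of_real x) - cf Z_one u * Ln (1 - complex_of_real x)) \<longlongrightarrow> cf Z_one w) (at_left 1)"
    using w(2) hd by (simp add: cf_L_ser_h_coeff)
  define a where "a l = (tau m 0 - es m l) / real l" for l
  have a0: "a l \<ge> 0" for l using es_le[of m "l - 1"] by (cases l) (auto simp: a_def simp del: es.simps)
  have as: "a sums cI m"
    using es_defect_sums[of m] sums_Suc_iff[of a "cI m"] by (simp add: a_def cI_def del: es.simps of_nat_Suc)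
  have ev: "eventually (\<lambda>x :: real. x \<in> {0<..<1}) (at_left 1)" by (rule eventually_at_left_real) simp
  have "((\<lambda>x. complex_of_real ((-1) ^ m * (\<Sum>l. a l * x ^ l))) \<longlongrightarrow> of_real ((-1) ^ m * cI m)) (at_left 1)"
    by (intro tendsto_of_real tendsto_mult tendsto_const abel_nonneg a0 as)
  moreover have "\<forall>\<^sub>F x in at_left 1. complex_of_real ((-1) ^ m * (\<Sum>l. a l * x ^ l)) = h_coeff w (complex_of_real x) - cf Z_one u * Ln (1 - complex_of_real x)"
    using ev
  proof eventually_elim
    case (elim x)
    have "summable (\<lambda>l. a l * x ^ l)"
    proof (rule summable_comparison_test'[of a 0])
      show "summable a" using as by (simp add: sums_iff)
      show "norm (a l * x ^ l) \<le> a l" for l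
        using elim a0[of l] power_le_one[of x l] by (simp add: abs_mult mult_left_le)
    qed
    hence "(\<lambda>l. complex_of_real ((-1) ^ m * (a l * x ^ l))) sums complex_of_real ((-1) ^ m * (\<Sum>l. a l * x ^ l))"
      by (intro sums_of_real sums_mult summable_sums)
    moreover have "(\<lambda>l. h_fps w $ l * of_real x ^ l - cf Z_one u * (- (of_real x ^ l / of_nat l))) sums (h_coeff w (of_real x) - cf Z_one u * Ln (1 - of_real x))"
      using elim Ln_series'[of "- complex_of_real x"] by (intro sums_diff sums_mult h_coeff_eval) auto
    moreover have "h_fps w $ l * of_real x ^ l - cf Z_one u * (- (of_real x ^ l / of_nat l)) = complex_of_real ((-1) ^ m * (a l * x ^ l))" for l
      unfolding w_def h_fps_A10 u_def Z_one_wpow by (simp add: a_def algebra_simps diff_divide_distrib)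
    ultimately show ?case using sums_unique2 by simp
  qed
  ultimately have "((\<lambda>x. h_coeff w (complex_of_real x) - cf Z_one u * Ln (1 - complex_of_real x)) \<longlongrightarrow> of_real ((-1) ^ m * cI m)) (at_left 1)"
    by (rule Lim_transform_eventually)
  from tendsto_unique[OF _ lim1 this] show ?thesis unfolding w_def by simp
qed

text \<open>The word is a palindrome of odd length, so the antipode negates its coefficient, while
  \<open>sw\<close> carries it to \<open>A10 n 0\<close>; both maps send Z to its inverse.\<close>

lemma Z_one_pb: "cf Z_one (X0 # wpow [X1, X0] n) = - cf Z_one (A10 n 0)"
proof -
  define w where "w = X0 # wpow [X1, X0] n"
  have "map flip w = A10 n 0"
  proof -
    have "map flip (wpow [X1, X0] n) = wpow [X0, X1] n" by (induction n) (simp_all add: wpow_Suc)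
    thus ?thesis using wpow_shift[of X1 X0 n] by (simp add: w_def A10_def)
  qed
  moreover have "rev w = w" unfolding w_def by (simp add: rev_wpow wpow_shift)
  moreover have "odd (length w)" by (simp add: w_def)
  ultimately have "cf Z_one_inv w = - cf Z_one w" "cf (sw Z_one) w = cf Z_one (A10 n 0)"
    by (simp_all add: Z_one_inv_def)
  hence "- cf Z_one w = cf Z_one (A10 n 0)" by (simp only: Z_one_inv_eq_sw)
  thus ?thesis unfolding w_def by (metis minus_minus)
qed

unbundle no vec_syntax

text \<open>\<open>fps_sin (2 * t)\<close> is sin 2ut as a series in u; the index shift is the
  factor u that differentiation in t produces.\<close>

lemma DERIV_fps_sin_cos:
  "((\<lambda>t :: real. fps_sin (2 * t) $ Suc n) has_real_derivative 2 * fps_cos (2 * x) $ n) (at x within S)"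
  "((\<lambda>t :: real. fps_cos (2 * t) $ Suc n) has_real_derivative - 2 * fps_sin (2 * x) $ n) (at x within S)"
proof -
  note D = DERIV_double_power[of n x S]
  have "((\<lambda>t. (-1) ^ (n div 2) * ((2 * t) ^ Suc n / fact (Suc n))) has_real_derivative
     (-1) ^ (n div 2) * (2 * ((2 * x) ^ n / fact n))) (at x within S)"
    by (rule DERIV_cmult[OF D])
  thus "((\<lambda>t :: real. fps_sin (2 * t) $ Suc n) has_real_derivative 2 * fps_cos (2 * x) $ n) (at x within S)"
    by (cases "even n") (simp_all add: fps_sin_def fps_cos_def mult_ac del: fact_Suc)
  have "((\<lambda>t. (-1) ^ (Suc n div 2) * ((2 * t) ^ Suc n / fact (Suc n))) has_real_derivative
     (-1) ^ (Suc n div 2) * (2 * ((2 * x) ^ n / fact n))) (at x within S)"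
    by (rule DERIV_cmult[OF D])
  thus "((\<lambda>t :: real. fps_cos (2 * t) $ Suc n) has_real_derivative - 2 * fps_sin (2 * x) $ n) (at x within S)"
    by (cases "even n") (auto simp: fps_sin_def fps_cos_def mult_ac simp del: fact_Suc elim!: oddE)
qed

lemma continuous_fps_sin_cos [continuous_intros]:
  "continuous_on S (\<lambda>t :: real. fps_sin (2 * t) $ n)" "continuous_on S (\<lambda>t :: real. fps_cos (2 * t) $ n)"
  by (cases "even n"; simp add: fps_sin_def fps_cos_def; intro continuous_intros; simp)+

section \<open>Integrals against the cotangent\<close>

definition sI :: "nat \<Rightarrow> (real \<Rightarrow> real) \<Rightarrow> real" where
  "sI k f = integral {0..pi/2} (\<lambda>t. 2 * sin (2 * real k * t) * f t)"

lemma sI_has_integral: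
  "continuous_on {0..pi/2} f \<Longrightarrow> ((\<lambda>t. 2 * sin (2 * real k * t) * f t) has_integral sI k f) {0..pi/2}"
  unfolding sI_def by (intro integrable_integral integrable_continuous_real continuous_intros)

text \<open>The expansion of k / (k^2 - u^2) in powers of u; division by zero makes it 0 for
  \<open>k = 0\<close>.\<close>

definition Ak :: "nat \<Rightarrow> real fps" where "Ak k = Abs_fps (\<lambda>n. if even n then 1 / real k ^ Suc n else 0)"

lemma sin_cos_at_pi2: "sin (2 * real k * (pi / 2)) = 0" "cos (2 * real k * (pi / 2)) = (-1) ^ k"
  by (simp_all add: mult.commute)

text \<open>The hypothesis says that k^2 - u^2 times the unknown series is k F, and that factor can
  be cancelled.\<close>

lemma fps_k2_cancel:
  assumes "k > 0" "\<And>n. real k ^ 2 * a n - (if n \<ge> 2 then a (n - 2) else 0) = real k * F $ n"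
  shows "Abs_fps a = Ak k * F"
proof -
  define P where "P = fps_const (real k ^ 2) - fps_X ^ 2"
  have "P $ 0 \<noteq> 0" using assms(1) by (simp add: P_def)
  hence P: "P \<noteq> 0" by auto
  have nth: "(P * G) $ n = real k ^ 2 * G $ n - (if n \<ge> 2 then G $ (n - 2) else 0)" for G n
    by (simp add: P_def left_diff_distrib fps_X_power_mult_nth)
  have "P * Ak k = fps_const (real k)"
  proof (rule fps_ext)
    fix n
    show "(P * Ak k) $ n = fps_const (real k) $ n"
    proof (cases "n < 2")
      case True
      hence "n = 0 \<or> n = 1" by auto
      thus ?thesis using assms(1) by (auto simp: nth Ak_def power2_eq_square)
    next
      case False
      then obtain m where "n = m + 2" by (metis add.commute le_Suc_ex not_less)
      thus ?thesis using assms(1) by (simp add: nth Ak_def power2_eq_square)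
    qed
  qed
  hence "P * (Ak k * F) = fps_const (real k) * F" by (simp flip: mult.assoc)
  also have "\<dots> = P * Abs_fps a"
    by (rule fps_ext) (simp add: nth flip: assms(2))
  finally show ?thesis using P by simp
qed

text \<open>The integral of 2 sin 2kt sin 2ut over [0, pi/2] is (-1)^(k+1) k sin(pi u) / (k^2 -
  u^2); coefficientwise it comes from two integrations by parts.\<close>

lemma sI_sin:
  assumes "k > 0"
  shows "Abs_fps (\<lambda>n. sI k (\<lambda>t. fps_sin (2 * t) $ n)) = Ak k * (fps_const ((-1) ^ Suc k) * fps_sin pi)"
proof (rule fps_k2_cancel[OF assms])
  fix n
  \<comment> \<open>\<open>c\<close> and \<open>s'\<close> are the cosine and sine series multiplied
    by u and u^2, the factors left by one and two differentiations.\<close>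
  define c where "c n t = (case n of 0 \<Rightarrow> 0 | Suc n' \<Rightarrow> fps_cos (2 * t :: real) $ n')" for n t
  define s' where "s' n t = (case n of 0 \<Rightarrow> 0 | Suc 0 \<Rightarrow> 0 | Suc (Suc n') \<Rightarrow> fps_sin (2 * t :: real) $ n')" for n t
  define F where "F t = sin (2 * real k * t) * c n t - real k * (cos (2 * real k * t) * fps_sin (2 * t) $ n)" for t
  have ds: "((\<lambda>t. fps_sin (2 * t) $ n) has_real_derivative 2 * c n x) (at x within S)" for x S
    using DERIV_fps_sin_cos(1)[of "n - 1" x S] by (cases n) (auto simp: c_def fps_sin_def)
  have dc: "((\<lambda>t. c n t) has_real_derivative - 2 * s' n x) (at x within S)" for x S
    using DERIV_fps_sin_cos(2)[of "n - 2" x S]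
    by (cases n; cases "n - 1") (auto simp: c_def s'_def fps_cos_def)
  have "((\<lambda>t. real k ^ 2 * (2 * sin (2 * real k * t) * fps_sin (2 * t) $ n) - 2 * sin (2 * real k * t) * s' n t)
     has_integral F (pi/2) - F 0) {0..pi/2}"
  proof (rule fundamental_theorem_of_calculus)
    fix x
    have "(F has_real_derivative real k ^ 2 * (2 * sin (2 * real k * x) * fps_sin (2 * x) $ n) - 2 * sin (2 * real k * x) * s' n x) (at x within {0..pi/2})"
      unfolding F_def by (rule derivative_eq_intros ds dc refl | simp add: algebra_simps power2_eq_square)+
    thus "(F has_vector_derivative real k ^ 2 * (2 * sin (2 * real k * x) * fps_sin (2 * x) $ n) - 2 * sin (2 * real k * x) * s' n x) (at x within {0..pi/2})"
      by (simp add: has_real_derivative_iff_has_vector_derivative)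
  qed auto
  moreover have "((\<lambda>t. real k ^ 2 * (2 * sin (2 * real k * t) * fps_sin (2 * t) $ n) - 2 * sin (2 * real k * t) * s' n t)
     has_integral real k ^ 2 * sI k (\<lambda>t. fps_sin (2 * t) $ n) - sI k (s' n)) {0..pi/2}"
    by (intro has_integral_diff has_integral_mult_right sI_has_integral continuous_fps_sin_cos)
       (cases n; cases "n - 1"; auto simp: s'_def[abs_def] intro!: continuous_intros)
  ultimately have e: "real k ^ 2 * sI k (\<lambda>t. fps_sin (2 * t) $ n) - sI k (s' n) = F (pi/2) - F 0"
    by (rule has_integral_unique[rotated])
  have "F (pi/2) - F 0 = real k * (fps_const ((-1) ^ Suc k) * fps_sin pi) $ n"
    unfolding F_def sin_cos_at_pi2 by (auto simp: fps_sin_def dest: odd_pos)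
  moreover have "sI k (s' n) = (if n \<ge> 2 then sI k (\<lambda>t. fps_sin (2 * t) $ (n - 2)) else 0)"
    by (cases n; cases "n - 1") (auto simp: s'_def[abs_def] sI_def)
  ultimately show "real k ^ 2 * sI k (\<lambda>t. fps_sin (2 * t) $ n) - (if n \<ge> 2 then sI k (\<lambda>t. fps_sin (2 * t) $ (n - 2)) else 0)
     = real k * (fps_const ((-1) ^ Suc k) * fps_sin pi) $ n"
    using e by simp
qed

text \<open>Unlike for the sine, the endpoint 0 contributes: this is the summand 1, and the origin
  of the non-alternating series \<open>Phi\<close>.\<close>

lemma sI_cos:
  assumes "k > 0"
  shows "Abs_fps (\<lambda>n. sI k (\<lambda>t. fps_cos (2 * t) $ n)) = Ak k * (1 + fps_const ((-1) ^ Suc k) * fps_cos pi)"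
proof (rule fps_k2_cancel[OF assms])
  fix n
  define s where "s n t = (case n of 0 \<Rightarrow> 0 | Suc n' \<Rightarrow> fps_sin (2 * t :: real) $ n')" for n t
  define c' where "c' n t = (case n of 0 \<Rightarrow> 0 | Suc 0 \<Rightarrow> 0 | Suc (Suc n') \<Rightarrow> fps_cos (2 * t :: real) $ n')" for n t
  define F where "F t = - (sin (2 * real k * t) * s n t) - real k * (cos (2 * real k * t) * fps_cos (2 * t) $ n)" for t
  have dc: "((\<lambda>t. fps_cos (2 * t) $ n) has_real_derivative - 2 * s n x) (at x within S)" for x S
    using DERIV_fps_sin_cos(2)[of "n - 1" x S] by (cases n) (auto simp: s_def fps_cos_def)
  have ds: "((\<lambda>t. s n t) has_real_derivative 2 * c' n x) (at x within S)" for x S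
    using DERIV_fps_sin_cos(1)[of "n - 2" x S]
    by (cases n; cases "n - 1") (auto simp: s_def c'_def fps_sin_def)
  have "((\<lambda>t. real k ^ 2 * (2 * sin (2 * real k * t) * fps_cos (2 * t) $ n) - 2 * sin (2 * real k * t) * c' n t)
     has_integral F (pi/2) - F 0) {0..pi/2}"
  proof (rule fundamental_theorem_of_calculus)
    fix x
    have "(F has_real_derivative real k ^ 2 * (2 * sin (2 * real k * x) * fps_cos (2 * x) $ n) - 2 * sin (2 * real k * x) * c' n x) (at x within {0..pi/2})"
      unfolding F_def by (rule derivative_eq_intros ds dc refl | simp add: algebra_simps power2_eq_square)+
    thus "(F has_vector_derivative real k ^ 2 * (2 * sin (2 * real k * x) * fps_cos (2 * x) $ n) - 2 * sin (2 * real k * x) * c' n x) (at x within {0..pi/2})"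
      by (simp add: has_real_derivative_iff_has_vector_derivative)
  qed auto
  moreover have "((\<lambda>t. real k ^ 2 * (2 * sin (2 * real k * t) * fps_cos (2 * t) $ n) - 2 * sin (2 * real k * t) * c' n t)
     has_integral real k ^ 2 * sI k (\<lambda>t. fps_cos (2 * t) $ n) - sI k (c' n)) {0..pi/2}"
    by (intro has_integral_diff has_integral_mult_right sI_has_integral continuous_fps_sin_cos)
       (cases n; cases "n - 1"; auto simp: c'_def[abs_def] intro!: continuous_intros)
  ultimately have e: "real k ^ 2 * sI k (\<lambda>t. fps_cos (2 * t) $ n) - sI k (c' n) = F (pi/2) - F 0"
    by (rule has_integral_unique[rotated])
  have "s n 0 = 0" by (cases n) (auto simp: s_def fps_sin_def intro: odd_pos)
  hence "F (pi/2) - F 0 = real k * (1 + fps_const ((-1) ^ Suc k) * fps_cos pi) $ n"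
    unfolding F_def sin_cos_at_pi2 by (cases "n = 0") (auto simp: fps_cos_def algebra_simps)
  moreover have "sI k (c' n) = (if n \<ge> 2 then sI k (\<lambda>t. fps_cos (2 * t) $ (n - 2)) else 0)"
    by (cases n; cases "n - 1") (auto simp: c'_def[abs_def] sI_def)
  ultimately show "real k ^ 2 * sI k (\<lambda>t. fps_cos (2 * t) $ n) - (if n \<ge> 2 then sI k (\<lambda>t. fps_cos (2 * t) $ (n - 2)) else 0)
     = real k * (1 + fps_const ((-1) ^ Suc k) * fps_cos pi) $ n"
    using e by simp
qed

text \<open>This Poisson-type kernel increases to \<open>cot t\<close> as \<open>r\<close> tends to 1.\<close>

definition ker :: "real \<Rightarrow> real \<Rightarrow> real" where
  "ker r t = 2 * r * sin (2 * t) / (1 - 2 * r * cos (2 * t) + r ^ 2)"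

text \<open>In this form the denominator is visibly at least 4 r sin^2 t, which bounds the kernel by
  cot t.\<close>

lemma ker_denom: fixes r t :: real shows "1 - 2 * r * cos (2 * t) + r ^ 2 = (1 - r) ^ 2 + 4 * r * sin t ^ 2"
  unfolding cos_double_sin[of t] by (simp add: power2_eq_square algebra_simps)

text \<open>The kernel is twice the imaginary part of the geometric series in r exp(2it).\<close>

lemma ker_sums:
  assumes "0 \<le> r" "r < 1"
  shows "(\<lambda>k. r ^ k * (2 * sin (2 * real k * t))) sums ker r t"
proof -
  define z where "z = of_real r * cis (2 * t)"
  have z: "norm z < 1" using assms by (simp add: z_def norm_mult)
  have zk: "z ^ k = of_real (r ^ k) * cis (2 * real k * t)" for k
    by (simp add: z_def power_mult_distrib Complex.DeMoivre mult_ac)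
  have "(\<lambda>k. 2 * Im (z ^ k)) sums (2 * Im (1 / (1 - z)))"
    by (intro sums_mult sums_Im geometric_sums z)
  moreover have "2 * Im (1 / (1 - z)) = ker r t"
  proof -
    have D: "(1 - r * cos (2 * t)) ^ 2 + (r * sin (2 * t)) ^ 2 = 1 - 2 * r * cos (2 * t) + r ^ 2"
      using sin_cos_squared_add[of "2 * t"] by algebra
    have "Im (1 / (1 - z)) = r * sin (2 * t) / ((1 - r * cos (2 * t)) ^ 2 + (r * sin (2 * t)) ^ 2)"
      by (simp add: Im_divide z_def)
    thus ?thesis unfolding D by (simp add: ker_def)
  qed
  ultimately show ?thesis by (simp add: zk mult_ac)
qed

lemma ker_bounds:
  assumes "0 < r" "r < 1" "0 \<le> t" "t \<le> pi / 2"
  shows "0 \<le> ker r t \<and> ker r t * t \<le> 1"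
proof (cases "t = 0")
  case False
  hence s: "sin t > 0" "cos t \<ge> 0" using assms by (auto intro!: sin_gt_zero cos_ge_zero)
  have d: "4 * r * sin t ^ 2 > 0" using s assms by simp
  have n: "2 * r * sin (2 * t) \<ge> 0" using s assms by (simp add: sin_double)
  have "ker r t \<le> 2 * r * sin (2 * t) / (4 * r * sin t ^ 2)"
    unfolding ker_def ker_denom using n d by (intro divide_left_mono) (use assms in \<open>auto intro!: mult_pos_pos add_nonneg_pos\<close>)
  also have "\<dots> = cot t" using s assms by (simp add: sin_double cot_def power2_eq_square)
  finally have "ker r t * t \<le> cot t * t" using assms by (intro mult_right_mono)
  moreover have "ker r t \<ge> 0" unfolding ker_def ker_denom using n d by (intro divide_nonneg_nonneg) auto
  moreover have "cot t * t \<le> 1" using cot_t_le[of t] False assms by auto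
  ultimately show ?thesis by linarith
qed (simp add: ker_def)

lemma continuous_ker:
  assumes "0 < r" "r < 1" shows "continuous_on {0..pi/2} (ker r)"
proof -
  have "1 - 2 * r * cos (2 * t) + r ^ 2 \<noteq> 0" for t
  proof -
    have "(1 - r) ^ 2 > 0" "4 * r * sin t ^ 2 \<ge> 0" using assms by auto
    thus ?thesis unfolding ker_denom by linarith
  qed
  thus ?thesis unfolding ker_def[abs_def] by (intro continuous_intros) auto
qed

lemma tendsto_ker: "((\<lambda>r. ker r t) \<longlongrightarrow> cot t) (at_left 1)" if "0 \<le> t" "t \<le> pi / 2"
proof (cases "t = 0")
  case False
  hence s: "sin t > 0" using that by (auto intro!: sin_gt_zero)
  have "((\<lambda>r. 2 * r * sin (2 * t) / ((1 - r) ^ 2 + 4 * r * sin t ^ 2)) \<longlongrightarrow>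
     2 * 1 * sin (2 * t) / ((1 - 1) ^ 2 + 4 * 1 * sin t ^ 2)) (at_left 1)"
    by (intro tendsto_intros) (use s in auto)
  also have "2 * 1 * sin (2 * t) / ((1 - 1) ^ 2 + 4 * 1 * sin t ^ 2) = cot t"
    using s by (simp add: sin_double cot_def power2_eq_square)
  finally show ?thesis unfolding ker_def ker_denom .
qed (simp add: ker_def cot_def)

text \<open>Continuous functions vanishing at least linearly at 0, so that their product with cot t
  is bounded.\<close>

definition gd :: "(real \<Rightarrow> real) \<Rightarrow> bool" where
  "gd f \<longleftrightarrow> continuous_on {0..pi/2} f \<and> (\<exists>M. \<forall>t\<in>{0..pi/2}. \<bar>f t\<bar> \<le> M * t)"
definition cint :: "(real \<Rightarrow> real) \<Rightarrow> real" where
  "cint f = integral {0..pi/2} (\<lambda>t. cot t * f t)"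
text \<open>A sequence tending to 1 from below, since dominated convergence is applied to sequences
  of functions.\<close>

definition rj :: "nat \<Rightarrow> real" where "rj j = 1 - 1 / real (j + 2)"

lemma rj: "0 < rj j" "rj j < 1" "filterlim rj (at_left 1) sequentially"
proof -
  show r: "0 < rj j" "rj j < 1" for j by (simp_all add: rj_def field_simps)
  have "(\<lambda>j. 1 - 1 / real (j + 2)) \<longlonglongrightarrow> 1 - 0"
    by (intro tendsto_diff tendsto_const LIMSEQ_ignore_initial_segment[OF lim_1_over_n])
  hence "rj \<longlonglongrightarrow> 1" by (simp add: rj_def[abs_def])
  thus "filterlim rj (at_left 1) sequentially"
    unfolding filterlim_at using r by (auto intro!: always_eventually simp: less_imp_neq)
qed

text \<open>Two dominated convergences: for fixed r the sine series of the kernel is integrated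
  termwise, then r tends to 1. The damping is needed because the sine series of cot does not
  converge by itself.\<close>

lemma gd_cint:
  assumes "gd f"
  shows "(\<lambda>t. cot t * f t) integrable_on {0..pi/2}"
    and "(\<lambda>j. \<Sum>k. rj j ^ k * sI k f) \<longlonglongrightarrow> cint f"
    and "summable (\<lambda>k. rj j ^ k * sI k f)"
proof -
  obtain M where f: "continuous_on {0..pi/2} f" and M: "\<And>t. t \<in> {0..pi/2} \<Longrightarrow> \<bar>f t\<bar> \<le> M * t"
    using assms unfolding gd_def by blast
  have M0: "\<bar>f t\<bar> \<le> \<bar>M\<bar> * t" if "t \<in> {0..pi/2}" for t
    using M[OF that] that abs_ge_self[of M] by (meson atLeastAtMost_iff mult_right_mono order_trans)
  have a: "(\<lambda>t. ker (rj j) t * f t) integrable_on {0..pi/2}" for j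
    by (intro integrable_continuous_real continuous_intros continuous_ker rj f)
  have b: "norm (ker (rj j) t * f t) \<le> \<bar>M\<bar>" if "t \<in> {0..pi/2}" for j t
  proof -
    have "norm (ker (rj j) t * f t) \<le> ker (rj j) t * (\<bar>M\<bar> * t)"
      using ker_bounds[of "rj j" t] rj that M0[OF that] by (auto simp: abs_mult intro!: mult_left_mono)
    also have "\<dots> = \<bar>M\<bar> * (ker (rj j) t * t)" by simp
    also have "\<dots> \<le> \<bar>M\<bar> * 1" using ker_bounds[of "rj j" t] rj that by (intro mult_left_mono) auto
    finally show ?thesis by simp
  qed
  have c: "(\<lambda>j. ker (rj j) t * f t) \<longlonglongrightarrow> cot t * f t" if "t \<in> {0..pi/2}" for t
    by (intro tendsto_mult tendsto_const filterlim_compose[OF tendsto_ker rj(3)]) (use that in auto)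
  have d: "(\<lambda>_. \<bar>M\<bar>) integrable_on {0..pi/2}" by auto
  note dc = dominated_convergence[OF a d b c]
  show "(\<lambda>t. cot t * f t) integrable_on {0..pi/2}" using dc by blast
  have S: "(\<lambda>k. rj j ^ k * sI k f) sums integral {0..pi/2} (\<lambda>t. ker (rj j) t * f t)" for j
  proof -
    define r where "r = rj j"
    have r: "0 < r" "r < 1" by (simp_all add: r_def rj)
    define modB where "modB = 1 / (1 - r) * (2 * (\<bar>M\<bar> * (pi / 2)))"
    have pI: "((\<lambda>t. \<Sum>k<n. r ^ k * (2 * sin (2 * real k * t) * f t)) has_integral (\<Sum>k<n. r ^ k * sI k f)) {0..pi/2}" for n
      by (intro has_integral_sum has_integral_mult_right sI_has_integral f) auto
    have A: "(\<lambda>t. \<Sum>k<n. r ^ k * (2 * sin (2 * real k * t) * f t)) integrable_on {0..pi/2}" for n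
      using pI by blast
    have C: "norm (\<Sum>k<n. r ^ k * (2 * sin (2 * real k * t) * f t)) \<le> modB" if t: "t \<in> {0..pi/2}" for n t
    proof -
      have "\<bar>f t\<bar> \<le> \<bar>M\<bar> * (pi / 2)"
        using M0[OF t] t mult_left_mono[of t "pi / 2" "\<bar>M\<bar>"] by auto
      hence ft: "norm (r ^ k * (2 * sin (2 * real k * t) * f t)) \<le> r ^ k * (2 * 1 * (\<bar>M\<bar> * (pi / 2)))" for k
        using r by (simp only: real_norm_def abs_mult power_abs) (intro mult_mono, auto)
      have "norm (\<Sum>k<n. r ^ k * (2 * sin (2 * real k * t) * f t)) \<le> (\<Sum>k<n. r ^ k * (2 * 1 * (\<bar>M\<bar> * (pi / 2))))"
        by (intro sum_norm_le ft)
      also have "\<dots> = (\<Sum>k<n. r ^ k) * (2 * (\<bar>M\<bar> * (pi / 2)))" by (simp add: sum_distrib_right)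
      also have "(\<Sum>k<n. r ^ k) \<le> 1 / (1 - r)"
        using r sum_le_suminf[of "\<lambda>k. r ^ k" "{..<n}"] suminf_geometric[of r] by (simp add: summable_geometric)
      hence "(\<Sum>k<n. r ^ k) * (2 * (\<bar>M\<bar> * (pi / 2))) \<le> modB"
        unfolding modB_def by (intro mult_right_mono) auto
      finally show ?thesis .
    qed
    have D: "(\<lambda>n. \<Sum>k<n. r ^ k * (2 * sin (2 * real k * t) * f t)) \<longlonglongrightarrow> ker r t * f t" for t
      using sums_mult2[OF ker_sums[of r t], of "f t"] r by (simp add: sums_def mult.assoc)
    have E: "(\<lambda>_. modB) integrable_on {0..pi/2}" by auto
    have "(\<lambda>n. integral {0..pi/2} (\<lambda>t. \<Sum>k<n. r ^ k * (2 * sin (2 * real k * t) * f t))) \<longlonglongrightarrow> integral {0..pi/2} (\<lambda>t. ker r t * f t)"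
      using dominated_convergence[OF A E C D] by blast
    moreover have "integral {0..pi/2} (\<lambda>t. \<Sum>k<n. r ^ k * (2 * sin (2 * real k * t) * f t)) = (\<Sum>k<n. r ^ k * sI k f)" for n
      using pI by (rule integral_unique)
    ultimately show ?thesis by (simp add: sums_def r_def)
  qed
  show "summable (\<lambda>k. rj j ^ k * sI k f)" using S by (rule sums_summable)
  have "(\<Sum>k. rj j ^ k * sI k f) = integral {0..pi/2} (\<lambda>t. ker (rj j) t * f t)" for j
    using S by (rule sums_unique[symmetric])
  thus "(\<lambda>j. \<Sum>k. rj j ^ k * sI k f) \<longlonglongrightarrow> cint f"
    using dc by (simp add: cint_def)
qed


lemma zeta_sums: "s \<ge> 2 \<Longrightarrow> (\<lambda>k. 1 / real k ^ s) sums zeta s"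
proof -
  assume s: "s \<ge> 2"
  have "summable (\<lambda>k. 1 / real k ^ s)"
    using inverse_power_summable[OF s, where ?'a = real] by (simp add: divide_inverse power_inverse)
  hence "(\<lambda>k. 1 / real (Suc k) ^ s) sums zeta s"
    unfolding zeta_def by (intro summable_sums) (subst summable_Suc_iff)
  thus ?thesis using s sums_Suc_iff[of "\<lambda>k. 1 / real k ^ s" "zeta s"] by (simp add: zero_power)
qed

text \<open>The alternating sum is the full sum minus twice its even part, and the even part is
  2^(-s) times the full sum.\<close>

lemma alternating_zeta_sums:
  assumes "s \<ge> 2"
  shows "(\<lambda>k. (-1) ^ Suc k / real k ^ s) sums ((1 - 1 / 2 ^ (s - 1)) * zeta s)"
proof -
  define g where "g k = (if even k then 1 / real k ^ s else 0)" for k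
  have "(\<lambda>k. 1 / 2 ^ s * (1 / real k ^ s)) sums (1 / 2 ^ s * zeta s)"
    by (intro sums_mult zeta_sums assms)
  hence "(\<lambda>k. g (2 * k)) sums (1 / 2 ^ s * zeta s)" by (simp add: g_def power_mult_distrib)
  hence "g sums (1 / 2 ^ s * zeta s)"
    by (subst (asm) sums_mono_reindex) (auto simp: strict_mono_def g_def elim!: evenE)
  from sums_diff[OF zeta_sums[OF assms] sums_mult[OF this, of 2]]
  have "(\<lambda>k. 1 / real k ^ s - 2 * g k) sums (zeta s - 2 * (1 / 2 ^ s * zeta s))" .
  moreover have "1 / real k ^ s - 2 * g k = (-1) ^ Suc k / real k ^ s" for k by (simp add: g_def)
  moreover have "zeta s - 2 * (1 / 2 ^ s * zeta s) = (1 - 1 / 2 ^ (s - 1)) * zeta s"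
    using assms by (cases s) (auto simp: field_simps)
  ultimately show ?thesis by simp
qed

text \<open>The coefficients of Lambda(u), the sum over k of (-1)^(k+1) k / (k^2 - u^2): alternating
  zeta values at the odd arguments i + 1.\<close>

definition lam :: "nat \<Rightarrow> real" where
  "lam i = (if i = 0 then ln 2 else if even i then (1 - 1 / 2 ^ i) * zeta (Suc i) else 0)"

lemma tannery_rj:
  assumes "\<And>k. \<bar>b k\<bar> \<le> M k" "summable M" "b sums s"
  shows "(\<lambda>j. \<Sum>k. rj j ^ k * b k) \<longlonglongrightarrow> s" "summable (\<lambda>k. rj j ^ k * b k)"
proof -
  have le: "norm (rj j ^ k * b k) \<le> M k" for j k
  proof -
    have "rj j ^ k * \<bar>b k\<bar> \<le> 1 * \<bar>b k\<bar>"
      using rj(1,2)[of j] by (intro mult_right_mono power_le_one) auto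
    thus ?thesis using assms(1)[of k] rj(1)[of j] by (simp add: abs_mult)
  qed
  show "summable (\<lambda>k. rj j ^ k * b k)"
    by (rule summable_comparison_test'[OF assms(2), of 0]) (rule le)
  have "(\<lambda>j. \<Sum>k. rj j ^ k * b k) \<longlonglongrightarrow> (\<Sum>k. 1 ^ k * b k)"
  proof (rule conjunct2[OF conjunct2[OF tannerys_theorem[where M = M]]])
    have "rj \<longlonglongrightarrow> 1" using rj(3) by (simp add: filterlim_at)
    thus "(\<lambda>j. rj j ^ k * b k) \<longlonglongrightarrow> 1 ^ k * b k" for k by (intro tendsto_intros)
    show "\<forall>\<^sub>F (k, j) in at_top \<times>\<^sub>F sequentially. norm (rj j ^ k * b k) \<le> M k"
      using le by (intro always_eventually) auto
  qed (use assms in auto)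
  thus "(\<lambda>j. \<Sum>k. rj j ^ k * b k) \<longlonglongrightarrow> s" using assms(3) by (simp add: sums_iff)
qed

text \<open>At i = 0 the undamped series converges only conditionally, and the logarithm series at r
  is used; for even i >= 2 convergence is absolute.\<close>

lemma Ak_lim:
  "(\<lambda>j. \<Sum>k. rj j ^ k * ((-1) ^ Suc k * Ak k $ i)) \<longlonglongrightarrow> lam i"
  "summable (\<lambda>k. rj j ^ k * ((-1) ^ Suc k * Ak k $ i))"
proof -
  have "(\<lambda>j. \<Sum>k. rj j ^ k * ((-1) ^ Suc k * Ak k $ i)) \<longlonglongrightarrow> lam i \<and>
    summable (\<lambda>k. rj j ^ k * ((-1) ^ Suc k * Ak k $ i))"
  proof (cases "i = 0")
    case True
    have "(\<lambda>k. rj j ^ k * ((-1) ^ Suc k * Ak k $ i)) sums ln (1 + rj j)" for j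
    proof -
      have "(\<lambda>k. - ((- rj j) ^ k) / real k) sums ln (1 + rj j)"
        using rj(1,2)[of j] by (intro ln_series') auto
      moreover have "- ((- rj j) ^ k) / real k = rj j ^ k * ((-1) ^ Suc k * Ak k $ i)" for k
        using True by (simp add: Ak_def power_minus[of "rj j"])
      ultimately show ?thesis by simp
    qed
    moreover have "(\<lambda>j. ln (1 + rj j)) \<longlonglongrightarrow> ln (1 + 1)"
      using rj(3) by (intro tendsto_intros) (auto simp: filterlim_at)
    ultimately show ?thesis using True by (simp add: sums_iff lam_def)
  next
    case False
    show ?thesis
    proof (cases "even i")
      case True
      have "Suc i \<ge> 2" using False by simp
      from tannery_rj[OF _ sums_summable[OF zeta_sums[OF this]] alternating_zeta_sums[OF this]]
      show ?thesis using True False by (simp add: lam_def Ak_def abs_mult power_abs)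
    qed (use False in \<open>simp add: lam_def Ak_def\<close>)
  qed
  thus "(\<lambda>j. \<Sum>k. rj j ^ k * ((-1) ^ Suc k * Ak k $ i)) \<longlonglongrightarrow> lam i"
    "summable (\<lambda>k. rj j ^ k * ((-1) ^ Suc k * Ak k $ i))" by blast+
qed

lemma Ak_mult_lim:
  "(\<lambda>j. \<Sum>k. rj j ^ k * (Ak k * (fps_const ((-1) ^ Suc k) * F)) $ n) \<longlonglongrightarrow> (Abs_fps lam * F) $ n"
  "summable (\<lambda>k. rj j ^ k * (Ak k * (fps_const ((-1) ^ Suc k) * F)) $ n)"
proof -
  have e: "rj j ^ k * (Ak k * (fps_const ((-1) ^ Suc k) * F)) $ n =
     (\<Sum>i=0..n. F $ (n - i) * (rj j ^ k * ((-1) ^ Suc k * Ak k $ i)))" for j k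
  proof -
    have A: "Ak k * (fps_const ((-1) ^ Suc k) * F) = fps_const ((-1) ^ Suc k) * (Ak k * F)"
      by (rule mult.left_commute)
    show ?thesis
      unfolding A fps_mult_left_const_nth[of _ "Ak k * F"] fps_mult_nth[of "Ak k"] sum_distrib_left
      by (intro sum.cong refl) (simp add: mult_ac)
  qed
  show "summable (\<lambda>k. rj j ^ k * (Ak k * (fps_const ((-1) ^ Suc k) * F)) $ n)"
    unfolding e by (intro summable_sum summable_mult Ak_lim)
  have "(\<Sum>k. rj j ^ k * (Ak k * (fps_const ((-1) ^ Suc k) * F)) $ n) =
     (\<Sum>i=0..n. F $ (n - i) * (\<Sum>k. rj j ^ k * ((-1) ^ Suc k * Ak k $ i)))" for j
  proof -
    have "(\<Sum>k. \<Sum>i=0..n. F $ (n - i) * (rj j ^ k * ((-1) ^ Suc k * Ak k $ i))) =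
       (\<Sum>i=0..n. \<Sum>k. F $ (n - i) * (rj j ^ k * ((-1) ^ Suc k * Ak k $ i)))"
      by (rule suminf_sum) (intro summable_mult Ak_lim)
    also have "\<dots> = (\<Sum>i=0..n. F $ (n - i) * (\<Sum>k. rj j ^ k * ((-1) ^ Suc k * Ak k $ i)))"
      by (intro sum.cong refl suminf_mult Ak_lim)
    finally show ?thesis unfolding e .
  qed
  moreover have "(\<lambda>j. \<Sum>i=0..n. F $ (n - i) * (\<Sum>k. rj j ^ k * ((-1) ^ Suc k * Ak k $ i)))
     \<longlonglongrightarrow> (\<Sum>i=0..n. F $ (n - i) * lam i)"
    by (intro tendsto_sum tendsto_mult tendsto_const Ak_lim)
  moreover have "(Abs_fps lam * F) $ n = (\<Sum>i=0..n. F $ (n - i) * lam i)"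
    unfolding fps_mult_nth by (simp add: mult.commute)
  ultimately show "(\<lambda>j. \<Sum>k. rj j ^ k * (Ak k * (fps_const ((-1) ^ Suc k) * F)) $ n) \<longlonglongrightarrow> (Abs_fps lam * F) $ n"
    by presburger
qed

lemma gd_power: "gd (\<lambda>t. c * t ^ Suc n)"
  unfolding gd_def
proof (intro conjI exI[of _ "\<bar>c\<bar> * (pi / 2) ^ n"] ballI continuous_intros)
  fix t assume t: "t \<in> {0..pi/2}"
  hence "t ^ n \<le> (pi / 2) ^ n" by (intro power_mono) auto
  hence "\<bar>c\<bar> * (t ^ n * t) \<le> \<bar>c\<bar> * ((pi / 2) ^ n * t)"
    using t by (intro mult_left_mono mult_right_mono) auto
  thus "\<bar>c * t ^ Suc n\<bar> \<le> \<bar>c\<bar> * (pi / 2) ^ n * t" using t by (simp add: abs_mult mult_ac)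
qed

lemma gd_zero: "gd (\<lambda>_. 0)"
  using gd_power[of 0 0] by simp

lemma gd_sin: "gd (\<lambda>t. fps_sin (2 * t) $ n)"
proof (cases "even n")
  case False
  then obtain m where "n = Suc m" by (cases n) auto
  thus ?thesis using False gd_power[of "(-1) ^ (m div 2) * 2 ^ n / fact n" m]
    by (simp add: fps_sin_def power_mult_distrib mult.assoc del: power_Suc fact_Suc)
qed (simp add: fps_sin_def gd_zero)

lemma gd_cos: "n > 0 \<Longrightarrow> gd (\<lambda>t. fps_cos (2 * t) $ n)"
proof (cases "even n")
  case True
  assume "n > 0"
  then obtain m where "n = Suc m" by (cases n) auto
  thus ?thesis using True gd_power[of "(-1) ^ (n div 2) * 2 ^ n / fact n" m]
    by (simp add: fps_cos_def power_mult_distrib mult.assoc del: power_Suc fact_Suc)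
qed (simp add: fps_cos_def gd_zero)

text \<open>The series in u of the integrals of cot t sin 2ut and of cot t (cos 2ut - 1); setting
  the constant coefficient of \<open>Cf\<close> to 0 is the subtraction of 1.\<close>

definition Jf :: "real fps" where "Jf = Abs_fps (\<lambda>n. cint (\<lambda>t. fps_sin (2 * t) $ n))"
definition Cf :: "real fps" where "Cf = Abs_fps (\<lambda>n. if n = 0 then 0 else cint (\<lambda>t. fps_cos (2 * t) $ n))"
definition Phi :: "real fps" where
  "Phi = Abs_fps (\<lambda>n. if n \<noteq> 0 \<and> even n then zeta (Suc n) else 0)"
definition Lam :: "real fps" where "Lam = Abs_fps lam"

lemma sI_0: "sI 0 f = 0"
  by (simp add: sI_def)

lemma Ak_0: "Ak 0 = 0"
  by (rule fps_ext) (simp add: Ak_def)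

lemma Jf_eq: "Jf = Lam * fps_sin pi"
proof (rule fps_ext)
  fix n
  have "sI k (\<lambda>t. fps_sin (2 * t) $ n) = (Ak k * (fps_const ((-1) ^ Suc k) * fps_sin pi)) $ n" for k
  proof (cases "k = 0")
    case False
    thus ?thesis using arg_cong[OF sI_sin, of k "\<lambda>F. F $ n"] by simp
  qed (simp add: sI_0 Ak_0)
  hence "(\<lambda>j. \<Sum>k. rj j ^ k * sI k (\<lambda>t. fps_sin (2 * t) $ n)) \<longlonglongrightarrow> (Lam * fps_sin pi) $ n"
    using Ak_mult_lim(1)[of "fps_sin pi" n] by (simp only: Lam_def)
  moreover have "(\<lambda>j. \<Sum>k. rj j ^ k * sI k (\<lambda>t. fps_sin (2 * t) $ n)) \<longlonglongrightarrow> Jf $ n"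
    using gd_cint(2)[OF gd_sin] by (simp add: Jf_def)
  ultimately show "Jf $ n = (Lam * fps_sin pi) $ n" using LIMSEQ_unique by blast
qed

text \<open>Subtracting ln 2 only adjusts the constant coefficient, which is 0 for \<open>Cf\<close>
  but ln 2 for Lambda(u) cos(pi u).\<close>

lemma Cf_eq: "Cf = Phi + Lam * fps_cos pi - fps_const (ln 2)"
proof (rule fps_ext)
  fix n
  show "Cf $ n = (Phi + Lam * fps_cos pi - fps_const (ln 2)) $ n"
  proof (cases "n = 0")
    case True
    thus ?thesis by (simp add: Cf_def Phi_def Lam_def lam_def)
  next
    case False
    have s: "sI k (\<lambda>t. fps_cos (2 * t) $ n) = Ak k $ n + (Ak k * (fps_const ((-1) ^ Suc k) * fps_cos pi)) $ n" for k
    proof (cases "k = 0")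
      case False
      thus ?thesis using arg_cong[OF sI_cos, of k "\<lambda>F. F $ n"] by (simp add: distrib_left)
    qed (simp add: sI_0 Ak_0)
    have P: "(\<lambda>j. \<Sum>k. rj j ^ k * Ak k $ n) \<longlonglongrightarrow> Phi $ n \<and> (\<forall>j. summable (\<lambda>k. rj j ^ k * Ak k $ n))"
    proof (cases "even n")
      case True
      have "Suc n \<ge> 2" using False by simp
      from tannery_rj[OF _ sums_summable[OF zeta_sums[OF this]] zeta_sums[OF this]]
      show ?thesis using True False by (simp add: Phi_def Ak_def)
    qed (simp add: Phi_def Ak_def)
    have "(\<Sum>k. rj j ^ k * sI k (\<lambda>t. fps_cos (2 * t) $ n)) = (\<Sum>k. rj j ^ k * Ak k $ n) +
       (\<Sum>k. rj j ^ k * (Ak k * (fps_const ((-1) ^ Suc k) * fps_cos pi)) $ n)" for j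
      unfolding s distrib_left using P by (intro suminf_add[symmetric] Ak_mult_lim) auto
    hence "(\<lambda>j. \<Sum>k. rj j ^ k * sI k (\<lambda>t. fps_cos (2 * t) $ n)) \<longlonglongrightarrow> Phi $ n + (Abs_fps lam * fps_cos pi) $ n"
      using tendsto_add[OF conjunct1[OF P] Ak_mult_lim(1)] by presburger
    moreover have "(\<lambda>j. \<Sum>k. rj j ^ k * sI k (\<lambda>t. fps_cos (2 * t) $ n)) \<longlonglongrightarrow> Cf $ n"
      using gd_cint(2)[OF gd_cos] False by (simp add: Cf_def)
    ultimately have "Cf $ n = Phi $ n + (Abs_fps lam * fps_cos pi) $ n" using LIMSEQ_unique by blast
    thus ?thesis using False by (simp add: Lam_def)
  qed
qed

section \<open>Linearity of the integral against cot, and bivariate series\<close>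

lemma gd_add: "gd f \<Longrightarrow> gd g \<Longrightarrow> gd (\<lambda>t. f t + g t)"
proof -
  assume "gd f" "gd g"
  then obtain M N where *: "continuous_on {0..pi/2} f" "continuous_on {0..pi/2} g"
    "\<And>t. t \<in> {0..pi/2} \<Longrightarrow> \<bar>f t\<bar> \<le> M * t" "\<And>t. t \<in> {0..pi/2} \<Longrightarrow> \<bar>g t\<bar> \<le> N * t"
    unfolding gd_def by blast
  have "\<bar>f t + g t\<bar> \<le> (M + N) * t" if "t \<in> {0..pi/2}" for t
    using *(3,4)[OF that] by (simp add: distrib_right abs_le_iff)
  with * show ?thesis unfolding gd_def by (blast intro: continuous_on_add)
qed

lemma gd_mult: "gd f \<Longrightarrow> continuous_on {0..pi/2} g \<Longrightarrow> gd (\<lambda>t. g t * f t)"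
proof -
  assume "gd f" and g: "continuous_on {0..pi/2} g"
  then obtain M where *: "continuous_on {0..pi/2} f" "\<And>t. t \<in> {0..pi/2} \<Longrightarrow> \<bar>f t\<bar> \<le> M * t"
    unfolding gd_def by blast
  have "bounded (g ` {0..pi/2})"
    by (intro compact_imp_bounded compact_continuous_image g) auto
  then obtain N where N: "\<And>t. t \<in> {0..pi/2} \<Longrightarrow> \<bar>g t\<bar> \<le> N" unfolding bounded_iff real_norm_def by blast
  have "\<bar>g t * f t\<bar> \<le> (N * M) * t" if "t \<in> {0..pi/2}" for t
  proof -
    have "\<bar>g t\<bar> * \<bar>f t\<bar> \<le> N * (M * t)"
      using N[OF that] *(2)[OF that] by (intro mult_mono) auto
    thus ?thesis by (simp add: abs_mult mult.assoc)
  qed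
  with * g show ?thesis unfolding gd_def by (blast intro: continuous_on_mult)
qed

lemma gd_cmult: "gd f \<Longrightarrow> gd (\<lambda>t. c * f t)"
  by (rule gd_mult) auto

lemma gd_sum: "(\<And>i. i \<in> I \<Longrightarrow> gd (f i)) \<Longrightarrow> gd (\<lambda>t. \<Sum>i\<in>I. f i t)"
  by (induction I rule: infinite_finite_induct) (auto intro: gd_add gd_zero)

lemma cint_cmult: "cint (\<lambda>t. c * f t) = c * cint f"
proof -
  have "(\<lambda>t. cot t * (c * f t)) = (\<lambda>t. c * (cot t * f t))" by (simp add: fun_eq_iff mult_ac)
  thus ?thesis by (simp add: cint_def)
qed

lemma cint_add: "gd f \<Longrightarrow> gd g \<Longrightarrow> cint (\<lambda>t. f t + g t) = cint f + cint g"
  using integral_add[OF gd_cint(1) gd_cint(1), of f g] by (simp add: cint_def distrib_left)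

lemma cint_zero: "cint (\<lambda>_. 0) = 0"
  by (simp add: cint_def)

lemma cint_sum: "(\<And>i. i \<in> I \<Longrightarrow> gd (f i)) \<Longrightarrow> cint (\<lambda>t. \<Sum>i\<in>I. f i t) = (\<Sum>i\<in>I. cint (f i))"
  by (induction I rule: infinite_finite_induct) (auto simp: cint_add cint_zero gd_sum)

text \<open>In a bivariate series the outer index is the exponent of \<open>x\<close>, the inner one that of \<open>y\<close>.\<close>

definition GD2 :: "(real \<Rightarrow> real fps fps) \<Rightarrow> bool" where "GD2 K \<longleftrightarrow> (\<forall>a b. gd (\<lambda>t. K t $ a $ b))"
definition CI2 :: "(real \<Rightarrow> real fps fps) \<Rightarrow> real fps fps" where
  "CI2 K = Abs_fps (\<lambda>a. Abs_fps (\<lambda>b. cint (\<lambda>t. K t $ a $ b)))"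

lemma fps2_mult_nth: "(A * K) $ a $ b = (\<Sum>i=0..a. \<Sum>j=0..b. A $ i $ j * K $ (a - i) $ (b - j))"
  for A K :: "real fps fps"
  by (simp add: fps_mult_nth fps_sum_nth)

lemma CI2_cmult:
  assumes "GD2 K"
  shows "GD2 (\<lambda>t. A * K t)" "CI2 (\<lambda>t. A * K t) = A * CI2 K"
proof -
  have g: "gd (\<lambda>t. A $ i $ j * K t $ a $ b)" for i j a b
    using assms by (intro gd_cmult) (auto simp: GD2_def)
  show "GD2 (\<lambda>t. A * K t)"
    unfolding GD2_def fps2_mult_nth by (intro allI gd_sum g)
  show "CI2 (\<lambda>t. A * K t) = A * CI2 K"
    by (intro fps_ext) (simp add: CI2_def fps2_mult_nth cint_sum gd_sum g cint_cmult)
qed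

lemma CI2_add: "GD2 K \<Longrightarrow> GD2 L \<Longrightarrow> GD2 (\<lambda>t. K t + L t) \<and> CI2 (\<lambda>t. K t + L t) = CI2 K + CI2 L"
  by (auto simp: GD2_def CI2_def gd_add cint_add intro!: fps_ext)

text \<open>Substitutions: \<open>ix g\<close> is g(x), \<open>iy g\<close> is g(y),
  \<open>Hs e g\<close> is g(x + e y), and \<open>tr\<close> exchanges x and y.\<close>

definition ix :: "real fps \<Rightarrow> real fps fps" where "ix g = Abs_fps (\<lambda>a. fps_const (g $ a))"
definition iy :: "real fps \<Rightarrow> real fps fps" where "iy g = fps_const g"
definition Hs :: "real \<Rightarrow> real fps \<Rightarrow> real fps fps" where
  "Hs e g = Abs_fps (\<lambda>a. Abs_fps (\<lambda>b. g $ (a + b) * real ((a + b) choose a) * e ^ b))"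
definition tr :: "real fps fps \<Rightarrow> real fps fps" where
  "tr F = Abs_fps (\<lambda>a. Abs_fps (\<lambda>b. F $ b $ a))"

lemma ix_nth [simp]: "ix g $ a $ b = (if b = 0 then g $ a else 0)"
  by (simp add: ix_def)

lemma iy_nth [simp]: "iy g $ a $ b = (if a = 0 then g $ b else 0)"
  by (simp add: iy_def)

lemma tr_nth [simp]: "tr F $ a $ b = F $ b $ a"
  by (simp add: tr_def)

lemma fps2_eqI: "(\<And>a b. F $ a $ b = G $ a $ b) \<Longrightarrow> F = (G :: real fps fps)"
  by (intro fps_ext) auto

lemma iy_mult: "iy (f * g) = iy f * iy g" and iy_add: "iy (f + g) = iy f + iy g"
  by (simp_all add: iy_def)

lemma tr_mult: "tr (F * G) = tr F * tr G"
proof (rule fps2_eqI)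
  fix a b
  show "tr (F * G) $ a $ b = (tr F * tr G) $ a $ b"
    by (simp add: fps2_mult_nth) (rule sum.swap)
qed

lemma tr_simps [simp]: "tr (ix g) = iy g" "tr (iy g) = ix g" "tr (F + G) = tr F + tr G" "tr (F - G) = tr F - tr G"
  "tr (tr F) = F" "tr 1 = 1"
  by (rule fps2_eqI; auto)+

lemma ix_mult: "ix (f * g) = ix f * ix g"
proof -
  have "tr (iy (f * g)) = tr (iy f * iy g)" by (simp add: iy_mult)
  thus ?thesis by (simp add: tr_mult)
qed

lemma ix_iy_nth: "(ix f * iy g) $ a $ b = f $ a * g $ b"
  unfolding iy_def ix_def by simp

lemma iy_right_nth: "(F * iy g) $ a = F $ a * g"
  by (simp add: iy_def)

text \<open>Substituting x + e y respects products; for coefficients this is Vandermonde's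
  convolution of binomials.\<close>

lemma Hs_mult:
  assumes "e ^ 2 = 1"
  shows "Hs e (f * g) = Hs e f * Hs e g"
proof (rule fps2_eqI)
  fix a b :: nat
  define n where "n = a + b"
  \<comment> \<open>With k = i + j, extending the range of k to 0..n adds only vanishing binomials
    and makes it independent of i, so that the sums can be exchanged.\<close>
  have inner: "(\<Sum>j=0..b. Hs e f $ i $ j * Hs e g $ (a - i) $ (b - j)) =
     (\<Sum>k=0..n. f $ k * g $ (n - k) * e ^ b * real ((k choose i) * ((n - k) choose (a - i))))" if i: "i \<le> a" for i
  proof -
    have "(\<Sum>k=0..n. f $ k * g $ (n - k) * e ^ b * real ((k choose i) * ((n - k) choose (a - i)))) =
      (\<Sum>k\<in>{i..i + b}. f $ k * g $ (n - k) * e ^ b * real ((k choose i) * ((n - k) choose (a - i))))"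
    proof (rule sum.mono_neutral_right)
      show "\<forall>k\<in>{0..n} - {i..i + b}. f $ k * g $ (n - k) * e ^ b * real ((k choose i) * ((n - k) choose (a - i))) = 0"
      proof
        fix k assume "k \<in> {0..n} - {i..i + b}"
        hence "k < i \<or> n - k < a - i" using i by (auto simp: n_def)
        thus "f $ k * g $ (n - k) * e ^ b * real ((k choose i) * ((n - k) choose (a - i))) = 0"
          by (auto simp: binomial_eq_0)
      qed
    qed (use i in \<open>auto simp: n_def\<close>)
    also have "\<dots> = (\<Sum>j=0..b. f $ (i + j) * g $ (n - (i + j)) * e ^ b * real (((i + j) choose i) * ((n - (i + j)) choose (a - i))))"
      by (rule sum.reindex_bij_witness[of _ "\<lambda>j. i + j" "\<lambda>k. k - i"]) auto
    also have "\<dots> = (\<Sum>j=0..b. Hs e f $ i $ j * Hs e g $ (a - i) $ (b - j))"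
    proof (rule sum.cong[OF refl])
      fix j assume "j \<in> {0..b}"
      hence j: "j \<le> b" by simp
      have "n - (i + j) = a - i + (b - j)" using i j by (simp add: n_def)
      moreover have "e ^ b = e ^ j * e ^ (b - j)" using j by (simp flip: power_add)
      ultimately show "f $ (i + j) * g $ (n - (i + j)) * e ^ b * real (((i + j) choose i) * ((n - (i + j)) choose (a - i))) = Hs e f $ i $ j * Hs e g $ (a - i) $ (b - j)"
        by (simp add: Hs_def mult_ac)
    qed
    finally show ?thesis by simp
  qed
  have "(Hs e f * Hs e g) $ a $ b = (\<Sum>i=0..a. \<Sum>k=0..n. f $ k * g $ (n - k) * e ^ b * real ((k choose i) * ((n - k) choose (a - i))))"
    unfolding fps2_mult_nth by (rule sum.cong) (auto simp: inner)
  also have "\<dots> = (\<Sum>k=0..n. f $ k * g $ (n - k) * e ^ b * real (\<Sum>i=0..a. (k choose i) * ((n - k) choose (a - i))))"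
    by (subst sum.swap) (simp add: sum_distrib_left)
  also have "\<dots> = (\<Sum>k=0..n. f $ k * g $ (n - k) * e ^ b * real (n choose a))"
  proof (rule sum.cong[OF refl])
    fix k assume "k \<in> {0..n}"
    hence "(\<Sum>i=0..a. (k choose i) * ((n - k) choose (a - i))) = n choose a"
      using vandermonde[of k "n - k" a] by (simp add: atLeast0AtMost)
    thus "f $ k * g $ (n - k) * e ^ b * real (\<Sum>i=0..a. (k choose i) * ((n - k) choose (a - i))) = f $ k * g $ (n - k) * e ^ b * real (n choose a)"
      by simp
  qed
  also have "\<dots> = Hs e (f * g) $ a $ b"
    by (simp add: Hs_def fps_mult_nth n_def sum_distrib_left sum_distrib_right mult_ac)
  finally show "Hs e (f * g) $ a $ b = (Hs e f * Hs e g) $ a $ b" by simp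
qed

lemma Hs_sin:
  assumes "e = 1 \<or> e = - 1"
  shows "Hs e (fps_sin c) = ix (fps_sin c) * iy (fps_cos c) + fps_const (fps_const e) * (ix (fps_cos c) * iy (fps_sin c))"
proof (rule fps2_eqI)
  fix a b :: nat
  have bin: "real ((a + b) choose a) = fact (a + b) / (fact a * fact b)"
    by (subst binomial_fact) auto
  show "Hs e (fps_sin c) $ a $ b = (ix (fps_sin c) * iy (fps_cos c) + fps_const (fps_const e) * (ix (fps_cos c) * iy (fps_sin c))) $ a $ b"
    using assms
    by (cases "even a"; cases "even b")
       (auto simp: Hs_def ix_iy_nth fps_sin_def fps_cos_def bin power_add elim!: evenE oddE)
qed


lemma fps_sin_cos_one: "fps_sin (c :: real) * fps_sin c = 1 - fps_cos c * fps_cos c"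
  using fps_sin_cos_sum_of_squares[of c] by (simp add: power2_eq_square algebra_simps)

lemma fps_sin_diff: "fps_sin (a - b :: real) = fps_sin a * fps_cos b - fps_cos a * fps_sin b"
proof -
  have "fps_sin (- b) = - fps_sin b" "fps_cos (- b) = fps_cos b"
    by (rule fps_ext; auto simp: fps_sin_def fps_cos_def power_minus[of b])+
  thus ?thesis using fps_sin_add[of a "- b"] by simp
qed

text \<open>Of \<open>CC\<close> only the symmetry in x and y and the values at y = 0 are used; it
  is never evaluated in general.\<close>

definition CC :: "real fps fps" where "CC = CI2 (\<lambda>t. ix (fps_cos (2 * t)) * iy (fps_cos (2 * t)) - 1)"
definition SC :: "real fps fps" where "SC = CI2 (\<lambda>t. ix (fps_sin (2 * t)) * iy (fps_cos (2 * t)))"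
definition CS :: "real fps fps" where "CS = CI2 (\<lambda>t. ix (fps_cos (2 * t)) * iy (fps_sin (2 * t)))"

lemma GD2_basic:
  "GD2 (\<lambda>t. ix (fps_cos (2 * t)) * iy (fps_cos (2 * t)) - 1)"
  "GD2 (\<lambda>t. ix (fps_sin (2 * t)) * iy (fps_cos (2 * t)))"
  "GD2 (\<lambda>t. ix (fps_cos (2 * t)) * iy (fps_sin (2 * t)))"
  "GD2 (\<lambda>t. fps_const (fps_const (2 * t)))"
proof -
  show "GD2 (\<lambda>t. ix (fps_sin (2 * t)) * iy (fps_cos (2 * t)))"
    using gd_mult[OF gd_sin continuous_fps_sin_cos(2)] by (simp add: GD2_def ix_iy_nth mult.commute)
  show "GD2 (\<lambda>t. ix (fps_cos (2 * t)) * iy (fps_sin (2 * t)))"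
    using gd_mult[OF gd_sin continuous_fps_sin_cos(2)] by (simp add: GD2_def ix_iy_nth)
  show "GD2 (\<lambda>t. fps_const (fps_const (2 * t)))"
    unfolding GD2_def
  proof (intro allI)
    fix a b :: nat
    show "gd (\<lambda>t. fps_const (fps_const (2 * t)) $ a $ b)"
      using gd_power[of 2 0] gd_zero by (cases "a = 0"; cases "b = 0") simp_all
  qed
  have one: "(1 :: real fps fps) $ a $ b = (if a = 0 \<and> b = 0 then 1 else 0)" for a b by simp
  show "GD2 (\<lambda>t. ix (fps_cos (2 * t)) * iy (fps_cos (2 * t)) - 1)"
    unfolding GD2_def
  proof (intro allI)
    fix a b :: nat
    consider "a = 0 \<and> b = 0" | "a > 0" | "b > 0" by auto
    hence "gd (\<lambda>t. fps_cos (2 * t) $ a * fps_cos (2 * t) $ b - (if a = 0 \<and> b = 0 then 1 else 0))"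
    proof cases
      case 1
      thus ?thesis using gd_zero by (simp add: ix_iy_nth fps_cos_def)
    next
      case 2
      thus ?thesis using gd_mult[OF gd_cos[OF 2] continuous_fps_sin_cos(2), of b]
        by (simp add: ix_iy_nth mult.commute)
    next
      case 3
      thus ?thesis using gd_mult[OF gd_cos[OF 3] continuous_fps_sin_cos(2), of a]
        by (cases "a = 0") (simp_all add: ix_iy_nth)
    qed
    thus "gd (\<lambda>t. (ix (fps_cos (2 * t)) * iy (fps_cos (2 * t)) - 1) $ a $ b)"
      by (simp only: fps_sub_nth ix_iy_nth one)
  qed
qed

abbreviation (input) sx :: "real fps fps" where "sx \<equiv> ix (fps_sin pi)"
abbreviation (input) sy :: "real fps fps" where "sy \<equiv> iy (fps_sin pi)"
abbreviation (input) cx :: "real fps fps" where "cx \<equiv> ix (fps_cos pi)"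
abbreviation (input) cy :: "real fps fps" where "cy \<equiv> iy (fps_cos pi)"

text \<open>A generating function for the integrands of \<open>etaI\<close>. The subtracted term
  makes it vanish at t = 0 and reproduces, at y^0, the regularisation used in
  \<open>cI\<close>.\<close>

definition Et :: "real \<Rightarrow> real fps fps" where
  "Et t = ix (fps_sin (pi - 2 * t)) * iy (fps_cos (2 * t)) - fps_const (fps_const (1 - 2 * t / pi)) * sx"

lemma Et_eq: "Et t = sx * (ix (fps_cos (2 * t)) * iy (fps_cos (2 * t)) - 1)
   + (- cx) * (ix (fps_sin (2 * t)) * iy (fps_cos (2 * t)))
   + (fps_const (fps_const (1 / pi)) * sx) * fps_const (fps_const (2 * t))"
proof -
  have "ix (f - g) = ix f - ix g" for f g by (rule fps2_eqI) simp
  hence A: "ix (fps_sin (pi - 2 * t)) = sx * ix (fps_cos (2 * t)) - cx * ix (fps_sin (2 * t))"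
    by (simp add: fps_sin_diff ix_mult)
  define c d :: "real fps fps" where "c = fps_const (fps_const (1 / pi))" and "d = fps_const (fps_const (2 * t))"
  have modB: "fps_const (fps_const (1 - 2 * t / pi)) = 1 - c * d"
    unfolding c_def d_def by (rule fps2_eqI) auto
  show ?thesis unfolding Et_def A modB c_def[symmetric] d_def[symmetric] by (simp add: algebra_simps)
qed

lemma CI2_2t: "CI2 (\<lambda>t. fps_const (fps_const (2 * t))) = fps_const (fps_const (pi * ln 2))"
proof -
  have "cint (\<lambda>t. 2 * t) = Jf $ 1" by (simp add: Jf_def fps_sin_def)
  also have "\<dots> = pi * ln 2" unfolding Jf_eq by (simp add: fps_mult_nth Lam_def lam_def fps_sin_def)
  finally show ?thesis by (intro fps2_eqI) (auto simp: CI2_def cint_zero)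
qed

lemma CI2_Et: "GD2 Et" "CI2 Et = sx * CC - cx * SC + fps_const (fps_const (ln 2)) * sx"
proof -
  note b = CI2_cmult[OF GD2_basic(1), of sx] CI2_cmult[OF GD2_basic(2), of "- cx"]
    CI2_cmult[OF GD2_basic(4), of "fps_const (fps_const (1 / pi)) * sx"]
  note c = CI2_add[OF b(1,3)]
  note e = CI2_add[OF conjunct1[OF c] b(5)]
  have E: "Et = (\<lambda>t. sx * (ix (fps_cos (2 * t)) * iy (fps_cos (2 * t)) - 1)
   + (- cx) * (ix (fps_sin (2 * t)) * iy (fps_cos (2 * t)))
   + (fps_const (fps_const (1 / pi)) * sx) * fps_const (fps_const (2 * t)))"
    by (rule ext) (rule Et_eq)
  show "GD2 Et" unfolding E using e by blast
  have "CI2 Et = sx * CC + (- cx) * SC + (fps_const (fps_const (1 / pi)) * sx) * fps_const (fps_const (pi * ln 2))"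
    unfolding E using e c b by (simp only: CC_def SC_def CI2_2t)
  also have "\<dots> = sx * CC - cx * SC + (fps_const (fps_const (1 / pi)) * fps_const (fps_const (pi * ln 2))) * sx"
    by (simp add: algebra_simps)
  also have "fps_const (fps_const (1 / pi)) * fps_const (fps_const (pi * ln 2)) = fps_const (fps_const (ln 2) :: real fps)"
    by simp
  finally show "CI2 Et = sx * CC - cx * SC + fps_const (fps_const (ln 2)) * sx" .
qed

lemma tr_CI2: "tr (CI2 K) = CI2 (\<lambda>t. tr (K t))"
  by (intro fps2_eqI) (simp add: CI2_def)

lemma tr_CC_SC: "tr CC = CC" "tr SC = CS"
  by (simp_all add: CC_def SC_def CS_def tr_CI2 tr_mult mult.commute)

text \<open>The addition theorem of the sine, applied under the integral.\<close>

lemma Hs_Jf: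
  assumes "e = 1 \<or> e = - 1"
  shows "Hs e Jf = SC + fps_const (fps_const e) * CS"
proof -
  have "Hs e Jf = CI2 (\<lambda>t. Hs e (fps_sin (2 * t)))"
  proof (rule fps2_eqI)
    fix a b
    have "cint (\<lambda>t. real (a + b choose a) * e ^ b * fps_sin (2 * t) $ (a + b)) =
       real (a + b choose a) * e ^ b * cint (\<lambda>t. fps_sin (2 * t) $ (a + b))"
      by (rule cint_cmult)
    thus "Hs e Jf $ a $ b = CI2 (\<lambda>t. Hs e (fps_sin (2 * t))) $ a $ b"
      by (simp add: CI2_def Hs_def Jf_def mult_ac)
  qed
  also have "\<dots> = SC + fps_const (fps_const e) * CS"
    unfolding Hs_sin[OF assms] using CI2_add[OF GD2_basic(2) CI2_cmult(1)[OF GD2_basic(3)]]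
      CI2_cmult(2)[OF GD2_basic(3)] by (simp add: SC_def CS_def)
  finally show ?thesis .
qed

definition Del :: "real fps fps" where "Del = Hs 1 Lam - Hs (-1) Lam"

text \<open>\<open>CC\<close> and ln 2 occur with the symmetric factor sin(pi x) sin(pi y) and
  cancel. Twice the rest is (SC + CS) sin pi(x-y) - (SC - CS) sin pi(x+y), and sin pi(x+y) sin
  pi(x-y) = sin^2 pi x - sin^2 pi y.\<close>

lemma antisymmetry:
  "2 * (CI2 Et * sy - tr (CI2 Et * sy)) = Del * (sx * sx - sy * sy)"
proof -
  have l: "tr (fps_const (fps_const c)) = fps_const (fps_const c)" for c :: real
    by (rule fps2_eqI) auto
  have p: "SC + CS = Hs 1 Lam * (sx * cy + cx * sy)"
    using Hs_Jf[of 1] Hs_sin[of 1 pi] Hs_mult[of 1 Lam "fps_sin pi"] by (simp add: Jf_eq)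
  have n: "fps_const (fps_const (- 1)) = (- 1 :: real fps fps)"
    by (rule fps2_eqI) auto
  have "Hs (-1) Jf = SC - CS" using Hs_Jf[of "-1"] unfolding n by simp
  moreover have "Hs (-1) (fps_sin pi) = sx * cy - cx * sy" using Hs_sin[of "-1" pi] unfolding n by simp
  ultimately have m: "SC - CS = Hs (-1) Lam * (sx * cy - cx * sy)"
    using Hs_mult[of "-1" Lam "fps_sin pi"] by (simp add: Jf_eq)
  have D: "CI2 Et * sy - tr (CI2 Et * sy) = sx * cy * CS - cx * sy * SC"
    unfolding CI2_Et(2) by (simp add: tr_mult tr_CC_SC l algebra_simps)
  have "2 * (CI2 Et * sy - tr (CI2 Et * sy)) = (SC + CS) * (sx * cy - cx * sy) - (SC - CS) * (sx * cy + cx * sy)"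
    unfolding D by (simp add: algebra_simps)
  also have "\<dots> = Del * ((sx * sx) * (cy * cy) - (cx * cx) * (sy * sy))"
    unfolding p m Del_def by (simp add: algebra_simps)
  also have "cy * cy = 1 - sy * sy"
    using arg_cong[OF fps_sin_cos_one[of pi], of iy] by (simp add: iy_mult[symmetric]) (simp add: iy_def)
  also have "cx * cx = 1 - sx * sx"
    using arg_cong[OF fps_sin_cos_one[of pi], of "\<lambda>f. tr (iy f)"] \<open>cy * cy = 1 - sy * sy\<close>
    by (metis tr_mult tr_simps(2,4,6))
  finally show ?thesis by (simp add: algebra_simps)
qed

text \<open>Lambda is even, so Lambda(x+y) - Lambda(x-y) does not change when x and y are
  exchanged.\<close>

lemma tr_Del: "tr Del = Del"
proof (rule fps2_eqI)
  fix a b :: nat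
  have "(b + a choose b) = (a + b choose a)" by (subst binomial_symmetric) (auto simp: add.commute)
  moreover have "lam (a + b) = 0" if "even a \<noteq> even b" using that by (auto simp: lam_def)
  ultimately show "tr Del $ a $ b = Del $ a $ b"
    by (cases "even a"; cases "even b") (auto simp: Del_def Hs_def Lam_def add.commute)
qed

text \<open>Arranged so that \<open>antisymmetry\<close> becomes symmetry. Its odd-odd coefficients
  turn out to be those of the series in hypothesis II, up to a constant.\<close>

definition Qb :: "real fps fps" where "Qb = 2 * CI2 Et * sy + Del * (sy * sy)"

lemma tr_Qb: "tr Qb = Qb"
proof -
  have "tr 2 = (2 :: real fps fps)" using tr_simps(3)[of 1 1] by simp
  hence "tr Qb = 2 * tr (CI2 Et * sy) + Del * (sx * sx)"
    unfolding Qb_def by (simp add: tr_mult tr_Del)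
  also have "\<dots> = Qb" using antisymmetry unfolding Qb_def by (simp add: algebra_simps)
  finally show ?thesis .
qed


text \<open>sin(pi u) is pi u times the generating function in u^2 of the coefficients of Z at the
  words (X1 X0)^j, so multiplying by it mirrors multiplying by \<open>pj pD Z_one\<close>.\<close>

lemma fps_sin_pi_nth: "fps_sin pi $ (2 * j) = 0" "fps_sin pi $ Suc (2 * j) = pi * ((-1) ^ j * tau j 0)"
  by (simp_all add: fps_sin_def tau_at_0 del: fact_Suc)

definition eta :: "nat \<Rightarrow> nat \<Rightarrow> real" where
  "eta m k = (if k = 0 then (-1) ^ m * cI m else (-1) ^ (Suc m + k) * etaI m k)"

lemma Z_one_A10_eta: "cf Z_one (A10 m k) = of_real (eta m k)"
  by (cases "k = 0") (simp_all add: eta_def Z_one_A10 Z_one_A10_0)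

lemma CI2_Et_nth: "CI2 Et $ Suc (2 * m) $ (2 * k) = - (pi / 2) * eta m k"
proof -
  have s: "fps_sin (pi - 2 * t) $ Suc (2 * m) = (-1) ^ m * oc m t" for t
    by (simp add: fps_sin_def oc_def del: fact_Suc)
  have e: "Et t $ Suc (2 * m) $ (2 * k) = (-1) ^ m * oc m t * fps_cos (2 * t) $ (2 * k) -
     (if k = 0 then (1 - 2 * t / pi) * (pi * ((-1) ^ m * tau m 0)) else 0)" for t
    unfolding Et_def by (simp add: ix_iy_nth s fps_sin_pi_nth(2)[of m])
  show ?thesis
  proof (cases "k = 0")
    case True
    have "Et t $ Suc (2 * m) $ (2 * k) = - ((-1) ^ m) * ((pi - 2 * t) * tau m 0 - oc m t)" for t
      unfolding e using True by (simp add: fps_cos_def field_simps)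
    hence "CI2 Et $ Suc (2 * m) $ (2 * k) = - ((-1) ^ m) * cint (\<lambda>t. (pi - 2 * t) * tau m 0 - oc m t)"
      by (simp only: CI2_def fps_nth_Abs_fps cint_cmult)
    thus ?thesis using True by (simp add: eta_def cI_def cint_def)
  next
    case False
    have "Et t $ Suc (2 * m) $ (2 * k) = (-1) ^ (m + k) * (oc m t * ((2 * t) ^ (2 * k) / fact (2 * k)))" for t
      unfolding e using False by (simp add: fps_cos_def power_add)
    hence "CI2 Et $ Suc (2 * m) $ (2 * k) = (-1) ^ (m + k) * cint (\<lambda>t. oc m t * ((2 * t) ^ (2 * k) / fact (2 * k)))"
      by (simp only: CI2_def fps_nth_Abs_fps cint_cmult)
    thus ?thesis using False by (simp add: eta_def etaI_def cint_def)
  qed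
qed

lemma sum_parity: "(\<Sum>i\<le>Suc (2 * n). f i) = (\<Sum>k\<le>n. f (2 * k) + f (Suc (2 * k)))"
  by (induction n) (simp_all add: algebra_simps)

lemma times_sin_pi_nth:
  "(F * fps_sin pi) $ Suc (2 * n) = (\<Sum>k\<le>n. F $ (2 * k) * (pi * ((-1) ^ (n - k) * tau (n - k) 0)))"
  "(F * fps_sin pi) $ (2 * n) = (\<Sum>k<n. F $ Suc (2 * k) * (pi * ((-1) ^ (n - Suc k) * tau (n - Suc k) 0)))"
proof -
  have "(F * fps_sin pi) $ Suc (2 * n) = (\<Sum>k\<le>n. F $ (2 * k) * fps_sin pi $ (Suc (2 * n) - 2 * k) + F $ Suc (2 * k) * fps_sin pi $ (Suc (2 * n) - Suc (2 * k)))"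
    unfolding fps_mult_nth atLeast0AtMost by (rule sum_parity)
  also have "\<dots> = (\<Sum>k\<le>n. F $ (2 * k) * (pi * ((-1) ^ (n - k) * tau (n - k) 0)))"
  proof (rule sum.cong[OF refl])
    fix k assume "k \<in> {..n}"
    hence "Suc (2 * n) - 2 * k = Suc (2 * (n - k))" "Suc (2 * n) - Suc (2 * k) = 2 * (n - k)" by auto
    thus "F $ (2 * k) * fps_sin pi $ (Suc (2 * n) - 2 * k) + F $ Suc (2 * k) * fps_sin pi $ (Suc (2 * n) - Suc (2 * k)) = F $ (2 * k) * (pi * ((-1) ^ (n - k) * tau (n - k) 0))"
      by (simp only: fps_sin_pi_nth mult_zero_right add_0_right)
  qed
  finally show "(F * fps_sin pi) $ Suc (2 * n) = \<dots>" .
  show "(F * fps_sin pi) $ (2 * n) = (\<Sum>k<n. F $ Suc (2 * k) * (pi * ((-1) ^ (n - Suc k) * tau (n - Suc k) 0)))"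
  proof (cases n)
    case 0
    thus ?thesis by (simp add: fps_sin_def)
  next
    case (Suc m)
    have "(F * fps_sin pi) $ (2 * n) = (\<Sum>i\<le>Suc (2 * m). F $ i * fps_sin pi $ (2 * n - i))"
      unfolding fps_mult_nth atLeast0AtMost Suc by (simp add: fps_sin_def)
    also have "\<dots> = (\<Sum>k\<le>m. F $ (2 * k) * fps_sin pi $ (2 * n - 2 * k) + F $ Suc (2 * k) * fps_sin pi $ (2 * n - Suc (2 * k)))"
      by (rule sum_parity)
    also have "\<dots> = (\<Sum>k\<le>m. F $ Suc (2 * k) * (pi * ((-1) ^ (n - Suc k) * tau (n - Suc k) 0)))"
    proof (rule sum.cong[OF refl])
      fix k assume "k \<in> {..m}"
      hence "2 * n - 2 * k = 2 * (n - k)" "2 * n - Suc (2 * k) = Suc (2 * (n - Suc k))" using Suc by auto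
      thus "F $ (2 * k) * fps_sin pi $ (2 * n - 2 * k) + F $ Suc (2 * k) * fps_sin pi $ (2 * n - Suc (2 * k)) = F $ Suc (2 * k) * (pi * ((-1) ^ (n - Suc k) * tau (n - Suc k) 0))"
        by (simp only: fps_sin_pi_nth mult_zero_right add_0_right)
    qed
    finally show ?thesis unfolding Suc by (simp only: lessThan_Suc_atMost)
  qed
qed

text \<open>At y = 0 the integral becomes sin(pi x) Cf - cos(pi x) Jf + ln 2 sin(pi x), where the
  Lambda and ln 2 terms cancel and only \<open>Phi\<close> is left.\<close>

lemma eta_0: "eta m 0 = - (2 / pi) * (Phi * fps_sin pi) $ Suc (2 * m)"
proof -
  have "SC $ a $ 0 = Jf $ a" for a
    by (simp add: SC_def CI2_def Jf_def ix_iy_nth fps_cos_def)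
  moreover have "CC $ a $ 0 = Cf $ a" for a
    by (cases "a = 0") (auto simp: CC_def CI2_def Cf_def ix_iy_nth fps_cos_def cint_zero)
  ultimately have E0: "CI2 Et $ a $ 0 = (fps_sin pi * Cf - fps_cos pi * Jf + fps_const (ln 2) * fps_sin pi) $ a" for a
  proof -
    have "(sx * F) $ a $ 0 = (fps_sin pi * (Abs_fps (\<lambda>a. F $ a $ 0))) $ a"
      "(cx * F) $ a $ 0 = (fps_cos pi * (Abs_fps (\<lambda>a. F $ a $ 0))) $ a" for F
      unfolding fps2_mult_nth by (simp_all add: fps_mult_nth)
    moreover have "Abs_fps (\<lambda>a. SC $ a $ 0) = Jf" "Abs_fps (\<lambda>a. CC $ a $ 0) = Cf"
      by (simp_all add: fps_eq_iff \<open>\<And>a. SC $ a $ 0 = Jf $ a\<close> \<open>\<And>a. CC $ a $ 0 = Cf $ a\<close>)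
    ultimately show ?thesis
      unfolding CI2_Et(2) fps_add_nth fps_sub_nth fps_mult_left_const_nth by simp
  qed
  have "CI2 Et $ Suc (2 * m) $ 0 = (Phi * fps_sin pi) $ Suc (2 * m)"
    unfolding E0 by (simp add: Cf_eq Jf_eq algebra_simps del: fps_sub_nth fps_add_nth)
  moreover have "CI2 Et $ Suc (2 * m) $ 0 = - (pi / 2) * eta m 0"
    using CI2_Et_nth[of m 0] by simp
  ultimately have "(Phi * fps_sin pi) $ Suc (2 * m) = - (pi / 2) * eta m 0" by simp
  thus ?thesis by simp
qed

section \<open>Monodromy\<close>

text \<open>The coefficient of \<open>S1_10\<close> at \<open>A10 m k\<close>. The binomial vanishes
  for \<open>k = 0\<close>, which encodes the condition n >= 1 there.\<close>

definition s10c :: "nat \<Rightarrow> nat \<Rightarrow> real" where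
  "s10c m k = - 4 * (lam (2 * (m + k)) * real ((2 * m + 2 * k) choose (2 * m + 1)))"

text \<open>Odd powers of y are doubled in Lambda(x+y) - Lambda(x-y); the binomial of the expansion
  is the one in \<open>S1_10\<close>.\<close>

lemma Del_nth: "Del $ Suc (2 * m) $ Suc (2 * k) = - (1 / 2) * s10c m (Suc k)"
  by (simp add: Del_def Hs_def Lam_def s10c_def)

definition pc :: "nat \<Rightarrow> nat \<Rightarrow> real" where
  "pc m k = 2 * eta m k + (\<Sum>i\<le>k. s10c m i * ((-1) ^ (k - i) * tau (k - i) 0))"

definition Qc :: "nat \<Rightarrow> nat \<Rightarrow> real" where
  "Qc m n = (\<Sum>k\<le>n. pc m k * ((-1) ^ (n - k) * tau (n - k) 0))"

text \<open>Up to the factor -pi^2/2 this is a coefficient of the symmetric series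
  \<open>Qb\<close>; its two factors sin(pi y) stand for the two factors \<open>pj pD Z_one\<close>
  of hypothesis II.\<close>

lemma Qc_sym: "Qc m n = Qc n m"
proof -
  have "Qb $ Suc (2 * m) $ Suc (2 * n) = - (pi ^ 2 / 2) * Qc m n" for m n
  proof -
    define F where "F = 2 * CI2 Et $ Suc (2 * m) + Del $ Suc (2 * m) * fps_sin pi"
    have Q: "Qb = (2 * CI2 Et + Del * sy) * sy" by (simp add: Qb_def algebra_simps)
    have two: "(2 * CI2 Et) $ a = 2 * CI2 Et $ a" for a by (simp only: mult_2 fps_add_nth)
    have 1: "Qb $ Suc (2 * m) = F * fps_sin pi"
      unfolding Q iy_right_nth fps_add_nth two F_def ..
    have F: "F $ (2 * k) = - pi / 2 * pc m k" for k
    proof -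
      \<comment> \<open>The coefficient of y^(2i+1) in \<open>Del\<close> belongs to
        \<open>s10c m (Suc i)\<close>, hence the shift; the omitted term has
        \<open>s10c m 0 = 0\<close>.\<close>
      have A: "(\<Sum>i\<le>k. s10c m i * ((-1) ^ (k - i) * tau (k - i) 0)) = (\<Sum>i<k. s10c m (Suc i) * ((-1) ^ (k - Suc i) * tau (k - Suc i) 0))"
      proof (cases k)
        case 0
        thus ?thesis by (simp add: s10c_def)
      next
        case (Suc j)
        have "s10c m 0 = 0" by (simp add: s10c_def)
        thus ?thesis unfolding Suc by (simp add: sum.atMost_Suc_shift lessThan_Suc_atMost del: sum.atMost_Suc)
      qed
      have modB: "F $ (2 * k) = 2 * CI2 Et $ Suc (2 * m) $ (2 * k) + (Del $ Suc (2 * m) * fps_sin pi) $ (2 * k)"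
        by (simp only: F_def mult_2 fps_add_nth)
      show ?thesis
      proof -
        have "(Del $ Suc (2 * m) * fps_sin pi) $ (2 * k) = (- pi / 2) * (\<Sum>i<k. s10c m (Suc i) * ((-1) ^ (k - Suc i) * tau (k - Suc i) 0))"
          unfolding times_sin_pi_nth(2) Del_nth sum_distrib_left by (rule sum.cong[OF refl]) simp
        moreover have "2 * CI2 Et $ Suc (2 * m) $ (2 * k) = (- pi / 2) * (2 * eta m k)"
          unfolding CI2_Et_nth by simp
        ultimately show ?thesis using A modB unfolding pc_def by (simp only: distrib_left)
      qed
    qed
    show ?thesis
      unfolding 1 times_sin_pi_nth(1) F Qc_def sum_distrib_left
      by (rule sum.cong[OF refl]) (simp add: power2_eq_square)
  qed
  moreover have "Qb $ Suc (2 * m) $ Suc (2 * n) = Qb $ Suc (2 * n) $ Suc (2 * m)"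
    by (metis tr_Qb tr_nth)
  ultimately show ?thesis by simp
qed

text \<open>For words built from blocks the relevant splittings are indexed by the number of blocks
  on the left, so a noncommutative product becomes an ordinary convolution.\<close>

lemma cf_times_conv:
  assumes "\<And>u v. cf X u \<noteq> 0 \<Longrightarrow> cf Y v \<noteq> 0 \<Longrightarrow> u @ v = w \<Longrightarrow> \<exists>k\<le>n. u = f k \<and> v = g k"
    and "\<And>k. k \<le> n \<Longrightarrow> f k @ g k = w" and "inj_on f {..n :: nat}"
  shows "cf (X * Y) w = (\<Sum>k\<le>n. cf X (f k) * cf Y (g k))"
proof -
  have "cf (X * Y) w = (\<Sum>(u, v)\<in>(\<lambda>k. (f k, g k)) ` {..n}. cf X u * cf Y v)"
    unfolding cf_times_splits
  proof (rule sum.mono_neutral_right)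
    show "finite {(u, v). w = u @ v}" by (rule finite_splits)
    show "(\<lambda>k. (f k, g k)) ` {..n} \<subseteq> {(u, v). w = u @ v}" using assms(2) by auto
    show "\<forall>i\<in>{(u, v). w = u @ v} - (\<lambda>k. (f k, g k)) ` {..n}. (case i of (u, v) \<Rightarrow> cf X u * cf Y v) = 0"
      using assms(1) by (force simp: image_iff)
  qed
  also have "\<dots> = (\<Sum>k\<le>n. cf X (f k) * cf Y (g k))"
    using assms(3) by (subst sum.reindex) (auto simp: inj_on_def)
  finally show ?thesis .
qed

lemma wpow_add: "wpow w (m + n) = wpow w m @ wpow w n"
  by (induction m) (simp_all add: wpow_Suc)

lemma A10_0_Suc: "A10 0 k = X1 # wpow [X1, X0] k" "A10 (Suc m) k = X1 # X0 # A10 m k"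
  by (simp_all add: A10_def wpow_Suc)

lemma A10_neq: "A10 0 k \<noteq> A10 (Suc m) k'"
  by (cases k) (auto simp: A10_0_Suc wpow_Suc)

lemma A10_inj: "A10 m k = A10 m' k' \<longleftrightarrow> m = m' \<and> k = k'"
proof
  assume eq: "A10 m k = A10 m' k'"
  have "m = m'" using eq
  proof (induction m arbitrary: m')
    case 0
    thus ?case using A10_neq by (cases m') auto
  next
    case (Suc m)
    thus ?case using A10_neq[of k' m k] by (cases m') (auto simp: A10_0_Suc)
  qed
  moreover have "length (A10 m k) = length (A10 m' k')" using eq by simp
  ultimately show "m = m' \<and> k = k'" by (simp add: A10_def)
qed auto

lemma S1_10_A10: "S1_10 (A10 m k) = s10c m k"
proof -
  have set: "{(m', n). n \<ge> 1 \<and> wpow [X1, X0] m' @ [X1] @ wpow [X1, X0] n = A10 m k} = (if k \<ge> 1 then {(m, k)} else {})"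
    unfolding A10_def[symmetric] A10_inj by auto
  show ?thesis
  proof (cases "k \<ge> 1")
    case True
    have "2 * (m + k) \<noteq> 0" using True by simp
    thus ?thesis unfolding S1_10_def set using True
      by (simp add: s10c_def lam_def mult.assoc add_ac)
  next
    case False
    thus ?thesis unfolding S1_10_def set by (simp add: s10c_def)
  qed
qed

lemma S0_00_wpow: "S0_00 (X0 # wpow [X1, X0] k) = (if k = 0 then 0 else - 4 * zeta (2 * k + 1))"
proof -
  have "wpow [X0, X1] n @ [X0] = X0 # wpow [X1, X0] k \<longleftrightarrow> n = k" for n
  proof
    assume "wpow [X0, X1] n @ [X0] = X0 # wpow [X1, X0] k"
    hence "length (X0 # wpow [X1, X0] n) = length (X0 # wpow [X1, X0] k)" by (simp only: wpow_shift)
    thus "n = k" by simp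
  qed (simp add: wpow_shift)
  hence "{n. n \<ge> 1 \<and> wpow [X0, X1] n @ [X0] = X0 # wpow [X1, X0] k} = (if k = 0 then {} else {k})"
    by auto
  thus ?thesis by (simp add: S0_00_def)
qed

lemma S0_00_form:
  assumes "S0_00 u \<noteq> 0" obtains k where "u = X0 # wpow [X1, X0] k"
proof -
  have "{n. n \<ge> 1 \<and> wpow [X0, X1] n @ [X0] = u} \<noteq> {}"
    using assms unfolding S0_00_def by (metis mult_zero_right sum.empty)
  thus ?thesis using that by (auto simp: wpow_shift)
qed

lemma S1_10_form:
  assumes "S1_10 u \<noteq> 0" obtains m k where "u = A10 m k"
proof -
  have "{(m, n). n \<ge> 1 \<and> wpow [X1, X0] m @ [X1] @ wpow [X1, X0] n = u} \<noteq> {}"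
    using assms unfolding S1_10_def by (metis (no_types, lifting) mult_zero_right sum.empty)
  thus ?thesis using that by (auto simp: A10_def)
qed

lemma cf_pD: "cf (pj pD Z_one) (wpow [X1, X0] n) = of_real ((-1) ^ n * tau n 0)"
  by (auto simp: cf_pj pD_iff Z_one_wpow)

lemma pD_form: "cf (pj pD Z) v \<noteq> 0 \<Longrightarrow> \<exists>j. v = wpow [X1, X0] j"
  by (auto simp: cf_pj pD_iff split: if_splits)

lemma cf_two: "cf (2 * X) w = 2 * cf X w"
  by (simp only: mult_2 cf_ring)

text \<open>At X0 (X1 X0)^n this is \<open>eta_0\<close>, because multiplying by
  \<open>pj pD Z_one\<close> acts as multiplying by sin(pi u) / pi; at other words both sides
  vanish.\<close>

lemma condition_I: "cser S0_00 * pj pD Z_one = - (2 * pj pb Z_one)"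
proof (rule ser_eqI)
  fix w
  have rhs: "cf (- (2 * pj pb Z_one)) w = (if pb w then - 2 * cf Z_one w else 0)"
    by (simp add: cf_two cf_pj del: cf_times_Nil)
  show "cf (cser S0_00 * pj pD Z_one) w = cf (- (2 * pj pb Z_one)) w"
  proof (cases "pb w")
    case True
    then obtain n where w: "w = X0 # wpow [X1, X0] n" by (auto simp: pb_iff)
    have "cf (cser S0_00 * pj pD Z_one) w = (\<Sum>k\<le>n. cf (cser S0_00) (X0 # wpow [X1, X0] k) * cf (pj pD Z_one) (wpow [X1, X0] (n - k)))"
    proof (rule cf_times_conv)
      fix u v assume u: "cf (cser S0_00) u \<noteq> 0" and v: "cf (pj pD Z_one) v \<noteq> 0" and uv: "u @ v = w"
      obtain k j where kj: "u = X0 # wpow [X1, X0] k" "v = wpow [X1, X0] j"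
        using u pD_form[OF v] by (auto elim: S0_00_form)
      have "length u + length v = length w" using uv by (metis length_append)
      hence "n = k + j" by (simp add: kj w)
      thus "\<exists>k\<le>n. u = X0 # wpow [X1, X0] k \<and> v = wpow [X1, X0] (n - k)"
        using kj by (intro exI[of _ k]) auto
    next
      fix k assume "k \<le> n"
      thus "(X0 # wpow [X1, X0] k) @ wpow [X1, X0] (n - k) = w"
        unfolding w by (simp flip: wpow_add)
    next
      show "inj_on (\<lambda>k. X0 # wpow [X1, X0] k) {..n}"
        by (auto simp: inj_on_def dest!: arg_cong[where f = length])
    qed
    also have "\<dots> = of_real (- 4 * (\<Sum>k\<le>n. Phi $ (2 * k) * ((-1) ^ (n - k) * tau (n - k) 0)))"
      unfolding cf_pD cf_cser S0_00_wpow sum_distrib_left of_real_sum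
      by (rule sum.cong[OF refl]) (simp add: Phi_def)
    also have "(\<Sum>k\<le>n. Phi $ (2 * k) * ((-1) ^ (n - k) * tau (n - k) 0)) = (Phi * fps_sin pi) $ Suc (2 * n) / pi"
      unfolding times_sin_pi_nth(1) sum_divide_distrib by (rule sum.cong[OF refl]) simp
    also have "of_real (- 4 * ((Phi * fps_sin pi) $ Suc (2 * n) / pi)) = complex_of_real (2 * eta n 0)"
      unfolding eta_0 by simp
    also have "\<dots> = - 2 * cf Z_one w" unfolding w Z_one_pb Z_one_A10_eta by simp
    finally show ?thesis using True rhs by simp
  next
    case False
    have "\<not> cf (cser S0_00 * pj pD Z_one) w \<noteq> 0"
    proof
      assume "cf (cser S0_00 * pj pD Z_one) w \<noteq> 0"
      then obtain u v where uv: "w = u @ v" "S0_00 u \<noteq> 0" "cf (pj pD Z_one) v \<noteq> 0"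
        by (auto elim!: cf_times_nonzeroE)
      obtain k j where kj: "u = X0 # wpow [X1, X0] k" "v = wpow [X1, X0] j"
        using uv pD_form by (metis S0_00_form)
      have "w = X0 # wpow [X1, X0] (k + j)" by (simp add: uv kj wpow_add)
      with False show False by (auto simp: pb_iff)
    qed
    thus ?thesis using False rhs by simp
  qed
qed

definition PP :: ser where "PP = 2 * pj pH1 Z_one + cser S1_10 * pj pD Z_one"

lemma A10_wpow: "A10 m k @ wpow [X1, X0] j = A10 m (k + j)"
  by (simp add: A10_def wpow_add)

lemma PP_form: "cf PP u \<noteq> 0 \<Longrightarrow> \<exists>m k. u = A10 m k"
proof -
  assume "cf PP u \<noteq> 0"
  then consider "cf (pj pH1 Z_one) u \<noteq> 0" | "cf (cser S1_10 * pj pD Z_one) u \<noteq> 0"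
    unfolding PP_def cf_ring cf_two by fastforce
  thus ?thesis
  proof cases
    case 1
    thus ?thesis by (auto simp: cf_pj pH1_iff split: if_splits)
  next
    case 2
    then obtain p q where pq: "u = p @ q" "S1_10 p \<noteq> 0" "cf (pj pD Z_one) q \<noteq> 0"
      by (auto elim!: cf_times_nonzeroE)
    obtain m k j where "p = A10 m k" "q = wpow [X1, X0] j"
      using pq pD_form by (metis S1_10_form)
    thus ?thesis using pq A10_wpow by auto
  qed
qed

lemma cf_PP: "cf PP (A10 m k) = of_real (pc m k)"
proof -
  have "cf (cser S1_10 * pj pD Z_one) (A10 m k) = (\<Sum>i\<le>k. cf (cser S1_10) (A10 m i) * cf (pj pD Z_one) (wpow [X1, X0] (k - i)))"
  proof (rule cf_times_conv)
    fix u v assume u: "cf (cser S1_10) u \<noteq> 0" and v: "cf (pj pD Z_one) v \<noteq> 0" and uv: "u @ v = A10 m k"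
    obtain m' k' j where kj: "u = A10 m' k'" "v = wpow [X1, X0] j"
      using u pD_form[OF v] by (auto elim: S1_10_form)
    hence "m' = m" "k = k' + j" using uv by (auto simp: A10_wpow A10_inj)
    thus "\<exists>i\<le>k. u = A10 m i \<and> v = wpow [X1, X0] (k - i)"
      using kj by (intro exI[of _ k']) auto
  qed (auto simp: A10_wpow A10_inj inj_on_def)
  also have "\<dots> = of_real (\<Sum>i\<le>k. s10c m i * ((-1) ^ (k - i) * tau (k - i) 0))"
    unfolding cf_pD cf_cser S1_10_A10 by simp
  finally have 1: "cf (cser S1_10 * pj pD Z_one) (A10 m k) = \<dots>" .
  have "pH1 (A10 m k)" by (auto simp: pH1_iff)
  hence "cf (2 * pj pH1 Z_one) (A10 m k) = of_real (2 * eta m k)"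
    by (simp add: cf_two cf_pj Z_one_A10_eta)
  thus ?thesis unfolding PP_def cf_ring 1 by (simp add: pc_def)
qed

definition ww :: "nat \<Rightarrow> nat \<Rightarrow> word" where "ww m n = A10 m 0 @ [X1] @ wpow [X0, X1] n"

lemma A10_snoc: "(A10 m k @ [X1]) @ wpow [X0, X1] j = ww m (k + j)"
proof -
  have "wpow [X1, X0] k @ [X1] = X1 # wpow [X0, X1] k" by (rule wpow_shift)
  thus ?thesis by (simp add: A10_def ww_def wpow_add)
qed

lemma rev_ww: "rev (ww m n) = ww n m"
proof -
  have "rev (wpow [X0, X1] n @ []) = wpow [X1, X0] n" for n by (simp add: rev_wpow)
  thus ?thesis by (simp add: ww_def A10_def rev_wpow)
qed

lemma A10_neq_ww: "ww m n = ww m' n' \<longleftrightarrow> m = m' \<and> n = n'"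
proof
  assume eq: "ww m n = ww m' n'"
  have ww: "ww 0 n = X1 # X1 # wpow [X0, X1] n" "ww (Suc m) n = X1 # X0 # ww m n" for m n
    by (simp_all add: ww_def A10_0_Suc)
  have "m = m'" using eq
  proof (induction m arbitrary: m')
    case 0
    thus ?case by (cases m') (auto simp: ww)
  next
    case (Suc m)
    thus ?case by (cases m') (auto simp: ww)
  qed
  moreover have "length (ww m n) = length (ww m' n')" using eq by simp
  ultimately show "m = m' \<and> n = n'" by (simp add: ww_def A10_def)
qed auto

lemma cf_WW: "cf (PP * lt X1 * rv (pj pD Z_one)) (ww m n) = of_real (Qc m n)"
proof -
  have snoc: "\<exists>m k. u = A10 m k @ [X1]" if u: "cf (PP * lt X1) u \<noteq> 0" for u
  proof (cases u rule: rev_cases)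
    case Nil
    thus ?thesis using u by (simp add: cf_lt)
  next
    case (snoc a x)
    hence "x = X1" "cf PP a \<noteq> 0" using u by (auto simp: cf_times_lt_snoc split: if_splits)
    thus ?thesis using PP_form snoc by auto
  qed
  have rvD: "\<exists>j. v = wpow [X0, X1] j" if "cf (rv (pj pD Z_one)) v \<noteq> 0" for v
  proof -
    obtain j where "rev v = wpow [X1, X0] j" using \<open>cf (rv (pj pD Z_one)) v \<noteq> 0\<close> pD_form by auto
    thus ?thesis by (metis rev_rev_ident rev_wpow)
  qed
  have "cf (PP * lt X1 * rv (pj pD Z_one)) (ww m n) =
     (\<Sum>k\<le>n. cf (PP * lt X1) (A10 m k @ [X1]) * cf (rv (pj pD Z_one)) (wpow [X0, X1] (n - k)))"
  proof (rule cf_times_conv)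
    fix u v assume u: "cf (PP * lt X1) u \<noteq> 0" and v: "cf (rv (pj pD Z_one)) v \<noteq> 0" and uv: "u @ v = ww m n"
    obtain m' k' j where kj: "u = A10 m' k' @ [X1]" "v = wpow [X0, X1] j"
      using snoc[OF u] rvD[OF v] by auto
    hence "m' = m" "n = k' + j" using uv A10_snoc[of m' k' j] by (auto simp: A10_neq_ww)
    thus "\<exists>k\<le>n. u = A10 m k @ [X1] \<and> v = wpow [X0, X1] (n - k)"
      using kj by (intro exI[of _ k']) auto
  next
    fix k assume "k \<le> n"
    thus "(A10 m k @ [X1]) @ wpow [X0, X1] (n - k) = ww m n" unfolding A10_snoc by simp
  qed (auto simp: A10_inj inj_on_def)
  also have "\<dots> = of_real (Qc m n)"
    unfolding cf_times_lt_snoc cf_PP cf_maps rev_wpow cf_pD Qc_def by simp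
  finally show ?thesis .
qed

lemma WW_form: "cf (PP * lt X1 * rv (pj pD Z_one)) w \<noteq> 0 \<Longrightarrow> \<exists>m n. w = ww m n"
proof -
  assume "cf (PP * lt X1 * rv (pj pD Z_one)) w \<noteq> 0"
  then obtain u v where uv: "w = u @ v" "cf (PP * lt X1) u \<noteq> 0" "cf (rv (pj pD Z_one)) v \<noteq> 0"
    by (rule cf_times_nonzeroE)
  obtain a where a: "u = a @ [X1]" "cf PP a \<noteq> 0"
    using uv(2) by (cases u rule: rev_cases) (auto simp: cf_times_lt_snoc cf_lt split: if_splits)
  obtain m k where "a = A10 m k" using PP_form[OF a(2)] by auto
  moreover obtain j where "v = wpow [X0, X1] j" using uv(3) pD_form by (metis cf_maps(1) rev_rev_ident rev_wpow)
  ultimately show ?thesis using uv a A10_snoc by auto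
qed

text \<open>The support consists of the words \<open>ww m n\<close>, and reversal exchanges their
  two indices, so the symmetry of \<open>Qc\<close> is all that is needed.\<close>

lemma condition_II: "rv (PP * lt X1 * rv (pj pD Z_one)) = PP * lt X1 * rv (pj pD Z_one)"
proof (rule ser_eqI)
  fix w
  define W where "W = PP * lt X1 * rv (pj pD Z_one)"
  show "cf (rv (PP * lt X1 * rv (pj pD Z_one))) w = cf (PP * lt X1 * rv (pj pD Z_one)) w"
    unfolding W_def[symmetric]
  proof (cases "\<exists>m n. w = ww m n")
    case True
    then obtain m n where "w = ww m n" by blast
    thus "cf (rv W) w = cf W w" by (simp add: W_def rev_ww cf_WW Qc_sym[of m n])
  next
    case False
    hence "\<nexists>m n. rev w = ww m n" by (metis rev_rev_ident rev_ww)
    hence "cf W (rev w) = 0" "cf W w = 0" using False WW_form unfolding W_def by blast+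
    thus "cf (rv W) w = cf W w" by simp
  qed
qed

lemma core_Z_one: "core Z_one"
proof
  show "modB (cser S0_00 * pj pD Z_one) = - modB (2 * pj pb Z_one)" unfolding condition_I by simp
  show "modB_rv (modB ((2 * pj pH1 Z_one + cser S1_10 * pj pD Z_one) * lt X1 * rv (pj pD Z_one)))
           = modB ((2 * pj pH1 Z_one + cser S1_10 * pj pD Z_one) * lt X1 * rv (pj pD Z_one))"
    using condition_II by (simp add: PP_def)
qed

definition Nm :: ser where "Nm = Z_one * lt X1 * Z_one_inv"

text \<open>Since \<open>Sh\<close> equals its own reversal, palindromicity of
  \<open>Sh * Nm\<close> is a commutation rule.\<close>

lemma Sh_Nm: "modB Sh * modB Nm = modB_rv (modB Nm) * modB Sh"
  using core.SN_palindrome[OF core_Z_one] by (simp add: Nm_def Z_one_inv_def modB_rv_times)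

text \<open>The constants by which a branch may be multiplied without changing the coefficients
  of \<open>sv_ser\<close> at the words of \<open>B1\<close>.\<close>

definition stab_Sh :: "ser set" where
  "stab_Sh = {D. cf D [] = 1 \<and> modB (cj (rv D) * Sh * D) = modB Sh}"

lemma stab_Sh_mult: "D \<in> stab_Sh \<Longrightarrow> D' \<in> stab_Sh \<Longrightarrow> D * D' \<in> stab_Sh"
proof -
  assume *: "D \<in> stab_Sh" "D' \<in> stab_Sh"
  have "modB (cj (rv (D * D')) * Sh * (D * D')) = modB (cj (rv D')) * modB (cj (rv D) * Sh * D) * modB D'"
    by (simp add: modB_times rv_times cj_times mult.assoc)
  also have "\<dots> = modB (cj (rv D') * Sh * D')" using * by (simp add: stab_Sh_def modB_times)
  finally show ?thesis using * by (simp add: stab_Sh_def)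
qed

lemma one_stab_Sh: "1 \<in> stab_Sh"
  by (simp add: stab_Sh_def cf_one)

text \<open>If conjugation inverts \<open>M\<close>, then \<open>cj (rv M)\<close> inverts
  \<open>rv M\<close>, and invariance of \<open>Sh\<close> turns into a commutation rule.\<close>

lemma stab_Sh_intertwine:
  assumes "modB Sh * modB M = modB_rv (modB M) * modB Sh" "cj M * M = 1" "M * cj M = 1" "cf M [] = 1"
  shows "M \<in> stab_Sh"
proof -
  have "rv (M * cj M) = 1" by (simp only: assms) simp
  hence "modB (cj (rv M)) * modB_rv (modB M) = 1" by (simp add: rv_times flip: modB_times)
  hence "modB (cj (rv M) * Sh * M) = modB Sh"
    using assms(1) by (simp add: modB_times mult.assoc) (simp flip: mult.assoc)
  thus ?thesis using assms by (simp add: stab_Sh_def)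
qed

section \<open>The two monodromy generators preserve the middle series\<close>

lemma modB_ex_X0: "modB (ex X0 c) = 1 + modB (cst c) * modB (lt X0)"
proof -
  have "cf (ex X0 c) w = cf (1 + cst c * lt X0) w" if "w \<in> B1" for w
  proof (cases "length w \<ge> 2")
    case True
    then obtain x y v where w: "w = x # y # v"
      by (metis Suc_le_length_iff numeral_2_eq_2)
    have "w \<noteq> replicate (length w) X0"
    proof
      assume "w = replicate (length w) X0"
      hence "w = X0 # X0 # replicate (length v) X0" by (simp add: w)
      thus False using that by (simp add: B1_iff)
    qed
    thus ?thesis by (auto simp: w cf_ex cf_one cf_lt)
  next
    case False
    thus ?thesis by (cases w; cases "tl w") (auto simp: cf_ex cf_one cf_lt)
  qed
  hence "modB (ex X0 c) = modB (1 + cst c * lt X0)" by (simp only: modB_eq_iff) blast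
  thus ?thesis by (simp add: modB_times)
qed

lemma modB_ex_X1: "modB (ex X1 c) = 1 + modB (cst c) * modB (lt X1) + modB (cst (c ^ 2 / 2)) * (modB (lt X1) * modB (lt X1))"
proof -
  have "cf (ex X1 c) w = cf (1 + cst c * lt X1 + cst (c ^ 2 / 2) * (lt X1 * lt X1)) w" if "w \<in> B1" for w
  proof (cases "length w \<ge> 3")
    case True
    then obtain x y z v where w: "w = x # y # z # v"
      by (metis Suc_le_length_iff numeral_3_eq_3)
    have "w \<noteq> replicate (length w) X1"
    proof
      assume "w = replicate (length w) X1"
      hence "w = X1 # X1 # X1 # replicate (length v) X1" by (simp add: w)
      thus False using that by (simp add: B1_iff)
    qed
    thus ?thesis by (auto simp: w cf_ex cf_one cf_lt cf_lt_times_Cons)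
  next
    case False
    thus ?thesis
      by (cases w; cases "tl w"; cases "tl (tl w)")
         (auto simp: cf_ex cf_one cf_lt cf_lt_times_Cons numeral_2_eq_2)
  qed
  hence "modB (ex X1 c) = modB (1 + cst c * lt X1 + cst (c ^ 2 / 2) * (lt X1 * lt X1))" by (simp only: modB_eq_iff) blast
  thus ?thesis by (simp add: modB_times)
qed

lemma modB_cst_commute: "modB (cst c) * y = y * modB (cst c)"
  by transfer (simp add: eqB_def)

lemma modB_cst_left: "y * (modB (cst c) * z) = modB (cst c) * (y * z)"
  unfolding mult.assoc[symmetric] by (simp only: modB_cst_commute)

text \<open>Most products create X0 X0. In the two that do not, moving X0 from right to left
  exchanges the block counts of the remaining word, and the binomial is symmetric under that
  exchange.\<close>

lemma Sh_X0: "modB Sh * modB (lt X0) = modB (lt X0) * modB Sh"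
proof -
  have z: "modB (cser S0_00) * modB (lt X0) = 0" "modB (lt X0) * modB (cser S0_00) = 0"
    "modB (cser S1_10) * modB (lt X0) = 0" "modB (lt X0) * modB (cser S1_01) = 0"
    "modB (cser S1_00) * modB (lt X0) = 0" "modB (lt X0) * modB (cser S1_00) = 0"
    by (rule modB_times_eq_0, rule not_B1_zeros; auto simp: cf_lt split: if_splits dest: S0_00_nonzero S1_10_nonzero S1_01_nonzero S1_00_nonzero)+
  have shift: "rev (A10 m (Suc k)) @ [X0] = X0 # A10 k (Suc m)" for m k
  proof -
    have "rev (A10 m (Suc k)) @ [X0] = wpow [X0, X1] (Suc k) @ [X1] @ (wpow [X0, X1] m @ [X0])"
      by (simp add: A10_def rev_wpow)
    also have "\<dots> = wpow [X0, X1] k @ [X0] @ [X1] @ [X1] @ X0 # wpow [X1, X0] m"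
      by (simp add: wpow_Suc2 wpow_shift)
    also have "\<dots> = (wpow [X0, X1] k @ [X0]) @ [X1] @ wpow [X1, X0] (Suc m)" by (simp add: wpow_Suc)
    finally show ?thesis by (simp add: wpow_shift A10_def)
  qed
  have "cf (cser S1_01 * lt X0) w = cf (lt X0 * cser S1_10) w" for w
  proof (cases "\<exists>k m. w = X0 # A10 k (Suc m)")
    case True
    then obtain k m where w: "w = X0 # A10 k (Suc m)" by blast
    have "s10c m (Suc k) = s10c k (Suc m)"
    proof -
      have "(2 * m + 2 * Suc k) choose (2 * m + 1) = (2 * k + 2 * Suc m) choose (2 * k + 1)"
        by (subst binomial_symmetric) (auto simp: algebra_simps)
      thus ?thesis by (simp add: s10c_def add.commute)
    qed
    moreover have "cf (cser S1_01 * lt X0) w = of_real (s10c m (Suc k))"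
      unfolding w shift[symmetric] cf_times_lt_snoc by (simp add: S1_01_def ser_rev_def S1_10_A10)
    ultimately show ?thesis unfolding w cf_lt_times_Cons by (simp add: S1_10_A10)
  next
    case False
    have s0: "S1_10 (A10 m 0) = 0" for m by (simp add: S1_10_A10 s10c_def)
    have "cf (cser S1_01 * lt X0) w = 0"
    proof (cases w rule: rev_cases)
      case (snoc u x)
      have "S1_10 (rev u) = 0" if "x = X0"
      proof (rule ccontr)
        assume nz: "S1_10 (rev u) \<noteq> 0"
        then obtain m k where mk: "rev u = A10 m k" by (rule S1_10_form)
        then obtain k' where "k = Suc k'" using nz s0 by (cases k) auto
        hence "w = X0 # A10 k' (Suc m)" using shift[of m k'] mk snoc that by (metis rev_rev_ident)
        with False show False by blast
      qed
      thus ?thesis by (auto simp: snoc cf_times_lt_snoc S1_01_def ser_rev_def)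
    qed (simp add: cf_lt)
    moreover have "cf (lt X0 * cser S1_10) w = 0"
    proof (cases w)
      case (Cons x v)
      have "S1_10 v = 0" if "x = X0"
      proof (rule ccontr)
        assume nz: "S1_10 v \<noteq> 0"
        then obtain m k where mk: "v = A10 m k" by (rule S1_10_form)
        then obtain k' where "k = Suc k'" using nz s0 by (cases k) auto
        with False mk Cons that show False by blast
      qed
      thus ?thesis by (auto simp: Cons cf_lt_times_Cons)
    qed (simp add: cf_lt)
    ultimately show ?thesis by simp
  qed
  hence "cser S1_01 * lt X0 = lt X0 * cser S1_10" by (intro ser_eqI)
  hence "modB (cser S1_01) * modB (lt X0) = modB (lt X0) * modB (cser S1_10)" by (simp flip: modB_times)
  with z show ?thesis by (simp add: Sh_eq algebra_simps)
qed


lemma ex_assoc: "ex x a * (ex x (- a) * Y) = Y" "ex x (- a) * (ex x a * Y) = Y"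
  by (simp_all add: ex_inverse flip: mult.assoc)

lemma Z_one_Z_one_inv_assoc: "Z_one_inv * (Z_one * Y) = Y"
  by (simp add: Z_one_Z_one_inv flip: mult.assoc)

lemma ex_X0_stab_Sh: "ex X0 (of_real a * \<i>) \<in> stab_Sh"
proof (rule stab_Sh_intertwine)
  show "modB Sh * modB (ex X0 (of_real a * \<i>)) = modB_rv (modB (ex X0 (of_real a * \<i>))) * modB Sh"
  proof -
    have "modB_rv (modB (ex X0 c)) = modB (ex X0 c)" for c by simp
    thus ?thesis by (simp add: modB_ex_X0 distrib_left distrib_right modB_cst_left Sh_X0 mult.assoc del: modB_rv_modB)
  qed
qed (simp_all add: ex_inverse)

text \<open>In the quotient the element is 1 + c n + c^2 n^2 / 2 with n the class of
  \<open>Nm\<close>, and the commutation rule for n implies the one for n^2.\<close>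

lemma ex_X1_stab_Sh: "Z_one * ex X1 (of_real a * \<i>) * Z_one_inv \<in> stab_Sh"
proof (rule stab_Sh_intertwine)
  define c where "c = of_real a * \<i>"
  have cc: "cnj c = - c" by (simp add: c_def)
  have E: "cf Z_one_inv [] = 1" "cj Z_one_inv = Z_one_inv" by (simp_all add: Z_one_inv_eq_sw flip: ser_maps_ring(24))
  show "cf (Z_one * ex X1 (of_real a * \<i>) * Z_one_inv) [] = 1" by (simp add: E)
  have "cj (Z_one * ex X1 c * Z_one_inv) * (Z_one * ex X1 c * Z_one_inv) = Z_one * ex X1 (- c) * (Z_one_inv * Z_one) * ex X1 c * Z_one_inv"
    by (simp add: cj_times E cc mult.assoc)
  thus "cj (Z_one * ex X1 (of_real a * \<i>) * Z_one_inv) * (Z_one * ex X1 (of_real a * \<i>) * Z_one_inv) = 1"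
    by (simp add: Z_one_Z_one_inv mult.assoc ex_assoc Z_one_Z_one_inv_assoc flip: c_def)
  have "(Z_one * ex X1 c * Z_one_inv) * cj (Z_one * ex X1 c * Z_one_inv) = Z_one * ex X1 c * (Z_one_inv * Z_one) * ex X1 (- c) * Z_one_inv"
    by (simp add: cj_times E cc mult.assoc)
  thus "(Z_one * ex X1 (of_real a * \<i>) * Z_one_inv) * cj (Z_one * ex X1 (of_real a * \<i>) * Z_one_inv) = 1"
    by (simp add: Z_one_Z_one_inv mult.assoc ex_assoc Z_one_Z_one_inv_assoc flip: c_def)
  define n where "n = modB Nm"
  have ZE: "modB Z_one * modB Z_one_inv = 1" "modB Z_one_inv * modB Z_one = 1" by (simp_all add: Z_one_Z_one_inv flip: modB_times)
  have n: "n = modB Z_one * modB (lt X1) * modB Z_one_inv" by (simp add: n_def Nm_def modB_times)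
  have nn: "n * n = modB Z_one * (modB (lt X1) * modB (lt X1)) * modB Z_one_inv"
    unfolding n using ZE(2) by (metis mult.assoc mult.right_neutral)
  have M: "modB (Z_one * ex X1 c * Z_one_inv) = 1 + modB (cst c) * n + modB (cst (c ^ 2 / 2)) * (n * n)"
    unfolding nn unfolding n modB_times modB_ex_X1
    by (simp add: distrib_left distrib_right ZE mult.assoc modB_cst_left)
  have sn: "modB Sh * n = modB_rv n * modB Sh" using Sh_Nm by (simp add: n_def)
  have snn: "modB Sh * (n * n) = modB_rv n * modB_rv n * modB Sh" by (metis sn mult.assoc)
  have "modB Sh * modB (Z_one * ex X1 c * Z_one_inv) = modB Sh + modB (cst c) * (modB Sh * n) + modB (cst (c ^ 2 / 2)) * (modB Sh * (n * n))"
    unfolding M by (simp add: distrib_left modB_cst_left)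
  also have "\<dots> = modB_rv (modB (Z_one * ex X1 c * Z_one_inv)) * modB Sh"
  proof -
    have "modB_rv (modB (cst c) * y) = modB (cst c) * modB_rv y" for c y
      by (simp add: modB_rv_times modB_cst_commute)
    thus ?thesis unfolding M sn snn by (simp add: distrib_right modB_rv_times mult.assoc modB_cst_left)
  qed
  finally show "modB Sh * modB (Z_one * ex X1 (of_real a * \<i>) * Z_one_inv) = modB_rv (modB (Z_one * ex X1 (of_real a * \<i>) * Z_one_inv)) * modB Sh"
    by (simp only: c_def)
qed

section \<open>The global function and its derivatives\<close>

text \<open>The slit plane and two half planes that bridge its cuts cover the plane without 0 and 1.
  Every index above 1 denotes the right half plane, so the family is total.\<close>

definition chart_dom :: "nat \<Rightarrow> complex set" where
  "chart_dom i = (if i = 0 then slit_plane else if i = 1 then {z. Re z < 0} else {z. Re z > 1})"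
definition chart_sol :: "nat \<Rightarrow> complex \<Rightarrow> ser" where
  "chart_sol i = (if i = 0 then L_ser else if i = 1 then L_left else L_right)"

lemma open_chart_dom: "open (chart_dom i)"
  by (simp add: chart_dom_def open_slit open_halfspace_Re_lt open_halfspace_Re_gt)

lemma KZ_sol_chart_sol: "KZ_sol (chart_dom i) (chart_sol i)"
  by (simp add: chart_dom_def chart_sol_def KZ_sol_L_ser KZ_sol_L_left KZ_sol_L_right)

lemma chart_dom_cover: "z \<notin> {0, 1} \<Longrightarrow> \<exists>i. z \<in> chart_dom i"
proof -
  assume "z \<notin> {0, 1}"
  hence "z \<in> slit_plane \<or> Re z < 0 \<or> Re z > 1" by (auto simp: slit_iff complex_eq_iff)
  thus ?thesis
    by (elim disjE; rule_tac exI[of _ 0] exI[of _ 1] exI[of _ 2]) (auto simp: chart_dom_def)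
qed

text \<open>The two half planes are disjoint, so distinct charts meet only inside the slit plane.
  The factor is only locally constant: 1 on one side of the real axis, a generator or its inverse on
  the other.\<close>

lemma chart_sol_transition:
  assumes "z \<in> chart_dom i" "z \<in> chart_dom j"
  shows "\<exists>M\<in>stab_Sh. \<exists>V. open V \<and> z \<in> V \<and> V \<subseteq> chart_dom i \<inter> chart_dom j \<and> (\<forall>y\<in>V. chart_sol i y = M * chart_sol j y)"
proof -
  define e where "e = (\<lambda>a :: real. ex X0 (of_real a * \<i>))"
  define f where "f = (\<lambda>a :: real. Z_one * ex X1 (of_real a * \<i>) * Z_one_inv)"
  have inG: "1 \<in> stab_Sh" "e a \<in> stab_Sh" "f a \<in> stab_Sh" for a
    by (simp_all only: e_def f_def one_stab_Sh ex_X0_stab_Sh ex_X1_stab_Sh)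
  have e: "e (- a) * (e a * Y) = Y" for a Y by (simp add: e_def ex_assoc)
  have f: "f (- a) * (f a * Y) = Y" for a Y
    by (simp add: f_def mult.assoc Z_one_Z_one_inv_assoc ex_assoc) (simp add: Z_one_Z_one_inv flip: mult.assoc)
  have Plo: "L_left y = e (2 * pi) * L_ser y" if "Re y < 0" "Im y < 0" for y
    using L_left_lower[OF that] by (simp add: e_def)
  have Pup: "L_right y = f (2 * pi) * L_ser y" if "Re y > 1" "Im y > 0" for y
    using L_right_upper[OF that] by (simp add: f_def)
  have op: "open {y. Re y < 0 \<and> Im y < 0}" "open {y. Re y < 0 \<and> Im y > 0}"
    "open {y. Re y > 1 \<and> Im y < 0}" "open {y. Re y > 1 \<and> Im y > 0}"
    by (simp_all add: Collect_conj_eq open_Int open_halfspace_Re_lt open_halfspace_Re_gt open_halfspace_Im_lt open_halfspace_Im_gt)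
  have main: "\<exists>M\<in>stab_Sh. \<exists>M'\<in>stab_Sh. \<exists>V. open V \<and> z \<in> V \<and> V \<subseteq> slit_plane \<inter> chart_dom k \<and>
      (\<forall>y\<in>V. chart_sol k y = M * L_ser y \<and> L_ser y = M' * chart_sol k y)"
    if "z \<in> slit_plane" "z \<in> chart_dom k" for k
  proof -
    consider "k = 0" | "k = 1" "Im z < 0" | "k = 1" "Im z > 0" | "k > 1" "Im z < 0" | "k > 1" "Im z > 0"
    proof -
      have "k \<noteq> 0 \<Longrightarrow> Im z \<noteq> 0" using \<open>z \<in> slit_plane\<close> \<open>z \<in> chart_dom k\<close>
        by (auto simp: chart_dom_def slit_iff split: if_splits)
      hence "k = 0 \<or> Im z < 0 \<or> Im z > 0" by (meson linorder_neqE)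
      moreover have "k = 0 \<or> k = 1 \<or> k > 1" by auto
      ultimately show ?thesis using that by blast
    qed
    thus ?thesis
    proof cases
      case 1
      thus ?thesis using that open_slit inG(1)
        by (intro bexI[of _ 1] exI[of _ slit_plane]) (auto simp: chart_dom_def chart_sol_def)
    next
      case 2
      thus ?thesis using that op(1) e[of "2 * pi"]
        by (intro bexI[of _ "e (2 * pi)"] bexI[of _ "e (- (2 * pi))"] exI[of _ "{y. Re y < 0 \<and> Im y < 0}"] inG)
           (auto simp: chart_dom_def chart_sol_def slit_iff Plo)
    next
      case 3
      thus ?thesis using that op(2) inG(1)
        by (intro bexI[of _ 1] exI[of _ "{y. Re y < 0 \<and> Im y > 0}"])
           (auto simp: chart_dom_def chart_sol_def slit_iff L_left_upper)
    next
      case 4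
      thus ?thesis using that op(3) inG(1)
        by (intro bexI[of _ 1] exI[of _ "{y. Re y > 1 \<and> Im y < 0}"])
           (auto simp: chart_dom_def chart_sol_def slit_iff L_right_lower)
    next
      case 5
      thus ?thesis using that op(4) f[of "2 * pi"]
        by (intro bexI[of _ "f (2 * pi)"] bexI[of _ "f (- (2 * pi))"] exI[of _ "{y. Re y > 1 \<and> Im y > 0}"] inG)
           (auto simp: chart_dom_def chart_sol_def slit_iff Pup)
    qed
  qed
  show ?thesis
  proof (cases "chart_dom i = chart_dom j \<and> chart_sol i = chart_sol j")
    case True
    thus ?thesis using assms open_chart_dom[of i] inG(1) by (intro bexI[of _ 1] exI[of _ "chart_dom i"]) auto
  next
    case False
    have "i = 0 \<or> j = 0"
    proof (rule ccontr)
      assume n: "\<not> (i = 0 \<or> j = 0)"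
      have "if k = 1 then Re z < 0 else Re z > 1" if "z \<in> chart_dom k" "k \<noteq> 0" for k
        using that by (simp add: chart_dom_def split: if_splits)
      from this[OF assms(1)] this[OF assms(2)] n have "i = 1 \<longleftrightarrow> j = 1"
        by (auto split: if_splits)
      with n False show False by (simp only: chart_dom_def chart_sol_def) simp
    qed
    thus ?thesis
    proof
      assume i: "i = 0"
      have 0: "z \<in> slit_plane" "chart_dom i = slit_plane" "chart_sol i = L_ser" using assms(1) i by (simp_all add: chart_dom_def chart_sol_def)
      show ?thesis unfolding 0(2,3) using main[OF 0(1) assms(2)] by blast
    next
      assume j: "j = 0"
      have 0: "z \<in> slit_plane" "chart_dom j = slit_plane" "chart_sol j = L_ser" using assms(2) j by (simp_all add: chart_dom_def chart_sol_def)
      show ?thesis unfolding 0(2,3) using main[OF 0(1) assms(1)] by blast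
    qed
  qed
qed

definition sv_ser :: "ser \<Rightarrow> ser" where "sv_ser P = cj (rv P) * Sh * P"

lemma sv_ser_stab_Sh:
  assumes "D \<in> stab_Sh" "w \<in> B1"
  shows "cf (sv_ser (D * P)) w = cf (sv_ser P) w"
proof -
  have "modB (sv_ser (D * P)) = modB (cj (rv P)) * modB (cj (rv D) * Sh * D) * modB P"
    by (simp add: sv_ser_def modB_times rv_times cj_times mult.assoc)
  also have "\<dots> = modB (sv_ser P)" using assms by (simp add: stab_Sh_def sv_ser_def modB_times)
  finally show ?thesis using assms(2) by (simp add: modB_eq_iff)
qed

lemma Fhat_branch_sv_ser:
  assumes "\<And>u. A u (cnj z) = cnj (cf P u)" "\<And>u. C u z = cf P u"
  shows "Fhat_branch A C w z = cf (sv_ser P) w"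
  unfolding Fhat_branch_def sv_ser_def cf_times3_splits by (simp add: assms Sh_def)

text \<open>For words of \<open>B1\<close> the choice of chart is harmless, because solutions in two
  charts differ by an element of \<open>stab_Sh\<close>.\<close>

definition Fhat_glob :: "word \<Rightarrow> complex \<Rightarrow> complex" where
  "Fhat_glob w z = cf (sv_ser (chart_sol (SOME i. z \<in> chart_dom i) z)) w"

lemma Fhat_glob_eq:
  assumes "z \<in> chart_dom i" "w \<in> B1"
  shows "Fhat_glob w z = cf (sv_ser (chart_sol i z)) w"
proof -
  define k where "k = (SOME i. z \<in> chart_dom i)"
  have "z \<in> chart_dom k" unfolding k_def using assms(1) by (rule someI)
  then obtain M where "M \<in> stab_Sh" "chart_sol k z = M * chart_sol i z"
    using chart_sol_transition[of z k i] assms(1) by blast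
  thus ?thesis unfolding Fhat_glob_def k_def[symmetric] using sv_ser_stab_Sh assms(2) by simp
qed

lemma Fhat_glob_slit:
  assumes "z \<in> slit_plane" "w \<in> B1"
  shows "Fhat_glob w z = Fhat_branch mpl mpl w z"
proof -
  have "Fhat_glob w z = cf (sv_ser (L_ser z)) w" using Fhat_glob_eq[of z 0 w] assms by (simp add: chart_dom_def chart_sol_def)
  also have "\<dots> = Fhat_branch mpl mpl w z"
    using assms by (intro Fhat_branch_sv_ser[symmetric]) (simp_all add: mpl_eq L_ser_cnj)
  finally show ?thesis .
qed

section \<open>Wirtinger derivatives\<close>

definition wirtinger :: "(complex \<Rightarrow> complex) \<Rightarrow> complex \<Rightarrow> complex \<Rightarrow> complex \<Rightarrow> bool" where
  "wirtinger f a b z \<longleftrightarrow> (f has_derivative (\<lambda>h. a * h + b * cnj h)) (at z)"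

lemma wirtinger_d:
  assumes "wirtinger f a b z"
  shows "d_z f z = a" "d_zbar f z = b"
proof -
  have "frechet_derivative f (at z) = (\<lambda>h. a * h + b * cnj h)"
    using frechet_derivative_at[OF assms[unfolded wirtinger_def]] by simp
  thus "d_z f z = a" "d_zbar f z = b"
    by (simp_all add: d_z_def d_zbar_def algebra_simps)
qed

lemma wirtinger_holo: "(f has_field_derivative a) (at z) \<Longrightarrow> wirtinger f a 0 z"
  by (simp add: wirtinger_def has_field_derivative_def)

lemma wirtinger_cnj: "wirtinger f a b z \<Longrightarrow> wirtinger (\<lambda>z. cnj (f z)) (cnj b) (cnj a) z"
  unfolding wirtinger_def by (drule has_derivative_cnj) (simp add: add.commute)

lemma wirtinger_mult: "wirtinger f a b z \<Longrightarrow> wirtinger g c d z \<Longrightarrow> wirtinger (\<lambda>z. f z * g z) (f z * c + a * g z) (f z * d + b * g z) z"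
  unfolding wirtinger_def by (drule (1) has_derivative_mult) (simp add: algebra_simps)

lemma wirtinger_sum: "(\<And>i. i \<in> I \<Longrightarrow> wirtinger (f i) (a i) (b i) z) \<Longrightarrow> wirtinger (\<lambda>z. \<Sum>i\<in>I. f i z) (\<Sum>i\<in>I. a i) (\<Sum>i\<in>I. b i) z"
  unfolding wirtinger_def
  by (drule has_derivative_sum) (simp_all add: sum.distrib sum_distrib_right)

lemma wirtinger_transform:
  assumes "wirtinger f a b z" "open U" "z \<in> U" "\<And>y. y \<in> U \<Longrightarrow> f y = g y"
  shows "wirtinger g a b z"
  unfolding wirtinger_def
  by (rule has_derivative_transform_within_open[OF assms(1)[unfolded wirtinger_def] assms(2,3)]) (rule assms(4))

definition ser_wirtinger :: "(complex \<Rightarrow> ser) \<Rightarrow> ser \<Rightarrow> ser \<Rightarrow> complex \<Rightarrow> bool" where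
  "ser_wirtinger F A C z \<longleftrightarrow> (\<forall>w. wirtinger (\<lambda>z. cf (F z) w) (cf A w) (cf C w) z)"

lemma ser_wirtinger_times:
  assumes "ser_wirtinger F A C z" "ser_wirtinger G A' C' z"
  shows "ser_wirtinger (\<lambda>z. F z * G z) (F z * A' + A * G z) (F z * C' + C * G z) z"
  unfolding ser_wirtinger_def
proof
  fix w
  have "wirtinger (\<lambda>z. \<Sum>i\<le>length w. cf (F z) (take i w) * cf (G z) (drop i w))
    (\<Sum>i\<le>length w. cf (F z) (take i w) * cf A' (drop i w) + cf A (take i w) * cf (G z) (drop i w))
    (\<Sum>i\<le>length w. cf (F z) (take i w) * cf C' (drop i w) + cf C (take i w) * cf (G z) (drop i w)) z"
    using assms by (intro wirtinger_sum wirtinger_mult) (auto simp: ser_wirtinger_def)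
  thus "wirtinger (\<lambda>z. cf (F z * G z) w) (cf (F z * A' + A * G z) w) (cf (F z * C' + C * G z) w) z"
    by (simp add: cf_times sum.distrib)
qed

lemma ser_wirtinger_const: "ser_wirtinger (\<lambda>_. X) 0 0 z"
  by (simp add: ser_wirtinger_def wirtinger_holo)

text \<open>The right factor is holomorphic and the left one antiholomorphic, so the two derivatives
  remove letters at opposite ends of the word.\<close>

lemma ser_wirtinger_sv_ser:
  assumes "KZ_sol U P" "z \<in> U"
  shows "ser_wirtinger (\<lambda>z. sv_ser (P z)) (sv_ser (P z) * KZ_form z) (KZ_form (cnj z) * sv_ser (P z)) z"
proof -
  have 1: "ser_wirtinger P (P z * KZ_form z) 0 z"
    using assms unfolding KZ_sol_def ser_deriv_def ser_wirtinger_def by (auto intro: wirtinger_holo)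
  have rOm: "rv (KZ_form z) = KZ_form z" by (simp add: KZ_form_def rv_times cst_commute)
  have "ser_wirtinger (\<lambda>z. cj (rv (P z))) 0 (cj (rv (P z * KZ_form z))) z"
    unfolding ser_wirtinger_def
  proof
    fix w
    have "wirtinger (\<lambda>z. cf (P z) (rev w)) (cf (P z * KZ_form z) (rev w)) 0 z"
      using 1 by (auto simp: ser_wirtinger_def)
    from wirtinger_cnj[OF this] show "wirtinger (\<lambda>z. cf (cj (rv (P z))) w) (cf 0 w) (cf (cj (rv (P z * KZ_form z))) w) z"
      by (simp del: cf_times_Nil)
  qed
  hence 2: "ser_wirtinger (\<lambda>z. cj (rv (P z))) 0 (KZ_form (cnj z) * cj (rv (P z))) z"
    by (simp add: rv_times cj_times rOm del: ser_maps_ring(23))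
  from ser_wirtinger_times[OF ser_wirtinger_times[OF 2 ser_wirtinger_const[of Sh]] 1]
  show ?thesis by (simp add: sv_ser_def mult.assoc)
qed

lemma cf_KZ_form_times: "cf (KZ_form c * F) (x # w) = cf F w / (c - pt x)"
proof -
  have "KZ_form c * F = cst (1 / c) * (lt X0 * F) + cst (1 / (c - 1)) * (lt X1 * F)"
    by (simp add: KZ_form_def distrib_right mult.assoc)
  thus ?thesis by (cases x) (simp_all add: cf_lt_times_Cons pt_def)
qed

lemma wirtinger_Fhat_glob:
  assumes "w \<in> B1" "z \<in> chart_dom i"
  shows "wirtinger (Fhat_glob w) (cf (sv_ser (chart_sol i z) * KZ_form z) w) (cf (KZ_form (cnj z) * sv_ser (chart_sol i z)) w) z"
proof (rule wirtinger_transform[OF _ open_chart_dom assms(2)])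
  show "wirtinger (\<lambda>z. cf (sv_ser (chart_sol i z)) w) (cf (sv_ser (chart_sol i z) * KZ_form z) w) (cf (KZ_form (cnj z) * sv_ser (chart_sol i z)) w) z"
    using ser_wirtinger_sv_ser[OF KZ_sol_chart_sol assms(2)] by (auto simp: ser_wirtinger_def)
qed (simp add: Fhat_glob_eq assms(1))

lemma Fhat_glob_d_zbar:
  assumes "x # v \<in> B1" "z \<notin> {0, 1}"
  shows "d_zbar (Fhat_glob (x # v)) z = Fhat_glob v z / (cnj z - pt x)"
proof -
  obtain i where i: "z \<in> chart_dom i" using chart_dom_cover assms(2) by blast
  have "v \<in> B1" using assms(1) B1_append[of "[x]" v] by simp
  thus ?thesis using wirtinger_d(2)[OF wirtinger_Fhat_glob[OF assms(1) i]] i by (simp add: cf_KZ_form_times Fhat_glob_eq)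
qed

lemma cnj_pt: "cnj (pt x) = pt x"
  by (cases x) (simp_all add: pt_def)

text \<open>The first derivative is known on an open set and may be replaced by its formula there;
  the factor 1 / (cnj z - c) then has zero derivative in z.\<close>

lemma Fhat_glob_d_z_d_zbar:
  assumes "[x] @ w @ [y] \<in> B1" "z \<notin> {0, 1}"
  shows "d_z (d_zbar (Fhat_glob ([x] @ w @ [y]))) z = Fhat_glob w z / ((cnj z - pt x) * (z - pt y))"
proof -
  obtain i where i: "z \<in> chart_dom i" using chart_dom_cover assms(2) by blast
  have wy: "w @ [y] \<in> B1" "w \<in> B1" using assms(1) B1_append by blast+
  define c where "c = pt x"
  have nz: "cnj u - c \<noteq> 0" if "u \<in> - {0, 1}" for u
    using that by (cases x) (auto simp: c_def pt_def complex_cnj_cancel_iff dest: arg_cong[where f = cnj])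
  have "wirtinger (\<lambda>z. z - cnj c) 1 0 z" by (intro wirtinger_holo) (auto intro!: derivative_eq_intros)
  have "((\<lambda>z. inverse (z - c)) has_field_derivative - inverse ((z - c) ^ 2)) (at z)"
    using nz[of "cnj z"] assms(2) by (auto intro!: derivative_eq_intros simp: power2_eq_square dest: arg_cong[where f = cnj])
  from wirtinger_cnj[OF wirtinger_holo[OF this]]
  have inv: "wirtinger (\<lambda>z. inverse (cnj z - c)) 0 (cnj (- inverse ((z - c) ^ 2))) z"
    by (simp add: c_def cnj_pt)
  have "wirtinger (\<lambda>z. Fhat_glob (w @ [y]) z * inverse (cnj z - c))
     (Fhat_glob (w @ [y]) z * 0 + cf (sv_ser (chart_sol i z) * KZ_form z) (w @ [y]) * inverse (cnj z - c)) (Fhat_glob (w @ [y]) z * cnj (- inverse ((z - c) ^ 2)) + cf (KZ_form (cnj z) * sv_ser (chart_sol i z)) (w @ [y]) * inverse (cnj z - c)) z"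
    by (intro wirtinger_mult wirtinger_Fhat_glob wy i inv)
  hence "wirtinger (d_zbar (Fhat_glob ([x] @ w @ [y])))
     (Fhat_glob (w @ [y]) z * 0 + cf (sv_ser (chart_sol i z) * KZ_form z) (w @ [y]) * inverse (cnj z - c)) (Fhat_glob (w @ [y]) z * cnj (- inverse ((z - c) ^ 2)) + cf (KZ_form (cnj z) * sv_ser (chart_sol i z)) (w @ [y]) * inverse (cnj z - c)) z"
  proof (rule wirtinger_transform[where U = "- {0, 1}"])
    show "open (- {0, 1 :: complex})" by (intro open_Compl) auto
    fix u :: complex assume "u \<in> - {0, 1}"
    thus "Fhat_glob (w @ [y]) u * inverse (cnj u - c) = d_zbar (Fhat_glob ([x] @ w @ [y])) u"
      using Fhat_glob_d_zbar[of x "w @ [y]" u] assms(1) by (simp add: c_def divide_inverse)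
  qed (use assms in auto)
  from wirtinger_d(1)[OF this] show ?thesis
    using i wy by (simp add: cf_times_KZ_form Fhat_glob_eq c_def divide_inverse)
qed

lemma Fhat_glob_isCont: "w \<in> B1 \<Longrightarrow> z \<notin> {0, 1} \<Longrightarrow> isCont (Fhat_glob w) z"
proof -
  assume "w \<in> B1" "z \<notin> {0, 1}"
  moreover then obtain i where "z \<in> chart_dom i" using chart_dom_cover by blast
  ultimately show ?thesis using wirtinger_Fhat_glob unfolding wirtinger_def by (blast intro: has_derivative_continuous)
qed

text \<open>On the slit plane this is \<open>rv Sh = Sh\<close> combined with
  \<open>L_ser_cnj\<close>; continuity extends it across the cuts.\<close>

lemma Fhat_glob_sym:
  assumes "w \<in> B1" "z \<notin> {0, 1}"
  shows "Fhat_glob w z = Fhat_glob (rev w) (cnj z)"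
proof -
  have slit: "Fhat_glob w z = Fhat_glob (rev w) (cnj z)" if "z \<in> slit_plane" for z
  proof -
    have "cj (rv (cj (L_ser z))) * Sh * cj (L_ser z) = rv (cj (rv (L_ser z)) * Sh * L_ser z)"
      by (simp add: rv_times mult.assoc)
    hence "sv_ser (L_ser (cnj z)) = rv (sv_ser (L_ser z))" using that by (simp add: sv_ser_def L_ser_cnj)
    thus ?thesis using Fhat_glob_eq[of z 0 w] Fhat_glob_eq[of "cnj z" 0 "rev w"] that assms(1)
      by (simp add: chart_dom_def chart_sol_def)
  qed
  have "z islimpt slit_plane"
    unfolding islimpt_approachable
  proof (intro allI impI)
    fix e :: real assume "e > 0"
    define d where "d = (if Im z \<ge> 0 then min e 1 / 2 else - (min e 1 / 2))"
    have "d \<noteq> 0" "\<bar>d\<bar> < e" "Im z + d \<noteq> 0" using \<open>e > 0\<close> by (auto simp: d_def)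
    moreover have "dist (z + \<i> * of_real d) z = \<bar>d\<bar>" by (simp add: dist_norm norm_mult)
    ultimately show "\<exists>x'\<in>slit_plane. x' \<noteq> z \<and> dist x' z < e"
      by (intro bexI[of _ "z + \<i> * of_real d"]) (auto simp: slit_iff)
  qed
  hence nb: "at z within slit_plane \<noteq> bot" by (simp add: trivial_limit_within)
  have cz: "cnj z \<notin> {0, 1}" using assms(2) by (auto dest: arg_cong[where f = cnj])
  have "isCont (Fhat_glob (rev w) \<circ> cnj) z"
    using Fhat_glob_isCont[of "rev w" "cnj z"] assms(1) cz
    by (intro continuous_at_compose) (auto intro: continuous_intros)
  hence "isCont (\<lambda>z. Fhat_glob w z - Fhat_glob (rev w) (cnj z)) z"
    using Fhat_glob_isCont[OF assms] by (intro continuous_intros) (auto simp: o_def)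
  hence "((\<lambda>z. Fhat_glob w z - Fhat_glob (rev w) (cnj z)) \<longlongrightarrow> Fhat_glob w z - Fhat_glob (rev w) (cnj z)) (at z within slit_plane)"
    unfolding isCont_def by (rule tendsto_within_subset) simp
  moreover have "((\<lambda>z. Fhat_glob w z - Fhat_glob (rev w) (cnj z)) \<longlongrightarrow> 0) (at z within slit_plane)"
    by (rule tendsto_eventually) (use slit in \<open>auto simp: eventually_at_filter\<close>)
  ultimately have "Fhat_glob w z - Fhat_glob (rev w) (cnj z) = 0" using tendsto_unique[OF nb] by blast
  thus ?thesis by simp
qed

text \<open>The binomial bound makes the absolute values of the terms sum to at most
  \<open>t * (\<bar>x\<bar> + \<bar>y\<bar>) ^ n\<close>, which yields absolute convergence of the double series.\<close>

definition binom_form :: "nat \<Rightarrow> real \<Rightarrow> (real \<Rightarrow> real \<Rightarrow> complex) \<Rightarrow> bool" where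
  "binom_form n t f \<longleftrightarrow> (\<exists>\<kappa>. (\<forall>m. norm (\<kappa> m) \<le> t * real (n choose m)) \<and>
     (\<forall>x y. f x y = (\<Sum>m\<le>n. \<kappa> m * of_real x ^ m * of_real y ^ (n - m))))"

lemma binom_form_const: "binom_form 0 (norm c) (\<lambda>_ _. c)"
  unfolding binom_form_def
  by (rule exI[of _ "\<lambda>m. if m = 0 then c else 0"]) auto

text \<open>Multiplication by a linear form adds neighbouring coefficients, so the bound is
  preserved by Pascal's rule.\<close>

lemma binom_form_linear:
  assumes "binom_form n t f" "norm e \<le> 1"
  shows "binom_form (Suc n) t (\<lambda>x y. (of_real x + e * of_real y) * f x y)"
proof -
  obtain \<kappa> where k: "\<And>m. norm (\<kappa> m) \<le> t * real (n choose m)"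
    "\<And>x y. f x y = (\<Sum>m\<le>n. \<kappa> m * of_real x ^ m * of_real y ^ (n - m))"
    using assms(1) unfolding binom_form_def by blast
  define \<mu> where "\<mu> = (\<lambda>m. (case m of 0 \<Rightarrow> 0 | Suc l \<Rightarrow> \<kappa> l) + e * \<kappa> m)"
  have ek: "norm (e * \<kappa> m) \<le> t * real (n choose m)" for m
    using mult_mono[OF assms(2) k(1)[of m]] by (simp add: norm_mult)
  have "norm (\<mu> m) \<le> t * real (Suc n choose m)" for m
  proof (cases m)
    case 0
    thus ?thesis using ek[of 0] by (simp add: \<mu>_def)
  next
    case (Suc l)
    have "norm (\<mu> m) \<le> norm (\<kappa> l) + norm (e * \<kappa> m)"
      unfolding \<mu>_def Suc by (simp add: norm_triangle_ineq)
    also have "\<dots> \<le> t * real (n choose l) + t * real (n choose m)"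
      by (intro add_mono k ek)
    finally show ?thesis by (simp add: Suc algebra_simps)
  qed
  moreover have "(of_real x + e * of_real y) * f x y
    = (\<Sum>m\<le>Suc n. \<mu> m * of_real x ^ m * of_real y ^ (Suc n - m))" for x y
  proof -
    have z: "\<kappa> (Suc n) = 0" using k(1)[of "Suc n"] by (simp add: binomial_eq_0)
    have "(\<Sum>m\<le>Suc n. \<mu> m * of_real x ^ m * of_real y ^ (Suc n - m))
      = (\<Sum>m\<le>Suc n. (case m of 0 \<Rightarrow> 0 | Suc l \<Rightarrow> \<kappa> l) * of_real x ^ m * of_real y ^ (Suc n - m))
      + (\<Sum>m\<le>Suc n. e * \<kappa> m * of_real x ^ m * of_real y ^ (Suc n - m))"
      by (simp only: \<mu>_def distrib_right sum.distrib)
    also have "(\<Sum>m\<le>Suc n. (case m of 0 \<Rightarrow> 0 | Suc l \<Rightarrow> \<kappa> l) * of_real x ^ m * of_real y ^ (Suc n - m))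
      = of_real x * f x y"
      by (subst sum.atMost_Suc_shift) (simp add: k(2) sum_distrib_left algebra_simps)
    also have "(\<Sum>m\<le>Suc n. e * \<kappa> m * of_real x ^ m * of_real y ^ (Suc n - m)) = e * of_real y * f x y"
      by (simp add: z k(2) sum_distrib_left Suc_diff_le algebra_simps)
    finally show ?thesis by (simp add: distrib_right)
  qed
  ultimately show ?thesis unfolding binom_form_def by blast
qed

lemma binom_form_monomial:
  "binom_form (p + q) (norm c) (\<lambda>x y. c * cnj (Complex x y) ^ p * Complex x y ^ q)"
proof (induction p)
  case 0
  show ?case
  proof (induction q)
    case (Suc q)
    have "of_real x + \<i> * of_real y = Complex x y" for x y
      by (simp add: complex_eq_iff)
    with binom_form_linear[OF Suc, of \<i>] show ?case by (simp add: mult_ac)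
  qed (use binom_form_const in simp)
next
  case (Suc p)
  have "of_real x + - \<i> * of_real y = cnj (Complex x y)" for x y
    by (simp add: complex_eq_iff)
  with binom_form_linear[OF Suc, of "- \<i>"] show ?case
    by (simp add: mult_ac del: mult_minus_left)
qed

lemma binom_form_sum:
  assumes "\<And>i. i \<in> I \<Longrightarrow> binom_form n (t i) (f i)"
  shows "binom_form n (\<Sum>i\<in>I. t i) (\<lambda>x y. \<Sum>i\<in>I. f i x y)"
proof -
  obtain \<kappa> where k: "\<And>i m. i \<in> I \<Longrightarrow> norm (\<kappa> i m) \<le> t i * real (n choose m)"
    "\<And>i x y. i \<in> I \<Longrightarrow> f i x y = (\<Sum>m\<le>n. \<kappa> i m * of_real x ^ m * of_real y ^ (n - m))"
    using assms unfolding binom_form_def by metis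
  have "norm (\<Sum>i\<in>I. \<kappa> i m) \<le> (\<Sum>i\<in>I. t i) * real (n choose m)" for m
    unfolding sum_distrib_right by (rule sum_norm_le) (rule k)
  moreover have "(\<Sum>i\<in>I. f i x y) = (\<Sum>m\<le>n. (\<Sum>i\<in>I. \<kappa> i m) * of_real x ^ m * of_real y ^ (n - m))" for x y
    by (simp add: k(2) sum_distrib_right) (rule sum.swap)
  ultimately show ?thesis unfolding binom_form_def by (intro exI[of _ "\<lambda>m. \<Sum>i\<in>I. \<kappa> i m"]) blast
qed

text \<open>The series by total degree N stays absolutely convergent after each term is split into
  monomials; reindexing (N, m) as (m, N - m) then gives the double series.\<close>

lemma binom_form_has_sum:
  assumes "\<And>N. binom_form N (t N) (f N)" "summable (\<lambda>N. t N * \<rho> ^ N)" "\<And>N. t N \<ge> 0"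
  shows "\<exists>a. \<forall>x y s. \<bar>x\<bar> + \<bar>y\<bar> \<le> \<rho> \<longrightarrow> (\<lambda>N. f N x y) sums s \<longrightarrow>
    ((\<lambda>(m, n). a m n * of_real x ^ m * of_real y ^ n) has_sum s) (UNIV :: (nat \<times> nat) set)"
proof -
  obtain \<kappa> where k: "\<And>N m. norm (\<kappa> N m) \<le> t N * real (N choose m)"
    "\<And>N x y. f N x y = (\<Sum>m\<le>N. \<kappa> N m * of_real x ^ m * of_real y ^ (N - m))"
    using assms(1) unfolding binom_form_def by metis
  show ?thesis
  proof (intro exI[of _ "\<lambda>m n. \<kappa> (m + n) m"] allI impI)
    fix x y s assume xy: "\<bar>x\<bar> + \<bar>y\<bar> \<le> \<rho>" and s: "(\<lambda>N. f N x y) sums s"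
    define g where "g = (\<lambda>N m. \<kappa> N m * of_real x ^ m * of_real y ^ (N - m))"
    have bound: "(\<Sum>m\<le>N. norm (g N m)) \<le> t N * \<rho> ^ N" for N
    proof -
      have "(\<Sum>m\<le>N. norm (g N m)) \<le> (\<Sum>m\<le>N. t N * real (N choose m) * \<bar>x\<bar> ^ m * \<bar>y\<bar> ^ (N - m))"
        unfolding g_def norm_mult norm_power norm_of_real
        by (intro sum_mono mult_right_mono k) auto
      also have "\<dots> = t N * (\<bar>x\<bar> + \<bar>y\<bar>) ^ N"
        by (simp add: binomial_ring sum_distrib_left mult.assoc)
      also have "\<dots> \<le> t N * \<rho> ^ N" using xy assms(3) by (intro mult_left_mono power_mono) auto
      finally show ?thesis .
    qed
    have sn: "summable (\<lambda>N. norm (\<Sum>m\<le>N. norm (g N m)))"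
      by (rule summable_comparison_test'[OF assms(2), of 0]) (use bound in \<open>simp add: sum_nonneg\<close>)
    have "(\<lambda>N. norm (\<Sum>m\<le>N. norm (g N m))) summable_on UNIV"
      using norm_summable_imp_summable_on[of "\<lambda>N. norm (\<Sum>m\<le>N. norm (g N m))"] sn by simp
    hence "(\<lambda>p. norm (case p of (N, m) \<Rightarrow> g N m)) summable_on (SIGMA N:UNIV. {..N})"
      by (subst Infinite_Sum.abs_summable_on_Sigma_iff) simp
    hence "(\<lambda>(N, m). g N m) summable_on (SIGMA N:UNIV. {..N})"
      by (rule Infinite_Sum.abs_summable_summable)
    moreover have "summable (\<lambda>N. norm (f N x y))"
      by (rule summable_comparison_test'[OF sn, of 0]) (simp add: k(2) g_def sum_norm_le sum_nonneg)
    hence "((\<lambda>N. f N x y) has_sum s) UNIV" using s by (rule norm_summable_imp_has_sum)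
    ultimately have "((\<lambda>(N, m). g N m) has_sum s) (SIGMA N:UNIV. {..N})"
      by (intro has_sum_SigmaI[where g = "\<lambda>N. f N x y"]) (simp_all add: k(2) g_def)
    also have "?this \<longleftrightarrow> ((\<lambda>(m, n). \<kappa> (m + n) m * of_real x ^ m * of_real y ^ n) has_sum s) UNIV"
      by (rule has_sum_reindex_bij_witness[of _ "\<lambda>(m, n). (m + n, m)" "\<lambda>(N, m). (m, N - m)"])
         (auto simp: g_def)
    finally show "((\<lambda>(m, n). \<kappa> (m + n) m * of_real x ^ m * of_real y ^ n) has_sum s) UNIV" .
  qed
qed

section \<open>Real-analyticity\<close>

definition real_powser :: "complex \<Rightarrow> real \<Rightarrow> (complex \<Rightarrow> complex) \<Rightarrow> bool" where
  "real_powser z0 r F \<longleftrightarrow> (\<exists>a :: nat \<Rightarrow> nat \<Rightarrow> complex. \<forall>z\<in>ball z0 r.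
     ((\<lambda>(m, n). a m n * of_real (Re (z - z0)) ^ m * of_real (Im (z - z0)) ^ n) has_sum F z) UNIV)"

lemma real_powser_cmult:
  assumes "real_powser z0 r F"
  shows "real_powser z0 r (\<lambda>z. c * F z)"
proof -
  obtain a where a: "\<And>z. z \<in> ball z0 r \<Longrightarrow> ((\<lambda>(m, n). a m n * of_real (Re (z - z0)) ^ m
      * of_real (Im (z - z0)) ^ n) has_sum F z) UNIV"
    using assms unfolding real_powser_def by blast
  show ?thesis unfolding real_powser_def
  proof (intro exI[of _ "\<lambda>m n. c * a m n"] ballI)
    fix z assume "z \<in> ball z0 r"
    from has_sum_cmult_right[OF a[OF this], of c]
    show "((\<lambda>(m, n). c * a m n * of_real (Re (z - z0)) ^ m * of_real (Im (z - z0)) ^ n) has_sum c * F z) UNIV"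
      by (simp add: case_prod_unfold mult.assoc)
  qed
qed

lemma has_sum_finite_sum:
  fixes s :: "'i \<Rightarrow> 'b :: topological_comm_monoid_add"
  assumes "\<And>i. i \<in> I \<Longrightarrow> (f i has_sum s i) A"
  shows "((\<lambda>x. \<Sum>i\<in>I. f i x) has_sum (\<Sum>i\<in>I. s i)) A"
  using assms by (induction I rule: infinite_finite_induct) (auto intro!: has_sum_add)

lemma real_powser_sum:
  assumes "\<And>i. i \<in> I \<Longrightarrow> real_powser z0 r (F i)"
  shows "real_powser z0 r (\<lambda>z. \<Sum>i\<in>I. F i z)"
proof -
  define H where "H = (\<lambda>i (a :: nat \<Rightarrow> nat \<Rightarrow> complex). \<forall>z\<in>ball z0 r. ((\<lambda>(m, n). a m n * of_real (Re (z - z0)) ^ m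
      * of_real (Im (z - z0)) ^ n) has_sum F i z) UNIV)"
  have "\<forall>i\<in>I. \<exists>a. H i a" using assms unfolding real_powser_def H_def by blast
  from bchoice[OF this] obtain a where "\<forall>i\<in>I. H i (a i)" ..
  hence a: "((\<lambda>(m, n). a i m n * of_real (Re (z - z0)) ^ m
      * of_real (Im (z - z0)) ^ n) has_sum F i z) UNIV" if "i \<in> I" "z \<in> ball z0 r" for i z
    using that by (simp add: H_def)
  show ?thesis unfolding real_powser_def
  proof (intro exI[of _ "\<lambda>m n. \<Sum>i\<in>I. a i m n"] ballI)
    fix z assume "z \<in> ball z0 r"
    have "((\<lambda>x. \<Sum>i\<in>I. case x of (m, n) \<Rightarrow> a i m n * of_real (Re (z - z0)) ^ m
        * of_real (Im (z - z0)) ^ n) has_sum (\<Sum>i\<in>I. F i z)) UNIV"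
      using a[OF _ \<open>z \<in> ball z0 r\<close>] by (rule has_sum_finite_sum)
    thus "((\<lambda>(m, n). (\<Sum>i\<in>I. a i m n) * of_real (Re (z - z0)) ^ m * of_real (Im (z - z0)) ^ n)
        has_sum (\<Sum>i\<in>I. F i z)) UNIV"
      by (simp add: case_prod_unfold sum_distrib_right)
  qed
qed

text \<open>Radius R/8 gives |Re| + |Im| <= R/4, safely inside the distance R/2 at which both Taylor
  series are known to converge.\<close>

lemma real_powser_cnj_mult:
  assumes "f holomorphic_on ball z0 R" "g holomorphic_on ball z0 R" "R > 0"
  shows "real_powser z0 (R / 8) (\<lambda>z. cnj (f z) * g z)"
proof -
  define a where "a = (\<lambda>n. cnj ((deriv ^^ n) f z0 / fact n))"
  define b where "b = (\<lambda>n. (deriv ^^ n) g z0 / fact n)"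
  have fs: "(\<lambda>n. a n * cnj (z - z0) ^ n) sums cnj (f z)" if "z \<in> ball z0 R" for z
  proof -
    have "(\<lambda>n. cnj ((deriv ^^ n) f z0 / fact n * (z - z0) ^ n)) sums cnj (f z)"
      unfolding sums_cnj by (rule holomorphic_power_series[OF assms(1) that])
    thus ?thesis by (simp add: a_def)
  qed
  have gs: "(\<lambda>n. b n * (z - z0) ^ n) sums g z" if "z \<in> ball z0 R" for z
    unfolding b_def by (rule holomorphic_power_series[OF assms(2) that])
  define z1 where "z1 = z0 + of_real (R / 2)"
  have z1: "z1 \<in> ball z0 R" "z1 - z0 = of_real (R / 2)" using assms(3) by (auto simp: z1_def dist_norm)
  define \<rho> where "\<rho> = R / 4"
  have an: "summable (\<lambda>n. norm (a n * w ^ n))" if "norm w \<le> \<rho>" for w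
    using fs[OF z1(1)] that assms(3) unfolding z1(2) \<rho>_def
    by (intro powser_insidea[where x = "of_real (R / 2)"]) (auto simp: sums_iff simp del: of_real_divide)
  have bn: "summable (\<lambda>n. norm (b n * w ^ n))" if "norm w \<le> \<rho>" for w
    using gs[OF z1(1)] that assms(3) unfolding z1(2) \<rho>_def
    by (intro powser_insidea[where x = "of_real (R / 2)"]) (auto simp: sums_iff simp del: of_real_divide)
  define t where "t = (\<lambda>N. \<Sum>p\<le>N. norm (a p * b (N - p)))"
  define F where "F = (\<lambda>N x y. \<Sum>p\<le>N. a p * b (N - p) * cnj (Complex x y) ^ p * Complex x y ^ (N - p))"
  have bf: "binom_form N (t N) (F N)" for N
    unfolding t_def F_def
  proof (rule binom_form_sum)
    fix p assume "p \<in> {..N}"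
    thus "binom_form N (norm (a p * b (N - p))) (\<lambda>x y. a p * b (N - p) * cnj (Complex x y) ^ p * Complex x y ^ (N - p))"
      using binom_form_monomial[of p "N - p" "a p * b (N - p)"] by simp
  qed
  have r0: "norm (of_real \<rho> :: complex) \<le> \<rho>" using assms(3) by (simp add: \<rho>_def)
  have "summable (\<lambda>N. \<Sum>p\<le>N. norm (a p * of_real \<rho> ^ p) * norm (b (N - p) * of_real \<rho> ^ (N - p)))"
    using Cauchy_product_sums[of "\<lambda>n. norm (a n * of_real \<rho> ^ n)" "\<lambda>n. norm (b n * of_real \<rho> ^ n)"]
      an[OF r0] bn[OF r0] by (auto simp: sums_iff)
  also have "(\<lambda>N. \<Sum>p\<le>N. norm (a p * of_real \<rho> ^ p) * norm (b (N - p) * of_real \<rho> ^ (N - p)))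
    = (\<lambda>N. t N * \<rho> ^ N)"
  proof
    fix N
    have "norm (a p * of_real \<rho> ^ p) * norm (b (N - p) * of_real \<rho> ^ (N - p))
        = norm (a p * b (N - p)) * \<rho> ^ N" if "p \<le> N" for p
    proof -
      have "\<rho> ^ p * \<rho> ^ (N - p) = \<rho> ^ N" using that by (simp flip: power_add)
      moreover have "\<bar>\<rho>\<bar> = \<rho>" using assms(3) by (simp add: \<rho>_def)
      ultimately show ?thesis
        by (simp add: norm_mult norm_power mult.assoc mult.left_commute flip: \<open>\<rho> ^ p * \<rho> ^ (N - p) = \<rho> ^ N\<close>)
    qed
    thus "(\<Sum>p\<le>N. norm (a p * of_real \<rho> ^ p) * norm (b (N - p) * of_real \<rho> ^ (N - p))) = t N * \<rho> ^ N"
      by (simp add: t_def sum_distrib_right)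
  qed
  finally obtain c where c: "\<And>x y s. \<bar>x\<bar> + \<bar>y\<bar> \<le> \<rho> \<Longrightarrow> (\<lambda>N. F N x y) sums s \<Longrightarrow>
    ((\<lambda>(m, n). c m n * of_real x ^ m * of_real y ^ n) has_sum s) (UNIV :: (nat \<times> nat) set)"
    using binom_form_has_sum[OF bf, of \<rho>] by (auto simp: t_def sum_nonneg)
  show ?thesis unfolding real_powser_def
  proof (intro exI[of _ c] ballI c)
    fix z assume z: "z \<in> ball z0 (R / 8)"
    hence h: "norm (z - z0) < R / 8" by (simp add: dist_norm norm_minus_commute)
    show "\<bar>Re (z - z0)\<bar> + \<bar>Im (z - z0)\<bar> \<le> \<rho>"
      using h abs_Re_le_cmod[of "z - z0"] abs_Im_le_cmod[of "z - z0"] unfolding \<rho>_def by linarith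
    have zb: "z \<in> ball z0 R" "norm (z - z0) \<le> \<rho>" using z h assms(3) by (auto simp: \<rho>_def)
    have "(\<lambda>N. \<Sum>p\<le>N. (a p * cnj (z - z0) ^ p) * (b (N - p) * (z - z0) ^ (N - p))) sums
        ((\<Sum>n. a n * cnj (z - z0) ^ n) * (\<Sum>n. b n * (z - z0) ^ n))"
      by (intro Cauchy_product_sums an bn) (use zb(2) in \<open>simp_all only: complex_mod_cnj\<close>)
    also have "(\<Sum>n. a n * cnj (z - z0) ^ n) = cnj (f z)" using fs[OF zb(1)] by (simp add: sums_iff)
    also have "(\<Sum>n. b n * (z - z0) ^ n) = g z" using gs[OF zb(1)] by (simp add: sums_iff)
    finally show "(\<lambda>N. F N (Re (z - z0)) (Im (z - z0))) sums (cnj (f z) * g z)"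
      unfolding F_def complex_surj by (simp add: mult_ac)
  qed
qed

lemma cf_chart_sol_holomorphic: "(\<lambda>z. cf (D * chart_sol i z) u) holomorphic_on chart_dom i"
  using KZ_sol_cmult[OF KZ_sol_chart_sol, of i D] unfolding KZ_sol_def ser_deriv_def
  by (subst holomorphic_on_open[OF open_chart_dom]) blast

lemma Fhat_glob_real_analytic:
  assumes "w \<in> B1"
  shows "real_analytic_on (Fhat_glob w) (- {0, 1})"
  unfolding real_analytic_on_def
proof
  fix z0 :: complex assume "z0 \<in> - {0, 1}"
  then obtain i where "z0 \<in> chart_dom i" using chart_dom_cover by blast
  then obtain R where R: "R > 0" "ball z0 R \<subseteq> chart_dom i" using open_chart_dom openE by blast
  have hol: "(\<lambda>z. cf (chart_sol i z) u) holomorphic_on ball z0 R" for u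
    using holomorphic_on_subset[OF cf_chart_sol_holomorphic[of 1] R(2)] by simp
  have "real_powser z0 (R / 8) (\<lambda>z. \<Sum>(u1, u2, u3)\<in>{(u1, u2, u3). w = u1 @ u2 @ u3}.
      cf Sh u2 * (cnj (cf (chart_sol i z) (rev u1)) * cf (chart_sol i z) u3))"
    unfolding case_prod_unfold
    by (intro real_powser_sum real_powser_cmult real_powser_cnj_mult hol R(1))
  hence *: "real_powser z0 (R / 8) (\<lambda>z. cf (sv_ser (chart_sol i z)) w)"
    unfolding sv_ser_def cf_times3_splits by (simp add: mult_ac)
  have "z \<in> chart_dom i" if "z \<in> ball z0 (R / 8)" for z
    using that R by (intro subsetD[OF R(2)]) auto
  hence "Fhat_glob w z = cf (sv_ser (chart_sol i z)) w" if "z \<in> ball z0 (R / 8)" for z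
    using Fhat_glob_eq assms that by blast
  hence "real_powser z0 (R / 8) (Fhat_glob w)"
    using * unfolding real_powser_def by (simp del: mem_ball)
  thus "\<exists>r>0. \<exists>a :: nat \<Rightarrow> nat \<Rightarrow> complex. \<forall>z\<in>ball z0 r.
        ((\<lambda>(m, n). a m n * of_real (Re (z - z0)) ^ m * of_real (Im (z - z0)) ^ n)
           has_sum Fhat_glob w z) UNIV"
    unfolding real_powser_def using R(1) by (intro exI[of _ "R / 8"]) simp
qed

section \<open>Continuation along paths\<close>

lemma eventually_nhds_cnj:
  "eventually P (nhds c) \<Longrightarrow> eventually (\<lambda>z. P (cnj z)) (nhds (cnj c))"
proof -
  assume "eventually P (nhds c)"
  then obtain S where "open S" "c \<in> S" "\<forall>z\<in>S. P z" by (auto simp: eventually_nhds)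
  moreover from this have "open (cnj -` S)" by (intro open_vimage continuous_intros)
  ultimately show ?thesis unfolding eventually_nhds by (intro exI[of _ "cnj -` S"]) auto
qed

lemma analytic_on_cnj_cnj:
  assumes "f analytic_on {c}"
  shows "(\<lambda>z. cnj (f (cnj z))) analytic_on {cnj c}"
proof -
  obtain e where e: "e > 0" "f holomorphic_on ball c e"
    using assms by (auto simp: analytic_on_def)
  have "cnj ` ball (cnj c) e \<subseteq> ball c e"
  proof clarsimp
    fix x assume "dist (cnj c) x < e"
    thus "dist c (cnj x) < e"
      by (metis complex_cnj_cnj complex_cnj_diff complex_mod_cnj dist_norm)
  qed
  moreover have "cnj ` ball (cnj c) e = ball c e"
  proof
    show "ball c e \<subseteq> cnj ` ball (cnj c) e"
    proof
      fix x assume "x \<in> ball c e"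
      hence "cnj x \<in> ball (cnj c) e"
        by (simp add: dist_norm flip: complex_cnj_diff)
      thus "x \<in> cnj ` ball (cnj c) e" by (metis complex_cnj_cnj imageI)
    qed
  qed fact
  ultimately have "(cnj \<circ> f \<circ> cnj) holomorphic_on ball (cnj c) e"
    using e(2) by (intro holomorphic_on_compose_cnj_cnj) auto
  thus ?thesis using e(1) by (auto simp: analytic_on_def o_def)
qed

lemma continues_along_cnj:
  assumes "continues_along \<gamma> f g"
  shows "continues_along (cnj \<circ> \<gamma>) (\<lambda>z. cnj (f (cnj z))) (\<lambda>z. cnj (g (cnj z)))"
proof -
  obtain \<phi> where \<phi>: "\<And>t. t \<in> {0..1} \<Longrightarrow> \<phi> t analytic_on {\<gamma> t}"
    "\<And>t. t \<in> {0..1} \<Longrightarrow> \<forall>\<^sub>F s in at t within {0..1}. \<forall>\<^sub>F z in nhds (\<gamma> s). \<phi> s z = \<phi> t z"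
    "\<forall>\<^sub>F z in nhds (\<gamma> 0). \<phi> 0 z = f z" "\<forall>\<^sub>F z in nhds (\<gamma> 1). \<phi> 1 z = g z"
    using assms unfolding continues_along_def by blast
  have ev: "\<forall>\<^sub>F z in nhds (cnj c). cnj (h (cnj z)) = cnj (k (cnj z))"
    if "\<forall>\<^sub>F z in nhds c. h z = k z" for h k :: "complex \<Rightarrow> complex" and c
    using eventually_nhds_cnj[OF that] by simp
  show ?thesis unfolding continues_along_def o_def
  proof (intro exI[of _ "\<lambda>t z. cnj (\<phi> t (cnj z))"] conjI ballI)
    fix t :: real assume t: "t \<in> {0..1}"
    show "(\<lambda>z. cnj (\<phi> t (cnj z))) analytic_on {cnj (\<gamma> t)}" by (intro analytic_on_cnj_cnj \<phi>(1) t)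
    show "\<forall>\<^sub>F s in at t within {0..1}. \<forall>\<^sub>F z in nhds (cnj (\<gamma> s)). cnj (\<phi> s (cnj z)) = cnj (\<phi> t (cnj z))"
      using \<phi>(2)[OF t] by (rule eventually_mono) (rule ev)
  qed (intro ev \<phi>)+
qed

text \<open>All coefficients are continued at once, with one neighbourhood for the whole series, and
  over an arbitrary parameter interval, so that pieces can be joined.\<close>

definition ser_continues :: "(real \<Rightarrow> complex) \<Rightarrow> real \<Rightarrow> real \<Rightarrow> (complex \<Rightarrow> ser) \<Rightarrow> (complex \<Rightarrow> ser) \<Rightarrow> bool" where
  "ser_continues \<gamma> a b P Q \<longleftrightarrow>
     (\<exists>\<phi>. (\<forall>t\<in>{a..b}. \<forall>u. (\<lambda>z. cf (\<phi> t z) u) analytic_on {\<gamma> t}) \<and>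
        (\<forall>t\<in>{a..b}. \<exists>d>0. \<forall>s\<in>{a..b}. \<bar>s - t\<bar> < d \<longrightarrow> (\<forall>\<^sub>F z in nhds (\<gamma> s). \<phi> s z = \<phi> t z)) \<and>
        (\<forall>\<^sub>F z in nhds (\<gamma> a). \<phi> a z = P z) \<and> (\<forall>\<^sub>F z in nhds (\<gamma> b). \<phi> b z = Q z))"

text \<open>At the junction the two families agree only near the common point of the path;
  continuity keeps nearby points of the path inside that neighbourhood.\<close>

lemma ser_continues_trans:
  assumes "ser_continues \<gamma> a b P Q" "ser_continues \<gamma> b c Q R" "a \<le> b" "b \<le> c"
    and cont: "continuous_on {a..c} \<gamma>"
  shows "ser_continues \<gamma> a c P R"
proof -
  obtain f where f: "\<And>t u. t \<in> {a..b} \<Longrightarrow> (\<lambda>z. cf (f t z) u) analytic_on {\<gamma> t}"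
    "\<And>t. t \<in> {a..b} \<Longrightarrow> \<exists>d>0. \<forall>s\<in>{a..b}. \<bar>s - t\<bar> < d \<longrightarrow> (\<forall>\<^sub>F z in nhds (\<gamma> s). f s z = f t z)"
    "\<forall>\<^sub>F z in nhds (\<gamma> a). f a z = P z" "\<forall>\<^sub>F z in nhds (\<gamma> b). f b z = Q z"
    using assms(1) unfolding ser_continues_def by blast
  obtain g where g: "\<And>t u. t \<in> {b..c} \<Longrightarrow> (\<lambda>z. cf (g t z) u) analytic_on {\<gamma> t}"
    "\<And>t. t \<in> {b..c} \<Longrightarrow> \<exists>d>0. \<forall>s\<in>{b..c}. \<bar>s - t\<bar> < d \<longrightarrow> (\<forall>\<^sub>F z in nhds (\<gamma> s). g s z = g t z)"
    "\<forall>\<^sub>F z in nhds (\<gamma> b). g b z = Q z" "\<forall>\<^sub>F z in nhds (\<gamma> c). g c z = R z"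
    using assms(2) unfolding ser_continues_def by blast
  have fg: "\<forall>\<^sub>F z in nhds (\<gamma> b). g b z = f b z"
    using f(4) g(3) by eventually_elim simp
  then obtain V where V: "open V" "\<gamma> b \<in> V" "\<And>z. z \<in> V \<Longrightarrow> g b z = f b z"
    by (auto simp: eventually_nhds)
  obtain e where e: "e > 0" "\<And>z. dist z (\<gamma> b) < e \<Longrightarrow> z \<in> V"
    using V(1,2) by (auto simp: open_dist)
  obtain d0 where d0: "d0 > 0" "\<And>s. s \<in> {a..c} \<Longrightarrow> \<bar>s - b\<bar> < d0 \<Longrightarrow> \<gamma> s \<in> V"
  proof -
    obtain d where "d > 0" "\<forall>s\<in>{a..c}. dist s b < d \<longrightarrow> dist (\<gamma> s) (\<gamma> b) < e"
      using cont assms(3,4) e(1) unfolding continuous_on_iff by (meson atLeastAtMost_iff)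
    thus ?thesis using that[of d] e(2) by (auto simp: dist_real_def)
  qed
  define h where "h = (\<lambda>t. if t \<le> b then f t else g t)"
  have loc: "\<exists>d>0. \<forall>s\<in>{a..c}. \<bar>s - t\<bar> < d \<longrightarrow> (\<forall>\<^sub>F z in nhds (\<gamma> s). h s z = h t z)"
    if t: "t \<in> {a..c}" for t
  proof -
    consider "t < b" | "t = b" | "t > b" by linarith
    thus ?thesis
    proof cases
      case 1
      then obtain d where "d > 0" "\<forall>s\<in>{a..b}. \<bar>s - t\<bar> < d \<longrightarrow> (\<forall>\<^sub>F z in nhds (\<gamma> s). f s z = f t z)"
        using f(2)[of t] t by auto
      thus ?thesis using 1 by (intro exI[of _ "min d (b - t)"]) (auto simp: h_def)
    next
      case 3
      then obtain d where "d > 0" "\<forall>s\<in>{b..c}. \<bar>s - t\<bar> < d \<longrightarrow> (\<forall>\<^sub>F z in nhds (\<gamma> s). g s z = g t z)"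
        using g(2)[of t] t by auto
      thus ?thesis using 3 by (intro exI[of _ "min d (t - b)"]) (auto simp: h_def)
    next
      case 2
      obtain d1 where d1: "d1 > 0" "\<forall>s\<in>{a..b}. \<bar>s - b\<bar> < d1 \<longrightarrow> (\<forall>\<^sub>F z in nhds (\<gamma> s). f s z = f b z)"
        using f(2)[of b] assms(3) by auto
      obtain d2 where d2: "d2 > 0" "\<forall>s\<in>{b..c}. \<bar>s - b\<bar> < d2 \<longrightarrow> (\<forall>\<^sub>F z in nhds (\<gamma> s). g s z = g b z)"
        using g(2)[of b] assms(4) by auto
      have "\<forall>\<^sub>F z in nhds (\<gamma> s). h s z = h t z"
        if s: "s \<in> {a..c}" "\<bar>s - b\<bar> < d0" "\<bar>s - b\<bar> < d1" "\<bar>s - b\<bar> < d2" for s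
      proof (cases "s \<le> b")
        case True
        thus ?thesis using d1(2) s 2 by (auto simp: h_def)
      next
        case False
        have "\<forall>\<^sub>F z in nhds (\<gamma> s). g s z = g b z" using d2(2) s False by auto
        moreover have "\<forall>\<^sub>F z in nhds (\<gamma> s). z \<in> V" using d0(2)[OF s(1,2)] V(1) by (rule eventually_nhds_in_open[rotated])
        ultimately show ?thesis
          by eventually_elim (use False 2 V(3) in \<open>simp add: h_def\<close>)
      qed
      thus ?thesis using d0(1) d1(1) d2(1) 2 by (intro exI[of _ "min d0 (min d1 d2)"]) auto
    qed
  qed
  show ?thesis unfolding ser_continues_def
  proof (intro exI[of _ h] conjI ballI allI loc)
    show "(\<lambda>z. cf (h t z) u) analytic_on {\<gamma> t}" if "t \<in> {a..c}" for t u
      using f(1)[of t u] g(1)[of t u] that by (auto simp: h_def)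
    show "\<forall>\<^sub>F z in nhds (\<gamma> a). h a z = P z" using f(3) assms(3) by (simp add: h_def)
    show "\<forall>\<^sub>F z in nhds (\<gamma> c). h c z = R z"
    proof (cases "c = b")
      case True
      show ?thesis using fg g(4) unfolding True by eventually_elim (simp add: h_def)
    qed (use g(4) assms(4) in \<open>simp add: h_def\<close>)
  qed
qed

text \<open>Inside one chart a constant family of germs suffices; the only change is at the start,
  where the transition factor joins \<open>D\<close>.\<close>

lemma ser_continues_chart:
  assumes "a \<le> b" "\<gamma> ` {a..b} \<subseteq> chart_dom j" "\<gamma> a \<in> chart_dom i" "D \<in> stab_Sh"
  shows "\<exists>D'\<in>stab_Sh. ser_continues \<gamma> a b (\<lambda>z. D * chart_sol i z) (\<lambda>z. D' * chart_sol j z)"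
proof -
  have "\<gamma> a \<in> chart_dom j" using assms(1,2) by auto
  then obtain M V where M: "M \<in> stab_Sh" "open V" "\<gamma> a \<in> V" "\<forall>y\<in>V. chart_sol i y = M * chart_sol j y"
    using chart_sol_transition[OF assms(3)] by blast
  show ?thesis
  proof (rule bexI[OF _ stab_Sh_mult[OF assms(4) M(1)]])
    show "ser_continues \<gamma> a b (\<lambda>z. D * chart_sol i z) (\<lambda>z. D * M * chart_sol j z)"
      unfolding ser_continues_def
    proof (intro exI[of _ "\<lambda>_ z. D * M * chart_sol j z"] conjI ballI allI)
      fix t u assume "t \<in> {a..b}"
      hence "\<gamma> t \<in> chart_dom j" using assms(2) by auto
      thus "(\<lambda>z. cf (D * M * chart_sol j z) u) analytic_on {\<gamma> t}"
        using cf_chart_sol_holomorphic[of "D * M" j u] open_chart_dom by (meson analytic_at)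
    next
      have "\<forall>\<^sub>F z in nhds (\<gamma> a). z \<in> V" using M(2,3) by (rule eventually_nhds_in_open)
      thus "\<forall>\<^sub>F z in nhds (\<gamma> a). D * M * chart_sol j z = D * chart_sol i z"
        by eventually_elim (use M(4) in \<open>simp add: mult.assoc\<close>)
    qed (auto intro: exI[of _ 1])
  qed
qed

text \<open>By interval bisection: the claim is transitive, and a short interval is mapped into a
  single chart.\<close>

lemma ser_continues_path:
  assumes "continuous_on {0..1} \<gamma>" "\<gamma> ` {0..1} \<subseteq> - {0, 1}" "\<gamma> 0 \<in> chart_dom i"
  shows "\<exists>j. \<exists>D\<in>stab_Sh. \<gamma> 1 \<in> chart_dom j \<and> ser_continues \<gamma> 0 1 (chart_sol i) (\<lambda>z. D * chart_sol j z)"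
proof -
  \<comment> \<open>The premise \<open>0 <= a\<close> and \<open>b <= 1\<close> makes the claim
    vacuous for short intervals that leave [0, 1]; \<open>D\<close> varies because the second piece
    starts with the factor reached by the first.\<close>
  define Q where "Q = (\<lambda>a b :: real. 0 \<le> a \<and> b \<le> 1 \<longrightarrow> (\<forall>i. \<forall>D\<in>stab_Sh. \<gamma> a \<in> chart_dom i \<longrightarrow>
    (\<exists>j. \<exists>D'\<in>stab_Sh. \<gamma> b \<in> chart_dom j \<and> ser_continues \<gamma> a b (\<lambda>z. D * chart_sol i z) (\<lambda>z. D' * chart_sol j z))))"
  have "(0 :: real) \<le> 1" by simp
  hence "Q 0 1"
  proof (induction rule: Bolzano)
    case (trans a b c)
    show ?case unfolding Q_def
    proof (intro impI allI ballI)
      fix i D assume ac: "0 \<le> a \<and> c \<le> 1" and D: "D \<in> stab_Sh" and i: "\<gamma> a \<in> chart_dom i"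
      have "0 \<le> a \<and> b \<le> 1" "0 \<le> b \<and> c \<le> 1" using ac trans(3,4) by auto
      then obtain j D' where j: "D' \<in> stab_Sh" "\<gamma> b \<in> chart_dom j"
        "ser_continues \<gamma> a b (\<lambda>z. D * chart_sol i z) (\<lambda>z. D' * chart_sol j z)"
        using trans(1) D i unfolding Q_def by blast
      then obtain k D'' where k: "D'' \<in> stab_Sh" "\<gamma> c \<in> chart_dom k"
        "ser_continues \<gamma> b c (\<lambda>z. D' * chart_sol j z) (\<lambda>z. D'' * chart_sol k z)"
        using trans(2) \<open>0 \<le> b \<and> c \<le> 1\<close> unfolding Q_def by blast
      have "continuous_on {a..c} \<gamma>" using assms(1) ac by (auto intro: continuous_on_subset)
      from ser_continues_trans[OF j(3) k(3) trans(3,4) this] k(1,2)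
      show "\<exists>j. \<exists>D'\<in>stab_Sh. \<gamma> c \<in> chart_dom j \<and> ser_continues \<gamma> a c (\<lambda>z. D * chart_sol i z) (\<lambda>z. D' * chart_sol j z)"
        by blast
    qed
  next
    case (local x)
    hence "\<gamma> x \<in> - {0, 1}" using assms(2) by (intro subsetD[OF assms(2)]) auto
    then obtain j where j: "\<gamma> x \<in> chart_dom j" using chart_dom_cover[of "\<gamma> x"] by auto
    obtain e where e: "e > 0" "\<And>z. dist z (\<gamma> x) < e \<Longrightarrow> z \<in> chart_dom j"
      using j open_chart_dom[of j] by (auto simp: open_dist)
    obtain d where d: "d > 0" "\<forall>s\<in>{0..1}. dist s x < d \<longrightarrow> dist (\<gamma> s) (\<gamma> x) < e"
      using assms(1) local e(1) unfolding continuous_on_iff by (meson atLeastAtMost_iff)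
    have "Q a b" if "a \<le> x" "x \<le> b" "b - a < d" for a b
      unfolding Q_def
    proof (intro impI allI ballI)
      fix i D assume ab: "0 \<le> a \<and> b \<le> 1" and D: "D \<in> stab_Sh" and i: "\<gamma> a \<in> chart_dom i"
      have "\<gamma> s \<in> chart_dom j" if s: "s \<in> {a..b}" for s
      proof -
        have "s \<in> {0..1}" "dist s x < d"
          using s ab \<open>a \<le> x\<close> \<open>x \<le> b\<close> \<open>b - a < d\<close> by (auto simp: dist_real_def)
        thus ?thesis using d(2) e(2) by blast
      qed
      moreover have "a \<le> b" using that by simp
      ultimately show "\<exists>j. \<exists>D'\<in>stab_Sh. \<gamma> b \<in> chart_dom j \<and> ser_continues \<gamma> a b (\<lambda>z. D * chart_sol i z) (\<lambda>z. D' * chart_sol j z)"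
        using ser_continues_chart[of a b \<gamma> j i D] D i by fastforce
    qed
    thus ?case using d(1) by blast
  qed
  hence "\<exists>j. \<exists>D'\<in>stab_Sh. \<gamma> 1 \<in> chart_dom j \<and> ser_continues \<gamma> 0 1 (\<lambda>z. 1 * chart_sol i z) (\<lambda>z. D' * chart_sol j z)"
    unfolding Q_def using one_stab_Sh assms(3) by blast
  thus ?thesis by simp
qed

lemma ser_continues_continues_along:
  assumes "ser_continues \<gamma> 0 1 P Q" "\<forall>\<^sub>F z in nhds (\<gamma> 0). cf (P z) u = f z"
  shows "continues_along \<gamma> f (\<lambda>z. cf (Q z) u)"
proof -
  obtain \<phi> where \<phi>: "\<forall>t\<in>{0..1}. \<forall>u. (\<lambda>z. cf (\<phi> t z) u) analytic_on {\<gamma> t}"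
    "\<forall>t\<in>{0..1}. \<exists>d>0. \<forall>s\<in>{0..1}. \<bar>s - t\<bar> < d \<longrightarrow> (\<forall>\<^sub>F z in nhds (\<gamma> s). \<phi> s z = \<phi> t z)"
    "\<forall>\<^sub>F z in nhds (\<gamma> 0). \<phi> 0 z = P z" "\<forall>\<^sub>F z in nhds (\<gamma> 1). \<phi> 1 z = Q z"
    using assms(1) unfolding ser_continues_def by blast
  show ?thesis unfolding continues_along_def
  proof (intro exI[of _ "\<lambda>t z. cf (\<phi> t z) u"] conjI ballI)
    fix t :: real assume t: "t \<in> {0..1}"
    obtain d where d: "d > 0" "\<And>s. s \<in> {0..1} \<Longrightarrow> \<bar>s - t\<bar> < d \<Longrightarrow> \<forall>\<^sub>F z in nhds (\<gamma> s). \<phi> s z = \<phi> t z"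
      using \<phi>(2) t by blast
    have "\<forall>\<^sub>F z in nhds (\<gamma> s). cf (\<phi> s z) u = cf (\<phi> t z) u" if "s \<in> {0..1}" "\<bar>s - t\<bar> < d" for s
      using d(2)[OF that] by eventually_elim simp
    thus "\<forall>\<^sub>F s in at t within {0..1}. \<forall>\<^sub>F z in nhds (\<gamma> s). cf (\<phi> s z) u = cf (\<phi> t z) u"
      unfolding eventually_at using d(1) by (intro exI[of _ d]) (auto simp: dist_real_def)
  next
    show "\<forall>\<^sub>F z in nhds (\<gamma> 0). cf (\<phi> 0 z) u = f z" using \<phi>(3) assms(2) by eventually_elim simp
    show "\<forall>\<^sub>F z in nhds (\<gamma> 1). cf (\<phi> 1 z) u = cf (Q z) u" using \<phi>(4) by eventually_elim simp
  qed (use \<phi>(1) in blast)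
qed

lemma Fhat_single_valued_B1:
  assumes w: "w \<in> B1"
  shows "Fhat_single_valued w"
  unfolding Fhat_single_valued_def
proof (intro allI impI)
  fix \<gamma> :: "real \<Rightarrow> complex"
  assume *: "path \<gamma> \<and> path_image \<gamma> \<subseteq> - {0, 1} \<and> pathfinish \<gamma> = pathstart \<gamma> \<and> pathstart \<gamma> \<in> slit_plane"
  hence 0: "\<gamma> 0 \<in> slit_plane" "\<gamma> 1 = \<gamma> 0" by (simp_all add: pathstart_def pathfinish_def)
  have slit0: "chart_dom 0 = slit_plane" "chart_sol 0 = L_ser" by (simp_all add: chart_dom_def chart_sol_def)
  obtain j D where D: "D \<in> stab_Sh" "\<gamma> 1 \<in> chart_dom j" "ser_continues \<gamma> 0 1 L_ser (\<lambda>z. D * chart_sol j z)"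
    using ser_continues_path[of \<gamma> 0] * 0(1) unfolding slit0 path_def path_image_def by blast
  define C where "C = (\<lambda>u z. cf (D * chart_sol j z) u)"
  \<comment> \<open>Polylogarithms commute with conjugation, so conjugating the continued germ gives
    the continuation along the conjugate path. Both factors thus acquire the same \<open>D\<close>,
    as \<open>sv_ser\<close> requires.\<close>
  define A where "A = (\<lambda>u z. cnj (C u (cnj z)))"
  have ev_slit: "\<forall>\<^sub>F z in nhds (\<gamma> 0). z \<in> slit_plane"
    by (intro eventually_nhds_in_open open_slit 0)
  have "\<forall>\<^sub>F z in nhds (\<gamma> 0). cf (L_ser z) u = mpl u z" for u
    using ev_slit by eventually_elim (simp add: mpl_eq)
  hence C: "continues_along \<gamma> (mpl u) (C u)" for u
    unfolding C_def by (rule ser_continues_continues_along[OF D(3)])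
  have "continues_along \<gamma> (\<lambda>z. cnj (mpl u (cnj z))) (C u)" for u
    unfolding C_def
  proof (rule ser_continues_continues_along[OF D(3)])
    show "\<forall>\<^sub>F z in nhds (\<gamma> 0). cf (L_ser z) u = cnj (mpl u (cnj z))"
      using ev_slit by eventually_elim (simp add: mpl_eq L_ser_cnj)
  qed
  from continues_along_cnj[OF this] have A: "continues_along (cnj \<circ> \<gamma>) (mpl u) (A u)" for u
    by (simp add: A_def)
  have "\<forall>\<^sub>F z in nhds (\<gamma> 0). z \<in> chart_dom j" using D(2) 0(2) by (simp add: eventually_nhds_in_open open_chart_dom)
  with ev_slit have "\<forall>\<^sub>F z in nhds (\<gamma> 0). Fhat_branch A C w z = Fhat_branch mpl mpl w z"
  proof eventually_elim
    case (elim z)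
    have "Fhat_branch A C w z = cf (sv_ser (D * chart_sol j z)) w"
      by (rule Fhat_branch_sv_ser) (simp_all add: A_def C_def)
    thus ?case using sv_ser_stab_Sh[OF D(1) w] Fhat_glob_eq[OF elim(2) w] Fhat_glob_slit[OF elim(1) w] by simp
  qed
  with A C show "\<exists>A modB. (\<forall>u. continues_along (cnj \<circ> \<gamma>) (mpl u) (A u)) \<and>
      (\<forall>u. continues_along \<gamma> (mpl u) (modB u)) \<and>
      (\<forall>\<^sub>F z in nhds (pathstart \<gamma>). Fhat_branch A modB w z = Fhat_branch mpl mpl w z)"
    unfolding pathstart_def by blast
qed

theorem theorem1p6:
  shows "\<exists>Fhat :: word \<Rightarrow> complex \<Rightarrow> complex. \<forall>w\<in>B1.
      Fhat_single_valued w \<and>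
      real_analytic_on (Fhat w) (- {0, 1}) \<and>
      (\<forall>z\<in>slit_plane. Fhat w z = Fhat_branch mpl mpl w z) \<and>
      (\<forall>z\<in>- {0, 1}. Fhat w z = Fhat (rev w) (cnj z)) \<and>
      (\<forall>i j. [i] @ w @ [j] \<in> B1 \<longrightarrow>
         (\<forall>z\<in>- {0, 1}. d_z (d_zbar (Fhat ([i] @ w @ [j]))) z
                       = Fhat w z / ((cnj z - pt i) * (z - pt j))))"
proof (intro exI[of _ Fhat_glob] ballI conjI allI impI)
  fix w z assume "w \<in> B1" "z \<in> - {0, 1 :: complex}"
  thus "Fhat_glob w z = Fhat_glob (rev w) (cnj z)" by (intro Fhat_glob_sym) auto
next
  fix w i j z assume "[i] @ w @ [j] \<in> B1" "z \<in> - {0, 1 :: complex}"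
  thus "d_z (d_zbar (Fhat_glob ([i] @ w @ [j]))) z = Fhat_glob w z / ((cnj z - pt i) * (z - pt j))"
    by (intro Fhat_glob_d_z_d_zbar) auto
qed (auto intro: Fhat_single_valued_B1 Fhat_glob_real_analytic Fhat_glob_slit)

end
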